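(* Let $0<\alpha<d$, $1<p\le q<\infty$ and let $v$ be a weight on $\mathbb{R}^d$. Suppose that one of the following two conditions (a), (b) is satisfied. (a) $v\in A_\infty$, $$\max\left(\sup_{Q\in\mathcal{Q}:\,\ell_Q\le 1}|Q|^{\alpha/d-1/p}v(Q)^{1/q},\ \sup_{Q\in\mathcal{Q}:\,\ell_Q>1}\frac{v(Q)^{1/q}}{|Q|^{1/p}}\right)<\infty$$ and $$\lim_{\lambda\to\infty}\ \sup_{Q\in\mathcal{Q}:\,\ell_Q\le 1/\lambda}|Q|^{\alpha/d-1/p}v(Q)^{1/q}=0.$$ (b) For some $\theta>1$, $$\max\left(\sup_{Q\in\mathcal{Q}:\,\ell_Q\le 1}|Q|^{\alpha/d+1/q-1/p}\left(\frac{v^\theta(Q)}{|Q|}\right)^{\frac1{\theta q}},\ \sup_{Q\in\mathcal{Q}:\,\ell_Q>1}|Q|^{1/q-1/p}\left(\frac{v^\theta(Q)}{|Q|}\right)^{\frac1{\theta q}}\right)<\infty$$ and $$\lim_{\lambda\to\infty}\ \sup_{Q\in\mathcal{Q}:\,\ell_Q\le 1/\lambda}|Q|^{\alpha/d+1/q-1/p}\left(\frac{v^\theta(Q)}{|Q|}\right)^{\frac1{\theta q}}=0.$$ Then there is a finite constant $c$, independent of $\varepsilon$ and $\varphi$, such that for any $\varepsilon>0$ there exists $C(\varepsilon)>0$ such that, for any $\varphi\in C_c^\infty(\mathbb{R}^d)$, $$\|\varphi\|_{L^q(v)}\le c\left(\varepsilon\,\|(-\Delta)^{\alpha/2}\v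arphi\|_{L^p(dx)}+C(\varepsilon)\,\|\varphi\|_{L^p(dx)}\right).$$
   Context: $\mathcal{Q}=\mathcal{Q}(\mathbb{R}^d)$ is the family of all cubes in $\mathbb{R}^d$ with sides parallel to the axes; $\ell_Q$ is the side length and $|Q|$ the volume of $Q$. A weight is a nonnegative locally integrable function $v$ on $\mathbb{R}^d$; $v(Q)=\int_Q v\,dx$, $v^\theta(Q)=\int_Q v^\theta\,dx$, $\|\varphi\|_{L^q(v)}=(\int_{\mathbb{R}^d}|\varphi|^q v\,dx)^{1/q}$. For $1<s<\infty$, $$[w]_{A_s}=\sup_{Q\in\mathcal{Q}}\left(\frac1{|Q|}\int_Q w\,dx\right)\left(\frac1{|Q|}\int_Q w^{-\frac1{s-1}}\,dx\right)^{s-1},$$ and $w\in A_\infty$ means $[w]_{A_\infty}:=\lim_{s\to\infty}[w]_{A_s}<\infty$ (in particular $w\in A_s$ for some $1<s<\infty$). With the Fourier transform $\hat f(\xi)=\int_{\mathbb{R}^d}f(x)e^{-2\pi i x\cdot\xi}\,dx$, the operator $(-\Delta)^{\alpha/2}$ is the Fourier multiplier operator with symbol $(2\pi|\xi|)^\alpha$. *)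

theory Defs
  imports "HOL-Analysis.Analysis"
begin

definition cube :: "'a::euclidean_space \<Rightarrow> real \<Rightarrow> 'a set" where
  "cube a l = cbox a (a + l *\<^sub>R One)"

definition cubes :: "'a::euclidean_space set set" where
  "cubes = {cube a l | a l. 0 < l}"

definition side_length :: "'a::euclidean_space set \<Rightarrow> real" where
  "side_length Q = (THE l. 0 < l \<and> (\<exists>a. Q = cube a l))"

abbreviation vol :: "'a::euclidean_space set \<Rightarrow> real" where
  "vol Q \<equiv> measure lebesgue Q"

lemma vol_cube:
  fixes a :: "'a::euclidean_space"
  assumes "0 < l"
  shows "vol (cube a l) = l ^ DIM('a)"
  using assms unfolding cube_def
  by (subst measure_completion, simp, subst measure_lborel_cbox)
     (auto simp: inner_add_left inner_sum_left_Basis)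

lemma side_length_cube:
  fixes a :: "'a::euclidean_space"
  assumes "0 < l"
  shows "side_length (cube a l) = l"
  unfolding side_length_def
proof (rule the_equality)
  fix m assume m: "0 < m \<and> (\<exists>b. cube a l = cube b m)"
  then obtain b where "cube a l = cube b m" by blast
  then have "l ^ DIM('a) = m ^ DIM('a)"
    using assms m vol_cube by metis
  then show "m = l"
    using assms m by (metis DIM_positive less_le power_eq_imp_eq_base)
qed (use assms in auto)

text \<open>Real powers of extended nonnegative reals, intended for exponents \<open>a > 0\<close> only.\<close>

definition epowr :: "ennreal \<Rightarrow> real \<Rightarrow> ennreal" (infixr "epowr" 80) where
  "x epowr a = (if x = \<infinity> then \<infinity> else ennreal (enn2real x powr a))"

definition weight :: "('a::euclidean_space \<Rightarrow> real) \<Rightarrow> bool" where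
  "weight v \<longleftrightarrow> (\<forall>x. 0 \<le> v x) \<and> (\<forall>K. compact K \<longrightarrow> set_integrable lebesgue K v)"

text \<open>\<open>wmass \<theta> v Q\<close> is \<open>v\<^sup>\<theta>(Q)\<close>, the integral of \<open>v\<^sup>\<theta>\<close> over \<open>Q\<close>; it may be infinite
  for \<open>\<theta> > 1\<close>. The mass \<open>v(Q)\<close> is the case \<open>\<theta> = 1\<close>.\<close>

definition wmass :: "real \<Rightarrow> ('a::euclidean_space \<Rightarrow> real) \<Rightarrow> 'a set \<Rightarrow> ennreal" where
  "wmass \<theta> v Q = (\<integral>\<^sup>+x\<in>Q. ennreal (v x powr \<theta>) \<partial>lebesgue)"

text \<open>The factor \<open>w\<^bsup>-1/(s-1)\<^esup>\<close> is taken in the extended nonnegative reals, so that it is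
  infinite where \<open>w\<close> vanishes (\<open>inverse 0 = \<infinity>\<close>). The product of averages uses
  \<open>0 * \<infinity> = 0\<close>; this only matters on cubes where \<open>w\<close> vanishes almost everywhere, and if
  \<open>w\<close> is not almost everywhere zero then a larger cube makes the supremum infinite.\<close>

definition A_const :: "real \<Rightarrow> ('a::euclidean_space \<Rightarrow> real) \<Rightarrow> ennreal" where
  "A_const s w = (SUP Q\<in>cubes.
     ((\<integral>\<^sup>+x\<in>Q. ennreal (w x) \<partial>lebesgue) / ennreal (vol Q)) *
     ((\<integral>\<^sup>+x\<in>Q. inverse (ennreal (w x powr (1 / (s - 1)))) \<partial>lebesgue) / ennreal (vol Q))
       epowr (s - 1))"

definition A_infty_const :: "('a::euclidean_space \<Rightarrow> real) \<Rightarrow> ennreal" where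
  "A_infty_const w = Lim at_top (\<lambda>s. A_const s w)"

definition A_infty :: "('a::euclidean_space \<Rightarrow> real) \<Rightarrow> bool" where
  "A_infty w \<longleftrightarrow> A_infty_const w < \<infinity>"

text \<open>\<open>C_k k f\<close>: \<open>f\<close> is \<open>k\<close> times continuously differentiable, recursively through the
  partial derivatives in the coordinate directions.\<close>

primrec C_k :: "nat \<Rightarrow> ('a::euclidean_space \<Rightarrow> 'b::real_normed_vector) \<Rightarrow> bool" where
  "C_k 0 f \<longleftrightarrow> continuous_on UNIV f"
| "C_k (Suc k) f \<longleftrightarrow> (\<forall>x. f differentiable at x) \<and>
     (\<forall>i\<in>Basis. C_k k (\<lambda>x. frechet_derivative f (at x) i))"

definition Cc_infty :: "('a::euclidean_space \<Rightarrow> complex) set" where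
  "Cc_infty = {\<phi>. (\<forall>k. C_k k \<phi>) \<and> compact (closure {x. \<phi> x \<noteq> 0})}"

definition fourier :: "('a::euclidean_space \<Rightarrow> complex) \<Rightarrow> 'a \<Rightarrow> complex" where
  "fourier f \<xi> = (LINT x|lebesgue. f x * exp (- 2 * of_real pi * \<i> * of_real (x \<bullet> \<xi>)))"

definition inverse_fourier :: "('a::euclidean_space \<Rightarrow> complex) \<Rightarrow> 'a \<Rightarrow> complex" where
  "inverse_fourier g x = (LINT \<xi>|lebesgue. g \<xi> * exp (2 * of_real pi * \<i> * of_real (x \<bullet> \<xi>)))"

definition fourier_multiplier ::
    "('a::euclidean_space \<Rightarrow> complex) \<Rightarrow> ('a \<Rightarrow> complex) \<Rightarrow> 'a \<Rightarrow> complex" where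
  "fourier_multiplier m f = inverse_fourier (\<lambda>\<xi>. m \<xi> * fourier f \<xi>)"

text \<open>\<open>frac_laplacian \<alpha>\<close> is \<open>(-\<Delta>)\<^bsup>\<alpha>/2\<^esup>\<close>. For \<open>\<phi> \<in> Cc_infty\<close> and \<open>\<alpha> > 0\<close> the integrals in
  both Fourier transforms converge absolutely, so no extension to distributions is needed.\<close>

definition frac_laplacian :: "real \<Rightarrow> ('a::euclidean_space \<Rightarrow> complex) \<Rightarrow> 'a \<Rightarrow> complex" where
  "frac_laplacian \<alpha> = fourier_multiplier (\<lambda>\<xi>. of_real ((2 * pi * norm \<xi>) powr \<alpha>))"

definition Lp_norm ::
    "real \<Rightarrow> ('a::euclidean_space \<Rightarrow> real) \<Rightarrow> ('a \<Rightarrow> complex) \<Rightarrow> ennreal" where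
  "Lp_norm q v \<phi> = (\<integral>\<^sup>+x. ennreal (norm (\<phi> x) powr q * v x) \<partial>lebesgue) epowr (1 / q)"

end

(* With s = (2 pi |xi|)^2, the identity 1 = (1 - e^{-Ts})^N + (1 - (1 - e^{-Ts})^N) writes phi as
   k_1 * f + k_2 * phi, where f is the fractional Laplacian of phi: k_2 is a combination of Gaussians,
   and k_1, the kernel of (1 - e^{-Ts})^N s^{-alpha/2}, is a superposition of heat kernels bounded by
   |x|^{alpha-d} and, for N large, by T^{alpha/2+m} |x|^{-d-2m}.  Rapidly decaying kernels are bounded
   from L^p to L^q(v) by the growth condition on large cubes, and for k_1 away from the origin the
   constant tends to 0 with T.  The part of k_1 near the origin is dominated by dyadic averages over
   finitely many shifted grids; along the chain of cubes containing a point the averages are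
   dominated by those at which they double, and duality together with the maximal inequality bounds
   the remaining sum by the supremum over small cubes, which is as small as desired.  In case (a) the
   mass of a cube is moved to the part of it that meets no later stopping cube, which has at least
   half its volume; in case (b) Hoelder's inequality with the exponent theta replaces this step. *)
theory Submission
  imports Defs "HOL-Probability.Probability"
begin

section \<open>Extended real powers and Hoelder's inequality\<close>

text \<open>The bound of \<open>k_1\<close> by |x|^(\<alpha>-d) is uniform in T, and this fixes the
  order of the choices: the small-cube condition gives a radius for which the near part costs at
  most \<epsilon>/2; then T is taken so small, depending on that radius, that the tail costs at most
  \<epsilon>/2; C(\<epsilon>) takes whatever size the Gaussians at the times j T then have. The
  kernel of s^(-\<alpha>/2) alone decays like |x|^(\<alpha>-d), too slowly to be summed against a
  mass that may grow like l^(d q/p) on cubes of side l. The zero of (1 - e^(-Ts))^N at the origin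
  buys the missing decay; it is realised in the time variable as an N-fold difference of
  t^(\<alpha>/2-1). Afterwards only absolute values of kernels enter, so the estimates run in
  \<open>ennreal\<close>. On a grid the gap between p and q is paid by one inequality: a cell
  average e of f satisfies e^p |Q| \<le> J, the integral of f^p, so surplus powers of e^p |Q| are
  bounded by powers of J.\<close>

lemma epowr_ennreal [simp]: "0 \<le> x \<Longrightarrow> ennreal x epowr a = ennreal (x powr a)"
  by (simp add: epowr_def)

lemma epowr_numeral [simp]: "numeral k epowr a = ennreal (numeral k powr a)"
  using epowr_ennreal[of "numeral k" a] by simp

lemma ennreal_mult_divide_cancel: "0 < s \<Longrightarrow> ennreal s * (x / ennreal s) = x"
  by (simp add: ennreal_times_divide mult.commute[of "ennreal s"] mult_divide_eq_ennreal)

lemma epowr_top [simp]: "top epowr a = top"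
  by (simp add: epowr_def)

lemma epowr_0 [simp]: "0 epowr a = 0"
  by (simp add: epowr_def)

lemma epowr_one [simp]: "x epowr 1 = x"
  by (cases x) (auto simp: epowr_def)

lemma one_epowr [simp]: "1 epowr a = 1"
  using epowr_ennreal[of 1 a] by simp

lemma epowr_eq_top_iff [simp]: "x epowr a = top \<longleftrightarrow> x = top"
  by (auto simp: epowr_def)

lemma epowr_eq_0_iff [simp]: "x epowr a = 0 \<longleftrightarrow> x = 0"
  by (cases x) (auto simp: epowr_def)

lemma epowr_less_top_iff [simp]: "x epowr a < top \<longleftrightarrow> x < top"
  by (simp add: less_top[symmetric])

lemma epowr_mono: "x \<le> y \<Longrightarrow> 0 \<le> a \<Longrightarrow> x epowr a \<le> y epowr a"
  by (cases x; cases y) (auto simp: top_unique intro!: ennreal_leI powr_mono2)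

lemma epowr_mult: "0 < a \<Longrightarrow> (x * y) epowr a = x epowr a * y epowr a"
  by (cases x; cases y)
     (auto simp: ennreal_mult[symmetric] powr_mult ennreal_mult_top ennreal_top_mult)

lemma epowr_epowr: "(x epowr a) epowr b = x epowr (a * b)"
  by (cases x) (auto simp: powr_powr)

lemma epowr_add: "0 < a \<Longrightarrow> 0 < b \<Longrightarrow> x epowr (a + b) = x epowr a * x epowr b"
  by (cases x) (auto simp: powr_add ennreal_mult ennreal_top_mult)

lemma epowr_zero: "x \<noteq> 0 \<Longrightarrow> x \<noteq> top \<Longrightarrow> x epowr 0 = 1"
  by (cases x) auto

text \<open>\<open>epowr\<close> fixes 0 and \<infinity> for every exponent, exponent 0 included, so
  a law that admits arbitrary real exponents has to leave these two values out. It serves the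
  exponents 1/p - 1/q and q/p - 1, which vanish when p = q.\<close>

lemma epowr_add_nonneg:
  "x \<noteq> 0 \<Longrightarrow> x \<noteq> top \<Longrightarrow> x epowr (a + b) = x epowr a * x epowr b"
  by (cases x) (auto simp: powr_add ennreal_mult)

lemma epowr_inverse_cancel: "0 < a \<Longrightarrow> (x epowr a) epowr (1 / a) = x"
  "0 < a \<Longrightarrow> (x epowr (1 / a)) epowr a = x"
  by (simp_all add: epowr_epowr)

lemma epowr_divide: "0 < c \<Longrightarrow> 0 < a \<Longrightarrow> (x / ennreal c) epowr a = x epowr a / ennreal (c powr a)"
  by (simp add: divide_ennreal_def inverse_ennreal epowr_mult powr_minus inverse_eq_divide
      powr_divide)

lemma le_epowr_iff: "0 < a \<Longrightarrow> x epowr a \<le> y \<longleftrightarrow> x \<le> y epowr (1 / a)"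
  by (metis epowr_inverse_cancel epowr_mono less_eq_real_def zero_less_divide_1_iff)

lemma epowr_SUP:
  assumes "0 < a"
  shows "(SUP i\<in>I. f i) epowr a = (SUP i\<in>I. f i epowr a)"
proof (rule antisym)
  show "(SUP i\<in>I. f i) epowr a \<le> (SUP i\<in>I. f i epowr a)"
    using assms by (auto simp: le_epowr_iff intro!: SUP_least) (metis SUP_upper assms le_epowr_iff)
  show "(SUP i\<in>I. f i epowr a) \<le> (SUP i\<in>I. f i) epowr a"
    using assms by (intro SUP_least epowr_mono SUP_upper) auto
qed

text \<open>From x + y \<le> 2 max x y, so that exponents below and above 1 are covered alike;
  \<open>wnorm_add_le\<close> applies it with q and with 1/q.\<close>

lemma epowr_add_le:
  assumes "0 < a"
  shows "(x + y) epowr a \<le> ennreal (2 powr a) * (x epowr a + y epowr a)"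
proof -
  have "x + y \<le> 2 * max x y"
    by (cases "x \<le> y") (auto simp: mult_2 max_def intro: add_mono)
  also have "\<dots> = ennreal 2 * max x y" by simp
  finally have "(x + y) epowr a \<le> (ennreal 2 * max x y) epowr a"
    using assms by (intro epowr_mono) auto
  also have "\<dots> = ennreal (2 powr a) * max x y epowr a"
    using assms by (simp only: epowr_mult) simp
  also have "max x y epowr a \<le> x epowr a + y epowr a"
    by (cases "x \<le> y") (auto simp: max_def)
  finally show ?thesis by (simp add: mult_left_mono)
qed

lemma measurable_epowr [measurable]:
  assumes [measurable]: "f \<in> borel_measurable M"
  shows "(\<lambda>x. f x epowr a) \<in> borel_measurable M"
  unfolding epowr_def by measurable

section \<open>Young, Hoelder, duality and Jensen for integrals in \<open>ennreal\<close>\<close>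

lemma ennreal_Young:
  assumes "1 < p" "1 < q" "1 / p + 1 / q = 1"
  shows "x * y \<le> ennreal (1 / p) * x epowr p + ennreal (1 / q) * y epowr q"
proof (cases "x = 0 \<or> y = 0")
  case False
  show ?thesis
  proof (cases "x = top \<or> y = top")
    case True
    then have "ennreal (1 / p) * x epowr p + ennreal (1 / q) * y epowr q = top"
      using assms by (auto simp: ennreal_mult_top)
    then show ?thesis by (metis top_greatest)
  next
    case fin: False
    obtain a b where ab: "x = ennreal a" "y = ennreal b" "0 \<le> a" "0 \<le> b"
      using fin by (cases x; cases y) auto
    have "a * b \<le> a powr p / p + b powr q / q"
      using assms ab by (intro Youngs_inequality) auto
    then show ?thesis
      using assms ab by (auto simp: ennreal_mult[symmetric] ennreal_plus[symmetric] simp del: ennreal_plus intro!: ennreal_leI)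
  qed
qed auto

text \<open>Young's inequality for f and g divided by their norms, integrated. No integrability is
  assumed: if one of the two integrals vanishes, the product is 0 almost everywhere; if neither
  vanishes and one is infinite, so is the right-hand side.\<close>

lemma nn_integral_Holder:
  assumes pq: "1 < p" "1 < q" "1 / p + 1 / q = 1"
    and [measurable]: "f \<in> borel_measurable M" "g \<in> borel_measurable M"
  shows "(\<integral>\<^sup>+x. f x * g x \<partial>M)
    \<le> (\<integral>\<^sup>+x. f x epowr p \<partial>M) epowr (1 / p) * (\<integral>\<^sup>+x. g x epowr q \<partial>M) epowr (1 / q)"
    (is "_ \<le> ?A epowr _ * ?B epowr _")
proof (cases "?A = 0 \<or> ?B = 0")
  case True
  then have "AE x in M. f x * g x = 0"
    using nn_integral_0_iff_AE[of "\<lambda>x. f x epowr p" M] nn_integral_0_iff_AE[of "\<lambda>x. g x epowr q" M]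
    by auto
  then have "(\<integral>\<^sup>+x. f x * g x \<partial>M) = 0"
    by (subst nn_integral_0_iff_AE) auto
  then show ?thesis by simp
next
  case False
  show ?thesis
  proof (cases "?A = top \<or> ?B = top")
    case True
    then have "?A epowr (1 / p) * ?B epowr (1 / q) = top"
      using False by (auto simp: ennreal_mult_eq_top_iff)
    then show ?thesis by simp
  next
    case fin: False
    define a where "a = enn2real ?A" 
    define b where "b = enn2real ?B"
    have a: "?A = ennreal a" "0 < a" and b: "?B = ennreal b" "0 < b"
      using False fin unfolding a_def b_def
      by (auto simp: enn2real_positive_iff less_top[symmetric] zero_less_iff_neq_zero)
    define s where "s = a powr (1 / p)"
    define t where "t = b powr (1 / q)"
    have st: "0 < s" "0 < t" "s powr p = a" "t powr q = b"
      using a b pq by (auto simp: s_def t_def powr_powr)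
    have "(\<integral>\<^sup>+x. f x * g x \<partial>M) = (\<integral>\<^sup>+x. ennreal (s * t) * ((f x / ennreal s) * (g x / ennreal t)) \<partial>M)"
    proof (intro nn_integral_cong)
      fix x
      have "ennreal (s * t) * ((f x / ennreal s) * (g x / ennreal t))
         = (ennreal s * (f x / ennreal s)) * (ennreal t * (g x / ennreal t))"
        using st by (simp add: ennreal_mult ac_simps)
      also have "\<dots> = f x * g x"
        using st by (simp only: ennreal_mult_divide_cancel)
      finally show "f x * g x = ennreal (s * t) * ((f x / ennreal s) * (g x / ennreal t))" by simp
    qed
    also have "\<dots> = ennreal (s * t) * (\<integral>\<^sup>+x. (f x / ennreal s) * (g x / ennreal t) \<partial>M)"
      by (intro nn_integral_cmult) simp
    also have "(\<integral>\<^sup>+x. (f x / ennreal s) * (g x / ennreal t) \<partial>M)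
       \<le> (\<integral>\<^sup>+x. ennreal (1 / p) * (f x / ennreal s) epowr p + ennreal (1 / q) * (g x / ennreal t) epowr q \<partial>M)"
      by (intro nn_integral_mono ennreal_Young pq)
    also have "\<dots> = ennreal (1 / p) * (\<integral>\<^sup>+x. f x epowr p / ennreal a \<partial>M) + ennreal (1 / q) * (\<integral>\<^sup>+x. g x epowr q / ennreal b \<partial>M)"
      using st pq by (simp add: nn_integral_add nn_integral_cmult epowr_divide)
    also have "\<dots> = ennreal (1 / p) * (ennreal a / ennreal a) + ennreal (1 / q) * (ennreal b / ennreal b)"
      using a b by (simp add: nn_integral_divide)
    also have "\<dots> = ennreal (1 / p + 1 / q)"
      using a b pq(1,2) by (simp add: divide_ennreal)
    also have "\<dots> = 1" using pq by simp
    finally show ?thesis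
      using a b st by (simp add: mult_left_mono s_def t_def ennreal_mult)
  qed
qed

text \<open>Division by x^(1-1/r), legitimate because x is finite; x = \<infinity> would satisfy the
  first hypothesis for every A other than 0. Both uses below bound a quantity by a smaller power of
  itself, and each proves separately that it is finite.\<close>

lemma le_epowr_absorb:
  assumes "x \<le> A * x epowr (1 - 1 / r)" "x < top" "0 < r"
  shows "x \<le> A epowr r"
proof (cases "x = 0")
  case False
  show ?thesis
  proof (cases "A = top")
    case fin: False
    obtain a b where ab: "x = ennreal a" "A = ennreal b" "0 < a" "0 \<le> b"
      using False fin assms(2) by (cases x; cases A) auto
    have "a \<le> b * a powr (1 - 1 / r)"
      using assms(1) ab by (simp add: ennreal_mult[symmetric])
    also have "\<dots> = b * a / a powr (1 / r)"
      using ab by (simp add: powr_diff)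
    finally have "a powr (1 / r) \<le> b"
      using ab by (simp add: field_simps)
    then have "(a powr (1 / r)) powr r \<le> b powr r"
      using assms(3) by (intro powr_mono2) auto
    then show ?thesis
      using ab assms(3) by (simp add: powr_powr)
  qed (use assms in auto)
qed auto

text \<open>The test function is the (q-1)-st power of F, since (q-1) q' = q reproduces the integral
  on the left. F is first cut at height m and restricted to \<open>B m\<close>: this makes the
  integral finite, as \<open>le_epowr_absorb\<close> demands, and monotone convergence removes the
  truncation.\<close>

lemma nn_integral_duality:
  assumes q: "1 < q" "1 < q'" "1 / q + 1 / q' = 1"
    and [measurable]: "F \<in> borel_measurable M" "\<And>m. B m \<in> sets M"
    and B: "incseq B" "(\<Union>m. B m) = space M" "\<And>m::nat. emeasure M (B m) < top"
    and dual: "\<And>g. g \<in> borel_measurable M \<Longrightarrow>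
      (\<integral>\<^sup>+x. F x * g x \<partial>M) \<le> A * (\<integral>\<^sup>+x. g x epowr q' \<partial>M) epowr (1 / q')"
  shows "(\<integral>\<^sup>+x. F x epowr q \<partial>M) \<le> A epowr q"
proof -
  define G where "G m x = min (F x) (of_nat m) * indicator (B m) x" for m x
  have [measurable]: "G m \<in> borel_measurable M" for m unfolding G_def by measurable
  have GF: "G m x \<le> F x" for m x by (auto simp: G_def indicator_def)
  have sup: "(SUP m. G m x) = F x" if "x \<in> space M" for x
  proof (rule antisym)
    show "(SUP m. G m x) \<le> F x" by (intro SUP_least GF)
    from that B obtain k where k: "x \<in> B k" by auto
    show "F x \<le> (SUP m. G m x)"
    proof (rule dense_le)
      fix y assume y: "y < F x"
      then have "y < top" using less_le_trans top_greatest by blast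
      then obtain n where n: "y < of_nat n" using ennreal_Ex_less_of_nat by blast
      have "x \<in> B (max n k)" using k B(1) by (meson incseqD max.cobounded2 subsetD)
      moreover have "y \<le> of_nat (max n k)"
        using n by (metis max.cobounded1 of_nat_mono less_imp_le order_trans)
      ultimately have "y \<le> G (max n k) x"
        using y by (simp add: G_def less_imp_le)
      then show "y \<le> (SUP m. G m x)" by (rule SUP_upper2[OF UNIV_I])
    qed
  qed
  have inc: "incseq (\<lambda>m x. G m x epowr q)"
  proof (intro incseq_SucI le_funI epowr_mono)
    fix m x
    have "B m \<subseteq> B (Suc m)" using B(1) by (simp add: incseqD)
    then show "G m x \<le> G (Suc m) x"
      using of_nat_mono[of m "Suc m", where 'a=ennreal]
      by (auto simp: G_def indicator_def intro: min.coboundedI2 simp del: of_nat_Suc)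
  qed (use q in auto)
  have bd: "(\<integral>\<^sup>+x. G m x epowr q \<partial>M) \<le> A epowr q" for m
  proof (rule le_epowr_absorb)
    have "(\<integral>\<^sup>+x. G m x epowr q \<partial>M) \<le> (\<integral>\<^sup>+x. of_nat m epowr q * indicator (B m) x \<partial>M)"
      using q by (intro nn_integral_mono) (auto simp: G_def indicator_def intro!: epowr_mono)
    also have "\<dots> = of_nat m epowr q * emeasure M (B m)"
      by (simp add: nn_integral_cmult_indicator)
    also have "\<dots> < top"
      using B(3)[of m] by (simp add: ennreal_mult_less_top of_nat_less_top)
    finally show "(\<integral>\<^sup>+x. G m x epowr q \<partial>M) < top" .
    have "(\<integral>\<^sup>+x. G m x epowr q \<partial>M) \<le> (\<integral>\<^sup>+x. F x * G m x epowr (q - 1) \<partial>M)"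
    proof (intro nn_integral_mono)
      fix x
      have "G m x epowr q = G m x epowr (1 + (q - 1))" by simp
      also have "\<dots> = G m x epowr 1 * G m x epowr (q - 1)" using q by (intro epowr_add) auto
      also have "\<dots> \<le> F x * G m x epowr (q - 1)" by (auto intro!: mult_right_mono GF)
      finally show "G m x epowr q \<le> F x * G m x epowr (q - 1)" .
    qed
    also have "\<dots> \<le> A * (\<integral>\<^sup>+x. (G m x epowr (q - 1)) epowr q' \<partial>M) epowr (1 / q')"
      by (rule dual) simp
    also have "(q - 1) * q' = q" using q by (simp add: field_simps)
    then have "(\<integral>\<^sup>+x. (G m x epowr (q - 1)) epowr q' \<partial>M) = (\<integral>\<^sup>+x. G m x epowr q \<partial>M)"
      by (simp add: epowr_epowr)
    also have "1 / q' = 1 - 1 / q" using q(3) by simp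
    finally show "(\<integral>\<^sup>+x. G m x epowr q \<partial>M) \<le> A * (\<integral>\<^sup>+x. G m x epowr q \<partial>M) epowr (1 - 1 / q)" .
  qed (use q in auto)
  have "(\<integral>\<^sup>+x. F x epowr q \<partial>M) = (\<integral>\<^sup>+x. (SUP m. G m x epowr q) \<partial>M)"
    using q by (intro nn_integral_cong) (simp add: epowr_SUP[symmetric] sup)
  also have "\<dots> = (SUP m. \<integral>\<^sup>+x. G m x epowr q \<partial>M)"
    using inc by (intro nn_integral_monotone_convergence_SUP) auto
  also have "\<dots> \<le> A epowr q" by (intro SUP_least bd)
  finally show ?thesis .
qed

text \<open>Hoelder's inequality for the splitting w = w^(1/q) w^(1/p), with q conjugate to p. The
  mass of w is not normalised, hence the factor with exponent p - 1.\<close>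

lemma nn_integral_Jensen:
  assumes p: "1 < p" and [measurable]: "f \<in> borel_measurable M" "w \<in> borel_measurable M"
  shows "(\<integral>\<^sup>+x. w x * f x \<partial>M) epowr p
    \<le> (\<integral>\<^sup>+x. w x \<partial>M) epowr (p - 1) * (\<integral>\<^sup>+x. w x * f x epowr p \<partial>M)"
proof -
  define q where "q = p / (p - 1)"
  have q: "1 < q" "1 / p + 1 / q = 1" using p by (auto simp: q_def field_simps)
  have "(\<integral>\<^sup>+x. w x * f x \<partial>M) = (\<integral>\<^sup>+x. w x epowr (1 / q) * (w x epowr (1 / p) * f x) \<partial>M)"
  proof (intro nn_integral_cong)
    fix x
    have "w x = w x epowr (1 / q + 1 / p)" using q by (simp add: add.commute)
    also have "\<dots> = w x epowr (1 / q) * w x epowr (1 / p)" using p q by (intro epowr_add) auto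
    finally show "w x * f x = w x epowr (1 / q) * (w x epowr (1 / p) * f x)" by (metis mult.assoc)
  qed
  also have "\<dots> \<le> (\<integral>\<^sup>+x. (w x epowr (1 / q)) epowr q \<partial>M) epowr (1 / q)
      * (\<integral>\<^sup>+x. (w x epowr (1 / p) * f x) epowr p \<partial>M) epowr (1 / p)"
    using p q by (intro nn_integral_Holder) auto
  also have "(\<integral>\<^sup>+x. (w x epowr (1 / q)) epowr q \<partial>M) = (\<integral>\<^sup>+x. w x \<partial>M)"
    using q by (simp add: epowr_inverse_cancel)
  also have "(\<integral>\<^sup>+x. (w x epowr (1 / p) * f x) epowr p \<partial>M) = (\<integral>\<^sup>+x. w x * f x epowr p \<partial>M)"
    using p by (simp add: epowr_mult epowr_epowr)
  finally have "(\<integral>\<^sup>+x. w x * f x \<partial>M) epowr p \<le>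
     ((\<integral>\<^sup>+x. w x \<partial>M) epowr (1 / q) * (\<integral>\<^sup>+x. w x * f x epowr p \<partial>M) epowr (1 / p)) epowr p"
    using p by (intro epowr_mono) auto
  also have "\<dots> = (\<integral>\<^sup>+x. w x \<partial>M) epowr (p - 1) * (\<integral>\<^sup>+x. w x * f x epowr p \<partial>M)"
    using p by (simp add: epowr_mult epowr_epowr q_def)
  finally show ?thesis .
qed

section \<open>Stopping values of a sequence\<close>

text \<open>Along the chain of cells that contain a point, e lists the averages of a function, and
  the stops mark the principal cells of that chain. The level is the value at the latest stop; it
  ignores every value up to twice its own size.\<close>

fun stop_level :: "(nat \<Rightarrow> ennreal) \<Rightarrow> nat \<Rightarrow> ennreal" where
  "stop_level e 0 = e 0"
| "stop_level e (Suc n) = (if 2 * stop_level e n < e (Suc n) then e (Suc n) else stop_level e n)"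

fun stops :: "(nat \<Rightarrow> ennreal) \<Rightarrow> nat \<Rightarrow> bool" where
  "stops e 0 = True"
| "stops e (Suc n) = (2 * stop_level e n < e (Suc n))"

lemma le_stop_level: "e n \<le> 2 * stop_level e n"
proof (cases n)
  case 0
  have "1 * e 0 \<le> 2 * e 0" by (intro mult_right_mono) auto
  then show ?thesis using 0 by simp
next
  case (Suc k)
  have "1 * e (Suc k) \<le> 2 * e (Suc k)" by (intro mult_right_mono) auto
  then show ?thesis using Suc by auto
qed

lemma stop_level_eq: "stops e n \<Longrightarrow> stop_level e n = e n"
  by (cases n) auto

lemma stop_level_const:
  assumes "n \<le> m" "\<And>j. n < j \<Longrightarrow> j \<le> m \<Longrightarrow> \<not> stops e j"
  shows "stop_level e m = stop_level e n"
  using assms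
proof (induction m rule: dec_induct)
  case (step k)
  then have "\<not> stops e (Suc k)" by (simp del: stops.simps)
  then have "stop_level e (Suc k) = stop_level e k" by simp
  also have "\<dots> = stop_level e n" using step by (simp del: stops.simps)
  finally show ?case .
qed simp

lemma stop_level_attained: "\<exists>m\<le>n. stops e m \<and> stop_level e n = e m"
proof (induction n)
  case (Suc n)
  then show ?case by (cases "stops e (Suc n)") (auto intro: le_SucI)
qed auto

lemma stop_level_le_sum:
  "stop_level e n epowr r \<le> (\<Sum>m\<le>n. if stops e m then e m epowr r else 0)"
proof -
  obtain m where m: "m \<le> n" "stops e m" "stop_level e n = e m"
    using stop_level_attained by blast
  then have "stop_level e n epowr r = (if stops e m then e m epowr r else 0)" by simp
  also have "\<dots> \<le> (\<Sum>m\<le>n. if stops e m then e m epowr r else 0)"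
    using m by (intro member_le_sum) auto
  finally show ?thesis .
qed

text \<open>Consecutive stopping values at least double, so their \<open>r\<close>-th powers are dominated
  by a geometric series with this sum.\<close>

definition geo_const :: "real \<Rightarrow> real" where
  "geo_const r = 1 / (1 - 2 powr (- r))"

lemma geo_const:
  assumes "0 < r"
  shows "1 \<le> geo_const r" "geo_const r * 2 powr (- r) + 1 = geo_const r"
proof -
  have "2 powr (- r) < 2 powr (0::real)" using assms by (intro powr_less_mono) auto
  then have "2 powr (- r) < 1" by simp
  moreover define t where "t = 2 powr (- r)"
  ultimately have "0 \<le> t" "t < 1" by auto
  then show "1 \<le> geo_const r" "geo_const r * 2 powr (- r) + 1 = geo_const r"
    unfolding geo_const_def t_def[symmetric] by (auto simp: field_simps)
qed

text \<open>At a new stop the old level is less than half of the new value, so with K for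
  \<open>geo_const r\<close> the sum so far costs at most K 2^(-r) times the new term; K 2^(-r) + 1
  = K lets the constant reproduce itself.\<close>

lemma sum_stops_le:
  assumes r: "0 < r"
  shows "(\<Sum>m\<le>n. if stops e m then e m epowr r else 0)
    \<le> ennreal (geo_const r) * stop_level e n epowr r"
proof (induction n)
  case 0
  have "1 * e 0 epowr r \<le> ennreal (geo_const r) * e 0 epowr r"
    using geo_const(1)[OF r] by (intro mult_right_mono) auto
  then show ?case by simp
next
  case (Suc n)
  show ?case
  proof (cases "stops e (Suc n)")
    case True
    let ?c = "stop_level e n" and ?K = "geo_const r"
    have K: "0 \<le> ?K" using geo_const(1)[OF r] by simp
    have "(ennreal 2 * ?c) epowr r \<le> e (Suc n) epowr r"
      using True r by (intro epowr_mono) auto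
    then have 1: "ennreal (2 powr r) * ?c epowr r \<le> e (Suc n) epowr r"
      using r by (simp add: epowr_mult)
    have "?c epowr r = ennreal (2 powr (- r)) * (ennreal (2 powr r) * ?c epowr r)"
      by (simp add: mult.assoc[symmetric] ennreal_mult[symmetric] powr_minus)
    also have "\<dots> \<le> ennreal (2 powr (- r)) * e (Suc n) epowr r"
      by (intro mult_left_mono 1) auto
    finally have c: "?c epowr r \<le> ennreal (2 powr (- r)) * e (Suc n) epowr r" .
    have "(\<Sum>m\<le>Suc n. if stops e m then e m epowr r else 0)
        \<le> ennreal ?K * ?c epowr r + e (Suc n) epowr r"
      using Suc.IH True by (simp add: add_right_mono)
    also have "\<dots> \<le> ennreal ?K * (ennreal (2 powr (- r)) * e (Suc n) epowr r) + e (Suc n) epowr r"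
      by (intro add_right_mono mult_left_mono c) auto
    also have "\<dots> = ennreal (?K * 2 powr (- r) + 1) * e (Suc n) epowr r"
      using K by (simp add: ennreal_mult distrib_right mult.assoc)
    also have "\<dots> = ennreal ?K * e (Suc n) epowr r"
      by (subst geo_const(2)[OF r]) simp
    finally show ?thesis using True by simp
  qed (use Suc.IH in auto)
qed

lemma suminf_stops_le:
  assumes r: "0 < r"
  shows "(\<Sum>m. if stops e m then e m epowr r else 0)
    \<le> ennreal (geo_const r) * (SUP n. e n) epowr r"
proof (rule suminf_le_const)
  fix n
  have "stop_level e n \<le> (SUP n. e n)"
    using stop_level_attained[of n e] by (metis SUP_upper UNIV_I)
  have "(\<Sum>m<n. if stops e m then e m epowr r else 0) \<le> (\<Sum>m\<le>n. if stops e m then e m epowr r else 0)"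
    by (intro sum_mono2) auto
  also have "\<dots> \<le> ennreal (geo_const r) * stop_level e n epowr r"
    by (rule sum_stops_le[OF r])
  also have "\<dots> \<le> ennreal (geo_const r) * (SUP n. e n) epowr r"
    using r \<open>stop_level e n \<le> _\<close> by (intro mult_left_mono epowr_mono) auto
  finally show "(\<Sum>m<n. if stops e m then e m epowr r else 0)
    \<le> ennreal (geo_const r) * (SUP n. e n) epowr r" .
qed (rule summableI)

text \<open>Each \<open>e n\<close> is at most twice the sum of the stopping values up to n. After
  the sums are exchanged, a stop m carries the tail of \<open>a\<close> from m on, and the
  hypothesis compares this tail with \<open>a m\<close>. For the Riesz weights the tail is a
  geometric series.\<close>

lemma suminf_le_stops:
  fixes a e :: "nat \<Rightarrow> ennreal"
  assumes K: "\<And>m. (\<Sum>n. a (m + n)) \<le> K * a m"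
  shows "(\<Sum>n. a n * e n) \<le> 2 * K * (\<Sum>n. if stops e n then a n * e n else 0)"
proof (rule suminf_le_const)
  fix N
  let ?g = "\<lambda>m. if stops e m then e m else 0"
  have "(\<Sum>n<N. a n * e n) \<le> (\<Sum>n<N. 2 * (\<Sum>m<N. if m \<le> n then a n * ?g m else 0))"
  proof (intro sum_mono)
    fix n assume n: "n \<in> {..<N}"
    have "e n \<le> 2 * stop_level e n epowr 1" by (simp add: le_stop_level)
    also have "\<dots> \<le> 2 * (\<Sum>m\<le>n. ?g m)"
      using stop_level_le_sum[of e n 1] by (intro mult_left_mono) (auto cong: if_cong)
    also have "(\<Sum>m\<le>n. ?g m) = (\<Sum>m<N. if m \<le> n then ?g m else 0)"
      using n by (subst sum.inter_filter[symmetric]) (auto intro!: sum.cong)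
    finally have "a n * e n \<le> a n * (2 * (\<Sum>m<N. if m \<le> n then ?g m else 0))"
      by (intro mult_left_mono) auto
    also have "\<dots> = 2 * (\<Sum>m<N. if m \<le> n then a n * ?g m else 0)"
      unfolding sum_distrib_left by (intro sum.cong) (auto simp: mult.left_commute)
    finally show "a n * e n \<le> 2 * (\<Sum>m<N. if m \<le> n then a n * ?g m else 0)" .
  qed
  also have "\<dots> = 2 * (\<Sum>n<N. (\<Sum>m<N. if m \<le> n then a n * ?g m else 0))"
    by (simp add: sum_distrib_left)
  also have "\<dots> = 2 * (\<Sum>m<N. (\<Sum>n<N. if m \<le> n then a n * ?g m else 0))"
    by (subst sum.swap) simp
  also have "\<dots> \<le> 2 * (\<Sum>m<N. K * (a m * ?g m))"
  proof (intro mult_left_mono sum_mono)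
    fix m assume m: "m \<in> {..<N}"
    have "(\<Sum>n<N. if m \<le> n then a n * ?g m else 0) = (\<Sum>n<N. if m \<le> n then a n else 0) * ?g m"
      by (subst sum_distrib_right) (intro sum.cong, auto)
    also have "(\<Sum>n<N. if m \<le> n then a n else 0) = sum a {m..<N}"
      by (subst sum.inter_filter[symmetric]) (auto intro!: sum.cong)
    also have "\<dots> = (\<Sum>n<N - m. a (m + n))"
      using m by (subst sum.atLeastLessThan_shift_0) (auto simp: lessThan_atLeast0 add.commute)
    also have "\<dots> \<le> K * a m"
      by (rule order.trans[OF sum_le_suminf K]) auto
    finally show "(\<Sum>n<N. if m \<le> n then a n * ?g m else 0) \<le> K * (a m * ?g m)"
      by (simp add: mult_right_mono mult.assoc)
  qed simp
  also have "\<dots> = 2 * K * (\<Sum>m<N. if stops e m then a m * e m else 0)"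
    by (simp add: sum_distrib_left mult.assoc if_distrib cong: if_cong)
  also have "\<dots> \<le> 2 * K * (\<Sum>n. if stops e n then a n * e n else 0)"
    by (intro mult_left_mono sum_le_suminf) auto
  finally show "(\<Sum>n<N. a n * e n) \<le> 2 * K * (\<Sum>n. if stops e n then a n * e n else 0)" .
qed (rule summableI)

section \<open>Averages over a nested partition\<close>

text \<open>Here \<open>Q n x\<close> is the cell of generation n around x, and the average is the
  conditional expectation of f on that generation. On a null cell the quotient is 0 / 0 = 0.\<close>

definition cell_avg :: "'a measure \<Rightarrow> (nat \<Rightarrow> 'a \<Rightarrow> 'a set) \<Rightarrow> nat \<Rightarrow> ('a \<Rightarrow> ennreal) \<Rightarrow> 'a \<Rightarrow> ennreal" where
  "cell_avg M Q n f x = (\<integral>\<^sup>+y\<in>Q n x. f y \<partial>M) / emeasure M (Q n x)"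

text \<open>Measurability with respect to generation n, stated pointwise; the values of F may be of
  any type, so it also covers predicates such as \<open>stops\<close>.\<close>

definition cell_const :: "(nat \<Rightarrow> 'a \<Rightarrow> 'a set) \<Rightarrow> nat \<Rightarrow> ('a \<Rightarrow> 'b) \<Rightarrow> bool" where
  "cell_const Q n F \<longleftrightarrow> (\<forall>x. \<forall>y\<in>Q n x. F y = F x)"

lemma ennreal_divide_mult:
  assumes "0 < a" "0 < b"
  shows "x * y / ennreal (a * b) = (x / ennreal a) * (y / ennreal b)"
proof -
  have "inverse (ennreal (a * b)) = inverse (ennreal a) * inverse (ennreal b)"
    using assms by (simp only: inverse_ennreal mult_pos_pos inverse_mult_distrib)
      (simp add: ennreal_mult)
  then show ?thesis by (simp add: divide_ennreal_def ac_simps)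
qed

text \<open>The partitions are encoded by the map from a point to its cell: \<open>mem\<close> and
  \<open>cell_eq\<close> make \<open>Q n\<close> the class map of an equivalence relation, so no
  separate set of cells is carried along. The measure is a parameter because one grid serves both
  Lebesgue measure and its density by a weight.\<close>

locale nested_partition =
  fixes M :: "'a measure" and Q :: "nat \<Rightarrow> 'a \<Rightarrow> 'a set"
  assumes mem: "x \<in> Q n x"
    and cell_eq: "y \<in> Q n x \<Longrightarrow> Q n y = Q n x"
    and decreasing: "Q (Suc n) x \<subseteq> Q n x"
    and countable_cells: "countable (range (Q n))"
    and sets_cell [measurable]: "Q n x \<in> sets M"
    and finite_cell: "emeasure M (Q n x) < top"
    and space_UNIV: "space M = UNIV"
begin

abbreviation "E \<equiv> cell_avg M Q"

lemma cell_antimono: "m \<le> n \<Longrightarrow> Q n x \<subseteq> Q m x"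
  by (rule lift_Suc_antimono_le[of "\<lambda>n. Q n x"]) (auto intro: decreasing[THEN subsetD])

lemma cell_const_mono: "cell_const Q m F \<Longrightarrow> m \<le> n \<Longrightarrow> cell_const Q n F"
  unfolding cell_const_def using cell_antimono by blast

lemma cell_const_E: "cell_const Q n (E n f)"
  by (auto simp: cell_const_def cell_avg_def cell_eq)

lemma cell_const_compose: "cell_const Q n F \<Longrightarrow> cell_const Q n (\<lambda>x. h (F x))"
  by (simp add: cell_const_def)

lemma cell_const_compose2:
  "cell_const Q n F \<Longrightarrow> cell_const Q n G \<Longrightarrow> cell_const Q n (\<lambda>x. h (F x) (G x))"
  by (simp add: cell_const_def)

text \<open>A preimage is a union of cells, and there are only countably many.\<close>

lemma cell_const_measurable:
  assumes "cell_const Q n F" and "space N = UNIV"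
  shows "F \<in> measurable M N"
proof (rule measurableI)
  fix A
  have "F -` A \<inter> space M = \<Union>{C \<in> range (Q n). C \<subseteq> F -` A}"
    using assms mem unfolding cell_const_def by (auto simp: space_UNIV) blast
  also have "\<dots> \<in> sets M"
    by (intro sets.countable_Union countable_subset[OF _ countable_cells]) auto
  finally show "F -` A \<inter> space M \<in> sets M" .
qed (simp add: assms)

lemma cell_const_borel: "cell_const Q n F \<Longrightarrow> F \<in> borel_measurable M"
  by (rule cell_const_measurable) auto

lemma measurable_E [measurable]: "E n f \<in> borel_measurable M"
  by (rule cell_const_borel[OF cell_const_E])

lemma nn_integral_cells:
  assumes [measurable]: "f \<in> borel_measurable M"
  shows "(\<integral>\<^sup>+x. f x \<partial>M) = (\<integral>\<^sup>+C. (\<integral>\<^sup>+x\<in>C. f x \<partial>M) \<partial>count_space (range (Q n)))"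
proof -
  have cover: "(\<Union>C\<in>range (Q n). C) = UNIV" using mem by auto
  have "(\<integral>\<^sup>+x. f x \<partial>M) = emeasure (density M f) (\<Union>C\<in>range (Q n). C)"
    unfolding cover by (subst emeasure_density) (auto simp: space_UNIV[symmetric])
  also have "\<dots> = (\<integral>\<^sup>+C. emeasure (density M f) C \<partial>count_space (range (Q n)))"
  proof (rule emeasure_UN_countable)
    show "disjoint_family_on (\<lambda>C. C) (range (Q n))"
      unfolding disjoint_family_on_def using cell_eq by blast
  qed (auto intro: countable_cells)
  also have "\<dots> = (\<integral>\<^sup>+C. (\<integral>\<^sup>+x\<in>C. f x \<partial>M) \<partial>count_space (range (Q n)))"
    by (intro nn_integral_cong) (auto simp: emeasure_density)
  finally show ?thesis .
qed

lemma E_times_emeasure: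
  assumes [measurable]: "f \<in> borel_measurable M"
  shows "E n f x * emeasure M (Q n x) = (\<integral>\<^sup>+y\<in>Q n x. f y \<partial>M)"
proof (cases "emeasure M (Q n x) = 0")
  case True
  then have "(\<integral>\<^sup>+y\<in>Q n x. f y \<partial>M) = 0"
    by (intro nn_integral_null_set) auto
  then show ?thesis using True by simp
next
  case False
  then show ?thesis
    using finite_cell[of n x]
    by (simp add: cell_avg_def ennreal_divide_times mult_divide_eq_ennreal less_top[symmetric])
qed

lemma set_nn_integral_cell_const:
  assumes "cell_const Q n F" and [measurable]: "f \<in> borel_measurable M"
  shows "(\<integral>\<^sup>+y\<in>Q n x. F y * f y \<partial>M) = F x * (\<integral>\<^sup>+y\<in>Q n x. f y \<partial>M)"
proof -
  have "(\<integral>\<^sup>+y\<in>Q n x. F y * f y \<partial>M) = (\<integral>\<^sup>+y. F x * (f y * indicator (Q n x) y) \<partial>M)"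
    using assms by (intro nn_integral_cong) (auto simp: indicator_def cell_const_def)
  also have "\<dots> = F x * (\<integral>\<^sup>+y\<in>Q n x. f y \<partial>M)" by (intro nn_integral_cmult) simp
  finally show ?thesis .
qed

text \<open>The averaging property of conditional expectation: on a cell both sides equal the value
  of F there times the integral of f.\<close>

lemma nn_integral_E:
  assumes F: "cell_const Q n F" and [measurable]: "f \<in> borel_measurable M"
  shows "(\<integral>\<^sup>+x. F x * E n f x \<partial>M) = (\<integral>\<^sup>+x. F x * f x \<partial>M)"
proof -
  have [measurable]: "F \<in> borel_measurable M" by (rule cell_const_borel[OF F])
  have "(\<integral>\<^sup>+y\<in>C. F y * E n f y \<partial>M) = (\<integral>\<^sup>+y\<in>C. F y * f y \<partial>M)" if C: "C \<in> range (Q n)" for C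
  proof -
    obtain x where C: "C = Q n x" using C by auto
    have "(\<integral>\<^sup>+y\<in>C. F y * E n f y \<partial>M) = (\<integral>\<^sup>+y\<in>C. (F y * E n f y) * 1 \<partial>M)" by simp
    also have "\<dots> = (F x * E n f x) * emeasure M C"
      unfolding C
      by (subst set_nn_integral_cell_const[OF cell_const_compose2[OF F cell_const_E]]) auto
    also have "\<dots> = (\<integral>\<^sup>+y\<in>C. F y * f y \<partial>M)"
      unfolding C set_nn_integral_cell_const[OF F assms(2)] E_times_emeasure[OF assms(2), symmetric]
      by (rule mult.assoc)
    finally show ?thesis .
  qed
  note eq = this
  have "(\<integral>\<^sup>+x. F x * E n f x \<partial>M) = (\<integral>\<^sup>+C. (\<integral>\<^sup>+x\<in>C. F x * E n f x \<partial>M) \<partial>count_space (range (Q n)))"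
    by (rule nn_integral_cells) simp
  also have "\<dots> = (\<integral>\<^sup>+C. (\<integral>\<^sup>+x\<in>C. F x * f x \<partial>M) \<partial>count_space (range (Q n)))"
    by (rule nn_integral_cong) (simp only: eq space_count_space)
  also have "\<dots> = (\<integral>\<^sup>+x. F x * f x \<partial>M)"
    by (rule nn_integral_cells[symmetric]) simp
  finally show ?thesis .
qed

lemma E_Jensen:
  assumes r: "1 < r" and [measurable]: "f \<in> borel_measurable M"
  shows "E n f x epowr r \<le> E n (\<lambda>y. f y epowr r) x"
proof (cases "emeasure M (Q n x) = 0")
  case True
  then have "(\<integral>\<^sup>+y\<in>Q n x. f y \<partial>M) = 0"
    by (intro nn_integral_null_set) auto
  then show ?thesis by (simp add: cell_avg_def)
next
  case False
  then obtain m where m: "emeasure M (Q n x) = ennreal m" "0 < m"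
    using finite_cell[of n x] by (cases "emeasure M (Q n x)") auto
  have "(\<integral>\<^sup>+y\<in>Q n x. f y \<partial>M) epowr r = (\<integral>\<^sup>+y. indicator (Q n x) y * f y \<partial>M) epowr r"
    by (simp add: mult.commute)
  also have "\<dots> \<le> (\<integral>\<^sup>+y. indicator (Q n x) y \<partial>M) epowr (r - 1)
      * (\<integral>\<^sup>+y. indicator (Q n x) y * f y epowr r \<partial>M)"
    using r by (intro nn_integral_Jensen) auto
  also have "\<dots> = ennreal (m powr (r - 1)) * (\<integral>\<^sup>+y\<in>Q n x. f y epowr r \<partial>M)"
    using m by (simp add: mult.commute)
  finally have "(\<integral>\<^sup>+y\<in>Q n x. f y \<partial>M) epowr r / ennreal (m powr r)
      \<le> ennreal (m powr (r - 1)) * (\<integral>\<^sup>+y\<in>Q n x. f y epowr r \<partial>M) / ennreal (m powr r)"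
    by (rule divide_right_mono_ennreal)
  also have "\<dots> = ennreal (m powr (r - 1) / m powr r) * (\<integral>\<^sup>+y\<in>Q n x. f y epowr r \<partial>M)"
    using m by (simp add: divide_ennreal[symmetric] divide_ennreal_def ac_simps)
  also have "m powr (r - 1) / m powr r = 1 / m"
    using m by (simp add: powr_diff)
  also have "ennreal (1 / m) * (\<integral>\<^sup>+y\<in>Q n x. f y epowr r \<partial>M) = E n (\<lambda>y. f y epowr r) x"
    using m by (simp add: cell_avg_def divide_ennreal_def inverse_ennreal inverse_eq_divide mult.commute)
  finally show ?thesis
    using m r by (simp add: cell_avg_def epowr_divide)
qed

lemma E_Holder:
  assumes pq: "1 < p" "1 < q" "1 / p + 1 / q = 1"
    and [measurable]: "f \<in> borel_measurable M" "g \<in> borel_measurable M"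
  shows "E n (\<lambda>y. f y * g y) x
    \<le> E n (\<lambda>y. f y epowr p) x epowr (1 / p) * E n (\<lambda>y. g y epowr q) x epowr (1 / q)"
proof (cases "emeasure M (Q n x) = 0")
  case True
  then have "(\<integral>\<^sup>+y\<in>Q n x. f y * g y \<partial>M) = 0"
    by (intro nn_integral_null_set) auto
  then show ?thesis by (simp add: cell_avg_def)
next
  case False
  then obtain m where m: "emeasure M (Q n x) = ennreal m" "0 < m"
    using finite_cell[of n x] by (cases "emeasure M (Q n x)") auto
  let ?A = "\<integral>\<^sup>+y\<in>Q n x. f y epowr p \<partial>M" and ?B = "\<integral>\<^sup>+y\<in>Q n x. g y epowr q \<partial>M"
  have ind: "(f y * indicator (Q n x) y) epowr r = f y epowr r * indicator (Q n x) y" for f y r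
    by (auto simp: indicator_def)
  have "(\<integral>\<^sup>+y\<in>Q n x. f y * g y \<partial>M)
    = (\<integral>\<^sup>+y. (f y * indicator (Q n x) y) * (g y * indicator (Q n x) y) \<partial>M)"
    by (intro nn_integral_cong) (auto simp: indicator_def)
  also have "\<dots> \<le> ?A epowr (1 / p) * ?B epowr (1 / q)"
    using pq by (intro nn_integral_Holder[THEN order.trans]) (auto simp: ind)
  finally have "(\<integral>\<^sup>+y\<in>Q n x. f y * g y \<partial>M) / ennreal m
    \<le> ?A epowr (1 / p) * ?B epowr (1 / q) / ennreal (m powr (1 / p) * m powr (1 / q))"
    using m pq by (intro divide_right_mono_ennreal[THEN order.trans[OF _ eq_refl]])
      (auto simp: powr_add[symmetric])
  also have "\<dots> = (?A epowr (1 / p) / ennreal (m powr (1 / p))) * (?B epowr (1 / q) / ennreal (m powr (1 / q)))"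
    using m by (intro ennreal_divide_mult) auto
  finally show ?thesis
    using m pq by (simp add: cell_avg_def epowr_divide)
qed

section \<open>Stopping cells, their Carleson sum and the maximal inequality\<close>

definition stop_at :: "('a \<Rightarrow> ennreal) \<Rightarrow> nat \<Rightarrow> 'a set" where
  "stop_at f n = {x. stops (\<lambda>k. E k f x) n}"

text \<open>Within a stopping cell of generation n this is what the stopping cells of later
  generations leave uncovered. These sets are disjoint for different n, unlike the sets
  \<open>stop_at\<close>, and points at which the averages stop infinitely often belong to none of
  them.\<close>

definition last_stop :: "('a \<Rightarrow> ennreal) \<Rightarrow> nat \<Rightarrow> 'a set" where
  "last_stop f n = {x \<in> stop_at f n. \<forall>m>n. x \<notin> stop_at f m}"

lemma cell_const_stop_level: "cell_const Q n (\<lambda>x. stop_level (\<lambda>k. E k f x) n)"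
proof (induction n)
  case 0
  show ?case using cell_const_E[of 0 f] by (simp add: cell_const_def)
next
  case (Suc n)
  then have "cell_const Q (Suc n) (\<lambda>x. stop_level (\<lambda>k. E k f x) n)"
    by (rule cell_const_mono) simp
  then show ?case using cell_const_E[of "Suc n" f] by (simp add: cell_const_def)
qed

lemma cell_const_stops: "cell_const Q n (\<lambda>x. stops (\<lambda>k. E k f x) n)"
proof (cases n)
  case (Suc m)
  have "cell_const Q (Suc m) (\<lambda>x. stop_level (\<lambda>k. E k f x) m)"
    by (rule cell_const_mono[OF cell_const_stop_level]) simp
  then show ?thesis using cell_const_E[of "Suc m" f] Suc by (simp add: cell_const_def)
qed (simp add: cell_const_def)

lemma sum_stop_at:
  fixes g :: "nat \<Rightarrow> ennreal"
  shows "(\<Sum>n\<in>A. g n * indicator (stop_at f n) x) = (\<Sum>n\<in>A. if stops (\<lambda>k. E k f x) n then g n else 0)"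
  by (intro sum.cong) (auto simp: stop_at_def)

lemma cell_const_stop_at: "cell_const Q n (indicator (stop_at f n) :: 'a \<Rightarrow> ennreal)"
  using cell_const_stops[of n f] by (simp add: cell_const_def stop_at_def indicator_def)

lemma sets_stop_at [measurable]: "stop_at f n \<in> sets M"
proof -
  have "(\<lambda>x. stops (\<lambda>k. E k f x) n) \<in> measurable M (count_space UNIV)"
    by (rule cell_const_measurable[OF cell_const_stops]) simp
  then have "{x \<in> space M. stops (\<lambda>k. E k f x) n} \<in> sets M" by simp
  then show ?thesis by (simp add: stop_at_def space_UNIV)
qed

lemma sets_last_stop [measurable]: "last_stop f n \<in> sets M"
proof -
  have "last_stop f n = stop_at f n - (\<Union>m\<in>{n<..}. stop_at f m)"
    by (auto simp: last_stop_def)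
  then show ?thesis by auto
qed

lemma measurable_stop_level [measurable]:
  "(\<lambda>x. stop_level (\<lambda>k. E k f x) n) \<in> borel_measurable M"
  by (rule cell_const_borel[OF cell_const_stop_level])

text \<open>The partial sums \<open>S\<close> satisfy \<open>S \<le> K \<parallel>f\<parallel> S\<^bsup>1-1/r\<^esup>\<close>, because the stopping values along
  a chain of cells grow geometrically; no weak-type inequality is needed.\<close>

lemma Carleson_stops:
  assumes r: "1 < r" and [measurable]: "f \<in> borel_measurable M"
  shows "(\<Sum>n. \<integral>\<^sup>+x\<in>stop_at f n. E n f x epowr r \<partial>M)
    \<le> ennreal (geo_const (r - 1) powr r) * (\<integral>\<^sup>+x. f x epowr r \<partial>M)"
proof (cases "(\<integral>\<^sup>+x. f x epowr r \<partial>M) = top")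
  case True
  have "0 < geo_const (r - 1) powr r" using geo_const(1)[of "r - 1"] r by simp
  then show ?thesis using True by (simp add: ennreal_mult_top)
next
  case fin: False
  let ?K = "geo_const (r - 1)" and ?J = "\<integral>\<^sup>+x. f x epowr r \<partial>M"
  have K: "1 \<le> ?K" using geo_const(1)[of "r - 1"] r by simp
  define S where "S N = (\<Sum>n\<le>N. \<integral>\<^sup>+x\<in>stop_at f n. E n f x epowr r \<partial>M)" for N
  define c where "c N x = stop_level (\<lambda>k. E k f x) N" for N x
  have [measurable]: "c N \<in> borel_measurable M" for N unfolding c_def by measurable
  have bd: "S N \<le> ennreal (?K powr r) * ?J" for N
  proof -
    define q where "q = r / (r - 1)"
    have q: "1 < q" "1 / r + 1 / q = 1" "(r - 1) * q = r" "1 / q = 1 - 1 / r"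
      using r by (auto simp: q_def field_simps)
    \<comment> \<open>One power of the average is traded for f itself, because the remaining factors
      are constant on cells of generation n.\<close>
    have E_out: "(\<integral>\<^sup>+x\<in>stop_at f n. E n f x epowr r \<partial>M)
      = (\<integral>\<^sup>+x. (E n f x epowr (r - 1) * indicator (stop_at f n) x) * f x \<partial>M)" for n
    proof -
      have "(\<integral>\<^sup>+x\<in>stop_at f n. E n f x epowr r \<partial>M)
        = (\<integral>\<^sup>+x. (E n f x epowr (r - 1) * indicator (stop_at f n) x) * E n f x \<partial>M)"
      proof (intro nn_integral_cong)
        fix x
        have "E n f x epowr r = E n f x epowr ((r - 1) + 1)" by simp
        also have "\<dots> = E n f x epowr (r - 1) * E n f x" using r by (subst epowr_add) auto
        finally show "E n f x epowr r * indicator (stop_at f n) x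
          = (E n f x epowr (r - 1) * indicator (stop_at f n) x) * E n f x" by (simp add: ac_simps)
      qed
      also have "\<dots> = (\<integral>\<^sup>+x. (E n f x epowr (r - 1) * indicator (stop_at f n) x) * f x \<partial>M)"
        by (intro nn_integral_E cell_const_compose2[OF cell_const_compose[OF cell_const_E] cell_const_stop_at]) simp
      finally show ?thesis .
    qed
    have "S N = (\<integral>\<^sup>+x. (\<Sum>n\<le>N. E n f x epowr (r - 1) * indicator (stop_at f n) x) * f x \<partial>M)"
      unfolding S_def E_out sum_distrib_right by (rule nn_integral_sum[symmetric]) simp
    \<comment> \<open>At a fixed point the powers r - 1 of the stopping averages form a sum
      dominated by the last one.\<close>
    also have "\<dots> \<le> (\<integral>\<^sup>+x. (ennreal ?K * c N x epowr (r - 1)) * f x \<partial>M)"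
      using r by (intro nn_integral_mono mult_right_mono) (simp_all only: c_def sum_stop_at sum_stops_le diff_gt_0_iff_gt zero_le)
    also have "\<dots> = (\<integral>\<^sup>+x. ennreal ?K * (f x * c N x epowr (r - 1)) \<partial>M)"
      by (intro nn_integral_cong) (simp add: ac_simps)
    also have "\<dots> = ennreal ?K * (\<integral>\<^sup>+x. f x * c N x epowr (r - 1) \<partial>M)"
      by (intro nn_integral_cmult) simp
    also have "\<dots> \<le> ennreal ?K * (?J epowr (1 / r) * (\<integral>\<^sup>+x. (c N x epowr (r - 1)) epowr q \<partial>M) epowr (1 / q))"
      using r q by (intro mult_left_mono nn_integral_Holder) auto
    also have "(\<integral>\<^sup>+x. (c N x epowr (r - 1)) epowr q \<partial>M) = (\<integral>\<^sup>+x. c N x epowr r \<partial>M)"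
      by (simp add: epowr_epowr q)
    \<comment> \<open>The last level is one of the stopping averages, so its r-th power leads back
      to \<open>S N\<close>.\<close>
    also have "(\<integral>\<^sup>+x. c N x epowr r \<partial>M) \<le> (\<integral>\<^sup>+x. (\<Sum>n\<le>N. E n f x epowr r * indicator (stop_at f n) x) \<partial>M)"
      by (intro nn_integral_mono) (simp only: c_def sum_stop_at stop_level_le_sum)
    also have "\<dots> = S N"
      unfolding S_def by (subst nn_integral_sum) auto
    finally have "S N \<le> (ennreal ?K * ?J epowr (1 / r)) * S N epowr (1 - 1 / r)"
      using r q by (simp add: mult_left_mono epowr_mono mult.assoc)
    \<comment> \<open>Finiteness for the absorption: by Jensen each of the N + 1 terms is at most
      the integral of f^r.\<close>
    moreover have "S N < top"
    proof -
      have "(\<integral>\<^sup>+x\<in>stop_at f n. E n f x epowr r \<partial>M) < top" for n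
      proof -
        have "(\<integral>\<^sup>+x\<in>stop_at f n. E n f x epowr r \<partial>M) \<le> (\<integral>\<^sup>+x. 1 * E n (\<lambda>y. f y epowr r) x \<partial>M)"
          using r by (intro nn_integral_mono) (auto simp: indicator_def intro: E_Jensen)
        also have "\<dots> = (\<integral>\<^sup>+x. 1 * f x epowr r \<partial>M)"
          by (intro nn_integral_E) (auto simp: cell_const_def)
        also have "\<dots> < top" using fin by (simp add: less_top[symmetric])
        finally show ?thesis .
      qed
      then show ?thesis unfolding S_def by (simp add: ennreal_sum_less_top)
    qed
    ultimately have "S N \<le> (ennreal ?K * ?J epowr (1 / r)) epowr r"
      using r by (intro le_epowr_absorb) auto
    also have "\<dots> = ennreal (?K powr r) * ?J"
      using r K by (simp add: epowr_mult epowr_epowr)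
    finally show ?thesis .
  qed
  show ?thesis
  proof (rule suminf_le_const)
    fix n
    have "(\<Sum>n<n. \<integral>\<^sup>+x\<in>stop_at f n. E n f x epowr r \<partial>M) \<le> S n"
      unfolding S_def by (intro sum_mono2) auto
    then show "(\<Sum>n<n. \<integral>\<^sup>+x\<in>stop_at f n. E n f x epowr r \<partial>M) \<le> ennreal (?K powr r) * ?J"
      using bd[of n] by simp
  qed (rule summableI)
qed

text \<open>Every average is at most twice a stopping value, so the r-th power of the supremum is
  bounded by the sum over all stops, which \<open>Carleson_stops\<close> controls.\<close>

lemma maximal_inequality:
  assumes r: "1 < r" and [measurable]: "f \<in> borel_measurable M"
  shows "(\<integral>\<^sup>+x. (SUP n. E n f x) epowr r \<partial>M)
    \<le> ennreal (2 powr r * geo_const (r - 1) powr r) * (\<integral>\<^sup>+x. f x epowr r \<partial>M)"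
proof -
  let ?s = "\<lambda>x n. E n f x epowr r * indicator (stop_at f n) x"
  have "(SUP n. E n f x) epowr r \<le> ennreal (2 powr r) * (\<Sum>n. ?s x n)" for x
  proof -
    have "E n f x epowr r \<le> ennreal (2 powr r) * (\<Sum>n. ?s x n)" for n
    proof -
      have "E n f x epowr r \<le> (2 * stop_level (\<lambda>k. E k f x) n) epowr r"
        using r by (intro epowr_mono le_stop_level[of "\<lambda>k. E k f x" n]) auto
      also have "\<dots> = ennreal (2 powr r) * stop_level (\<lambda>k. E k f x) n epowr r"
        using r by (simp add: epowr_mult)
      also have "stop_level (\<lambda>k. E k f x) n epowr r \<le> (\<Sum>m\<le>n. ?s x m)"
        by (simp only: sum_stop_at stop_level_le_sum)
      also have "(\<Sum>m\<le>n. ?s x m) \<le> (\<Sum>n. ?s x n)"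
        by (intro sum_le_suminf) auto
      finally show ?thesis by (simp add: mult_left_mono)
    qed
    then show ?thesis using r by (subst epowr_SUP) (auto intro!: SUP_least)
  qed
  then have "(\<integral>\<^sup>+x. (SUP n. E n f x) epowr r \<partial>M) \<le> (\<integral>\<^sup>+x. ennreal (2 powr r) * (\<Sum>n. ?s x n) \<partial>M)"
    by (intro nn_integral_mono)
  also have "\<dots> = ennreal (2 powr r) * (\<Sum>n. \<integral>\<^sup>+x. ?s x n \<partial>M)"
    by (subst nn_integral_cmult) (auto simp: nn_integral_suminf)
  also have "\<dots> \<le> ennreal (2 powr r) * (ennreal (geo_const (r - 1) powr r) * (\<integral>\<^sup>+x. f x epowr r \<partial>M))"
    by (intro mult_left_mono Carleson_stops r) auto
  finally show ?thesis by (simp add: ennreal_mult mult.assoc)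
qed

text \<open>Chebyshev's inequality: on the cells at which the averages first stop again they exceed
  2 e, where e is the average over the whole cell Q, and the integral of f over these disjoint cells
  is at most e |Q|. Hence they fill at most half of Q.\<close>

lemma emeasure_later_stops:
  assumes x: "x \<in> stop_at f n" and [measurable]: "f \<in> borel_measurable M"
  shows "2 * emeasure M (Q n x - last_stop f n) \<le> emeasure M (Q n x)"
proof -
  let ?e = "E n f x"
  \<comment> \<open>The points of the cell whose next stop after n happens at m.\<close>
  define A where "A m = {y \<in> Q n x. n < m \<and> y \<in> stop_at f m \<and> (\<forall>j. n < j \<longrightarrow> j < m \<longrightarrow> y \<notin> stop_at f j)}" for m
  have [measurable]: "A m \<in> sets M" for m
  proof (cases "n < m")
    case True
    then have "A m = Q n x \<inter> stop_at f m - (\<Union>j\<in>{n<..<m}. stop_at f j)"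
      by (auto simp: A_def)
    then show ?thesis by auto
  qed (simp add: A_def)
  have disj: "disjoint_family A"
    unfolding disjoint_family_on_def
  proof (intro ballI impI)
    fix m k :: nat assume "m \<noteq> k"
    then show "A m \<inter> A k = {}"
      by (rule linorder_neqE_nat) (auto simp: A_def)
  qed
  have stop: "Q n x \<subseteq> stop_at f n"
    using x cell_const_stops[of n f] by (auto simp: cell_const_def stop_at_def)
  have UN: "Q n x - last_stop f n = (\<Union>m. A m)"
  proof
    show "Q n x - last_stop f n \<subseteq> (\<Union>m. A m)"
    proof
      fix y assume y: "y \<in> Q n x - last_stop f n"
      then have ex: "\<exists>m. n < m \<and> y \<in> stop_at f m" using stop by (auto simp: last_stop_def)
      define m where "m = (LEAST m. n < m \<and> y \<in> stop_at f m)"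
      have "n < m \<and> y \<in> stop_at f m" unfolding m_def using LeastI_ex[OF ex] .
      moreover have "y \<notin> stop_at f j" if "n < j" "j < m" for j
        using not_less_Least[of j "\<lambda>m. n < m \<and> y \<in> stop_at f m"] that unfolding m_def by auto
      ultimately have "y \<in> A m" using y by (auto simp: A_def)
      then show "y \<in> (\<Union>m. A m)" by auto
    qed
  qed (auto simp: A_def last_stop_def)
  have e_A: "2 * ?e < E m f y" if "y \<in> A m" for m y
  proof -
    from that have m: "n < m" "y \<in> Q n x" "stops (\<lambda>k. E k f y) m"
      "\<And>j. n < j \<Longrightarrow> j < m \<Longrightarrow> \<not> stops (\<lambda>k. E k f y) j"
      by (auto simp: A_def stop_at_def)
    then obtain k where k: "m = Suc k" "n \<le> k" by (cases m) auto
    have "stop_level (\<lambda>k. E k f y) k = stop_level (\<lambda>k. E k f y) n"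
      using m k by (intro stop_level_const) auto
    also have "\<dots> = E n f y"
      using stop m(2) by (intro stop_level_eq) (auto simp: stop_at_def)
    also have "\<dots> = ?e" using cell_const_E[of n f] m(2) by (simp add: cell_const_def)
    finally show ?thesis using m(3) k by simp
  qed
  \<comment> \<open>\<open>A m\<close> is decided by stops of generations up to m, so it is a union
    of cells of generation m and the average may be replaced by f.\<close>
  have int_A: "(\<integral>\<^sup>+y. indicator (A m) y * E m f y \<partial>M) = (\<integral>\<^sup>+y. indicator (A m) y * f y \<partial>M)" for m
  proof (cases "n < m")
    case True
    have "cell_const Q m (\<lambda>y. y \<in> A m)"
      unfolding cell_const_def
    proof (intro allI ballI)
      fix y z assume z: "z \<in> Q m y"
      then have "Q n z = Q n y" using cell_antimono[of n m y] True cell_eq[of z n y] by auto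
      then have "z \<in> Q n x \<longleftrightarrow> y \<in> Q n x" using mem cell_eq by metis
      moreover have "z \<in> stop_at f j \<longleftrightarrow> y \<in> stop_at f j" if "j \<le> m" for j
        using cell_const_mono[OF cell_const_stops[of j f] that] z
        unfolding cell_const_def stop_at_def by simp
      ultimately show "(z \<in> A m) = (y \<in> A m)"
        unfolding A_def mem_Collect_eq by (metis less_imp_le order_refl)
    qed
    then have "cell_const Q m (indicator (A m) :: 'a \<Rightarrow> ennreal)"
      by (simp add: cell_const_def indicator_def)
    then show ?thesis by (intro nn_integral_E) auto
  qed (simp add: A_def)
  have total: "(\<Sum>m. \<integral>\<^sup>+y. indicator (A m) y * f y \<partial>M) \<le> ?e * emeasure M (Q n x)"
  proof -
    have "(\<Sum>m. \<integral>\<^sup>+y. indicator (A m) y * f y \<partial>M) = (\<integral>\<^sup>+y. (\<Sum>m. f y * indicator (A m) y) \<partial>M)"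
      by (subst nn_integral_suminf) (auto simp: mult.commute)
    also have "\<dots> = (\<integral>\<^sup>+y. f y * indicator (\<Union>m. A m) y \<partial>M)"
      using disj by (intro nn_integral_cong) (simp only: ennreal_suminf_cmult suminf_indicator)
    also have "\<dots> \<le> (\<integral>\<^sup>+y\<in>Q n x. f y \<partial>M)"
      by (intro nn_integral_mono) (auto simp: A_def indicator_def)
    finally show ?thesis by (simp add: E_times_emeasure)
  qed
  have UN_meas: "emeasure M (\<Union>m. A m) = (\<Sum>m. emeasure M (A m))"
    using disj by (intro suminf_emeasure[symmetric]) auto
  \<comment> \<open>Dividing by e requires that e is neither 0 nor \<infinity>. If e = 0, the
    average is positive on \<open>A m\<close> while its integral there is 0, so \<open>A m\<close>
    is null; if e = \<infinity>, nothing exceeds 2 e and there is no later stop.\<close>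
  consider "?e = 0" | "?e = top" | "?e \<noteq> 0" "?e \<noteq> top" by blast
  then show ?thesis
  proof cases
    case 1
    have "emeasure M (A m) = 0" for m
    proof -
      have "(\<integral>\<^sup>+y. indicator (A m) y * f y \<partial>M) \<le> (\<Sum>m. \<integral>\<^sup>+y. indicator (A m) y * f y \<partial>M)"
        using sum_le_suminf[of "\<lambda>m. \<integral>\<^sup>+y. indicator (A m) y * f y \<partial>M" "{m}"] by simp
      also have "\<dots> = 0" using total 1 by simp
      finally have "(\<integral>\<^sup>+y. indicator (A m) y * E m f y \<partial>M) = 0" by (simp add: int_A)
      then have "AE y in M. indicator (A m) y * E m f y = 0"
        by (subst (asm) nn_integral_0_iff_AE) auto
      then have "AE y in M. y \<notin> A m"
      proof eventually_elim
        case (elim y)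
        then show ?case using e_A[of y m] 1 by (auto simp: indicator_def split: if_splits)
      qed
      then show ?thesis by (subst (asm) AE_iff_measurable[OF _ refl]) (auto simp: space_UNIV)
    qed
    then show ?thesis unfolding UN UN_meas by simp
  next
    case 2
    then have "A m = {}" for m using e_A by (auto simp: ennreal_mult_top)
    then show ?thesis unfolding UN by simp
  next
    case 3
    have "?e * (2 * emeasure M (\<Union>m. A m)) = (\<Sum>m. 2 * ?e * emeasure M (A m))"
      unfolding UN_meas ennreal_suminf_cmult by (simp only: ac_simps)
    also have "\<dots> \<le> (\<Sum>m. \<integral>\<^sup>+y. indicator (A m) y * E m f y \<partial>M)"
    proof (intro suminf_le summableI)
      fix m
      have "2 * ?e * emeasure M (A m) = (\<integral>\<^sup>+y. 2 * ?e * indicator (A m) y \<partial>M)"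
        by (simp add: nn_integral_cmult_indicator)
      also have "\<dots> \<le> (\<integral>\<^sup>+y. indicator (A m) y * E m f y \<partial>M)"
        using e_A by (intro nn_integral_mono) (auto simp: indicator_def intro: less_imp_le)
      finally show "2 * ?e * emeasure M (A m) \<le> (\<integral>\<^sup>+y. indicator (A m) y * E m f y \<partial>M)" .
    qed
    also have "\<dots> \<le> ?e * emeasure M (Q n x)" using total by (simp add: int_A)
    finally show ?thesis using 3 unfolding UN by (simp add: ennreal_mult_le_mult_iff)
  qed
qed

end

section \<open>Bilinear bounds over a nested partition\<close>

definition maximal_const :: "real \<Rightarrow> real" where
  "maximal_const r = 2 powr r * geo_const (r - 1) powr r"

lemma maximal_const_nonneg: "0 \<le> maximal_const r"
  by (simp add: maximal_const_def)

context nested_partition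
begin

text \<open>Jensen's inequality on one cell, after which f^p is integrated over the whole space.
  This pays for the gap between p and q: surplus powers of the left-hand side are replaced by powers
  of the full integral.\<close>

lemma E_powr_times_emeasure_le:
  assumes p: "1 < p" and [measurable]: "f \<in> borel_measurable M"
  shows "E n f x epowr p * emeasure M (Q n x) \<le> (\<integral>\<^sup>+x. f x epowr p \<partial>M)"
proof -
  have "E n f x epowr p * emeasure M (Q n x) \<le> E n (\<lambda>y. f y epowr p) x * emeasure M (Q n x)"
    using p by (intro mult_right_mono E_Jensen) auto
  also have "\<dots> = (\<integral>\<^sup>+y\<in>Q n x. f y epowr p \<partial>M)"
    by (rule E_times_emeasure) simp
  also have "\<dots> \<le> (\<integral>\<^sup>+x. f x epowr p \<partial>M)"
    by (intro nn_integral_mono) (auto simp: indicator_def)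
  finally show ?thesis .
qed

text \<open>\<open>suminf_le_stops\<close> at every point, integrated. The averages are those of M
  while the integral is over N, a second measure on the same sigma-algebra, so that the density of a
  weight can be inserted.\<close>

lemma nn_integral_series_le:
  assumes "\<And>m. (\<Sum>n. a (m + n)) \<le> K * a m" and [measurable]: "w \<in> borel_measurable N"
    and [measurable_cong]: "sets N = sets M"
  shows "(\<integral>\<^sup>+x. (\<Sum>n. a n * E n f x) * w x \<partial>N)
    \<le> 2 * K * (\<Sum>n. \<integral>\<^sup>+x. a n * E n f x * indicator (stop_at f n) x * w x \<partial>N)"
proof -
  have "(\<integral>\<^sup>+x. (\<Sum>n. a n * E n f x) * w x \<partial>N)
    \<le> (\<integral>\<^sup>+x. (2 * K) * (\<Sum>n. a n * E n f x * indicator (stop_at f n) x * w x) \<partial>N)"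
  proof (intro nn_integral_mono)
    fix x
    have "(\<Sum>n. a n * E n f x) * w x
      \<le> (2 * K * (\<Sum>n. if stops (\<lambda>k. E k f x) n then a n * E n f x else 0)) * w x"
      by (intro mult_right_mono suminf_le_stops assms) auto
    also have "(\<Sum>n. if stops (\<lambda>k. E k f x) n then a n * E n f x else 0)
      = (\<Sum>n. a n * E n f x * indicator (stop_at f n) x)"
      by (intro suminf_cong) (simp add: stop_at_def)
    finally show "(\<Sum>n. a n * E n f x) * w x
      \<le> (2 * K) * (\<Sum>n. a n * E n f x * indicator (stop_at f n) x * w x)"
      by (simp only: ennreal_suminf_multc mult.assoc[of "2 * K" _ "w x"])
  qed
  also have "\<dots> = (2 * K) * (\<integral>\<^sup>+x. (\<Sum>n. a n * E n f x * indicator (stop_at f n) x * w x) \<partial>N)"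
    by (intro nn_integral_cmult) simp
  also have "(\<integral>\<^sup>+x. (\<Sum>n. a n * E n f x * indicator (stop_at f n) x * w x) \<partial>N)
    = (\<Sum>n. \<integral>\<^sup>+x. a n * E n f x * indicator (stop_at f n) x * w x \<partial>N)"
    by (intro nn_integral_suminf) simp
  finally show ?thesis .
qed

text \<open>The bump gives room in Hoelder's inequality on a cell: for r = \<theta> q > q the
  conjugate exponent r' lies below q', so the maximal inequality applies to G^(r') with exponent t =
  q'/r' > 1. The averages of f are left with the power p/q, whose sum over the stops at a point is
  geometric, and Hoelder with q and q' concludes.\<close>

lemma bump_bilinear_bound:
  fixes a :: "nat \<Rightarrow> ennreal"
  assumes p: "1 < p" "p \<le> q" and q': "1 < q'" "1 / q + 1 / q' = 1" and \<theta>: "1 < \<theta>"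
    and [measurable]: "f \<in> borel_measurable M" "g \<in> borel_measurable M" "v \<in> borel_measurable M"
    and K: "\<And>m. (\<Sum>n. a (m + n)) \<le> K * a m"
    and pos: "\<And>n x. emeasure M (Q n x) \<noteq> 0"
    and bump: "\<And>n x. a n * E n (\<lambda>y. v y epowr \<theta>) x epowr (1 / (\<theta> * q))
      \<le> \<delta> * emeasure M (Q n x) epowr (1 / p - 1 / q)"
    and J: "(\<integral>\<^sup>+x. f x epowr p \<partial>M) < top"
  shows "(\<integral>\<^sup>+x. (\<Sum>n. a n * E n f x) * (v x * g x) \<partial>M)
    \<le> 2 * K * \<delta> * ennreal (geo_const (p / q) * maximal_const p powr (1 / q)
        * maximal_const (q' / (\<theta> * q / (\<theta> * q - 1))) powr (1 / q'))
      * (\<integral>\<^sup>+x. f x epowr p \<partial>M) epowr (1 / p) * (\<integral>\<^sup>+x. v x * g x epowr q' \<partial>M) epowr (1 / q')"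
proof -
  let ?J = "\<integral>\<^sup>+x. f x epowr p \<partial>M"
  define r where "r = \<theta> * q"
  define r' where "r' = r / (r - 1)"
  define t where "t = q' / r'"
  \<comment> \<open>Chosen so that v g = v^(1/q) G and G^(q') = v g^(q'): the norm of g with respect
    to v becomes an unweighted norm of G.\<close>
  define G where "G x = g x * v x epowr (1 / q')" for x
  define H where "H x = (SUP n. E n (\<lambda>y. G y epowr r') x)" for x
  have [measurable]: "G \<in> borel_measurable M" "H \<in> borel_measurable M"
    unfolding G_def H_def by measurable
  have q: "1 < q" using p by simp
  then have "q < r" using \<theta> by (simp add: r_def)
  have q'_eq: "q' = q / (q - 1)" using q q' by (auto simp: field_simps)
  have r: "1 < r" "1 < r'" "1 / r + 1 / r' = 1"
    using \<open>q < r\<close> q by (auto simp: r'_def field_simps)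
  \<comment> \<open>This says r' < q'.\<close>
  have "q * (r - 1) > r * (q - 1)" using \<open>q < r\<close> by (simp add: algebra_simps)
  then have t: "1 < t"
    using q r by (simp add: t_def r'_def q'_eq field_simps)
  have E_prod: "E n (\<lambda>y. v y * g y) x \<le> E n (\<lambda>y. v y epowr \<theta>) x epowr (1 / r) * H x epowr (1 / r')" for n x
  proof -
    have "(\<lambda>y. v y * g y) = (\<lambda>y. v y epowr (1 / q) * G y)"
    proof
      fix y
      have "v y = v y epowr (1 / q + 1 / q')" using q' by simp
      also have "\<dots> = v y epowr (1 / q) * v y epowr (1 / q')" using q q' by (intro epowr_add) auto
      finally show "v y * g y = v y epowr (1 / q) * G y" by (simp add: G_def ac_simps)
    qed
    then have "E n (\<lambda>y. v y * g y) x = E n (\<lambda>y. v y epowr (1 / q) * G y) x" by simp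
    also have "\<dots> \<le> E n (\<lambda>y. (v y epowr (1 / q)) epowr r) x epowr (1 / r) * E n (\<lambda>y. G y epowr r') x epowr (1 / r')"
      using r by (intro E_Holder) auto
    also have "(\<lambda>y. (v y epowr (1 / q)) epowr r) = (\<lambda>y. v y epowr \<theta>)"
      using q by (simp add: epowr_epowr r_def)
    also have "E n (\<lambda>y. G y epowr r') x epowr (1 / r') \<le> H x epowr (1 / r')"
      unfolding H_def using r by (intro epowr_mono SUP_upper) auto
    finally show ?thesis by (simp add: mult_left_mono)
  qed
  \<comment> \<open>The exponent 1 of the average is split as p (1/p - 1/q) + p/q. The first part
    together with the power of |Q| is bounded through \<open>E_powr_times_emeasure_le\<close>; the
    second part remains for the sum over stops.\<close>
  have avg: "E n f x * emeasure M (Q n x) epowr (1 / p - 1 / q)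
    \<le> ?J epowr (1 / p - 1 / q) * E n f x epowr (p / q)" for n x
  proof (cases "E n f x = 0")
    case False
    let ?e = "E n f x" and ?m = "emeasure M (Q n x)"
    have le: "?e epowr p * ?m \<le> ?J" by (intro E_powr_times_emeasure_le p) simp
    have m: "?m \<noteq> 0" "?m \<noteq> top" using pos finite_cell[of n x] by auto
    have e: "?e \<noteq> top"
      using le J m p by (auto simp: ennreal_top_mult top_unique less_top[symmetric])
    have "?e = ?e epowr (p * (1 / p - 1 / q) + p / q)"
      using p by (simp add: right_diff_distrib)
    also have "\<dots> = ?e epowr (p * (1 / p - 1 / q)) * ?e epowr (p / q)"
      using False e by (rule epowr_add_nonneg)
    finally have "?e * ?m epowr (1 / p - 1 / q)
      = (?e epowr p) epowr (1 / p - 1 / q) * ?e epowr (p / q) * ?m epowr (1 / p - 1 / q)"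
      by (simp add: epowr_epowr)
    also have "\<dots> = (?e epowr p) epowr (1 / p - 1 / q) * ?m epowr (1 / p - 1 / q) * ?e epowr (p / q)"
      by (simp add: ac_simps)
    also have "(?e epowr p) epowr (1 / p - 1 / q) * ?m epowr (1 / p - 1 / q)
       \<le> ?J epowr (1 / p - 1 / q)"
    \<comment> \<open>For p = q all three powers have exponent 0, and they equal 1 only because the
      values are neither 0 nor \<infinity>.\<close>
    proof (cases "p = q")
      case True
      have "?J \<noteq> 0" "?J \<noteq> top" using J le False e m p by auto
      then show ?thesis using True False e m by (simp add: epowr_zero)
    next
      case False
      then have "0 < 1 / p - 1 / q" using p by (auto simp: field_simps)
      then show ?thesis using le by (simp add: epowr_mult[symmetric] epowr_mono)
    qed
    finally show ?thesis by (simp add: mult_right_mono)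
  qed auto
  have "(\<integral>\<^sup>+x. (\<Sum>n. a n * E n f x) * (v x * g x) \<partial>M)
    \<le> 2 * K * (\<Sum>n. \<integral>\<^sup>+x. a n * E n f x * indicator (stop_at f n) x * (v x * g x) \<partial>M)"
    by (intro nn_integral_series_le K) auto
  \<comment> \<open>At a stop the other factors are constant on the cell, so v g may be replaced by
    its average, to which Hoelder and the bump condition apply.\<close>
  also have "(\<lambda>n. \<integral>\<^sup>+x. a n * E n f x * indicator (stop_at f n) x * (v x * g x) \<partial>M)
    = (\<lambda>n. \<integral>\<^sup>+x. a n * E n f x * indicator (stop_at f n) x * E n (\<lambda>x. v x * g x) x \<partial>M)"
    by (intro ext nn_integral_E[symmetric] cell_const_compose2[OF cell_const_compose[OF cell_const_E] cell_const_stop_at]) simp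
  also have "(\<Sum>n. \<integral>\<^sup>+x. a n * E n f x * indicator (stop_at f n) x * E n (\<lambda>x. v x * g x) x \<partial>M)
    = (\<integral>\<^sup>+x. (\<Sum>n. a n * E n f x * indicator (stop_at f n) x * E n (\<lambda>x. v x * g x) x) \<partial>M)"
    by (intro nn_integral_suminf[symmetric]) simp
  also have "\<dots> \<le> (\<integral>\<^sup>+x. \<delta> * ?J epowr (1 / p - 1 / q) * ennreal (geo_const (p / q)) * ((SUP n. E n f x) epowr (p / q) * H x epowr (1 / r')) \<partial>M)"
  proof (intro nn_integral_mono)
    fix x
    let ?c = "\<delta> * ?J epowr (1 / p - 1 / q)"
    have "(\<Sum>n. a n * E n f x * indicator (stop_at f n) x * E n (\<lambda>x. v x * g x) x)
      \<le> (\<Sum>n. ?c * H x epowr (1 / r') * (if stops (\<lambda>k. E k f x) n then E n f x epowr (p / q) else 0))"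
    proof (intro suminf_le summableI)
      fix n
      have "a n * E n f x * E n (\<lambda>x. v x * g x) x
        \<le> a n * E n f x * (E n (\<lambda>y. v y epowr \<theta>) x epowr (1 / r) * H x epowr (1 / r'))"
        by (intro mult_left_mono E_prod) auto
      also have "\<dots> = (a n * E n (\<lambda>y. v y epowr \<theta>) x epowr (1 / (\<theta> * q))) * (E n f x * H x epowr (1 / r'))"
        by (simp add: r_def ac_simps)
      also have "\<dots> \<le> (\<delta> * emeasure M (Q n x) epowr (1 / p - 1 / q)) * (E n f x * H x epowr (1 / r'))"
        by (intro mult_right_mono bump) auto
      also have "\<dots> = \<delta> * H x epowr (1 / r') * (E n f x * emeasure M (Q n x) epowr (1 / p - 1 / q))"
        by (simp add: ac_simps)
      also have "\<dots> \<le> \<delta> * H x epowr (1 / r') * (?J epowr (1 / p - 1 / q) * E n f x epowr (p / q))"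
        by (intro mult_left_mono avg) auto
      finally have "a n * E n f x * E n (\<lambda>x. v x * g x) x \<le> ?c * H x epowr (1 / r') * E n f x epowr (p / q)"
        by (simp add: ac_simps)
      then show "a n * E n f x * indicator (stop_at f n) x * E n (\<lambda>x. v x * g x) x
        \<le> ?c * H x epowr (1 / r') * (if stops (\<lambda>k. E k f x) n then E n f x epowr (p / q) else 0)"
        by (auto simp: stop_at_def)
    qed
    also have "\<dots> = ?c * H x epowr (1 / r') * (\<Sum>n. if stops (\<lambda>k. E k f x) n then E n f x epowr (p / q) else 0)"
      by (rule ennreal_suminf_cmult)
    also have "\<dots> \<le> ?c * H x epowr (1 / r') * (ennreal (geo_const (p / q)) * (SUP n. E n f x) epowr (p / q))"
      using p by (intro mult_left_mono suminf_stops_le) auto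
    finally show "(\<Sum>n. a n * E n f x * indicator (stop_at f n) x * E n (\<lambda>x. v x * g x) x)
      \<le> ?c * ennreal (geo_const (p / q)) * ((SUP n. E n f x) epowr (p / q) * H x epowr (1 / r'))"
      by (simp add: ac_simps)
  qed
  also have "\<dots> = \<delta> * ?J epowr (1 / p - 1 / q) * ennreal (geo_const (p / q))
      * (\<integral>\<^sup>+x. (SUP n. E n f x) epowr (p / q) * H x epowr (1 / r') \<partial>M)"
    by (intro nn_integral_cmult) simp
  also have "(\<integral>\<^sup>+x. (SUP n. E n f x) epowr (p / q) * H x epowr (1 / r') \<partial>M)
    \<le> (\<integral>\<^sup>+x. ((SUP n. E n f x) epowr (p / q)) epowr q \<partial>M) epowr (1 / q)
      * (\<integral>\<^sup>+x. (H x epowr (1 / r')) epowr q' \<partial>M) epowr (1 / q')"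
    using q q' by (intro nn_integral_Holder) auto
  also have "(\<integral>\<^sup>+x. ((SUP n. E n f x) epowr (p / q)) epowr q \<partial>M) = (\<integral>\<^sup>+x. (SUP n. E n f x) epowr p \<partial>M)"
    using q by (simp add: epowr_epowr)
  also have "(\<integral>\<^sup>+x. (H x epowr (1 / r')) epowr q' \<partial>M) = (\<integral>\<^sup>+x. H x epowr t \<partial>M)"
    by (simp add: epowr_epowr t_def)
  also have "(\<integral>\<^sup>+x. (SUP n. E n f x) epowr p \<partial>M) epowr (1 / q) \<le> (ennreal (maximal_const p) * ?J) epowr (1 / q)"
    unfolding maximal_const_def using p q by (intro epowr_mono maximal_inequality) auto
  also have "(\<integral>\<^sup>+x. H x epowr t \<partial>M) epowr (1 / q')
    \<le> (ennreal (maximal_const t) * (\<integral>\<^sup>+x. (G x epowr r') epowr t \<partial>M)) epowr (1 / q')"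
    unfolding maximal_const_def H_def using t q' by (intro epowr_mono maximal_inequality) auto
  also have "(\<integral>\<^sup>+x. (G x epowr r') epowr t \<partial>M) = (\<integral>\<^sup>+x. v x * g x epowr q' \<partial>M)"
    using r q' by (intro nn_integral_cong) (simp add: G_def epowr_mult epowr_epowr t_def mult.commute)
  finally have "(\<integral>\<^sup>+x. (\<Sum>n. a n * E n f x) * (v x * g x) \<partial>M) \<le>
    2 * K * (\<delta> * ?J epowr (1 / p - 1 / q) * ennreal (geo_const (p / q))
      * ((ennreal (maximal_const p) * ?J) epowr (1 / q)
      * (ennreal (maximal_const t) * (\<integral>\<^sup>+x. v x * g x epowr q' \<partial>M)) epowr (1 / q')))"
    by (simp add: mult_left_mono mult_mono)
  also have "\<dots> = 2 * K * \<delta> * (ennreal (geo_const (p / q)) * ennreal (maximal_const p powr (1 / q))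
        * ennreal (maximal_const t powr (1 / q')))
      * (?J epowr (1 / p - 1 / q) * ?J epowr (1 / q)) * (\<integral>\<^sup>+x. v x * g x epowr q' \<partial>M) epowr (1 / q')"
    using q q' by (simp add: epowr_mult maximal_const_nonneg ac_simps)
  also have "?J epowr (1 / p - 1 / q) * ?J epowr (1 / q) = ?J epowr (1 / p)"
  proof (cases "?J = 0")
    case False
    then have "?J epowr (1 / p - 1 / q) * ?J epowr (1 / q) = ?J epowr (1 / p - 1 / q + 1 / q)"
      using J by (intro epowr_add_nonneg[symmetric]) auto
    then show ?thesis by simp
  qed simp
  finally show ?thesis
    using geo_const(1)[of "p / q"] p q
    by (simp add: ennreal_mult t_def r'_def r_def mult.assoc)
qed

text \<open>A stopping cell has at least half of its M-measure outside all later stopping cells, so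
  doubling moves its N-mass to that part at the cost of D. The parts are disjoint for different
  generations, hence at each point the sum over stops has at most one term and its q-th power is the
  sum of the q-th powers. The maximal function of g is taken with respect to N, for which the
  maximal inequality of the grid holds as well.\<close>

lemma doubling_bilinear_bound:
  fixes a :: "nat \<Rightarrow> ennreal"
  assumes "nested_partition N Q" and sets_N [measurable_cong]: "sets N = sets M"
    and p: "1 < p" "p \<le> q" and q': "1 < q'" "1 / q + 1 / q' = 1"
    and [measurable]: "f \<in> borel_measurable M" "g \<in> borel_measurable M"
    and K: "\<And>m. (\<Sum>n. a (m + n)) \<le> K * a m"
    and pos: "\<And>n x. emeasure M (Q n x) \<noteq> 0"
    and doubling: "\<And>n x A. A \<in> sets M \<Longrightarrow> A \<subseteq> Q n x \<Longrightarrow> emeasure M (Q n x) \<le> 2 * emeasure M A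
      \<Longrightarrow> emeasure N (Q n x) \<le> D * emeasure N A"
    and growth: "\<And>n x. a n epowr q * emeasure N (Q n x) \<le> \<delta> epowr q * emeasure M (Q n x) epowr (q / p)"
    and J: "(\<integral>\<^sup>+x. f x epowr p \<partial>M) < top"
  shows "(\<integral>\<^sup>+x. (\<Sum>n. a n * E n f x) * g x \<partial>N)
    \<le> 2 * K * D * \<delta> * ennreal (maximal_const p powr (1 / q) * maximal_const q' powr (1 / q'))
      * (\<integral>\<^sup>+x. f x epowr p \<partial>M) epowr (1 / p) * (\<integral>\<^sup>+x. g x epowr q' \<partial>N) epowr (1 / q')"
proof -
  interpret N: nested_partition N Q by fact
  let ?J = "\<integral>\<^sup>+x. f x epowr p \<partial>M"
  let ?L = "\<lambda>n. indicator (last_stop f n) :: 'a \<Rightarrow> ennreal" and ?S = "\<lambda>n. indicator (stop_at f n) :: 'a \<Rightarrow> ennreal"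
  have q: "1 < q" using p by simp
  define H where "H x = (SUP n. N.E n g x)" for x
  have [measurable]: "H \<in> borel_measurable N" unfolding H_def by measurable
  define U where "U x = (\<Sum>n. a n * E n f x * ?L n x)" for x
  have [measurable]: "U \<in> borel_measurable N" unfolding U_def by measurable
  \<comment> \<open>By \<open>emeasure_later_stops\<close> the part covered later has at most half
    of the finite measure of the cell.\<close>
  have half: "emeasure N (Q n x) \<le> D * emeasure N (Q n x \<inter> last_stop f n)" if "x \<in> stop_at f n" for n x
  proof (rule doubling)
    let ?A = "emeasure M (Q n x \<inter> last_stop f n)" and ?B = "emeasure M (Q n x - last_stop f n)"
    have "emeasure M (Q n x) = ?A + ?B"
      by (subst plus_emeasure) (auto intro!: arg_cong[where f = "emeasure M"])
    then have "emeasure M (Q n x) + emeasure M (Q n x) = 2 * ?A + 2 * ?B"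
      by (simp add: mult_2 ac_simps)
    also have "\<dots> \<le> 2 * ?A + emeasure M (Q n x)"
      by (intro add_left_mono emeasure_later_stops that) simp
    finally show "emeasure M (Q n x) \<le> 2 * ?A"
      using finite_cell[of n x] by (auto simp add: add.commute[of "2 * ?A"] ennreal_add_left_cancel_le)
  qed auto
  have shrink: "(\<integral>\<^sup>+x. F x * ?S n x \<partial>N) \<le> D * (\<integral>\<^sup>+x. F x * ?L n x \<partial>N)"
    if F: "cell_const Q n F" for F n
  proof -
    have [measurable]: "F \<in> borel_measurable N" by (rule N.cell_const_borel[OF F])
    have "(\<integral>\<^sup>+x. F x * ?S n x \<partial>N) = (\<integral>\<^sup>+C. (\<integral>\<^sup>+x\<in>C. F x * ?S n x \<partial>N) \<partial>count_space (range (Q n)))"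
      by (rule N.nn_integral_cells) simp
    also have "\<dots> \<le> (\<integral>\<^sup>+C. D * (\<integral>\<^sup>+x\<in>C. F x * ?L n x \<partial>N) \<partial>count_space (range (Q n)))"
    proof (rule nn_integral_mono)
      fix C assume "C \<in> space (count_space (range (Q n)))"
      then obtain x where C: "C = Q n x" by auto
      have "(\<integral>\<^sup>+y\<in>C. F y * ?S n y \<partial>N) = (\<integral>\<^sup>+y\<in>C. (F y * ?S n y) * 1 \<partial>N)" by simp
      also have "\<dots> = F x * ?S n x * emeasure N (Q n x)"
        unfolding C by (subst N.set_nn_integral_cell_const[OF cell_const_compose2[OF F cell_const_stop_at]]) auto
      also have "\<dots> \<le> F x * (D * emeasure N (Q n x \<inter> last_stop f n))"
        using half[of x n] by (auto simp: indicator_def intro!: mult_left_mono)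
      also have "emeasure N (Q n x \<inter> last_stop f n) = (\<integral>\<^sup>+y\<in>Q n x. ?L n y \<partial>N)"
      proof -
        have "(\<integral>\<^sup>+y\<in>Q n x. ?L n y \<partial>N) = (\<integral>\<^sup>+y. indicator (Q n x \<inter> last_stop f n) y \<partial>N)"
          by (intro nn_integral_cong) (auto simp: indicator_def)
        then show ?thesis by simp
      qed
      also have "F x * (D * \<dots>) = D * (F x * \<dots>)" by (rule mult.left_commute)
      also have "F x * (\<integral>\<^sup>+y\<in>Q n x. ?L n y \<partial>N) = (\<integral>\<^sup>+y\<in>C. F y * ?L n y \<partial>N)"
        unfolding C by (rule N.set_nn_integral_cell_const[OF F, symmetric]) simp
      finally show "(\<integral>\<^sup>+y\<in>C. F y * ?S n y \<partial>N) \<le> D * (\<integral>\<^sup>+y\<in>C. F y * ?L n y \<partial>N)" .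
    qed
    also have "\<dots> = D * (\<integral>\<^sup>+C. (\<integral>\<^sup>+x\<in>C. F x * ?L n x \<partial>N) \<partial>count_space (range (Q n)))"
      by (intro nn_integral_cmult) simp
    also have "\<dots> = D * (\<integral>\<^sup>+x. F x * ?L n x \<partial>N)"
      by (subst N.nn_integral_cells[symmetric]) auto
    finally show ?thesis .
  qed
  \<comment> \<open>Cell by cell, growth replaces the N-mass by |Q|^(q/p), and (e^p |Q|)^(q/p) \<le>
    J^(q/p - 1) e^p |Q| leaves a sum of the form in \<open>Carleson_stops\<close>.\<close>
  have cell_mass: "(\<integral>\<^sup>+x. (a n * E n f x * ?S n x) epowr q \<partial>N)
      \<le> \<delta> epowr q * ?J epowr (q / p - 1) * (\<integral>\<^sup>+x. E n f x epowr p * ?S n x \<partial>M)" for n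
  proof -
    let ?F = "\<lambda>x. (a n * E n f x * ?S n x) epowr q"
    have F: "cell_const Q n ?F"
      by (rule cell_const_compose) (intro cell_const_compose2[OF cell_const_compose[OF cell_const_E] cell_const_stop_at])
    have [measurable]: "?F \<in> borel_measurable N" by (rule N.cell_const_borel[OF F])
    have "(\<integral>\<^sup>+x. ?F x \<partial>N) = (\<integral>\<^sup>+C. (\<integral>\<^sup>+x\<in>C. ?F x \<partial>N) \<partial>count_space (range (Q n)))"
      by (rule N.nn_integral_cells) simp
    also have "\<dots> \<le> (\<integral>\<^sup>+C. \<delta> epowr q * ?J epowr (q / p - 1) * (\<integral>\<^sup>+x\<in>C. E n f x epowr p * ?S n x \<partial>M) \<partial>count_space (range (Q n)))"
    proof (rule nn_integral_mono)
      fix C assume "C \<in> space (count_space (range (Q n)))"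
      then obtain x where C: "C = Q n x" by auto
      let ?e = "E n f x" and ?m = "emeasure M (Q n x)"
      have "(\<integral>\<^sup>+y\<in>C. ?F y \<partial>N) = (\<integral>\<^sup>+y\<in>C. ?F y * 1 \<partial>N)" by simp
      also have "\<dots> = ?F x * emeasure N (Q n x)"
        unfolding C by (subst N.set_nn_integral_cell_const[OF F]) auto
      also have "\<dots> = ?e epowr q * ?S n x * (a n epowr q * emeasure N (Q n x))"
        using q by (auto simp: indicator_def epowr_mult ac_simps)
      also have "\<dots> \<le> ?e epowr q * ?S n x * (\<delta> epowr q * ?m epowr (q / p))"
        by (intro mult_left_mono growth) auto
      also have "\<dots> = \<delta> epowr q * ((?e epowr p * ?m) epowr (q / p)) * ?S n x"
        using p q by (simp add: epowr_mult epowr_epowr ac_simps)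
      also have "(?e epowr p * ?m) epowr (q / p) \<le> ?J epowr (q / p - 1) * (?e epowr p * ?m)"
      proof (cases "?e epowr p * ?m = 0")
        case False
        have le: "?e epowr p * ?m \<le> ?J" by (intro E_powr_times_emeasure_le p) simp
        then have fin: "?e epowr p * ?m \<noteq> top" "?J \<noteq> 0" using J False by (auto simp: top_unique)
        have "(?e epowr p * ?m) epowr (q / p) = (?e epowr p * ?m) epowr ((q / p - 1) + 1)" by simp
        also have "\<dots> = (?e epowr p * ?m) epowr (q / p - 1) * (?e epowr p * ?m) epowr 1"
          using False fin by (intro epowr_add_nonneg) auto
        also have "\<dots> \<le> ?J epowr (q / p - 1) * (?e epowr p * ?m)"
          using p le by (simp add: mult_right_mono epowr_mono)
        finally show ?thesis .
      qed (simp only: epowr_0 zero_le)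
      also have "\<delta> epowr q * (?J epowr (q / p - 1) * (?e epowr p * ?m)) * ?S n x
        = \<delta> epowr q * ?J epowr (q / p - 1) * (?e epowr p * ?S n x * ?m)"
        by (simp add: ac_simps)
      also have "?e epowr p * ?S n x * ?m = (\<integral>\<^sup>+y\<in>C. (E n f y epowr p * ?S n y) * 1 \<partial>M)"
        unfolding C by (subst set_nn_integral_cell_const[OF cell_const_compose2[OF cell_const_compose[OF cell_const_E] cell_const_stop_at]]) auto
      finally show "(\<integral>\<^sup>+x\<in>C. ?F x \<partial>N)
        \<le> \<delta> epowr q * ?J epowr (q / p - 1) * (\<integral>\<^sup>+x\<in>C. E n f x epowr p * ?S n x \<partial>M)"
        by (simp add: mult_left_mono mult_right_mono)
    qed
    also have "\<dots> = \<delta> epowr q * ?J epowr (q / p - 1) * (\<integral>\<^sup>+C. (\<integral>\<^sup>+x\<in>C. E n f x epowr p * ?S n x \<partial>M) \<partial>count_space (range (Q n)))"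
      by (intro nn_integral_cmult) simp
    also have "\<dots> = \<delta> epowr q * ?J epowr (q / p - 1) * (\<integral>\<^sup>+x. E n f x epowr p * ?S n x \<partial>M)"
      by (subst nn_integral_cells[symmetric]) auto
    finally show ?thesis .
  qed
  have U_q: "(\<integral>\<^sup>+x. U x epowr q \<partial>N) \<le> \<delta> epowr q * ennreal (maximal_const p) * ?J epowr (q / p)"
  proof -
    have "(\<integral>\<^sup>+x. U x epowr q \<partial>N) \<le> (\<integral>\<^sup>+x. (\<Sum>n. (a n * E n f x * ?S n x) epowr q) \<partial>N)"
    proof (intro nn_integral_mono)
      fix x
      show "U x epowr q \<le> (\<Sum>n. (a n * E n f x * ?S n x) epowr q)"
      \<comment> \<open>A point has at most one last stop, so at most one term of \<open>U\<close>
        is not 0.\<close>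
      proof (cases "\<exists>n. x \<in> last_stop f n")
        case True
        then obtain n where n: "x \<in> last_stop f n" by blast
        have other: "x \<notin> last_stop f m" if "m \<noteq> n" for m
          using n that by (auto simp: last_stop_def) (metis linorder_neqE_nat)
        have "U x = (\<Sum>m\<in>{n}. a m * E m f x * ?L m x)"
          unfolding U_def using other by (intro suminf_finite) auto
        also have "\<dots> = a n * E n f x" using n by simp
        finally have "U x epowr q = (\<Sum>m\<in>{n}. (a m * E m f x * ?S m x) epowr q)"
          using n by (simp add: last_stop_def)
        also have "\<dots> \<le> (\<Sum>n. (a n * E n f x * ?S n x) epowr q)"
          by (intro sum_le_suminf) auto
        finally show ?thesis .
      next
        case False
        then have "U x = 0" by (simp add: U_def)
        then show ?thesis by simp
      qed
    qed
    also have "\<dots> = (\<Sum>n. \<integral>\<^sup>+x. (a n * E n f x * ?S n x) epowr q \<partial>N)"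
      by (intro nn_integral_suminf) simp
    also have "\<dots> \<le> (\<Sum>n. \<delta> epowr q * ?J epowr (q / p - 1) * (\<integral>\<^sup>+x. E n f x epowr p * ?S n x \<partial>M))"
      by (intro suminf_le cell_mass summableI)
    also have "\<dots> = \<delta> epowr q * ?J epowr (q / p - 1) * (\<Sum>n. \<integral>\<^sup>+x. E n f x epowr p * ?S n x \<partial>M)"
      by (rule ennreal_suminf_cmult)
    also have "\<dots> \<le> \<delta> epowr q * ?J epowr (q / p - 1) * (ennreal (geo_const (p - 1) powr p) * ?J)"
      by (intro mult_left_mono Carleson_stops p) auto
    also have "\<dots> \<le> \<delta> epowr q * ?J epowr (q / p - 1) * (ennreal (maximal_const p) * ?J)"
    proof -
      have "1 * geo_const (p - 1) powr p \<le> maximal_const p"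
        unfolding maximal_const_def using p by (intro mult_right_mono) (auto simp: ge_one_powr_ge_zero)
      then show ?thesis by (auto intro!: mult_left_mono mult_right_mono ennreal_leI)
    qed
    also have "\<dots> = \<delta> epowr q * ennreal (maximal_const p) * (?J epowr (q / p - 1) * ?J)"
      by (simp add: ac_simps)
    also have "?J epowr (q / p - 1) * ?J = ?J epowr (q / p)"
    proof (cases "?J = 0")
      case False
      then have "?J epowr (q / p - 1) * ?J epowr 1 = ?J epowr (q / p - 1 + 1)"
        using J by (intro epowr_add_nonneg[symmetric]) auto
      then show ?thesis by simp
    qed simp
    finally show ?thesis .
  qed
  have "(\<integral>\<^sup>+x. (\<Sum>n. a n * E n f x) * g x \<partial>N)
    \<le> 2 * K * (\<Sum>n. \<integral>\<^sup>+x. a n * E n f x * ?S n x * g x \<partial>N)"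
    by (intro nn_integral_series_le K) (simp_all add: sets_N)
  also have "(\<Sum>n. \<integral>\<^sup>+x. a n * E n f x * ?S n x * g x \<partial>N) \<le> (\<Sum>n. D * (\<integral>\<^sup>+x. a n * E n f x * ?L n x * H x \<partial>N))"
  proof (intro suminf_le summableI)
    fix n
    \<comment> \<open>g is averaged with respect to N before the mass is moved, because
      \<open>shrink\<close> asks for functions that are constant on cells; only afterwards is the
      average enlarged to \<open>H\<close>.\<close>
    have "(\<integral>\<^sup>+x. a n * E n f x * ?S n x * g x \<partial>N) = (\<integral>\<^sup>+x. a n * E n f x * ?S n x * N.E n g x \<partial>N)"
      by (intro N.nn_integral_E[symmetric] cell_const_compose2[OF cell_const_compose[OF cell_const_E] cell_const_stop_at]) simp
    also have "\<dots> = (\<integral>\<^sup>+x. (a n * E n f x * N.E n g x) * ?S n x \<partial>N)"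
      by (simp add: ac_simps)
    also have "\<dots> \<le> D * (\<integral>\<^sup>+x. (a n * E n f x * N.E n g x) * ?L n x \<partial>N)"
      by (intro shrink cell_const_compose2[OF cell_const_compose[OF cell_const_E] N.cell_const_E])
    also have "\<dots> \<le> D * (\<integral>\<^sup>+x. (a n * E n f x * H x) * ?L n x \<partial>N)"
      by (intro mult_left_mono nn_integral_mono mult_right_mono) (auto simp: H_def intro: SUP_upper)
    finally show "(\<integral>\<^sup>+x. a n * E n f x * ?S n x * g x \<partial>N) \<le> D * (\<integral>\<^sup>+x. a n * E n f x * ?L n x * H x \<partial>N)"
      by (simp add: ac_simps)
  qed
  also have "\<dots> = D * (\<Sum>n. \<integral>\<^sup>+x. a n * E n f x * ?L n x * H x \<partial>N)"
    by (rule ennreal_suminf_cmult)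
  also have "(\<Sum>n. \<integral>\<^sup>+x. a n * E n f x * ?L n x * H x \<partial>N) = (\<integral>\<^sup>+x. U x * H x \<partial>N)"
    unfolding U_def ennreal_suminf_multc[symmetric] by (rule nn_integral_suminf[symmetric]) simp
  also have "(\<integral>\<^sup>+x. U x * H x \<partial>N) \<le> (\<integral>\<^sup>+x. U x epowr q \<partial>N) epowr (1 / q) * (\<integral>\<^sup>+x. H x epowr q' \<partial>N) epowr (1 / q')"
    using q q' by (intro nn_integral_Holder) auto
  also have "(\<integral>\<^sup>+x. U x epowr q \<partial>N) epowr (1 / q)
    \<le> (\<delta> epowr q * ennreal (maximal_const p) * ?J epowr (q / p)) epowr (1 / q)"
    using q by (intro epowr_mono U_q) auto
  also have "(\<integral>\<^sup>+x. H x epowr q' \<partial>N) epowr (1 / q') \<le> (ennreal (maximal_const q') * (\<integral>\<^sup>+x. g x epowr q' \<partial>N)) epowr (1 / q')"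
    unfolding maximal_const_def H_def using q' by (intro epowr_mono N.maximal_inequality) auto
  finally have "(\<integral>\<^sup>+x. (\<Sum>n. a n * E n f x) * g x \<partial>N)
    \<le> 2 * K * (D * ((\<delta> epowr q * ennreal (maximal_const p) * ?J epowr (q / p)) epowr (1 / q)
      * (ennreal (maximal_const q') * (\<integral>\<^sup>+x. g x epowr q' \<partial>N)) epowr (1 / q')))"
    by (simp add: mult_left_mono mult_mono)
  also have "\<dots> = 2 * K * D * \<delta> * (ennreal (maximal_const p powr (1 / q)) * ennreal (maximal_const q' powr (1 / q')))
      * ?J epowr (1 / p) * (\<integral>\<^sup>+x. g x epowr q' \<partial>N) epowr (1 / q')"
    using q q' by (simp add: epowr_mult epowr_epowr maximal_const_nonneg ac_simps)
  finally show ?thesis by (simp add: ennreal_mult)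
qed

end

section \<open>Dyadic grids and the local Riesz potential\<close>

text \<open>Half-open cells of side L / 2^n in the grid through z. Comparing integer parts of the
  coordinates makes the equivalence classes, the nesting and the countability immediate, while
  \<open>dyadic_iff\<close> recovers the geometric description.\<close>

definition dyadic :: "'a::euclidean_space \<Rightarrow> real \<Rightarrow> nat \<Rightarrow> 'a \<Rightarrow> 'a set" where
  "dyadic z L n x = {y. \<forall>b\<in>Basis. \<lfloor>2 ^ n * ((y - z) \<bullet> b) / L\<rfloor> = \<lfloor>2 ^ n * ((x - z) \<bullet> b) / L\<rfloor>}"

definition dyadic_corner :: "'a::euclidean_space \<Rightarrow> real \<Rightarrow> nat \<Rightarrow> 'a \<Rightarrow> 'a" where
  "dyadic_corner z L n x = z + (\<Sum>b\<in>Basis. (L / 2 ^ n * \<lfloor>2 ^ n * ((x - z) \<bullet> b) / L\<rfloor>) *\<^sub>R b)"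

lemma dyadic_corner_inner:
  "b \<in> Basis \<Longrightarrow> dyadic_corner z L n x \<bullet> b = z \<bullet> b + L / 2 ^ n * \<lfloor>2 ^ n * ((x - z) \<bullet> b) / L\<rfloor>"
  by (simp add: dyadic_corner_def inner_add_left inner_sum_left inner_Basis if_distrib cong: if_cong)

lemma dyadic_iff:
  assumes "0 < L"
  shows "y \<in> dyadic z L n x \<longleftrightarrow> (\<forall>b\<in>Basis. dyadic_corner z L n x \<bullet> b \<le> y \<bullet> b
    \<and> y \<bullet> b < dyadic_corner z L n x \<bullet> b + L / 2 ^ n)"
proof -
  have "\<lfloor>2 ^ n * ((y - z) \<bullet> b) / L\<rfloor> = k \<longleftrightarrow>
    z \<bullet> b + L / 2 ^ n * k \<le> y \<bullet> b \<and> y \<bullet> b < z \<bullet> b + L / 2 ^ n * k + L / 2 ^ n" for b and k :: int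
    using assms by (simp add: floor_eq_iff field_simps inner_diff_left)
  then show ?thesis by (simp add: dyadic_def dyadic_corner_inner)
qed

lemma dyadic_subset_cube:
  assumes "0 < L" shows "dyadic z L n x \<subseteq> cube (dyadic_corner z L n x) (L / 2 ^ n)"
  by (auto simp: dyadic_iff[OF assms] cube_def mem_box inner_add_left less_imp_le)

lemma box_subset_dyadic:
  assumes "0 < L"
  shows "box (dyadic_corner z L n x) (dyadic_corner z L n x + (L / 2 ^ n) *\<^sub>R One) \<subseteq> dyadic z L n x"
  by (auto simp: dyadic_iff[OF assms] mem_box inner_add_left less_imp_le)

lemma sets_dyadic [measurable]: "dyadic z L n x \<in> sets borel"
proof -
  have "dyadic z L n x = (\<Inter>b\<in>Basis. {y \<in> space borel. \<lfloor>2 ^ n * ((y - z) \<bullet> b) / L\<rfloor> = \<lfloor>2 ^ n * ((x - z) \<bullet> b) / L\<rfloor>})"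
    by (auto simp: dyadic_def)
  also have "\<dots> \<in> sets borel" by (intro sets.finite_INT) auto
  finally show ?thesis .
qed

lemma emeasure_cube: "0 \<le> l \<Longrightarrow> emeasure lborel (cube (a::'a::euclidean_space) l) = ennreal (l ^ DIM('a))"
  unfolding cube_def by (subst emeasure_lborel_cbox) (auto simp: inner_add_left)

lemma sets_cube [measurable]: "cube a l \<in> sets borel"
  by (simp add: cube_def)

lemma emeasure_dyadic:
  fixes x :: "'a::euclidean_space"
  assumes L: "0 < L"
  shows "emeasure lborel (dyadic z L n x) = ennreal ((L / 2 ^ n) ^ DIM('a))"
proof (rule antisym)
  have "emeasure lborel (dyadic z L n x) \<le> emeasure lborel (cube (dyadic_corner z L n x) (L / 2 ^ n))"
    by (intro emeasure_mono dyadic_subset_cube L) auto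
  then show "emeasure lborel (dyadic z L n x) \<le> ennreal ((L / 2 ^ n) ^ DIM('a))"
    using L by (simp add: emeasure_cube)
  let ?c = "dyadic_corner z L n x"
  have "ennreal ((L / 2 ^ n) ^ DIM('a)) = emeasure lborel (box ?c (?c + (L / 2 ^ n) *\<^sub>R One))"
    using L by (subst emeasure_lborel_box) (auto simp: inner_add_left)
  also have "\<dots> \<le> emeasure lborel (dyadic z L n x)"
    by (intro emeasure_mono box_subset_dyadic L) auto
  finally show "ennreal ((L / 2 ^ n) ^ DIM('a)) \<le> emeasure lborel (dyadic z L n x)" .
qed

lemma nested_partition_dyadic:
  fixes z :: "'a::euclidean_space"
  assumes L: "0 < L" and N: "sets N = sets borel" "\<And>a l. 0 < l \<Longrightarrow> emeasure N (cube a l) < top"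
  shows "nested_partition N (dyadic z L)"
proof
  fix n :: nat and x y :: 'a
  show "x \<in> dyadic z L n x" by (simp add: dyadic_def)
  show "y \<in> dyadic z L n x \<Longrightarrow> dyadic z L n y = dyadic z L n x" by (auto simp: dyadic_def)
  show "dyadic z L (Suc n) x \<subseteq> dyadic z L n x"
  proof -
    \<comment> \<open>The index of a cell is the index of its subcell halved and rounded
      down.\<close>
    have "\<lfloor>2 ^ n * t / L\<rfloor> = \<lfloor>2 ^ Suc n * t / L\<rfloor> div 2" for t :: real
      using floor_divide_real_eq_div[of 2 "2 ^ Suc n * t / L"] by simp
    then show ?thesis unfolding dyadic_def by (smt (verit) mem_Collect_eq subsetI)
  qed
  show "countable (range (dyadic z L n))"
  proof -
    define G where "G h = {y. \<forall>b\<in>Basis. \<lfloor>2 ^ n * ((y - z) \<bullet> b) / L\<rfloor> = h b}" for h :: "'a \<Rightarrow> int"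
    have "dyadic z L n x = G (restrict (\<lambda>b. \<lfloor>2 ^ n * ((x - z) \<bullet> b) / L\<rfloor>) Basis)" for x
      by (auto simp: G_def dyadic_def)
    then have "range (dyadic z L n) \<subseteq> G ` (Basis \<rightarrow>\<^sub>E UNIV)" by auto
    moreover have "countable (Basis \<rightarrow>\<^sub>E UNIV :: ('a \<Rightarrow> int) set)"
      by (intro countable_PiE) auto
    ultimately show ?thesis by (rule countable_subset[OF _ countable_image])
  qed
  show "dyadic z L n x \<in> sets N" using N by simp
  have "emeasure N (dyadic z L n x) \<le> emeasure N (cube (dyadic_corner z L n x) (L / 2 ^ n))"
    using N by (intro emeasure_mono dyadic_subset_cube L) auto
  also have "\<dots> < top" using L by (intro N) auto
  finally show "emeasure N (dyadic z L n x) < top" .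
  show "space N = UNIV" using sets_eq_imp_space_eq[OF N(1)] by simp
qed

section \<open>The one-third trick for shifted grids\<close>

definition grid_shifts :: "real \<Rightarrow> 'a::euclidean_space set" where
  "grid_shifts L = (\<lambda>S. \<Sum>b\<in>S. (L / 3) *\<^sub>R b) ` Pow Basis"

lemma finite_grid_shifts [simp]: "finite (grid_shifts L :: 'a::euclidean_space set)"
  by (simp add: grid_shifts_def)

lemma card_grid_shifts: "card (grid_shifts L :: 'a::euclidean_space set) \<le> 2 ^ DIM('a)"
  unfolding grid_shifts_def
  using card_image_le[of "Pow Basis" "\<lambda>S. \<Sum>b\<in>S. (L / 3) *\<^sub>R b :: 'a"] by (simp add: card_Pow)

text \<open>The breakpoints of the two grids are at distance at least \<open>1/3\<close>, since \<open>3\<close> does not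
  divide \<open>2\<^sup>n\<close>.\<close>

lemma floor_third_shift:
  fixes s t :: real
  assumes "\<bar>s - t\<bar> < 1 / 3"
  shows "\<lfloor>s\<rfloor> = \<lfloor>t\<rfloor> \<or> \<lfloor>s - 2 ^ n / 3\<rfloor> = \<lfloor>t - 2 ^ n / 3\<rfloor>"
proof (rule ccontr)
  assume neq: "\<not> ?thesis"
  have between: "\<exists>m::int. min s t < m \<and> m \<le> max s t" if "\<lfloor>s\<rfloor> \<noteq> \<lfloor>t\<rfloor>" for s t :: real
    using that by (intro exI[of _ "max \<lfloor>s\<rfloor> \<lfloor>t\<rfloor>"]) (auto simp: min_def max_def; linarith)
  \<comment> \<open>If both integer parts differed, a breakpoint m of the first grid and a
    breakpoint k + 2^n/3 of the second would lie between s and t, hence at distance less than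
    1/3.\<close>
  obtain m :: int where m: "min s t < m" "m \<le> max s t" using between neq by blast
  obtain k :: int where k: "min (s - 2 ^ n / 3) (t - 2 ^ n / 3) < k" "k \<le> max (s - 2 ^ n / 3) (t - 2 ^ n / 3)"
    using between neq by blast
  have "\<bar>real_of_int m - real_of_int k - 2 ^ n / 3\<bar> < 1 / 3"
    using m k assms by (auto simp: min_def max_def abs_if split: if_splits)
  then have "\<bar>3 * (real_of_int m - real_of_int k) - 2 ^ n\<bar> < 1" by (simp add: abs_if split: if_splits)
  then have "\<bar>real_of_int (3 * (m - k) - 2 ^ n)\<bar> < 1" by simp
  then have "\<bar>3 * (m - k) - 2 ^ n\<bar> < 1" by linarith
  then have "3 * (m - k) = 2 ^ n" by linarith
  then have "(3::int) dvd 2 ^ n" by (metis dvd_triv_left)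
  then have "(3::int) dvd 2" using prime_dvd_power[of "3::int" 2 n] by simp
  then show False by simp
qed

text \<open>The coordinates choose independently: S collects the directions in which the unshifted
  grid separates x and y, and by \<open>floor_third_shift\<close> the grid moved by L/3 does not
  separate them there. The shift is the same for all n; relative to the cell side L / 2^n it is
  2^n/3, which stays at distance 1/3 from the integers.\<close>

lemma dyadic_third_shift:
  fixes x y :: "'a::euclidean_space"
  assumes L: "0 < L" and d: "norm (x - y) < L / 2 ^ n / 3"
  shows "\<exists>z\<in>grid_shifts L. y \<in> dyadic z L n x"
proof -
  define S where "S = {b \<in> (Basis::'a set). \<lfloor>2 ^ n * (y \<bullet> b) / L\<rfloor> \<noteq> \<lfloor>2 ^ n * (x \<bullet> b) / L\<rfloor>}"
  define z where "z = (\<Sum>b\<in>S. (L / 3) *\<^sub>R b)"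
  have "S \<subseteq> Basis" by (auto simp: S_def)
  then have z: "z \<bullet> b = (if b \<in> S then L / 3 else 0)" if "b \<in> Basis" for b
    using that unfolding z_def
    by (simp add: inner_sum_left inner_Basis subset_iff finite_subset[OF _ finite_Basis] if_distrib cong: if_cong sum.cong)
  have "y \<in> dyadic z L n x"
    unfolding dyadic_def
  proof (intro CollectI ballI)
    fix b :: 'a assume b: "b \<in> Basis"
    have "\<bar>(x - y) \<bullet> b\<bar> < L / 2 ^ n / 3" using Basis_le_norm[OF b, of "x - y"] d by simp
    then have "2 ^ n * \<bar>(x - y) \<bullet> b\<bar> / L < 1 / 3" using L by (simp add: field_simps)
    moreover have "\<bar>2 ^ n * (y \<bullet> b) / L - 2 ^ n * (x \<bullet> b) / L\<bar> = 2 ^ n * \<bar>(x - y) \<bullet> b\<bar> / L"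
      using L by (simp add: diff_divide_distrib[symmetric] right_diff_distrib[symmetric] abs_mult inner_diff_left abs_minus_commute)
    ultimately have close: "\<bar>2 ^ n * (y \<bullet> b) / L - 2 ^ n * (x \<bullet> b) / L\<bar> < 1 / 3" by simp
    show "\<lfloor>2 ^ n * ((y - z) \<bullet> b) / L\<rfloor> = \<lfloor>2 ^ n * ((x - z) \<bullet> b) / L\<rfloor>"
    proof (cases "b \<in> S")
      case True
      have "2 ^ n * ((w - z) \<bullet> b) / L = 2 ^ n * (w \<bullet> b) / L - 2 ^ n / 3" for w
        using L z[OF b] True by (simp add: inner_diff_left field_simps)
      then show ?thesis using floor_third_shift[OF close, of n] True by (auto simp: S_def)
    qed (use z[OF b] b in \<open>auto simp: S_def inner_diff_left\<close>)
  qed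
  moreover have "z \<in> grid_shifts L" using \<open>S \<subseteq> Basis\<close> by (auto simp: grid_shifts_def z_def)
  ultimately show ?thesis by blast
qed

section \<open>The truncated Riesz potential as a sum of dyadic averages\<close>

definition riesz_weight :: "real \<Rightarrow> real \<Rightarrow> nat \<Rightarrow> ennreal" where
  "riesz_weight \<alpha> L n = ennreal ((L / 2 ^ n) powr \<alpha>)"

lemma riesz_weight_tail:
  assumes "0 < \<alpha>" "0 < L"
  shows "(\<Sum>n. riesz_weight \<alpha> L (m + n)) \<le> ennreal (geo_const \<alpha>) * riesz_weight \<alpha> L m"
proof -
  have r: "0 \<le> 2 powr (- \<alpha>)" "2 powr (- \<alpha>) < 1"
    using assms powr_less_mono[of "-\<alpha>" 0 2] by auto
  have "riesz_weight \<alpha> L (m + n) = riesz_weight \<alpha> L m * ennreal ((2 powr (- \<alpha>)) ^ n)" for n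
  proof -
    have "L / 2 ^ (m + n) = (L / 2 ^ m) * 2 powr (- real n)"
      by (simp add: power_add powr_minus powr_realpow divide_inverse)
    moreover have "(2 powr (- real n)) powr \<alpha> = (2 powr (- \<alpha>)) ^ n"
      by (simp add: powr_powr powr_power mult.commute)
    ultimately have "(L / 2 ^ (m + n)) powr \<alpha> = (L / 2 ^ m) powr \<alpha> * (2 powr (- \<alpha>)) ^ n"
      using powr_mult[of "L / 2 ^ m" "2 powr (- real n)" \<alpha>] assms by (simp only:)
    then show ?thesis by (simp add: riesz_weight_def ennreal_mult)
  qed
  then have "(\<Sum>n. riesz_weight \<alpha> L (m + n)) = riesz_weight \<alpha> L m * (\<Sum>n. ennreal ((2 powr (- \<alpha>)) ^ n))"
    by simp
  also have "(\<Sum>n. ennreal ((2 powr (- \<alpha>)) ^ n)) = ennreal (\<Sum>n. (2 powr (- \<alpha>)) ^ n)"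
    using r by (intro suminf_ennreal2 summable_geometric) auto
  also have "(\<Sum>n. (2 powr (- \<alpha>)) ^ n) = geo_const \<alpha>"
    using r by (simp add: suminf_geometric geo_const_def)
  finally show ?thesis by (simp add: mult.commute)
qed

text \<open>Truncated at L/3 because points at smaller distance share a cell of side at most L in
  one of the shifted grids, so that only cubes of side at most L enter.\<close>

definition local_potential :: "real \<Rightarrow> real \<Rightarrow> ('a::euclidean_space \<Rightarrow> ennreal) \<Rightarrow> 'a \<Rightarrow> ennreal" where
  "local_potential \<alpha> L f x = (\<integral>\<^sup>+y. ennreal (norm (x - y) powr (\<alpha> - real DIM('a))) * indicator {..<L / 3} (norm (x - y)) * f y \<partial>lborel)"

lemma measurable_local_potential [measurable]:
  assumes [measurable]: "f \<in> borel_measurable borel"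
  shows "local_potential \<alpha> L f \<in> borel_measurable borel"
  unfolding local_potential_def by measurable

text \<open>There is a generation k with L/2^k/6 \<le> |x-y| < L/2^k/3. The upper bound puts x and y
  into one cell of a shifted grid, the lower bound compares the kernel with the cell side and
  produces the constant 6^(d-\<alpha>). On the diagonal the kernel is 0, since \<open>powr\<close>
  sends 0 to 0.\<close>

lemma riesz_kernel_le_dyadic:
  fixes x y :: "'a::euclidean_space"
  assumes \<alpha>: "\<alpha> < real DIM('a)" and L: "0 < L"
  shows "ennreal (norm (x - y) powr (\<alpha> - real DIM('a))) * indicator {..<L / 3} (norm (x - y))
    \<le> ennreal (6 powr (real DIM('a) - \<alpha>)) * (\<Sum>z\<in>grid_shifts L. \<Sum>n. riesz_weight (\<alpha> - real DIM('a)) L n * indicator (dyadic z L n x) y)"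
proof (cases "x = y \<or> L / 3 \<le> norm (x - y)")
  case False
  let ?r = "norm (x - y)"
  have r: "0 < ?r" "?r < L / 3" using False by auto
  have "\<exists>n. L / 3 / 2 ^ n \<le> ?r"
  proof -
    obtain n where "L / 3 / ?r < 2 ^ n" using real_arch_pow[of 2 "L / 3 / ?r"] by auto
    then have "L / 3 / 2 ^ n < ?r" using r by (simp add: divide_less_eq mult.commute mult.left_commute)
    then have "L / 3 / 2 ^ n \<le> ?r" by simp
    then show ?thesis ..
  qed
  then obtain n where n: "L / 3 / 2 ^ n \<le> ?r" "\<And>m. m < n \<Longrightarrow> \<not> L / 3 / 2 ^ m \<le> ?r"
    using exists_least_iff[of "\<lambda>n. L / 3 / 2 ^ n \<le> ?r"] by blast
  then obtain k where k: "n = Suc k" using r by (cases n) auto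
  then have close: "?r < L / 2 ^ k / 3" using n(2)[of k] by (simp add: not_le mult.commute)
  then obtain z where z: "z \<in> grid_shifts L" "y \<in> dyadic z L k x"
    using dyadic_third_shift[OF L] by blast
  have "L / 2 ^ k / 6 \<le> ?r" using n(1) k by (simp add: mult.commute mult.left_commute)
  then have "?r powr (\<alpha> - real DIM('a)) \<le> (L / 2 ^ k / 6) powr (\<alpha> - real DIM('a))"
    using L \<alpha> by (intro powr_mono2') auto
  also have "\<dots> = 6 powr (real DIM('a) - \<alpha>) * (L / 2 ^ k) powr (\<alpha> - real DIM('a))"
  proof -
    have "6 powr (real DIM('a) - \<alpha>) = inverse (6 powr (\<alpha> - real DIM('a)))"
      using powr_minus[of 6 "\<alpha> - real DIM('a)"] by simp
    moreover have "(L / 2 ^ k / 6) powr (\<alpha> - real DIM('a)) = (L / 2 ^ k) powr (\<alpha> - real DIM('a)) / 6 powr (\<alpha> - real DIM('a))"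
      using L by (intro powr_divide)
    ultimately show ?thesis by (simp only: divide_inverse mult.commute)
  qed
  finally have "ennreal (?r powr (\<alpha> - real DIM('a))) \<le> ennreal (6 powr (real DIM('a) - \<alpha>)) * riesz_weight (\<alpha> - real DIM('a)) L k"
    by (simp add: riesz_weight_def ennreal_mult[symmetric])
  also have "riesz_weight (\<alpha> - real DIM('a)) L k = (\<Sum>n\<in>{k}. riesz_weight (\<alpha> - real DIM('a)) L n * indicator (dyadic z L n x) y)"
    using z by simp
  also have "\<dots> \<le> (\<Sum>n. riesz_weight (\<alpha> - real DIM('a)) L n * indicator (dyadic z L n x) y)"
    by (intro sum_le_suminf) auto
  also have "\<dots> \<le> (\<Sum>z\<in>grid_shifts L. \<Sum>n. riesz_weight (\<alpha> - real DIM('a)) L n * indicator (dyadic z L n x) y)"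
    using z by (intro member_le_sum) auto
  finally show ?thesis using r by (simp add: mult_left_mono)
qed auto

lemma local_potential_le_dyadic:
  fixes f :: "'a::euclidean_space \<Rightarrow> ennreal"
  assumes \<alpha>: "\<alpha> < real DIM('a)" and L: "0 < L" and [measurable]: "f \<in> borel_measurable borel"
  shows "local_potential \<alpha> L f x \<le> ennreal (6 powr (real DIM('a) - \<alpha>))
    * (\<Sum>z\<in>grid_shifts L. \<Sum>n. riesz_weight \<alpha> L n * cell_avg lborel (dyadic z L) n f x)"
proof -
  \<comment> \<open>The side of a cell to the power \<alpha> - d; turning the integral over the cell
    into an average raises the exponent to \<alpha>.\<close>
  let ?w = "riesz_weight (\<alpha> - real DIM('a)) L"
  have "local_potential \<alpha> L f x \<le> (\<integral>\<^sup>+y. ennreal (6 powr (real DIM('a) - \<alpha>))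
      * (\<Sum>z\<in>grid_shifts L. \<Sum>n. ?w n * indicator (dyadic z L n x) y) * f y \<partial>lborel)"
    unfolding local_potential_def by (intro nn_integral_mono mult_right_mono riesz_kernel_le_dyadic \<alpha> L) auto
  also have "\<dots> = (\<integral>\<^sup>+y. ennreal (6 powr (real DIM('a) - \<alpha>))
      * (\<Sum>z\<in>grid_shifts L. \<Sum>n. ?w n * (f y * indicator (dyadic z L n x) y)) \<partial>lborel)"
    by (intro nn_integral_cong)
      (simp only: mult.assoc sum_distrib_right ennreal_suminf_multc[symmetric] mult.commute[of "indicator _ _" "f _"])
  also have "\<dots> = ennreal (6 powr (real DIM('a) - \<alpha>))
      * (\<integral>\<^sup>+y. (\<Sum>z\<in>grid_shifts L. \<Sum>n. ?w n * (f y * indicator (dyadic z L n x) y)) \<partial>lborel)"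
    by (intro nn_integral_cmult) simp
  also have "(\<integral>\<^sup>+y. (\<Sum>z\<in>grid_shifts L. \<Sum>n. ?w n * (f y * indicator (dyadic z L n x) y)) \<partial>lborel)
    = (\<Sum>z\<in>grid_shifts L. \<Sum>n. ?w n * (\<integral>\<^sup>+y\<in>dyadic z L n x. f y \<partial>lborel))"
    by (subst nn_integral_sum) (auto simp: nn_integral_suminf nn_integral_cmult)
  also have "\<dots> = (\<Sum>z\<in>grid_shifts L. \<Sum>n. riesz_weight \<alpha> L n * cell_avg lborel (dyadic z L) n f x)"
  proof (intro sum.cong refl suminf_cong)
    fix z :: 'a and n
    have "?w n = riesz_weight \<alpha> L n / ennreal ((L / 2 ^ n) ^ DIM('a))"
      using L by (simp add: riesz_weight_def powr_diff divide_ennreal powr_realpow)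
    then show "?w n * (\<integral>\<^sup>+y\<in>dyadic z L n x. f y \<partial>lborel) = riesz_weight \<alpha> L n * cell_avg lborel (dyadic z L) n f x"
      using L by (simp add: cell_avg_def emeasure_dyadic divide_ennreal_def ac_simps)
  qed
  finally show ?thesis .
qed

lemma epowr_sum_le:
  assumes "finite S" "0 < q"
  shows "(\<Sum>z\<in>S. F z) epowr q \<le> ennreal (real (card S) powr q) * (\<Sum>z\<in>S. F z epowr q)"
proof (cases "S = {}")
  case False
  define m where "m = Max (F ` S)"
  have m: "m \<in> F ` S" "\<And>z. z \<in> S \<Longrightarrow> F z \<le> m"
    using assms False by (auto simp: m_def)
  then obtain w where w: "w \<in> S" "m = F w" by blast
  have "(\<Sum>z\<in>S. F z) \<le> of_nat (card S) * m" by (intro sum_bounded_above m)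
  then have "(\<Sum>z\<in>S. F z) epowr q \<le> (ennreal (real (card S)) * m) epowr q"
    using assms by (intro epowr_mono) (auto simp: ennreal_of_nat_eq_real_of_nat)
  also have "\<dots> = ennreal (real (card S) powr q) * F w epowr q"
    using assms w by (simp add: epowr_mult)
  also have "F w epowr q \<le> (\<Sum>z\<in>S. F z epowr q)"
    using w assms by (intro member_le_sum) auto
  finally show ?thesis by (simp add: mult_left_mono)
qed simp

text \<open>The factor 6^(d-\<alpha>) comes from \<open>riesz_kernel_le_dyadic\<close>, 2^d from the
  q-th power of a sum over at most 2^d grids, and (2^d)^(1/q) from adding at most 2^d
  integrals.\<close>

definition grid_const :: "nat \<Rightarrow> real \<Rightarrow> real \<Rightarrow> real" where
  "grid_const d \<alpha> q = 6 powr (d - \<alpha>) * (2 ^ d * (2 ^ d) powr (1 / q))"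

text \<open>Duality on each grid separately; the bilinear hypothesis is uniform in the origin z, so
  the finitely many shifts cost only \<open>grid_const\<close>.\<close>

lemma local_potential_bound:
  fixes f :: "'a::euclidean_space \<Rightarrow> ennreal"
  assumes \<alpha>: "\<alpha> < real DIM('a)" and L: "0 < L" and q: "1 < q" "1 < q'" "1 / q + 1 / q' = 1"
    and [measurable]: "f \<in> borel_measurable borel"
    and N: "sets N = sets borel" "\<And>a l. 0 < l \<Longrightarrow> emeasure N (cube a l) < top"
    and bilinear: "\<And>z g. g \<in> borel_measurable borel \<Longrightarrow>
      (\<integral>\<^sup>+x. (\<Sum>n. riesz_weight \<alpha> L n * cell_avg lborel (dyadic z L) n f x) * g x \<partial>N)
        \<le> A * (\<integral>\<^sup>+x. g x epowr q' \<partial>N) epowr (1 / q')"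
  shows "(\<integral>\<^sup>+x. local_potential \<alpha> L f x epowr q \<partial>N) epowr (1 / q) \<le> ennreal (grid_const DIM('a) \<alpha> q) * A"
proof -
  note [measurable_cong] = N(1)
  let ?F = "\<lambda>z x. \<Sum>n. riesz_weight \<alpha> L n * cell_avg lborel (dyadic z L) n f x"
  let ?S = "grid_shifts L :: 'a set"
  have dy: "nested_partition lborel (dyadic z L)" for z :: 'a
    using L by (intro nested_partition_dyadic) (auto simp: emeasure_cube)
  have [measurable]: "cell_avg lborel (dyadic z L) n f \<in> borel_measurable borel" for z n
    using nested_partition.measurable_E[OF dy] by simp
  have "(\<integral>\<^sup>+x. ?F z x epowr q \<partial>N) \<le> A epowr q" for z
  proof (rule nn_integral_duality[OF q])
    \<comment> \<open>Cubes about 0 that exhaust the space. Since N is finite on cubes, they are the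
      sets of finite measure that \<open>nn_integral_duality\<close> asks for.\<close>
    define B where "B m = cube (- (real m + 1) *\<^sub>R One :: 'a) (2 * (real m + 1))" for m :: nat
    have B: "x \<in> B m \<longleftrightarrow> (\<forall>b\<in>Basis. \<bar>x \<bullet> b\<bar> \<le> real m + 1)" for x m
      by (auto simp: B_def cube_def mem_box inner_add_left abs_le_iff inner_minus_left)
    show "incseq B" by (rule incseq_SucI, rule subsetI, unfold B, rule ballI, drule (1) bspec) simp
    show "(\<Union>m. B m) = space N"
    proof -
      have "x \<in> (\<Union>m. B m)" for x :: 'a
      proof -
        obtain m :: nat where "norm x \<le> m" using real_arch_simple by blast
        then have "x \<in> B m" unfolding B using Basis_le_norm[of _ x] by fastforce
        then show ?thesis by blast
      qed
      then show ?thesis using sets_eq_imp_space_eq[OF N(1)] by auto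
    qed
    show "emeasure N (B m) < top" for m unfolding B_def by (rule N) simp
    show "B m \<in> sets N" for m by (simp add: B_def N(1))
    show "(\<integral>\<^sup>+x. ?F z x * g x \<partial>N) \<le> A * (\<integral>\<^sup>+x. g x epowr q' \<partial>N) epowr (1 / q')"
      if "g \<in> borel_measurable N" for g
      using that by (intro bilinear) (simp add: measurable_cong_sets[OF N(1) refl])
  qed simp
  note F = this
  have "(\<integral>\<^sup>+x. local_potential \<alpha> L f x epowr q \<partial>N)
    \<le> (\<integral>\<^sup>+x. ennreal ((6 powr (real DIM('a) - \<alpha>) * 2 ^ DIM('a)) powr q) * (\<Sum>z\<in>?S. ?F z x epowr q) \<partial>N)"
  proof (intro nn_integral_mono)
    fix x
    have "local_potential \<alpha> L f x epowr q \<le> (ennreal (6 powr (real DIM('a) - \<alpha>)) * (\<Sum>z\<in>?S. ?F z x)) epowr q"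
      using q by (intro epowr_mono local_potential_le_dyadic \<alpha> L) auto
    also have "\<dots> = ennreal ((6 powr (real DIM('a) - \<alpha>)) powr q) * (\<Sum>z\<in>?S. ?F z x) epowr q"
      using q by (simp add: epowr_mult)
    also have "(\<Sum>z\<in>?S. ?F z x) epowr q \<le> ennreal (real (card ?S) powr q) * (\<Sum>z\<in>?S. ?F z x epowr q)"
      using q by (intro epowr_sum_le) auto
    also have "ennreal (real (card ?S) powr q) \<le> ennreal ((2 ^ DIM('a)) powr q)"
    proof (intro ennreal_leI powr_mono2)
      have "real (card ?S) \<le> real (2 ^ DIM('a))" by (intro of_nat_mono card_grid_shifts)
      then show "real (card ?S) \<le> 2 ^ DIM('a)" by simp
    qed (use q in auto)
    finally show "local_potential \<alpha> L f x epowr q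
      \<le> ennreal ((6 powr (real DIM('a) - \<alpha>) * 2 ^ DIM('a)) powr q) * (\<Sum>z\<in>?S. ?F z x epowr q)"
      by (simp add: powr_mult ennreal_mult mult_left_mono mult_right_mono mult.assoc)
  qed
  also have "\<dots> = ennreal ((6 powr (real DIM('a) - \<alpha>) * 2 ^ DIM('a)) powr q) * (\<Sum>z\<in>?S. \<integral>\<^sup>+x. ?F z x epowr q \<partial>N)"
    by (simp add: nn_integral_cmult nn_integral_sum)
  also have "(\<Sum>z\<in>?S. \<integral>\<^sup>+x. ?F z x epowr q \<partial>N) \<le> of_nat (card ?S) * A epowr q"
    by (intro sum_bounded_above F)
  also have "of_nat (card ?S) \<le> ennreal (2 ^ DIM('a))"
  proof -
    have "real (card ?S) \<le> real (2 ^ DIM('a))" by (intro of_nat_mono card_grid_shifts)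
    then show ?thesis by (simp add: ennreal_of_nat_eq_real_of_nat ennreal_leI)
  qed
  finally have "(\<integral>\<^sup>+x. local_potential \<alpha> L f x epowr q \<partial>N)
    \<le> ennreal ((6 powr (real DIM('a) - \<alpha>) * 2 ^ DIM('a)) powr q) * (ennreal (2 ^ DIM('a)) * A epowr q)"
    by (simp add: mult_left_mono mult_right_mono)
  then have "(\<integral>\<^sup>+x. local_potential \<alpha> L f x epowr q \<partial>N) epowr (1 / q)
    \<le> (ennreal ((6 powr (real DIM('a) - \<alpha>) * 2 ^ DIM('a)) powr q) * (ennreal (2 ^ DIM('a)) * A epowr q)) epowr (1 / q)"
    using q by (intro epowr_mono) auto
  also have "\<dots> = ennreal (6 powr (real DIM('a) - \<alpha>) * 2 ^ DIM('a)) * (ennreal ((2 ^ DIM('a)) powr (1 / q)) * A)"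
    using q by (simp add: epowr_mult epowr_inverse_cancel powr_powr)
  also have "\<dots> = ennreal (grid_const DIM('a) \<alpha> q) * A"
    unfolding grid_const_def by (simp add: ennreal_mult mult.assoc)
  finally show ?thesis .
qed

section \<open>Bounds for the local potential and for rapidly decaying kernels\<close>

text \<open>Here q / (q - 1) is the exponent conjugate to q and \<theta> q / (\<theta> q - 1) the
  one conjugate to \<theta> q; the factor 2 \<open>geo_const\<close> \<alpha> is the cost of
  restricting the series to its stops.\<close>

definition bump_const :: "nat \<Rightarrow> real \<Rightarrow> real \<Rightarrow> real \<Rightarrow> real \<Rightarrow> real" where
  "bump_const d \<alpha> p q \<theta> = grid_const d \<alpha> q * (2 * geo_const \<alpha> * (geo_const (p / q) * maximal_const p powr (1 / q)
    * maximal_const (q / (q - 1) / (\<theta> * q / (\<theta> * q - 1))) powr (1 / (q / (q - 1)))))"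

definition doubling_const :: "nat \<Rightarrow> real \<Rightarrow> real \<Rightarrow> real \<Rightarrow> real" where
  "doubling_const d \<alpha> p q = grid_const d \<alpha> q * (2 * geo_const \<alpha>
    * (maximal_const p powr (1 / q) * maximal_const (q / (q - 1)) powr (1 / (q / (q - 1)))))"

lemma grid_const_nonneg: "0 \<le> grid_const d \<alpha> q"
  by (simp add: grid_const_def)

lemma bump_const_nonneg:
  assumes "0 < \<alpha>" "0 < p" "0 < q"
  shows "0 \<le> bump_const d \<alpha> p q \<theta>"
proof -
  have "0 \<le> geo_const \<alpha>" "0 \<le> geo_const (p / q)"
    using geo_const(1)[of \<alpha>] geo_const(1)[of "p / q"] assms by simp_all
  then show ?thesis unfolding bump_const_def by (simp add: grid_const_nonneg)
qed

lemma doubling_const_nonneg: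
  assumes "0 < \<alpha>"
  shows "0 \<le> doubling_const d \<alpha> p q"
  unfolding doubling_const_def using geo_const(1)[OF assms] by (simp add: grid_const_nonneg)

lemma ennreal_const_collect:
  fixes X Y :: ennreal
  assumes "0 \<le> a" "0 \<le> b" "0 \<le> k"
  shows "ennreal a * (2 * ennreal b * X * ennreal k * Y) = ennreal (a * (2 * b * k)) * X * Y"
  using assms by (simp add: ennreal_mult ac_simps)

lemma local_potential_bump:
  fixes v f :: "'a::euclidean_space \<Rightarrow> ennreal"
  assumes \<alpha>: "0 < \<alpha>" "\<alpha> < real DIM('a)" and p: "1 < p" "p \<le> q" and \<theta>: "1 < \<theta>" and L: "0 < L"
    and [measurable]: "v \<in> borel_measurable borel" "f \<in> borel_measurable borel"
    and fin: "\<And>a l. 0 < l \<Longrightarrow> (\<integral>\<^sup>+x\<in>cube a l. v x \<partial>lborel) < top"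
    and bump: "\<And>a l. 0 < l \<Longrightarrow> l \<le> L \<Longrightarrow>
      ennreal (l powr \<alpha>) * ((\<integral>\<^sup>+x\<in>cube a l. v x epowr \<theta> \<partial>lborel) / ennreal (l ^ DIM('a))) epowr (1 / (\<theta> * q))
        \<le> \<delta> * ennreal (l ^ DIM('a)) epowr (1 / p - 1 / q)"
    and J: "(\<integral>\<^sup>+x. f x epowr p \<partial>lborel) < top"
  shows "(\<integral>\<^sup>+x. v x * local_potential \<alpha> L f x epowr q \<partial>lborel) epowr (1 / q)
    \<le> ennreal (bump_const DIM('a) \<alpha> p q \<theta>) * \<delta> * (\<integral>\<^sup>+x. f x epowr p \<partial>lborel) epowr (1 / p)"
proof -
  define q' where "q' = q / (q - 1)"
  have q: "1 < q" "1 < q'" "1 / q + 1 / q' = 1" "1 / q' = 1 - 1 / q"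
    using p by (auto simp: q'_def field_simps)
  let ?c = "geo_const (p / q) * maximal_const p powr (1 / q)
        * maximal_const (q' / (\<theta> * q / (\<theta> * q - 1))) powr (1 / q')"
  let ?A = "2 * ennreal (geo_const \<alpha>) * \<delta> * ennreal ?c * (\<integral>\<^sup>+x. f x epowr p \<partial>lborel) epowr (1 / p)"
  have "(\<integral>\<^sup>+x. local_potential \<alpha> L f x epowr q \<partial>density lborel v) epowr (1 / q) \<le> ennreal (grid_const DIM('a) \<alpha> q) * ?A"
  proof (rule local_potential_bound[OF \<alpha>(2) L q(1,2,3)])
    fix z :: 'a and g :: "'a \<Rightarrow> ennreal" assume [measurable]: "g \<in> borel_measurable borel"
    interpret nested_partition lborel "dyadic z L"
      using L by (intro nested_partition_dyadic) (auto simp: emeasure_cube)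
    have "(\<integral>\<^sup>+x. (\<Sum>n. riesz_weight \<alpha> L n * E n f x) * g x \<partial>density lborel v)
      = (\<integral>\<^sup>+x. (\<Sum>n. riesz_weight \<alpha> L n * E n f x) * (v x * g x) \<partial>lborel)"
      by (subst nn_integral_density) (auto intro!: nn_integral_cong simp: ac_simps)
    also have "\<dots> \<le> ?A * (\<integral>\<^sup>+x. v x * g x epowr q' \<partial>lborel) epowr (1 / q')"
    proof (rule bump_bilinear_bound[OF p q(2,3) \<theta>])
      fix m show "(\<Sum>n. riesz_weight \<alpha> L (m + n)) \<le> ennreal (geo_const \<alpha>) * riesz_weight \<alpha> L m"
        using \<alpha> L by (intro riesz_weight_tail) auto
    next
      fix n and x :: 'a
      show "emeasure lborel (dyadic z L n x) \<noteq> 0" using L by (simp add: emeasure_dyadic)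
      let ?l = "L / 2 ^ n" and ?C = "cube (dyadic_corner z L n x) (L / 2 ^ n)"
      \<comment> \<open>A half-open cell lies in its closed cube and has the same volume, so its
        averages are at most those of the cube.\<close>
      have "E n (\<lambda>y. v y epowr \<theta>) x \<le> (\<integral>\<^sup>+x\<in>?C. v x epowr \<theta> \<partial>lborel) / ennreal (?l ^ DIM('a))"
        unfolding cell_avg_def emeasure_dyadic[OF L] using dyadic_subset_cube[OF L, of z n x]
        by (intro divide_right_mono_ennreal nn_integral_mono) (auto simp: indicator_def)
      then have "riesz_weight \<alpha> L n * E n (\<lambda>y. v y epowr \<theta>) x epowr (1 / (\<theta> * q))
        \<le> ennreal (?l powr \<alpha>) * ((\<integral>\<^sup>+x\<in>?C. v x epowr \<theta> \<partial>lborel) / ennreal (?l ^ DIM('a))) epowr (1 / (\<theta> * q))"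
        unfolding riesz_weight_def using \<theta> q by (intro mult_left_mono epowr_mono) auto
      also have "\<dots> \<le> \<delta> * ennreal (?l ^ DIM('a)) epowr (1 / p - 1 / q)"
        using L by (intro bump) (auto simp: field_simps)
      finally show "riesz_weight \<alpha> L n * E n (\<lambda>y. v y epowr \<theta>) x epowr (1 / (\<theta> * q))
        \<le> \<delta> * emeasure lborel (dyadic z L n x) epowr (1 / p - 1 / q)"
        by (simp only: emeasure_dyadic[OF L])
    qed (use J in auto)
    also have "(\<integral>\<^sup>+x. v x * g x epowr q' \<partial>lborel) = (\<integral>\<^sup>+x. g x epowr q' \<partial>density lborel v)"
      by (simp add: nn_integral_density)
    finally show "(\<integral>\<^sup>+x. (\<Sum>n. riesz_weight \<alpha> L n * E n f x) * g x \<partial>density lborel v)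
      \<le> ?A * (\<integral>\<^sup>+x. g x epowr q' \<partial>density lborel v) epowr (1 / q')" .
  qed (use fin in \<open>auto simp: emeasure_density\<close>)
  also have "\<dots> = ennreal (grid_const DIM('a) \<alpha> q * (2 * geo_const \<alpha> * ?c)) * \<delta> * (\<integral>\<^sup>+x. f x epowr p \<partial>lborel) epowr (1 / p)"
  proof -
    have "0 \<le> geo_const \<alpha>" "0 \<le> ?c"
      using geo_const(1)[of \<alpha>] geo_const(1)[of "p / q"] \<alpha> p by simp_all
    then show ?thesis by (intro ennreal_const_collect[where X = \<delta>] grid_const_nonneg)
  qed
  finally show ?thesis by (simp add: nn_integral_density bump_const_def q'_def)
qed

lemma local_potential_doubling:
  fixes v f :: "'a::euclidean_space \<Rightarrow> ennreal"
  assumes \<alpha>: "0 < \<alpha>" "\<alpha> < real DIM('a)" and p: "1 < p" "p \<le> q" and L: "0 < L"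
    and [measurable]: "v \<in> borel_measurable borel" "f \<in> borel_measurable borel"
    and fin: "\<And>a l. 0 < l \<Longrightarrow> (\<integral>\<^sup>+x\<in>cube a l. v x \<partial>lborel) < top"
    and doubling: "\<And>a l A. 0 < l \<Longrightarrow> A \<in> sets borel \<Longrightarrow> A \<subseteq> cube a l
      \<Longrightarrow> emeasure lborel (cube a l) \<le> 2 * emeasure lborel A
      \<Longrightarrow> (\<integral>\<^sup>+x\<in>cube a l. v x \<partial>lborel) \<le> D * (\<integral>\<^sup>+x\<in>A. v x \<partial>lborel)"
    and growth: "\<And>a l. 0 < l \<Longrightarrow> l \<le> L \<Longrightarrow>
      ennreal (l powr \<alpha>) epowr q * (\<integral>\<^sup>+x\<in>cube a l. v x \<partial>lborel)
        \<le> \<delta> epowr q * ennreal (l ^ DIM('a)) epowr (q / p)"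
    and J: "(\<integral>\<^sup>+x. f x epowr p \<partial>lborel) < top"
  shows "(\<integral>\<^sup>+x. v x * local_potential \<alpha> L f x epowr q \<partial>lborel) epowr (1 / q)
    \<le> ennreal (doubling_const DIM('a) \<alpha> p q) * D * \<delta> * (\<integral>\<^sup>+x. f x epowr p \<partial>lborel) epowr (1 / p)"
proof -
  define q' where "q' = q / (q - 1)"
  have q: "1 < q" "1 < q'" "1 / q + 1 / q' = 1" "1 / q' = 1 - 1 / q"
    using p by (auto simp: q'_def field_simps)
  let ?c = "maximal_const p powr (1 / q) * maximal_const q' powr (1 / q')"
  let ?A = "2 * ennreal (geo_const \<alpha>) * D * \<delta> * ennreal ?c * (\<integral>\<^sup>+x. f x epowr p \<partial>lborel) epowr (1 / p)"
  let ?N = "density lborel v"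
  have finN: "emeasure ?N (cube a l) < top" if "0 < l" for a l
    using fin[OF that] by (simp add: emeasure_density)
  have "(\<integral>\<^sup>+x. local_potential \<alpha> L f x epowr q \<partial>?N) epowr (1 / q) \<le> ennreal (grid_const DIM('a) \<alpha> q) * ?A"
  proof (rule local_potential_bound[OF \<alpha>(2) L q(1,2,3)])
    fix z :: 'a and g :: "'a \<Rightarrow> ennreal" assume [measurable]: "g \<in> borel_measurable borel"
    interpret nested_partition lborel "dyadic z L"
      using L by (intro nested_partition_dyadic) (auto simp: emeasure_cube)
    show "(\<integral>\<^sup>+x. (\<Sum>n. riesz_weight \<alpha> L n * E n f x) * g x \<partial>?N)
      \<le> ?A * (\<integral>\<^sup>+x. g x epowr q' \<partial>?N) epowr (1 / q')"
    proof (rule doubling_bilinear_bound[OF _ _ p q(2,3)])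
      show "nested_partition ?N (dyadic z L)"
        by (rule nested_partition_dyadic[OF L _ finN]) simp_all
      fix m show "(\<Sum>n. riesz_weight \<alpha> L (m + n)) \<le> ennreal (geo_const \<alpha>) * riesz_weight \<alpha> L m"
        using \<alpha> L by (intro riesz_weight_tail) auto
    next
      fix n and x :: 'a
      show "emeasure lborel (dyadic z L n x) \<noteq> 0" using L by (simp add: emeasure_dyadic)
      let ?l = "L / 2 ^ n" and ?C = "cube (dyadic_corner z L n x) (L / 2 ^ n)"
      have l: "0 < ?l" "?l \<le> L" using L by (auto simp: field_simps)
      have le: "emeasure ?N (dyadic z L n x) \<le> emeasure ?N ?C"
        by (intro emeasure_mono dyadic_subset_cube L) simp
      have "riesz_weight \<alpha> L n epowr q * emeasure ?N (dyadic z L n x)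
        \<le> ennreal (?l powr \<alpha>) epowr q * (\<integral>\<^sup>+x\<in>?C. v x \<partial>lborel)"
        unfolding riesz_weight_def using le by (intro mult_left_mono) (simp_all add: emeasure_density)
      also have "\<dots> \<le> \<delta> epowr q * ennreal (?l ^ DIM('a)) epowr (q / p)" by (rule growth[OF l])
      finally show "riesz_weight \<alpha> L n epowr q * emeasure ?N (dyadic z L n x)
        \<le> \<delta> epowr q * emeasure lborel (dyadic z L n x) epowr (q / p)"
        by (simp only: emeasure_dyadic[OF L])
      fix A assume A: "A \<in> sets lborel" "A \<subseteq> dyadic z L n x"
        "emeasure lborel (dyadic z L n x) \<le> 2 * emeasure lborel A"
      \<comment> \<open>A set that fills half of the cell fills half of the closed cube, which has
        the same volume; so the doubling hypothesis for cubes serves the cells.\<close>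
      have "emeasure ?N ?C \<le> D * emeasure ?N A"
        using A l L dyadic_subset_cube[OF L, of z n x] doubling[OF l(1), of A "dyadic_corner z L n x"]
        by (simp add: emeasure_density emeasure_cube emeasure_dyadic)
      then show "emeasure ?N (dyadic z L n x) \<le> D * emeasure ?N A" using le by simp
    qed (use J in auto)
  qed (use finN in auto)
  also have "\<dots> = ennreal (grid_const DIM('a) \<alpha> q * (2 * geo_const \<alpha> * ?c)) * D * \<delta> * (\<integral>\<^sup>+x. f x epowr p \<partial>lborel) epowr (1 / p)"
  proof -
    have "0 \<le> geo_const \<alpha>" "0 \<le> ?c"
      using geo_const(1)[of \<alpha>] \<alpha> by simp_all
    then show ?thesis
      using ennreal_const_collect[OF grid_const_nonneg, where X = "D * \<delta>"] by (simp only: mult.assoc)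
  qed
  finally show ?thesis by (simp add: nn_integral_density doubling_const_def q'_def)
qed

section \<open>Rapidly decaying kernels and Schur's test\<close>

definition decay :: "real \<Rightarrow> 'a::real_normed_vector \<Rightarrow> ennreal" where
  "decay D u = ennreal ((1 + norm u) powr (- D))"

lemma measurable_decay [measurable]: "decay D \<in> borel_measurable borel"
  unfolding decay_def by measurable

lemma decay_le_1: "0 \<le> D \<Longrightarrow> decay D u \<le> 1"
  unfolding decay_def using powr_mono[of "- D" 0 "1 + norm u"] by (auto simp flip: ennreal_1 split: if_splits)

lemma summable_decay: "summable (\<lambda>n. 1 / (real n + 1)\<^sup>2)"
  using inverse_power_summable[of 2, where 'a=real] summable_Suc_iff[of "\<lambda>n. inverse (real n ^ 2)"]
  by (simp add: inverse_eq_divide add.commute)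

text \<open>Only the growth of the mass of large cubes enters, by summation over the shells
  \<open>n \<le> \<bar>x - y\<bar> < n + 1\<close>.\<close>

lemma nn_integral_decay_le:
  fixes x :: "'a::euclidean_space"
  assumes N: "sets N = sets borel" and \<kappa>: "0 \<le> \<kappa>"
    and growth: "\<And>a l. 1 < l \<Longrightarrow> emeasure N (cube a l) \<le> G * ennreal (l powr \<kappa>)"
  shows "(\<integral>\<^sup>+y. decay (\<kappa> + 2) (x - y) \<partial>N) \<le> G * ennreal (2 powr \<kappa> * (\<Sum>n. 1 / (real n + 1)\<^sup>2))"
proof -
  note [measurable_cong] = N
  \<comment> \<open>A cube of half side n + 1 about x contains the shell n \<le> |x - y| < n + 1,
    and its side exceeds 1 even for n = 0.\<close>
  define B where "B n = cube (x - (real n + 1) *\<^sub>R One) (2 * (real n + 1))" for n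
  have "decay (\<kappa> + 2) (x - y) \<le> (\<Sum>n. ennreal ((real n + 1) powr (- (\<kappa> + 2))) * indicator (B n) y)" for y
  proof -
    define n where "n = nat \<lfloor>norm (x - y)\<rfloor>"
    have n: "real n \<le> norm (x - y)" "norm (x - y) < real n + 1"
      unfolding n_def by auto
    have "y \<in> B n"
      unfolding B_def cube_def mem_box
    proof (intro ballI)
      fix b :: 'a assume b: "b \<in> Basis"
      then have "\<bar>(x - y) \<bullet> b\<bar> \<le> real n + 1" using Basis_le_norm[OF b, of "x - y"] n by simp
      then show "(x - (real n + 1) *\<^sub>R One) \<bullet> b \<le> y \<bullet> b \<and> y \<bullet> b \<le> (x - (real n + 1) *\<^sub>R One + (2 * (real n + 1)) *\<^sub>R One) \<bullet> b"
        using b by (simp add: inner_diff_left inner_add_left abs_le_iff)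
    qed
    have "decay (\<kappa> + 2) (x - y) \<le> ennreal ((real n + 1) powr (- (\<kappa> + 2)))"
      unfolding decay_def using n \<kappa> by (intro ennreal_leI powr_mono2') auto
    also have "\<dots> = (\<Sum>n\<in>{n}. ennreal ((real n + 1) powr (- (\<kappa> + 2))) * indicator (B n) y)"
      using \<open>y \<in> B n\<close> by simp
    also have "\<dots> \<le> (\<Sum>n. ennreal ((real n + 1) powr (- (\<kappa> + 2))) * indicator (B n) y)"
      by (intro sum_le_suminf) auto
    finally show ?thesis .
  qed
  then have "(\<integral>\<^sup>+y. decay (\<kappa> + 2) (x - y) \<partial>N)
    \<le> (\<integral>\<^sup>+y. (\<Sum>n. ennreal ((real n + 1) powr (- (\<kappa> + 2))) * indicator (B n) y) \<partial>N)"
    by (intro nn_integral_mono)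
  also have "\<dots> = (\<Sum>n. ennreal ((real n + 1) powr (- (\<kappa> + 2))) * emeasure N (B n))"
  proof -
    have [measurable]: "B n \<in> sets N" for n by (simp add: B_def N)
    show ?thesis by (subst nn_integral_suminf) (simp_all add: nn_integral_cmult_indicator)
  qed
  also have "\<dots> \<le> (\<Sum>n. G * ennreal (2 powr \<kappa> * (1 / (real n + 1)\<^sup>2)))"
  proof (intro suminf_le summableI)
    fix n
    let ?m = "real n + 1"
    \<comment> \<open>The growth exponent \<kappa> cancels against the decay \<kappa> + 2 and leaves
      1/(n + 1)^2.\<close>
    have "ennreal (?m powr (- (\<kappa> + 2))) * emeasure N (B n)
      \<le> ennreal (?m powr (- (\<kappa> + 2))) * (G * ennreal ((2 * ?m) powr \<kappa>))"
      unfolding B_def by (intro mult_left_mono growth) auto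
    also have "\<dots> = G * ennreal (?m powr (- (\<kappa> + 2)) * (2 * ?m) powr \<kappa>)"
      by (simp add: ennreal_mult ac_simps)
    also have "?m powr (- (\<kappa> + 2)) * (2 * ?m) powr \<kappa> = 2 powr \<kappa> * (?m powr (- (\<kappa> + 2)) * ?m powr \<kappa>)"
      by (subst powr_mult[of 2]) (simp only: mult.left_commute)
    also have "?m powr (- (\<kappa> + 2)) * ?m powr \<kappa> = ?m powr (- 2)"
      by (simp add: powr_add[symmetric])
    also have "?m powr (- 2) = 1 / ?m\<^sup>2"
      by (simp add: powr_minus inverse_eq_divide)
    finally show "ennreal (?m powr (- (\<kappa> + 2))) * emeasure N (B n) \<le> G * ennreal (2 powr \<kappa> * (1 / ?m\<^sup>2))" .
  qed
  also have "\<dots> = G * (\<Sum>n. ennreal (2 powr \<kappa> * (1 / (real n + 1)\<^sup>2)))"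
    by (rule ennreal_suminf_cmult)
  also have "(\<Sum>n. ennreal (2 powr \<kappa> * (1 / (real n + 1)\<^sup>2))) = ennreal (\<Sum>n. 2 powr \<kappa> * (1 / (real n + 1)\<^sup>2))"
    by (intro suminf_ennreal2 summable_mult summable_decay) auto
  also have "(\<Sum>n. 2 powr \<kappa> * (1 / (real n + 1)\<^sup>2)) = 2 powr \<kappa> * (\<Sum>n. 1 / (real n + 1)\<^sup>2)"
    by (intro suminf_mult summable_decay)
  finally show ?thesis .
qed

text \<open>Schur's test. Jensen with the kernel as weight gives the p-th power and uses the
  integral in y; the passage from p to q uses that the kernel is at most 1, so that H is bounded by
  the full integral of f^p; Tonelli and the weighted integral in x finish.\<close>

lemma decay_convolution_bound:
  fixes v f :: "'a::euclidean_space \<Rightarrow> ennreal"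
  assumes p: "1 < p" "p \<le> q"
    and [measurable]: "v \<in> borel_measurable borel" "f \<in> borel_measurable borel"
    and D: "0 \<le> D"
    and c1: "\<And>x::'a. (\<integral>\<^sup>+y. decay D (x - y) \<partial>lborel) \<le> c1"
    and c2: "\<And>y::'a. (\<integral>\<^sup>+x. v x * decay D (y - x) \<partial>lborel) \<le> c2"
    and J: "(\<integral>\<^sup>+x. f x epowr p \<partial>lborel) < top"
  shows "(\<integral>\<^sup>+x. v x * (\<integral>\<^sup>+y. decay D (x - y) * f y \<partial>lborel) epowr q \<partial>lborel) epowr (1 / q)
    \<le> c1 epowr ((p - 1) / p) * c2 epowr (1 / q) * (\<integral>\<^sup>+x. f x epowr p \<partial>lborel) epowr (1 / p)"
proof -
  let ?J = "\<integral>\<^sup>+x. f x epowr p \<partial>lborel"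
  define H where "H x = (\<integral>\<^sup>+y. decay D (x - y) * f y epowr p \<partial>lborel)" for x
  have [measurable]: "H \<in> borel_measurable borel" unfolding H_def by measurable
  have H_le: "H x \<le> ?J" for x
    unfolding H_def
  proof (intro nn_integral_mono)
    fix y show "decay D (x - y) * f y epowr p \<le> f y epowr p"
      using mult_right_mono[OF decay_le_1[OF D], of "f y epowr p" "x - y"] by simp
  qed
  have pt: "(\<integral>\<^sup>+y. decay D (x - y) * f y \<partial>lborel) epowr q
    \<le> c1 epowr ((p - 1) * (q / p)) * (?J epowr (q / p - 1) * H x)" for x
  proof -
    have "(\<integral>\<^sup>+y. decay D (x - y) * f y \<partial>lborel) epowr p
      \<le> (\<integral>\<^sup>+y. decay D (x - y) \<partial>lborel) epowr (p - 1) * H x"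
      unfolding H_def using p by (intro nn_integral_Jensen) auto
    also have "\<dots> \<le> c1 epowr (p - 1) * H x"
      using p c1 by (intro mult_right_mono epowr_mono) auto
    finally have "((\<integral>\<^sup>+y. decay D (x - y) * f y \<partial>lborel) epowr p) epowr (q / p) \<le> (c1 epowr (p - 1) * H x) epowr (q / p)"
      using p by (intro epowr_mono) auto
    then have "(\<integral>\<^sup>+y. decay D (x - y) * f y \<partial>lborel) epowr q \<le> c1 epowr ((p - 1) * (q / p)) * H x epowr (q / p)"
      using p by (simp add: epowr_mult epowr_epowr)
    also have "H x epowr (q / p) \<le> ?J epowr (q / p - 1) * H x"
    proof (cases "H x = 0")
      case False
      have "H x \<noteq> top" using H_le[of x] J by (auto simp: top_unique)
      have "H x epowr (q / p) = H x epowr (q / p - 1 + 1)" by simp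
      also have "\<dots> = H x epowr (q / p - 1) * H x epowr 1"
        using False \<open>H x \<noteq> top\<close> by (rule epowr_add_nonneg)
      also have "\<dots> \<le> ?J epowr (q / p - 1) * H x"
        using p H_le[of x] by (simp add: mult_right_mono epowr_mono)
      finally show ?thesis .
    qed simp
    finally show ?thesis by (simp add: mult_left_mono)
  qed
  have vH: "(\<integral>\<^sup>+x. v x * H x \<partial>lborel) \<le> c2 * ?J"
  proof -
    have "(\<integral>\<^sup>+x. v x * H x \<partial>lborel) = (\<integral>\<^sup>+x. \<integral>\<^sup>+y. v x * (decay D (x - y) * f y epowr p) \<partial>lborel \<partial>lborel)"
      unfolding H_def by (intro nn_integral_cong nn_integral_cmult[symmetric]) simp
    also have "\<dots> = (\<integral>\<^sup>+y. \<integral>\<^sup>+x. v x * (decay D (x - y) * f y epowr p) \<partial>lborel \<partial>lborel)"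
      by (intro lborel_pair.Fubini'[symmetric]) simp
    also have "\<dots> = (\<integral>\<^sup>+y. \<integral>\<^sup>+x. (v x * decay D (y - x)) * f y epowr p \<partial>lborel \<partial>lborel)"
      by (simp add: decay_def norm_minus_commute mult.assoc)
    also have "\<dots> = (\<integral>\<^sup>+y. (\<integral>\<^sup>+x. v x * decay D (y - x) \<partial>lborel) * f y epowr p \<partial>lborel)"
      by (intro nn_integral_cong nn_integral_multc) simp
    also have "\<dots> \<le> (\<integral>\<^sup>+y. c2 * f y epowr p \<partial>lborel)"
      by (intro nn_integral_mono mult_right_mono c2) auto
    also have "\<dots> = c2 * ?J" by (intro nn_integral_cmult) simp
    finally show ?thesis .
  qed
  have "(\<integral>\<^sup>+x. v x * (\<integral>\<^sup>+y. decay D (x - y) * f y \<partial>lborel) epowr q \<partial>lborel)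
    \<le> (\<integral>\<^sup>+x. (c1 epowr ((p - 1) * (q / p)) * ?J epowr (q / p - 1)) * (v x * H x) \<partial>lborel)"
  proof (intro nn_integral_mono)
    fix x
    show "v x * (\<integral>\<^sup>+y. decay D (x - y) * f y \<partial>lborel) epowr q
      \<le> (c1 epowr ((p - 1) * (q / p)) * ?J epowr (q / p - 1)) * (v x * H x)"
      using mult_left_mono[OF pt[of x], of "v x"] by (simp add: ac_simps)
  qed
  also have "\<dots> = (c1 epowr ((p - 1) * (q / p)) * ?J epowr (q / p - 1)) * (\<integral>\<^sup>+x. v x * H x \<partial>lborel)"
    by (intro nn_integral_cmult) simp
  also have "\<dots> \<le> (c1 epowr ((p - 1) * (q / p)) * ?J epowr (q / p - 1)) * (c2 * ?J)"
    by (intro mult_left_mono vH) auto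
  also have "\<dots> = c1 epowr ((p - 1) * (q / p)) * c2 * (?J epowr (q / p - 1) * ?J)"
    by (simp add: ac_simps)
  also have "?J epowr (q / p - 1) * ?J = ?J epowr (q / p)"
  proof (cases "?J = 0")
    case False
    then have "?J epowr (q / p - 1) * ?J epowr 1 = ?J epowr (q / p - 1 + 1)"
      using J by (intro epowr_add_nonneg[symmetric]) auto
    then show ?thesis by simp
  qed simp
  finally have "(\<integral>\<^sup>+x. v x * (\<integral>\<^sup>+y. decay D (x - y) * f y \<partial>lborel) epowr q \<partial>lborel) epowr (1 / q)
    \<le> (c1 epowr ((p - 1) * (q / p)) * c2 * ?J epowr (q / p)) epowr (1 / q)"
    using p by (intro epowr_mono) auto
  also have "\<dots> = c1 epowr ((p - 1) / p) * c2 epowr (1 / q) * ?J epowr (1 / p)"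
    using p by (simp add: epowr_mult epowr_epowr)
  finally show ?thesis .
qed

section \<open>Fractional powers, finite differences and heat kernels\<close>

text \<open>The N-fold backward difference of the truncated power of t. Under the Laplace transform
  a backward difference multiplies by 1 - e^(-s).\<close>

primrec fdiff :: "nat \<Rightarrow> real \<Rightarrow> real \<Rightarrow> real" where
  "fdiff 0 \<gamma> t = (if 0 < t then t powr \<gamma> else 0)"
| "fdiff (Suc N) \<gamma> t = fdiff N \<gamma> t - fdiff N \<gamma> (t - 1)"

lemma fdiff_nonpos: "t \<le> 0 \<Longrightarrow> fdiff N \<gamma> t = 0"
  by (induction N arbitrary: t) auto

lemma measurable_fdiff [measurable]: "fdiff N \<gamma> \<in> borel_measurable borel"
proof (induction N)
  case 0
  have "fdiff 0 \<gamma> = (\<lambda>t. if 0 < t then t powr \<gamma> else 0)" by auto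
  then show ?case by simp
next
  case (Suc N)
  have [measurable]: "fdiff N \<gamma> \<in> borel_measurable borel" by (rule Suc)
  have "fdiff (Suc N) \<gamma> = (\<lambda>t. fdiff N \<gamma> t - fdiff N \<gamma> (t - 1))" by auto
  then show ?case by simp
qed

text \<open>For t > N all the points t, t - 1, ..., t - N are positive, away from the singularity of
  the truncated power.\<close>

lemma fdiff_has_derivative:
  "real N < t \<Longrightarrow> (fdiff N \<gamma> has_real_derivative \<gamma> * fdiff N (\<gamma> - 1) t) (at t)"
proof (induction N arbitrary: t)
  case 0
  then have t: "0 < t" by simp
  have "((\<lambda>t. t powr \<gamma>) has_real_derivative \<gamma> * t powr (\<gamma> - 1)) (at t)"
    by (rule has_real_derivative_powr[OF t])
  then have "(fdiff 0 \<gamma> has_real_derivative \<gamma> * t powr (\<gamma> - 1)) (at t)"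
    by (rule has_field_derivative_transform_within_open[of _ _ _ "{0<..}"]) (use t in auto)
  moreover have "\<gamma> * fdiff 0 (\<gamma> - 1) t = \<gamma> * t powr (\<gamma> - 1)" using t by simp
  ultimately show ?case by (simp only:)
next
  case (Suc N)
  have 1: "(fdiff N \<gamma> has_real_derivative \<gamma> * fdiff N (\<gamma> - 1) t) (at t)"
    using Suc by auto
  have "(fdiff N \<gamma> has_real_derivative \<gamma> * fdiff N (\<gamma> - 1) (t - 1)) (at (t - 1))"
    using Suc by auto
  then have 2: "((\<lambda>u. fdiff N \<gamma> (u + - 1)) has_real_derivative \<gamma> * fdiff N (\<gamma> - 1) (t - 1)) (at t)"
    using DERIV_shift[of "fdiff N \<gamma>" "\<gamma> * fdiff N (\<gamma> - 1) (t - 1)" t "- 1"] by simp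
  have "((\<lambda>u. fdiff N \<gamma> u - fdiff N \<gamma> (u + - 1)) has_real_derivative
    \<gamma> * fdiff N (\<gamma> - 1) t - \<gamma> * fdiff N (\<gamma> - 1) (t - 1)) (at t)"
    by (rule DERIV_diff[OF 1 2])
  moreover have "(\<lambda>u. fdiff N \<gamma> u - fdiff N \<gamma> (u + - 1)) = fdiff (Suc N) \<gamma>" by auto
  ultimately show ?case by (simp add: right_diff_distrib)
qed

text \<open>Each difference gains one power of t: by the mean value theorem it equals \<gamma> times
  a lower difference with exponent \<gamma> - 1 at some z between t - 1 and t, and z \<ge> t/2 makes
  z and t comparable. The exponent changes, so the induction keeps \<gamma> arbitrary.\<close>

lemma fdiff_decay:
  "\<exists>C\<ge>0. \<forall>t\<ge>real N + 1. \<bar>fdiff N \<gamma> t\<bar> \<le> C * t powr (\<gamma> - N)"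
proof (induction N arbitrary: \<gamma>)
  case 0
  show ?case by (intro exI[of _ 1]) auto
next
  case (Suc N)
  obtain C where C: "0 \<le> C" "\<And>t. real N + 1 \<le> t \<Longrightarrow> \<bar>fdiff N (\<gamma> - 1) t\<bar> \<le> C * t powr (\<gamma> - 1 - N)"
    using Suc[of "\<gamma> - 1"] by blast
  define e where "e = \<gamma> - real (Suc N)"
  have "\<bar>fdiff (Suc N) \<gamma> t\<bar> \<le> (\<bar>\<gamma>\<bar> * C * 2 powr \<bar>e\<bar>) * t powr e" if t: "real (Suc N) + 1 \<le> t" for t
  proof -
    have "\<exists>z. t - 1 < z \<and> z < t \<and> fdiff N \<gamma> t - fdiff N \<gamma> (t - 1) = (t - (t - 1)) * (\<gamma> * fdiff N (\<gamma> - 1) z)"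
      using t by (intro MVT2 fdiff_has_derivative) auto
    then obtain z where z: "t - 1 < z" "z < t" "fdiff (Suc N) \<gamma> t = \<gamma> * fdiff N (\<gamma> - 1) z"
      by auto
    have "t / 2 \<le> z" using t z by auto
    have "0 < z" using t z by auto
    have "z powr e \<le> 2 powr \<bar>e\<bar> * t powr e"
    proof (cases "0 \<le> e")
      case True
      have "1 * t powr e \<le> 2 powr \<bar>e\<bar> * t powr e"
        by (intro mult_right_mono) (auto simp: ge_one_powr_ge_zero)
      moreover have "z powr e \<le> t powr e" using True z \<open>0 < z\<close> by (intro powr_mono2) auto
      ultimately show ?thesis by simp
    next
      case False
      then have "z powr e \<le> (t / 2) powr e"
        using \<open>t / 2 \<le> z\<close> t by (intro powr_mono2') auto
      also have "\<dots> = 2 powr \<bar>e\<bar> * t powr e"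
      proof -
        have "2 powr \<bar>e\<bar> = inverse (2 powr e)" using False powr_minus[of 2 e] by (simp add: abs_if)
        moreover have "(t / 2) powr e = t powr e / 2 powr e" by (rule powr_divide)
        ultimately show ?thesis by (simp only: divide_inverse mult.commute)
      qed
      finally show ?thesis .
    qed
    have "\<bar>fdiff (Suc N) \<gamma> t\<bar> = \<bar>\<gamma>\<bar> * \<bar>fdiff N (\<gamma> - 1) z\<bar>"
      unfolding z(3) by (simp add: abs_mult)
    also have "\<dots> \<le> \<bar>\<gamma>\<bar> * (C * z powr e)"
    proof -
      have "\<gamma> - 1 - real N = e" by (simp add: e_def)
      then show ?thesis using C(2)[of z] t z by (intro mult_left_mono) auto
    qed
    also have "\<dots> \<le> \<bar>\<gamma>\<bar> * (C * (2 powr \<bar>e\<bar> * t powr e))"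
      using C(1) \<open>z powr e \<le> _\<close> by (intro mult_left_mono) auto
    finally show ?thesis by (simp only: mult.assoc)
  qed
  then show ?case using C(1) unfolding e_def by (intro exI[of _ "\<bar>\<gamma>\<bar> * C * 2 powr \<bar>e\<bar>"]) (auto simp: e_def)
qed

section \<open>Moments and Laplace transform of the differences\<close>

lemma nn_integral_powr_from_0:
  assumes "0 < \<beta>"
  shows "(\<integral>\<^sup>+t. ennreal (t powr (\<beta> - 1)) * indicator {0..R} t \<partial>lborel) < top"
proof (cases "0 \<le> R")
  case True
  have "((\<lambda>t. t powr (\<beta> - 1)) has_integral (R powr (\<beta> - 1 + 1) / (\<beta> - 1 + 1))) {0..R}"
    using assms True by (intro has_integral_powr_from_0) auto
  from nn_integral_has_integral_lebesgue'[OF _ this] show ?thesis by simp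
qed simp

lemma nn_integral_powr_inf:
  assumes "e < - 1" "0 < a"
  shows "(\<integral>\<^sup>+t. ennreal (t powr e) * indicator {a..} t \<partial>lborel) < top"
proof -
  have "((\<lambda>t. t powr e) has_integral (- (a powr (e + 1)) / (e + 1))) {a..}"
    using assms by (intro has_integral_powr_to_inf) auto
  from nn_integral_has_integral_lebesgue'[OF _ this] show ?thesis by simp
qed

lemma nn_integral_shift_real:
  fixes f :: "real \<Rightarrow> ennreal"
  assumes "f \<in> borel_measurable borel"
  shows "(\<integral>\<^sup>+t. f (t - c) \<partial>lborel) = (\<integral>\<^sup>+t. f t \<partial>lborel)"
  using nn_integral_real_affine[OF assms, of 1 "-c"] by simp

text \<open>The differences may be singular at 0, 1, ..., N, but every singularity is a translate of
  that of t^(\<beta>-1), integrable because \<beta> > 0. R stays arbitrary since a translation moves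
  it.\<close>

lemma fdiff_integrable_initial:
  assumes "0 < \<beta>"
  shows "(\<integral>\<^sup>+t. ennreal \<bar>fdiff N (\<beta> - 1) t\<bar> * indicator {..R} t \<partial>lborel) < top"
proof (induction N arbitrary: R)
  case 0
  have "(\<integral>\<^sup>+t. ennreal \<bar>fdiff 0 (\<beta> - 1) t\<bar> * indicator {..R} t \<partial>lborel)
    \<le> (\<integral>\<^sup>+t. ennreal (t powr (\<beta> - 1)) * indicator {0..R} t \<partial>lborel)"
    by (intro nn_integral_mono) (auto simp: indicator_def)
  then show ?case using nn_integral_powr_from_0[OF assms] by (rule le_less_trans)
next
  case (Suc N)
  have "(\<integral>\<^sup>+t. ennreal \<bar>fdiff (Suc N) (\<beta> - 1) t\<bar> * indicator {..R} t \<partial>lborel)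
    \<le> (\<integral>\<^sup>+t. ennreal \<bar>fdiff N (\<beta> - 1) t\<bar> * indicator {..R} t
        + ennreal \<bar>fdiff N (\<beta> - 1) (t - 1)\<bar> * indicator {..R - 1} (t - 1) \<partial>lborel)"
    by (intro nn_integral_mono) (auto simp: indicator_def ennreal_plus[symmetric] simp del: ennreal_plus intro!: ennreal_leI)
  also have "\<dots> = (\<integral>\<^sup>+t. ennreal \<bar>fdiff N (\<beta> - 1) t\<bar> * indicator {..R} t \<partial>lborel)
      + (\<integral>\<^sup>+t. ennreal \<bar>fdiff N (\<beta> - 1) (t - 1)\<bar> * indicator {..R - 1} (t - 1) \<partial>lborel)"
    by (intro nn_integral_add) auto
  also have "(\<integral>\<^sup>+t. ennreal \<bar>fdiff N (\<beta> - 1) (t - 1)\<bar> * indicator {..R - 1} (t - 1) \<partial>lborel)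
    = (\<integral>\<^sup>+t. ennreal \<bar>fdiff N (\<beta> - 1) t\<bar> * indicator {..R - 1} t \<partial>lborel)"
    by (rule nn_integral_shift_real) simp
  also have "(\<integral>\<^sup>+t. ennreal \<bar>fdiff N (\<beta> - 1) t\<bar> * indicator {..R} t \<partial>lborel) + \<dots> < top"
    using Suc by simp
  finally show ?case .
qed

text \<open>Up to N + 1 the power t^m is bounded; beyond, \<open>fdiff_decay\<close> leaves the
  exponent \<beta> - 1 - N + m, which is below -1 exactly when \<beta> + m < N.\<close>

lemma fdiff_moment_finite:
  assumes \<beta>: "0 < \<beta>" and m: "0 \<le> m" and N: "\<beta> + m < real N"
  shows "(\<integral>\<^sup>+t. ennreal (\<bar>fdiff N (\<beta> - 1) t\<bar> * t powr m) \<partial>lborel) < top"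
proof -
  obtain C where C: "0 \<le> C" "\<And>t. real N + 1 \<le> t \<Longrightarrow> \<bar>fdiff N (\<beta> - 1) t\<bar> \<le> C * t powr (\<beta> - 1 - N)"
    using fdiff_decay[of N "\<beta> - 1"] by blast
  let ?R = "real N + 1" and ?e = "\<beta> - 1 - N + m"
  have "(\<integral>\<^sup>+t. ennreal (\<bar>fdiff N (\<beta> - 1) t\<bar> * t powr m) \<partial>lborel)
    \<le> (\<integral>\<^sup>+t. ennreal (?R powr m) * (ennreal \<bar>fdiff N (\<beta> - 1) t\<bar> * indicator {..?R} t)
        + ennreal C * (ennreal (t powr ?e) * indicator {?R..} t) \<partial>lborel)"
  proof (intro nn_integral_mono)
    fix t
    consider "t \<le> 0" | "0 < t" "t \<le> ?R" | "?R < t" by linarith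
    then show "ennreal (\<bar>fdiff N (\<beta> - 1) t\<bar> * t powr m)
      \<le> ennreal (?R powr m) * (ennreal \<bar>fdiff N (\<beta> - 1) t\<bar> * indicator {..?R} t)
        + ennreal C * (ennreal (t powr ?e) * indicator {?R..} t)"
    proof cases
      case 1
      then show ?thesis by (simp add: fdiff_nonpos)
    next
      case 2
      then have "t powr m \<le> ?R powr m" using m by (intro powr_mono2) auto
      then have "ennreal (\<bar>fdiff N (\<beta> - 1) t\<bar> * t powr m) \<le> ennreal (?R powr m * \<bar>fdiff N (\<beta> - 1) t\<bar>)"
        by (intro ennreal_leI) (simp add: mult.commute mult_right_mono)
      then show ?thesis using 2 by (simp add: ennreal_mult add_increasing2)
    next
      case 3
      have "\<bar>fdiff N (\<beta> - 1) t\<bar> * t powr m \<le> C * t powr (\<beta> - 1 - N) * t powr m"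
        using 3 by (intro mult_right_mono C) auto
      also have "\<dots> = C * t powr ?e" by (simp add: powr_add)
      finally have "ennreal (\<bar>fdiff N (\<beta> - 1) t\<bar> * t powr m) \<le> ennreal (C * t powr ?e)" by (rule ennreal_leI)
      then show ?thesis using 3 C by (simp add: ennreal_mult)
    qed
  qed
  also have "\<dots> = ennreal (?R powr m) * (\<integral>\<^sup>+t. ennreal \<bar>fdiff N (\<beta> - 1) t\<bar> * indicator {..?R} t \<partial>lborel)
      + ennreal C * (\<integral>\<^sup>+t. ennreal (t powr ?e) * indicator {?R..} t \<partial>lborel)"
    by (simp add: nn_integral_add nn_integral_cmult)
  also have "\<dots> < top"
    using fdiff_integrable_initial[OF \<beta>, of N ?R] nn_integral_powr_inf[of ?e ?R] N
    by (simp add: ennreal_mult_less_top)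
  finally show ?thesis .
qed

text \<open>For N = 0 this is Euler's integral for the Gamma function after scaling by s; each
  further difference subtracts a translate by 1, whose transform carries the factor e^(-s).\<close>

lemma fdiff_Laplace:
  assumes \<beta>: "0 < \<beta>" and s: "0 < s"
  shows "has_bochner_integral lborel (\<lambda>t. fdiff N (\<beta> - 1) t * exp (- (s * t)))
    (Gamma \<beta> * s powr (- \<beta>) * (1 - exp (- s)) ^ N)"
proof (induction N)
  case 0
  let ?g = "\<lambda>t::real. indicator {0..} t * (t powr (\<beta> - 1) / exp t)"
  have "has_bochner_integral lborel ?g (Gamma \<beta>)"
  proof (rule has_bochner_integral_nn_integral)
    show "(\<integral>\<^sup>+t. ennreal (?g t) \<partial>lborel) = ennreal (Gamma \<beta>)"
      using Gamma_conv_nn_integral_real[OF \<beta>] by simp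
  qed (use \<beta> in \<open>auto intro: less_imp_le Gamma_real_pos\<close>)
  then have "has_bochner_integral lborel (\<lambda>t. ?g (0 + s * t)) (Gamma \<beta> /\<^sub>R \<bar>s\<bar>)"
    using s by (subst lborel_has_bochner_integral_real_affine_iff[symmetric]) auto
  then have "has_bochner_integral lborel (\<lambda>t. s powr (1 - \<beta>) * ?g (0 + s * t)) (s powr (1 - \<beta>) * (Gamma \<beta> /\<^sub>R \<bar>s\<bar>))"
    by (intro has_bochner_integral_mult_right)
  moreover have "s powr (1 - \<beta>) * ?g (0 + s * t) = fdiff 0 (\<beta> - 1) t * exp (- (s * t))" for t
  proof -
    have "s powr (1 - \<beta>) * s powr (\<beta> - 1) = 1" using s by (simp add: powr_add[symmetric])
    then have "s powr (1 - \<beta>) * (s powr (\<beta> - 1) * t powr (\<beta> - 1) / exp (s * t)) = t powr (\<beta> - 1) * exp (- (s * t))"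
      by (simp add: exp_minus divide_inverse mult.assoc[symmetric])
    then show ?thesis
      using s by (auto simp: indicator_def powr_mult zero_le_mult_iff not_less less_le)
  qed
  moreover have "s powr (1 - \<beta>) * (Gamma \<beta> /\<^sub>R \<bar>s\<bar>) = Gamma \<beta> * s powr (- \<beta>)"
  proof -
    have "s powr (1 - \<beta>) = s * s powr (- \<beta>)"
      using powr_add[of s 1 "- \<beta>"] s by simp
    then show ?thesis using s by (simp add: field_simps)
  qed
  ultimately show ?case by (simp only: power_0 mult_1_right)
next
  case (Suc N)
  let ?I = "Gamma \<beta> * s powr (- \<beta>) * (1 - exp (- s)) ^ N"
  let ?f = "\<lambda>t. fdiff N (\<beta> - 1) t * exp (- (s * t))"
  have "has_bochner_integral lborel (\<lambda>t. ?f (- 1 + 1 * t)) (?I /\<^sub>R \<bar>1\<bar>)"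
    using Suc by (subst lborel_has_bochner_integral_real_affine_iff[symmetric]) auto
  then have "has_bochner_integral lborel (\<lambda>t. exp (- s) * ?f (- 1 + 1 * t)) (exp (- s) * (?I /\<^sub>R \<bar>1\<bar>))"
    by (intro has_bochner_integral_mult_right)
  then have "has_bochner_integral lborel (\<lambda>t. ?f t - exp (- s) * ?f (- 1 + 1 * t)) (?I - exp (- s) * (?I /\<^sub>R \<bar>1\<bar>))"
    by (intro has_bochner_integral_diff Suc)
  moreover have "?f t - exp (- s) * ?f (- 1 + 1 * t) = fdiff (Suc N) (\<beta> - 1) t * exp (- (s * t))" for t
  proof -
    have "exp (- s) * exp (- (s * (- 1 + t))) = exp (- (s * t))"
      by (simp add: exp_add[symmetric] right_diff_distrib distrib_left)
    then have "exp (- s) * ?f (- 1 + 1 * t) = fdiff N (\<beta> - 1) (t - 1) * exp (- (s * t))"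
      by (simp add: mult.left_commute)
    then show ?thesis by (simp add: left_diff_distrib)
  qed
  moreover have "?I - exp (- s) * (?I /\<^sub>R \<bar>1\<bar>) = Gamma \<beta> * s powr (- \<beta>) * (1 - exp (- s)) ^ Suc N"
    by (simp add: algebra_simps)
  ultimately show ?case by simp
qed

section \<open>The Gauss-Weierstrass kernel and the kernel of the difference multiplier\<close>

definition heat :: "real \<Rightarrow> 'a::euclidean_space \<Rightarrow> real" where
  "heat t x = (4 * pi * t) powr (- real DIM('a) / 2) * exp (- (norm x)\<^sup>2 / (4 * t))"

lemma heat_nonneg: "0 \<le> heat t x"
  by (simp add: heat_def)

lemma measurable_heat [measurable]:
  assumes [measurable]: "f \<in> borel_measurable M" "g \<in> borel_measurable M"
  shows "(\<lambda>z. heat (f z) (g z)) \<in> borel_measurable M"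
  unfolding heat_def by measurable

lemma powr_le_exp:
  fixes \<kappa> :: real
  assumes "0 \<le> \<kappa>" shows "\<exists>C>0. \<forall>u>0. exp (- u) \<le> C * u powr (- \<kappa>)"
proof -
  define n where "n = nat \<lceil>\<kappa>\<rceil>"
  have n: "\<kappa> \<le> real n" unfolding n_def by linarith
  have "exp (- u) \<le> fact n * u powr (- \<kappa>)" if u: "0 < u" for u :: real
  proof -
    have "u powr \<kappa> \<le> fact n * exp u"
    proof (cases "1 \<le> u")
      case True
      have "u powr \<kappa> \<le> u powr real n" using True n by (intro powr_mono) auto
      also have "\<dots> = u ^ n" using u by (rule powr_realpow)
      also have "\<dots> = fact n * (u ^ n / fact n)" by simp
      also have "u ^ n / fact n \<le> exp u"
      proof -
        have "(\<Sum>k\<in>{n}. u ^ k /\<^sub>R fact k) \<le> (\<Sum>k. u ^ k /\<^sub>R fact k)"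
          using u by (intro sum_le_suminf summable_exp_generic) auto
        then show ?thesis by (simp add: exp_def divide_inverse mult.commute)
      qed
      finally show ?thesis by simp
    next
      case False
      then have "u powr \<kappa> \<le> 1" using u assms by (intro powr_le1) auto
      also have "1 \<le> fact n * exp u"
        using mult_mono[of 1 "fact n" 1 "exp u"] u by (simp add: fact_ge_1)
      finally show ?thesis .
    qed
    then show ?thesis using u by (simp add: exp_minus powr_minus field_simps)
  qed
  then show ?thesis by (intro exI[of _ "fact n"]) auto
qed

text \<open>The bound e^(-u) \<le> C u^(-\<kappa>) at u = |x|^2 / (4 t). The free parameter trades
  powers of t for decay in x: \<kappa> = 0 and \<kappa> = d/2 give the bound of
  \<open>diff_kernel\<close> by the Riesz kernel, \<kappa> = d/2 + m its fast decay.\<close>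

lemma heat_le:
  fixes \<kappa> :: real
  assumes "0 \<le> \<kappa>"
  shows "\<exists>C\<ge>0. \<forall>t>0. \<forall>x::'a::euclidean_space. x \<noteq> 0 \<longrightarrow>
    heat t x \<le> C * (t powr (\<kappa> - DIM('a) / 2) * norm x powr (- 2 * \<kappa>))"
proof -
  obtain C where C: "0 < C" "\<And>u. 0 < u \<Longrightarrow> exp (- u) \<le> C * u powr (- \<kappa>)"
    using powr_le_exp[OF assms] by blast
  let ?d = "real DIM('a) / 2"
  have "heat t x \<le> ((4 * pi) powr (- ?d) * C * 4 powr \<kappa>) * (t powr (\<kappa> - ?d) * norm x powr (- 2 * \<kappa>))"
    if t: "0 < t" and x: "x \<noteq> 0" for t and x :: 'a
  proof -
    have nx: "0 < norm x" using x by simp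
    have "exp (- (norm x)\<^sup>2 / (4 * t)) \<le> C * ((norm x)\<^sup>2 / (4 * t)) powr (- \<kappa>)"
      using C(2)[of "(norm x)\<^sup>2 / (4 * t)"] t x by simp
    also have "((norm x)\<^sup>2 / (4 * t)) powr (- \<kappa>) = 4 powr \<kappa> * (t powr \<kappa> * norm x powr (- 2 * \<kappa>))"
    proof -
      have "((norm x)\<^sup>2) powr (- \<kappa>) = norm x powr (- 2 * \<kappa>)"
        using nx by (simp add: powr_powr flip: powr_numeral)
      then have "((norm x)\<^sup>2 / (4 * t)) powr (- \<kappa>) = norm x powr (- 2 * \<kappa>) * (1 / (4 * t) powr (- \<kappa>))"
        using powr_divide[of "(norm x)\<^sup>2" "4 * t" "- \<kappa>"] by simp
      also have "1 / (4 * t) powr (- \<kappa>) = 4 powr \<kappa> * t powr \<kappa>"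
        using powr_minus_divide[of "4 * t" "- \<kappa>"] t by (simp add: powr_mult)
      finally show ?thesis by (simp only: ac_simps)
    qed
    finally have "heat t x \<le> (4 * pi * t) powr (- ?d) * (C * (4 powr \<kappa> * (t powr \<kappa> * norm x powr (- 2 * \<kappa>))))"
      unfolding heat_def by (simp add: mult_left_mono)
    also have "(4 * pi * t) powr (- ?d) = (4 * pi) powr (- ?d) * t powr (- ?d)"
      using t by (simp add: powr_mult)
    also have "(4 * pi) powr (- ?d) * t powr (- ?d) * (C * (4 powr \<kappa> * (t powr \<kappa> * norm x powr (- 2 * \<kappa>))))
      = ((4 * pi) powr (- ?d) * C * 4 powr \<kappa>) * ((t powr \<kappa> * t powr (- ?d)) * norm x powr (- 2 * \<kappa>))"
      by (simp only: ac_simps)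
    also have "t powr \<kappa> * t powr (- ?d) = t powr (\<kappa> - ?d)"
      by (simp add: powr_add[symmetric])
    finally show ?thesis .
  qed
  moreover have "0 \<le> (4 * pi) powr (- ?d) * C * 4 powr \<kappa>" using C(1) by simp
  ultimately show ?thesis by blast
qed

text \<open>Without the absolute value, this is \<open>\<Gamma>(\<beta>)\<close> times the kernel of the multiplier
  \<open>(1 - e\<^bsup>-Ts\<^esup>)\<^sup>N s\<^bsup>-\<beta>\<^esup>\<close> with \<open>s = (2\<pi>\<bar>\<xi>\<bar>)\<^sup>2\<close>.\<close>

definition diff_kernel :: "nat \<Rightarrow> real \<Rightarrow> real \<Rightarrow> 'a::euclidean_space \<Rightarrow> ennreal" where
  "diff_kernel N \<beta> T x = ennreal (T powr \<beta>) * (\<integral>\<^sup>+t. ennreal (\<bar>fdiff N (\<beta> - 1) t\<bar> * heat (T * t) x) \<partial>lborel)"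

text \<open>With \<kappa> = d/2 + m in \<open>heat_le\<close> the time enters as (T t)^m, so what
  has to be finite is the m-th moment of the difference. This is where N is required to be
  large.\<close>

lemma diff_kernel_far:
  fixes \<beta> m :: real
  assumes \<beta>: "0 < \<beta>" and m: "0 \<le> m" and N: "\<beta> + m < real N"
  shows "\<exists>C\<ge>0. \<forall>T>0. \<forall>x::'a::euclidean_space. x \<noteq> 0 \<longrightarrow>
    diff_kernel N \<beta> T x \<le> ennreal (C * T powr (\<beta> + m) * norm x powr (- (DIM('a) + 2 * m)))"
proof -
  let ?d = "real DIM('a) / 2"
  obtain C where C: "0 \<le> C" "\<And>t x::'a. 0 < t \<Longrightarrow> x \<noteq> 0 \<Longrightarrow>
      heat t x \<le> C * (t powr (?d + m - ?d) * norm x powr (- 2 * (?d + m)))"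
    using heat_le[of "?d + m", where 'a='a] m by auto
  define I where "I = enn2real (\<integral>\<^sup>+t. ennreal (\<bar>fdiff N (\<beta> - 1) t\<bar> * t powr m) \<partial>lborel)"
  have I: "(\<integral>\<^sup>+t. ennreal (\<bar>fdiff N (\<beta> - 1) t\<bar> * t powr m) \<partial>lborel) = ennreal I" "0 \<le> I"
    using fdiff_moment_finite[OF assms] unfolding I_def by auto
  have "diff_kernel N \<beta> T x \<le> ennreal (C * I * T powr (\<beta> + m) * norm x powr (- (DIM('a) + 2 * m)))"
    if T: "0 < T" and x: "x \<noteq> 0" for T and x :: 'a
  proof -
    let ?c = "C * T powr m * norm x powr (- (DIM('a) + 2 * m))"
    have "(\<integral>\<^sup>+t. ennreal (\<bar>fdiff N (\<beta> - 1) t\<bar> * heat (T * t) x) \<partial>lborel)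
      \<le> (\<integral>\<^sup>+t. ennreal ?c * ennreal (\<bar>fdiff N (\<beta> - 1) t\<bar> * t powr m) \<partial>lborel)"
    proof (intro nn_integral_mono)
      fix t :: real
      show "ennreal (\<bar>fdiff N (\<beta> - 1) t\<bar> * heat (T * t) x) \<le> ennreal ?c * ennreal (\<bar>fdiff N (\<beta> - 1) t\<bar> * t powr m)"
      proof (cases "0 < t")
        case True
        have "heat (T * t) x \<le> C * ((T * t) powr m * norm x powr (- (DIM('a) + 2 * m)))"
          using C(2)[of "T * t" x] T True x by (simp add: algebra_simps)
        also have "\<dots> = ?c * t powr m" using T True by (simp add: powr_mult)
        finally have "\<bar>fdiff N (\<beta> - 1) t\<bar> * heat (T * t) x \<le> \<bar>fdiff N (\<beta> - 1) t\<bar> * (?c * t powr m)"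
          by (intro mult_left_mono) auto
        then have "ennreal (\<bar>fdiff N (\<beta> - 1) t\<bar> * heat (T * t) x) \<le> ennreal (?c * (\<bar>fdiff N (\<beta> - 1) t\<bar> * t powr m))"
          by (intro ennreal_leI) (simp only: ac_simps)
        also have "\<dots> = ennreal ?c * ennreal (\<bar>fdiff N (\<beta> - 1) t\<bar> * t powr m)"
          using C(1) by (intro ennreal_mult) auto
        finally show ?thesis .
      qed (simp add: fdiff_nonpos)
    qed
    also have "\<dots> = ennreal ?c * ennreal I" by (subst nn_integral_cmult) (simp_all add: I)
    finally have "diff_kernel N \<beta> T x \<le> ennreal (T powr \<beta>) * (ennreal ?c * ennreal I)"
      unfolding diff_kernel_def by (intro mult_left_mono) auto
    also have "\<dots> = ennreal (T powr \<beta> * (?c * I))"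
      using C(1) I(2) by (simp add: ennreal_mult)
    also have "T powr \<beta> * (?c * I) = C * I * (T powr \<beta> * T powr m) * norm x powr (- (DIM('a) + 2 * m))"
      by (simp only: ac_simps)
    also have "T powr \<beta> * T powr m = T powr (\<beta> + m)" by (simp add: powr_add)
    finally show ?thesis .
  qed
  moreover have "0 \<le> C * I" using C I by simp
  ultimately show ?thesis by blast
qed

text \<open>The difference is split into 2^N shifted powers, each of which alone yields the Riesz
  kernel. Scaling time by |x|^2 / T removes both x and T from the integral, and this is why the
  bound is uniform in T.\<close>

lemma diff_kernel_near:
  fixes \<beta> :: real
  assumes \<beta>: "0 < \<beta>" "\<beta> < DIM('a) / 2"
  shows "\<exists>C\<ge>0. \<forall>T>0. \<forall>x::'a::euclidean_space. x \<noteq> 0 \<longrightarrow>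
    diff_kernel N \<beta> T x \<le> ennreal (C * norm x powr (2 * \<beta> - DIM('a)))"
proof -
  let ?d = "real DIM('a) / 2"
  obtain C0 where C0: "0 \<le> C0" "\<And>t x::'a. 0 < t \<Longrightarrow> x \<noteq> 0 \<Longrightarrow>
      heat t x \<le> C0 * (t powr (0 - ?d) * norm x powr (- 2 * 0))"
    using heat_le[of 0, where 'a='a] by auto
  obtain C1 where C1: "0 \<le> C1" "\<And>t x::'a. 0 < t \<Longrightarrow> x \<noteq> 0 \<Longrightarrow>
      heat t x \<le> C1 * (t powr (?d - ?d) * norm x powr (- 2 * ?d))"
    using heat_le[of ?d, where 'a='a] by auto
  define C where "C = max C0 C1"
  have heat_min: "heat t x \<le> C * min (norm x powr (- DIM('a))) (t powr (- ?d))"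
    if "0 < t" "x \<noteq> 0" for t and x :: 'a
  proof -
    have "heat t x \<le> C0 * t powr (- ?d)" "heat t x \<le> C1 * norm x powr (- DIM('a))"
      using C0(2)[OF that] C1(2)[OF that] that by simp_all
    moreover have "C0 * t powr (- ?d) \<le> C * t powr (- ?d)"
      "C1 * norm x powr (- DIM('a)) \<le> C * norm x powr (- DIM('a))"
      unfolding C_def by (auto intro: mult_right_mono)
    ultimately show ?thesis by (auto simp: min_def)
  qed
  have C: "0 \<le> C" using C0(1) by (simp add: C_def)
  \<comment> \<open>The profile left after scaling; integrable at 0 because \<beta> > 0 and at
    \<infinity> because \<beta> < d/2.\<close>
  define g where "g w = (if 0 < w then w powr (\<beta> - 1) * min 1 (w powr (- ?d)) else 0)" for w :: real
  have [measurable]: "g \<in> borel_measurable borel" unfolding g_def by measurable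
  have g0: "0 \<le> g w" for w by (simp add: g_def)
  have "(\<integral>\<^sup>+w. ennreal (g w) \<partial>lborel) \<le> (\<integral>\<^sup>+w. ennreal (w powr (\<beta> - 1)) * indicator {0..1} w
      + ennreal (w powr (\<beta> - 1 - ?d)) * indicator {1..} w \<partial>lborel)"
  proof (intro nn_integral_mono)
    fix w :: real
    consider "w \<le> 0" | "0 < w" "w \<le> 1" | "1 < w" by linarith
    then show "ennreal (g w) \<le> ennreal (w powr (\<beta> - 1)) * indicator {0..1} w
      + ennreal (w powr (\<beta> - 1 - ?d)) * indicator {1..} w"
    proof cases
      case 2
      then have "g w \<le> w powr (\<beta> - 1)" by (simp add: g_def mult_left_le)
      then show ?thesis using 2 by (simp add: ennreal_leI add_increasing2)
    next
      case 3
      then have "g w \<le> w powr (\<beta> - 1) * w powr (- ?d)" by (auto simp: g_def intro: mult_left_mono)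
      also have "\<dots> = w powr (\<beta> - 1 - ?d)" by (simp add: powr_add[symmetric])
      finally show ?thesis using 3 by (simp add: ennreal_leI)
    qed (simp add: g_def)
  qed
  also have "\<dots> = (\<integral>\<^sup>+w. ennreal (w powr (\<beta> - 1)) * indicator {0..1} w \<partial>lborel)
    + (\<integral>\<^sup>+w. ennreal (w powr (\<beta> - 1 - ?d)) * indicator {1..} w \<partial>lborel)"
    by (intro nn_integral_add) auto
  also have "\<dots> < top"
    using nn_integral_powr_from_0[of \<beta> 1] nn_integral_powr_inf[of "\<beta> - 1 - ?d" 1] \<beta> by simp
  finally obtain I where I: "(\<integral>\<^sup>+w. ennreal (g w) \<partial>lborel) = ennreal I" "0 \<le> I"
    by (cases "\<integral>\<^sup>+w. ennreal (g w) \<partial>lborel") auto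
  \<comment> \<open>A free shift j \<ge> 0 makes the induction on N work, since a further difference
    splits into the shifts j and j + 1.\<close>
  define F where "F N j T x = ennreal (T powr \<beta>) * (\<integral>\<^sup>+t. ennreal (\<bar>fdiff N (\<beta> - 1) (t - j)\<bar> * heat (T * t) x) \<partial>lborel)"
    for N j T and x :: 'a
  have F_le: "F N j T x \<le> ennreal (2 ^ N * (C * I) * norm x powr (2 * \<beta> - DIM('a)))"
    if T: "0 < T" and j: "0 \<le> j" and x: "x \<noteq> 0" for T j and x :: 'a
    using j
  proof (induction N arbitrary: j)
    case 0
    define R where "R = (norm x)\<^sup>2 / T"
    have R: "0 < R" using T x by (simp add: R_def)
    let ?c = "C * R powr (\<beta> - 1) * norm x powr (- DIM('a))"
    have "(\<integral>\<^sup>+t. ennreal (\<bar>fdiff 0 (\<beta> - 1) (t - j)\<bar> * heat (T * t) x) \<partial>lborel)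
      = ennreal \<bar>R\<bar> * (\<integral>\<^sup>+w. ennreal (\<bar>fdiff 0 (\<beta> - 1) ((j + R * w) - j)\<bar> * heat (T * (j + R * w)) x) \<partial>lborel)"
      using R by (intro nn_integral_real_affine) (auto simp: heat_def)
    also have "\<dots> \<le> ennreal R * (\<integral>\<^sup>+w. ennreal ?c * ennreal (g w) \<partial>lborel)"
    proof (intro mult_mono nn_integral_mono)
      fix w :: real
      show "ennreal (\<bar>fdiff 0 (\<beta> - 1) ((j + R * w) - j)\<bar> * heat (T * (j + R * w)) x) \<le> ennreal ?c * ennreal (g w)"
      proof (cases "0 < w")
        case True
        have pos: "0 < R * w" "0 < T * (R * w)" using True R T by auto
        have "heat (T * (j + R * w)) x \<le> C * min (norm x powr (- DIM('a))) ((T * (j + R * w)) powr (- ?d))"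
          using pos T 0 x by (intro heat_min) (auto intro: mult_pos_pos add_nonneg_pos)
        \<comment> \<open>The shift only makes the time later, and t^(-d/2) decreases.\<close>
        also have "\<dots> \<le> C * min (norm x powr (- DIM('a))) ((T * (R * w)) powr (- ?d))"
          using C pos T 0 x by (intro mult_left_mono min.mono powr_mono2') auto
        also have "(T * (R * w)) powr (- ?d) = norm x powr (- DIM('a)) * w powr (- ?d)"
        proof -
          have "(T * (R * w)) powr (- ?d) = ((norm x)\<^sup>2 * w) powr (- ?d)" using T by (simp add: R_def)
          also have "\<dots> = ((norm x)\<^sup>2) powr (- ?d) * w powr (- ?d)" by (rule powr_mult)
          also have "((norm x)\<^sup>2) powr (- ?d) = norm x powr (- DIM('a))"
            using x by (simp add: powr_powr flip: powr_numeral)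
          finally show ?thesis .
        qed
        also have "min (norm x powr (- DIM('a))) (norm x powr (- DIM('a)) * w powr (- ?d))
          = norm x powr (- DIM('a)) * min 1 (w powr (- ?d))"
          by (simp add: min_mult_distrib_left)
        finally have "(R * w) powr (\<beta> - 1) * heat (T * (j + R * w)) x
          \<le> (R * w) powr (\<beta> - 1) * (C * (norm x powr (- DIM('a)) * min 1 (w powr (- ?d))))"
          by (intro mult_left_mono) auto
        also have "\<dots> = ?c * g w"
          using True R by (simp add: g_def powr_mult)
        finally have "ennreal ((R * w) powr (\<beta> - 1) * heat (T * (j + R * w)) x) \<le> ennreal (?c * g w)"
          by (rule ennreal_leI)
        then show ?thesis using pos C g0[of w] by (simp add: ennreal_mult)
      next
        case False
        then have "R * w \<le> 0" using R by (simp add: mult_le_0_iff)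
        then show ?thesis by simp
      qed
    qed (use R in auto)
    also have "\<dots> = ennreal R * (ennreal ?c * ennreal I)"
      by (subst nn_integral_cmult) (simp_all add: I)
    finally have "F 0 j T x \<le> ennreal (T powr \<beta>) * (ennreal R * (ennreal ?c * ennreal I))"
      unfolding F_def by (intro mult_left_mono) auto
    also have "\<dots> = ennreal (T powr \<beta> * (R * (?c * I)))"
      using C I(2) R by (simp add: ennreal_mult)
    also have "T powr \<beta> * (R * (?c * I)) = (C * I) * (T powr \<beta> * (R * R powr (\<beta> - 1)) * norm x powr (- DIM('a)))"
      by (simp only: ac_simps)
    also have "R * R powr (\<beta> - 1) = R powr \<beta>" using R by (simp add: powr_diff)
    also have "T powr \<beta> * R powr \<beta> = (T * R) powr \<beta>" using T R by (simp add: powr_mult)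
    also have "(T * R) powr \<beta> = norm x powr (2 * \<beta>)"
      using T x by (simp add: R_def powr_powr flip: powr_numeral)
    also have "norm x powr (2 * \<beta>) * norm x powr (- DIM('a)) = norm x powr (2 * \<beta> - DIM('a))"
      by (simp add: powr_add[symmetric])
    finally show ?case by simp
  next
    case (Suc N)
    let ?B = "2 ^ N * (C * I) * norm x powr (2 * \<beta> - DIM('a))"
    have "F (Suc N) j T x \<le> F N j T x + F N (j + 1) T x"
    proof -
      have "(\<integral>\<^sup>+t. ennreal (\<bar>fdiff (Suc N) (\<beta> - 1) (t - j)\<bar> * heat (T * t) x) \<partial>lborel)
        \<le> (\<integral>\<^sup>+t. ennreal (\<bar>fdiff N (\<beta> - 1) (t - j)\<bar> * heat (T * t) x) + ennreal (\<bar>fdiff N (\<beta> - 1) (t - (j + 1))\<bar> * heat (T * t) x) \<partial>lborel)"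
      proof (intro nn_integral_mono)
        fix t
        have "\<bar>fdiff (Suc N) (\<beta> - 1) (t - j)\<bar> * heat (T * t) x
          \<le> (\<bar>fdiff N (\<beta> - 1) (t - j)\<bar> + \<bar>fdiff N (\<beta> - 1) (t - (j + 1))\<bar>) * heat (T * t) x"
          by (intro mult_right_mono heat_nonneg) (auto simp: diff_diff_eq)
        then have "ennreal (\<bar>fdiff (Suc N) (\<beta> - 1) (t - j)\<bar> * heat (T * t) x)
          \<le> ennreal (\<bar>fdiff N (\<beta> - 1) (t - j)\<bar> * heat (T * t) x + \<bar>fdiff N (\<beta> - 1) (t - (j + 1))\<bar> * heat (T * t) x)"
          unfolding distrib_right by (rule ennreal_leI)
        also have "\<dots> = ennreal (\<bar>fdiff N (\<beta> - 1) (t - j)\<bar> * heat (T * t) x) + ennreal (\<bar>fdiff N (\<beta> - 1) (t - (j + 1))\<bar> * heat (T * t) x)"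
          by (intro ennreal_plus mult_nonneg_nonneg heat_nonneg) auto
        finally show "ennreal (\<bar>fdiff (Suc N) (\<beta> - 1) (t - j)\<bar> * heat (T * t) x)
          \<le> ennreal (\<bar>fdiff N (\<beta> - 1) (t - j)\<bar> * heat (T * t) x) + ennreal (\<bar>fdiff N (\<beta> - 1) (t - (j + 1))\<bar> * heat (T * t) x)" .
      qed
      also have "\<dots> = (\<integral>\<^sup>+t. ennreal (\<bar>fdiff N (\<beta> - 1) (t - j)\<bar> * heat (T * t) x) \<partial>lborel)
         + (\<integral>\<^sup>+t. ennreal (\<bar>fdiff N (\<beta> - 1) (t - (j + 1))\<bar> * heat (T * t) x) \<partial>lborel)"
        by (intro nn_integral_add) (auto simp: heat_def)
      finally show ?thesis unfolding F_def distrib_left[symmetric] by (intro mult_left_mono) auto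
    qed
    also have "\<dots> \<le> ennreal ?B + ennreal ?B"
      using Suc.prems by (intro add_mono Suc.IH) auto
    also have "\<dots> = ennreal (2 ^ Suc N * (C * I) * norm x powr (2 * \<beta> - DIM('a)))"
      using C I(2) by (simp add: ennreal_plus[symmetric] del: ennreal_plus)
    finally show ?case .
  qed
  then have "diff_kernel N \<beta> T x \<le> ennreal (2 ^ N * (C * I) * norm x powr (2 * \<beta> - DIM('a)))"
    if "0 < T" "x \<noteq> 0" for T and x :: 'a
    using F_le[OF that(1) order_refl that(2)] by (simp add: F_def diff_kernel_def)
  then show ?thesis using C I(2) by (intro exI[of _ "2 ^ N * (C * I)"]) auto
qed

section \<open>Fourier transform of the heat kernel and inversion\<close>

definition wave :: "'a::euclidean_space \<Rightarrow> 'a \<Rightarrow> complex" where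
  "wave \<xi> x = exp (2 * of_real pi * \<i> * of_real (x \<bullet> \<xi>))"

lemma wave_eq_cis: "wave \<xi> x = cis (2 * pi * (x \<bullet> \<xi>))"
  by (simp add: wave_def cis_conv_exp mult_ac)

lemma norm_wave [simp]: "norm (wave \<xi> x) = 1"
  by (simp add: wave_eq_cis)

lemma wave_add: "wave \<xi> (x + y) = wave \<xi> x * wave \<xi> y"
  by (simp add: wave_eq_cis cis_mult inner_add_left distrib_left)

lemma wave_diff: "wave \<xi> (x - y) = wave \<xi> x * wave \<xi> (- y)"
  using wave_add[of \<xi> x "- y"] by simp

lemma wave_minus: "wave \<xi> (- x) = wave (- \<xi>) x"
  by (simp add: wave_def)

lemma measurable_wave [measurable]:
  assumes [measurable]: "f \<in> borel_measurable M" "g \<in> borel_measurable M"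
  shows "(\<lambda>z. wave (f z) (g z)) \<in> borel_measurable M"
  unfolding wave_def by measurable

lemma integral_affine:
  fixes f :: "'a::euclidean_space \<Rightarrow> 'b::{banach, second_countable_topology}"
  assumes c: "c \<noteq> 0" and [measurable]: "f \<in> borel_measurable borel"
  shows "integral\<^sup>L lborel f = \<bar>c\<bar> ^ DIM('a) *\<^sub>R integral\<^sup>L lborel (\<lambda>u. f (x + c *\<^sub>R u))"
proof -
  have "integral\<^sup>L lborel f = integral\<^sup>L (density (distr lborel borel (\<lambda>u. x + c *\<^sub>R u)) (\<lambda>_. ennreal (\<bar>c\<bar> ^ DIM('a)))) f"
    using lborel_affine[OF c, of x] by simp
  also have "\<dots> = integral\<^sup>L (distr lborel borel (\<lambda>u. x + c *\<^sub>R u)) (\<lambda>u. \<bar>c\<bar> ^ DIM('a) *\<^sub>R f u)"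
    by (rule integral_density) auto
  also have "\<dots> = integral\<^sup>L lborel (\<lambda>u. \<bar>c\<bar> ^ DIM('a) *\<^sub>R f (x + c *\<^sub>R u))"
    by (rule integral_distr) auto
  finally show ?thesis by simp
qed

text \<open>\<open>lborel\<close> is the image of the product of one-dimensional Lebesgue measures
  under the coordinates.\<close>

lemma has_bochner_integral_lborel_prod:
  fixes f :: "'a::euclidean_space \<Rightarrow> real \<Rightarrow> complex"
  assumes f: "\<And>b. b \<in> Basis \<Longrightarrow> integrable lborel (f b)"
  shows "has_bochner_integral lborel (\<lambda>x. \<Prod>b\<in>Basis. f b (x \<bullet> b)) (\<Prod>b\<in>Basis. integral\<^sup>L lborel (f b))"
proof -
  interpret product_sigma_finite "\<lambda>_::'a. lborel :: real measure" ..
  define F where "F x = (\<Prod>b\<in>Basis. f b (x \<bullet> b))" for x :: 'a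
  have [measurable]: "f b \<in> borel_measurable borel" if "b \<in> Basis" for b
    using borel_measurable_integrable[OF f[OF that]] by simp
  have [measurable]: "F \<in> borel_measurable borel"
    unfolding F_def by (intro borel_measurable_prod) measurable
  have eq: "F (\<Sum>b\<in>Basis. g b *\<^sub>R b) = (\<Prod>b\<in>Basis. f b (g b))" for g
    by (simp add: F_def inner_sum_left inner_Basis if_distrib cong: if_cong)
  have "integrable (\<Pi>\<^sub>M b\<in>Basis. lborel) (\<lambda>g. F (\<Sum>b\<in>Basis. g b *\<^sub>R b))"
    unfolding eq by (intro product_integrable_prod f) auto
  then have "integrable lborel F"
    by (subst lborel_eq) (auto simp: integrable_distr_eq)
  moreover have "integral\<^sup>L lborel F = (\<Prod>b\<in>Basis. integral\<^sup>L lborel (f b))"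
    by (subst lborel_eq, subst integral_distr) (auto simp: eq product_integral_prod f)
  ultimately show ?thesis unfolding F_def by (simp add: has_bochner_integral_iff)
qed

lemma heat_real_eq_std_normal:
  fixes u :: real
  assumes t: "0 < t"
  shows "heat t u = std_normal_density (u / sqrt (2 * t)) / sqrt (2 * t)"
proof -
  have "(4 * pi * t) powr (- 1 / 2) = 1 / sqrt (4 * pi * t)"
    using t powr_minus_divide[of "4 * pi * t" "1 / 2"] by (simp add: powr_half_sqrt)
  also have "sqrt (4 * pi * t) = sqrt (2 * pi) * sqrt (2 * t)"
    by (simp add: real_sqrt_mult[symmetric])
  finally have "(4 * pi * t) powr (- 1 / 2) = 1 / (sqrt (2 * pi) * sqrt (2 * t))" .
  moreover have "- u\<^sup>2 / (4 * t) = - ((u / sqrt (2 * t))\<^sup>2) / 2"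
    using t by (simp add: power_divide)
  ultimately show ?thesis by (simp add: heat_def std_normal_density_def)
qed

text \<open>Read off from the characteristic function of the standard normal distribution, rescaled
  by \<sigma> = sqrt (2 t).\<close>

lemma heat_real_Fourier:
  fixes b :: real
  assumes t: "0 < t"
  shows "has_bochner_integral lborel (\<lambda>u. of_real (heat t u) * iexp (b * u)) (of_real (exp (- (t * b\<^sup>2))))"
proof -
  define \<sigma> where "\<sigma> = sqrt (2 * t)"
  have \<sigma>: "0 < \<sigma>" "\<sigma>\<^sup>2 = 2 * t" using t by (auto simp: \<sigma>_def)
  let ?f = "\<lambda>x. std_normal_density x *\<^sub>R iexp (b * \<sigma> * x)"
  have "integrable std_normal_distribution (\<lambda>x. iexp (b * \<sigma> * x))"
  proof -
    interpret prob_space std_normal_distribution by (rule prob_space_normal_density) simp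
    show ?thesis by (intro integrable_const_bound[of _ 1]) auto
  qed
  then have "integrable lborel ?f"
    by (subst (asm) integrable_density) auto
  moreover have "integral\<^sup>L lborel ?f = char std_normal_distribution (b * \<sigma>)"
    unfolding char_def by (subst integral_density) auto
  ultimately have "has_bochner_integral lborel ?f (of_real (exp (- (b * \<sigma>)\<^sup>2 / 2)))"
    by (simp add: has_bochner_integral_iff char_std_normal_distribution)
  then have "has_bochner_integral lborel (\<lambda>u. ?f (0 + (1 / \<sigma>) * u)) (of_real (exp (- (b * \<sigma>)\<^sup>2 / 2)) /\<^sub>R \<bar>1 / \<sigma>\<bar>)"
    using \<sigma> by (subst lborel_has_bochner_integral_real_affine_iff[symmetric]) auto
  then have "has_bochner_integral lborel (\<lambda>u. of_real (1 / \<sigma>) * ?f (0 + (1 / \<sigma>) * u))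
    (of_real (1 / \<sigma>) * (of_real (exp (- (b * \<sigma>)\<^sup>2 / 2)) /\<^sub>R \<bar>1 / \<sigma>\<bar>))"
    by (rule has_bochner_integral_mult_right)
  moreover have "of_real (1 / \<sigma>) * ?f (0 + (1 / \<sigma>) * u) = of_real (heat t u) * iexp (b * u)" for u
    using \<sigma> by (simp add: heat_real_eq_std_normal[OF t] \<sigma>_def[symmetric] scaleR_conv_of_real)
  moreover have "of_real (1 / \<sigma>) * (of_real (exp (- (b * \<sigma>)\<^sup>2 / 2)) /\<^sub>R \<bar>1 / \<sigma>\<bar>) = complex_of_real (exp (- (t * b\<^sup>2)))"
    using \<sigma> by (simp add: scaleR_conv_of_real power_mult_distrib mult.commute)
  ultimately show ?thesis by simp
qed

lemma norm_sq_eq_sum: "(norm x)\<^sup>2 = (\<Sum>b\<in>Basis. (x \<bullet> b)\<^sup>2)"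
  unfolding power2_norm_eq_inner euclidean_inner[of x x] by (simp add: power2_eq_square)

lemma heat_eq_prod:
  fixes x :: "'a::euclidean_space"
  assumes t: "0 < t"
  shows "heat t x = (\<Prod>b\<in>Basis. heat t (x \<bullet> b))"
proof -
  have "(\<Prod>b\<in>(Basis::'a set). (4 * pi * t) powr (- 1 / 2)) = (4 * pi * t) powr (- real DIM('a) / 2)"
    using t by (simp add: powr_power)
  moreover have "(\<Prod>b\<in>Basis. exp (- (x \<bullet> b)\<^sup>2 / (4 * t))) = exp (- (norm x)\<^sup>2 / (4 * t))"
  proof -
    have "(\<Sum>b\<in>Basis. - (x \<bullet> b)\<^sup>2 / (4 * t)) = - (norm x)\<^sup>2 / (4 * t)"
      by (simp add: norm_sq_eq_sum[of x] sum_divide_distrib sum_negf)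
    moreover have "(\<Prod>b\<in>Basis. exp (- (x \<bullet> b)\<^sup>2 / (4 * t))) = exp (\<Sum>b\<in>Basis. - (x \<bullet> b)\<^sup>2 / (4 * t))"
      by (rule exp_sum[symmetric]) simp
    ultimately show ?thesis by (simp only:)
  qed
  ultimately show ?thesis by (simp add: heat_def prod.distrib)
qed

lemma heat_Fourier:
  fixes \<xi> :: "'a::euclidean_space"
  assumes t: "0 < t"
  shows "has_bochner_integral lborel (\<lambda>x. of_real (heat t x) * wave \<xi> x) (of_real (exp (- (t * (2 * pi * norm \<xi>)\<^sup>2))))"
proof -
  let ?f = "\<lambda>b u. of_real (heat t u) * iexp (2 * pi * (\<xi> \<bullet> b) * u)"
  have "has_bochner_integral lborel (\<lambda>x::'a. \<Prod>b\<in>Basis. ?f b (x \<bullet> b)) (\<Prod>b\<in>(Basis::'a set). integral\<^sup>L lborel (?f b))"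
  proof (rule has_bochner_integral_lborel_prod)
    fix b :: 'a
    show "integrable lborel (?f b)"
      using heat_real_Fourier[OF t, of "2 * pi * (\<xi> \<bullet> b)"] by (simp only: has_bochner_integral_iff)
  qed
  moreover have "(\<Prod>b\<in>Basis. ?f b (x \<bullet> b)) = of_real (heat t x) * wave \<xi> x" for x
  proof -
    have "(\<Prod>b\<in>Basis. iexp (2 * pi * (\<xi> \<bullet> b) * (x \<bullet> b))) = wave \<xi> x"
    proof -
      have "(\<Prod>b\<in>Basis. iexp (2 * pi * (\<xi> \<bullet> b) * (x \<bullet> b))) = exp (\<Sum>b\<in>Basis. \<i> * complex_of_real (2 * pi * (\<xi> \<bullet> b) * (x \<bullet> b)))"
        by (rule exp_sum[symmetric]) simp
      also have "(\<Sum>b\<in>Basis. \<i> * complex_of_real (2 * pi * (\<xi> \<bullet> b) * (x \<bullet> b)))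
        = \<i> * complex_of_real (\<Sum>b\<in>Basis. 2 * pi * (\<xi> \<bullet> b) * (x \<bullet> b))"
        by (simp only: sum_distrib_left of_real_sum)
      also have "(\<Sum>b\<in>Basis. 2 * pi * (\<xi> \<bullet> b) * (x \<bullet> b)) = 2 * pi * (x \<bullet> \<xi>)"
        unfolding euclidean_inner[of x \<xi>] sum_distrib_left by (intro sum.cong refl) (simp only: ac_simps)
      finally show ?thesis by (simp add: wave_def mult_ac)
    qed
    then show ?thesis by (simp add: prod.distrib heat_eq_prod[OF t, of x])
  qed
  moreover have "(\<Prod>b\<in>Basis. integral\<^sup>L lborel (?f b)) = complex_of_real (exp (- (t * (2 * pi * norm \<xi>)\<^sup>2)))"
  proof -
    have "integral\<^sup>L lborel (?f b) = of_real (exp (- (t * (2 * pi * (\<xi> \<bullet> b))\<^sup>2)))" for b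
      using heat_real_Fourier[OF t, of "2 * pi * (\<xi> \<bullet> b)"] by (simp add: has_bochner_integral_iff)
    then have "(\<Prod>b\<in>Basis. integral\<^sup>L lborel (?f b)) = of_real (\<Prod>b\<in>Basis. exp (- (t * (2 * pi * (\<xi> \<bullet> b))\<^sup>2)))"
      by simp
    also have "(\<Prod>b\<in>Basis. exp (- (t * (2 * pi * (\<xi> \<bullet> b))\<^sup>2))) = exp (- (t * (2 * pi * norm \<xi>)\<^sup>2))"
    proof -
      have "(2 * pi * norm \<xi>)\<^sup>2 = (\<Sum>b\<in>Basis. (2 * pi * (\<xi> \<bullet> b))\<^sup>2)"
        by (simp only: power_mult_distrib norm_sq_eq_sum[of \<xi>] sum_distrib_left)
      then have "(\<Sum>b\<in>Basis. - (t * (2 * pi * (\<xi> \<bullet> b))\<^sup>2)) = - (t * (2 * pi * norm \<xi>)\<^sup>2)"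
        by (simp only: sum_distrib_left sum_negf)
      moreover have "(\<Prod>b\<in>Basis. exp (- (t * (2 * pi * (\<xi> \<bullet> b))\<^sup>2))) = exp (\<Sum>b\<in>Basis. - (t * (2 * pi * (\<xi> \<bullet> b))\<^sup>2))"
        by (rule exp_sum[symmetric]) simp
      ultimately show ?thesis by (simp only:)
    qed
    finally show ?thesis .
  qed
  ultimately show ?thesis by (simp only:)
qed

lemma heat_minus [simp]: "heat t (- x) = heat t x"
  by (simp add: heat_def)

lemma heat_integral:
  assumes t: "0 < t"
  shows "integrable lborel (heat t :: 'a::euclidean_space \<Rightarrow> real)" "(\<integral>x. heat t (x::'a) \<partial>lborel) = 1"
proof -
  have "has_bochner_integral lborel (\<lambda>x::'a. complex_of_real (heat t x)) 1"
    using heat_Fourier[OF t, of "0::'a"] by (simp add: wave_def)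
  then have "has_bochner_integral lborel (\<lambda>x::'a. Re (complex_of_real (heat t x))) (Re 1)"
    by (rule has_bochner_integral_Re)
  then show "integrable lborel (heat t :: 'a \<Rightarrow> real)" "(\<integral>x. heat t (x::'a) \<partial>lborel) = 1"
    by (simp_all add: has_bochner_integral_iff)
qed

lemma integral_reflect:
  fixes f :: "'a::euclidean_space \<Rightarrow> 'b::{banach, second_countable_topology}"
  assumes [measurable]: "f \<in> borel_measurable borel"
  shows "(\<integral>y. f (x - y) \<partial>lborel) = (\<integral>y. f y \<partial>lborel)"
  using integral_affine[of "-1" f x] by simp

lemma heat_reflect_integrable:
  assumes t: "0 < t"
  shows "integrable lborel (\<lambda>y. heat t (x - y :: 'a::euclidean_space))"
proof (rule integrableI_nonneg)
  have "(\<integral>\<^sup>+y. ennreal (heat t (x - y)) \<partial>lborel) = (\<integral>\<^sup>+y. ennreal (heat t y) \<partial>density (distr lborel borel (\<lambda>u. x + (- 1) *\<^sub>R u)) (\<lambda>_. 1))"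
    by (subst nn_integral_density) (auto simp: nn_integral_distr)
  also have "\<dots> = (\<integral>\<^sup>+y. ennreal (heat t (y::'a)) \<partial>lborel)"
    using lborel_affine[of "-1" x] by simp
  also have "\<dots> < \<infinity>"
    using heat_integral(1)[OF t, where 'a='a] by (simp add: integrable_iff_bounded heat_nonneg)
  finally show "(\<integral>\<^sup>+y. ennreal (heat t (x - y)) \<partial>lborel) < \<infinity>" .
qed (auto simp: heat_nonneg)

text \<open>A character turns translation into a factor, so the convolution reduces to the transform
  of \<open>heat t\<close> at -\<xi>.\<close>

lemma heat_convolve_wave:
  fixes x \<xi> :: "'a::euclidean_space"
  assumes t: "0 < t"
  shows "(\<integral>y. of_real (heat t (x - y)) * wave \<xi> y \<partial>lborel) = of_real (exp (- (t * (2 * pi * norm \<xi>)\<^sup>2))) * wave \<xi> x"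
proof -
  have "(\<integral>y. of_real (heat t (x - y)) * wave \<xi> y \<partial>lborel)
    = (\<integral>y. (\<lambda>u. of_real (heat t u) * (wave \<xi> x * wave (- \<xi>) u)) (x - y) \<partial>lborel)"
  proof (intro Bochner_Integration.integral_cong refl)
    fix y
    have "wave \<xi> x * wave (- \<xi>) (x - y) = wave \<xi> y"
      using wave_add[of \<xi> x "y - x"] wave_minus[of \<xi> "x - y"] by simp
    then show "of_real (heat t (x - y)) * wave \<xi> y = (\<lambda>u. of_real (heat t u) * (wave \<xi> x * wave (- \<xi>) u)) (x - y)"
      by simp
  qed
  also have "\<dots> = (\<integral>u. of_real (heat t u) * (wave \<xi> x * wave (- \<xi>) u) \<partial>lborel)"
    by (rule integral_reflect) simp
  also have "\<dots> = (\<integral>u. wave \<xi> x * (of_real (heat t u) * wave (- \<xi>) u) \<partial>lborel)"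
    by (simp add: mult.left_commute)
  also have "\<dots> = wave \<xi> x * (\<integral>u. of_real (heat t u) * wave (- \<xi>) u \<partial>lborel)"
    by (rule integral_mult_right_zero)
  also have "(\<integral>u. of_real (heat t u) * wave (- \<xi>) u \<partial>lborel) = of_real (exp (- (t * (2 * pi * norm \<xi>)\<^sup>2)))"
    using heat_Fourier[OF t, of "- \<xi>"] by (simp add: has_bochner_integral_iff)
  finally show ?thesis by (simp add: mult.commute)
qed

text \<open>The Fubini criterion for every exchange of Bochner integrals below: a majorant that is a
  product of integrable functions of one variable each.\<close>

lemma integrable_pair_product:
  fixes u :: "'a::euclidean_space \<Rightarrow> complex" and g :: "'b::euclidean_space \<Rightarrow> complex"
    and h :: "'a \<Rightarrow> 'b \<Rightarrow> complex"
  assumes u: "integrable lborel u" and g: "integrable lborel g"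
    and [measurable]: "case_prod h \<in> borel_measurable (lborel \<Otimes>\<^sub>M lborel)"
    and h: "\<And>x y. norm (h x y) \<le> norm (u x) * norm (g y)"
  shows "integrable (lborel \<Otimes>\<^sub>M lborel) (case_prod h)"
proof (rule integrableI_bounded)
  have [measurable]: "u \<in> borel_measurable borel" "g \<in> borel_measurable borel"
    using u g by (auto dest: borel_measurable_integrable)
  have "(\<integral>\<^sup>+z. ennreal (norm (case_prod h z)) \<partial>(lborel \<Otimes>\<^sub>M lborel))
    \<le> (\<integral>\<^sup>+z. ennreal (norm (u (fst z))) * ennreal (norm (g (snd z))) \<partial>(lborel \<Otimes>\<^sub>M lborel))"
    using h by (intro nn_integral_mono) (auto simp: ennreal_mult[symmetric] intro!: ennreal_leI)
  also have "\<dots> = (\<integral>\<^sup>+x. \<integral>\<^sup>+y. ennreal (norm (u x)) * ennreal (norm (g y)) \<partial>lborel \<partial>lborel)"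
    by (subst lborel.nn_integral_fst[symmetric]) auto
  also have "\<dots> = (\<integral>\<^sup>+x. ennreal (norm (u x)) \<partial>lborel) * (\<integral>\<^sup>+y. ennreal (norm (g y)) \<partial>lborel)"
    by (simp add: nn_integral_cmult nn_integral_multc)
  also have "\<dots> < \<infinity>"
    using u g by (simp add: integrable_iff_bounded ennreal_mult_less_top)
  finally show "(\<integral>\<^sup>+z. ennreal (norm (case_prod h z)) \<partial>(lborel \<Otimes>\<^sub>M lborel)) < \<infinity>" .
qed simp

text \<open>Stated for an inverse transform of an integrable g, which is the form in which the
  fractional Laplacian of a test function comes.\<close>

lemma heat_convolve_inverse_transform:
  fixes g :: "'a::euclidean_space \<Rightarrow> complex"
  assumes t: "0 < t" and g: "integrable lborel g"
  shows "(\<integral>y. of_real (heat t (x - y)) * (\<integral>\<xi>. g \<xi> * wave \<xi> y \<partial>lborel) \<partial>lborel)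
    = (\<integral>\<xi>. g \<xi> * of_real (exp (- (t * (2 * pi * norm \<xi>)\<^sup>2))) * wave \<xi> x \<partial>lborel)"
proof -
  have [measurable]: "g \<in> borel_measurable borel" using g by (auto dest: borel_measurable_integrable)
  let ?h = "\<lambda>y \<xi>. of_real (heat t (x - y)) * (g \<xi> * wave \<xi> y)"
  have "integrable (lborel \<Otimes>\<^sub>M lborel) (case_prod ?h)"
    using heat_reflect_integrable[OF t, of x]
    by (intro integrable_pair_product[OF _ g, of "\<lambda>y. of_real (heat t (x - y))"])
       (auto simp: norm_mult)
  then have "(\<integral>\<xi>. (\<integral>y. ?h y \<xi> \<partial>lborel) \<partial>lborel) = (\<integral>y. (\<integral>\<xi>. ?h y \<xi> \<partial>lborel) \<partial>lborel)"
    by (rule lborel_pair.Fubini_integral)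
  moreover have "(\<integral>y. ?h y \<xi> \<partial>lborel) = g \<xi> * of_real (exp (- (t * (2 * pi * norm \<xi>)\<^sup>2))) * wave \<xi> x" for \<xi>
  proof -
    have "(\<integral>y. ?h y \<xi> \<partial>lborel) = (\<integral>y. g \<xi> * (of_real (heat t (x - y)) * wave \<xi> y) \<partial>lborel)"
      by (simp add: mult.left_commute)
    also have "\<dots> = g \<xi> * (\<integral>y. of_real (heat t (x - y)) * wave \<xi> y \<partial>lborel)"
      by (rule integral_mult_right_zero)
    finally show ?thesis by (simp add: heat_convolve_wave[OF t] mult.assoc)
  qed
  ultimately show ?thesis by (simp add: integral_mult_right_zero)
qed

text \<open>The Gaussian \<open>e\<^bsup>-ts\<^esup>\<close>, \<open>s = (2\<pi>\<bar>\<xi>\<bar>)\<^sup>2\<close>, is itself a multiple of a heat kernel, at time \<open>1/(16\<pi>\<^sup>2t)\<close>.\<close>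

lemma Gaussian_inverse_transform:
  fixes z :: "'a::euclidean_space"
  assumes t: "0 < t"
  shows "has_bochner_integral lborel (\<lambda>\<xi>. of_real (exp (- (t * (2 * pi * norm \<xi>)\<^sup>2))) * wave \<xi> z) (of_real (heat t z))"
proof -
  define r where "r = 1 / (16 * pi\<^sup>2 * t)"
  define k where "k = (4 * pi * t) powr (- real DIM('a) / 2)"
  have r: "0 < r" using t by (simp add: r_def)
  have eq: "exp (- (t * (2 * pi * norm \<xi>)\<^sup>2)) = k * heat r \<xi>" for \<xi> :: 'a
  proof -
    have "4 * pi * r = inverse (4 * pi * t)" using t by (simp add: r_def field_simps power2_eq_square)
    then have "k * (4 * pi * r) powr (- real DIM('a) / 2) = (4 * pi * t * inverse (4 * pi * t)) powr (- real DIM('a) / 2)"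
      unfolding k_def by (simp only: powr_mult)
    also have "\<dots> = 1" using t by (simp only: right_inverse mult_eq_0_iff zero_neq_numeral pi_neq_zero less_imp_neq[OF t, symmetric] powr_one_eq_one simp_thms not_False_eq_True)
    finally have "k * (4 * pi * r) powr (- real DIM('a) / 2) = 1" .
    moreover have "- (norm \<xi>)\<^sup>2 / (4 * r) = - (t * (2 * pi * norm \<xi>)\<^sup>2)"
      using t by (simp add: r_def power_mult_distrib)
    ultimately show ?thesis by (simp add: heat_def mult.assoc[symmetric])
  qed
  have "has_bochner_integral lborel (\<lambda>\<xi>. of_real k * (of_real (heat r \<xi>) * wave z \<xi>)) (of_real k * of_real (exp (- (r * (2 * pi * norm z)\<^sup>2))))"
    by (intro has_bochner_integral_mult_right heat_Fourier r)
  moreover have "k * exp (- (r * (2 * pi * norm z)\<^sup>2)) = heat t z"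
    using t by (simp add: heat_def k_def r_def power_mult_distrib)
  then have "of_real k * of_real (exp (- (r * (2 * pi * norm z)\<^sup>2))) = complex_of_real (heat t z)"
    by (metis of_real_mult)
  moreover have "wave z \<xi> = wave \<xi> z" for \<xi> by (simp add: wave_def inner_commute)
  ultimately show ?thesis unfolding eq of_real_mult by (simp only: mult.assoc)
qed

text \<open>The Gaussian makes the double integral absolutely convergent whether or not the
  transform of \<phi> is integrable; inversion is then obtained by letting t tend to 0.\<close>

lemma heat_convolve_eq_transform:
  fixes \<phi> :: "'a::euclidean_space \<Rightarrow> complex"
  assumes t: "0 < t" and \<phi>: "integrable lborel \<phi>"
  shows "(\<integral>y. of_real (heat t (x - y)) * \<phi> y \<partial>lborel)
    = (\<integral>\<xi>. (\<integral>y. \<phi> y * wave (- \<xi>) y \<partial>lborel) * of_real (exp (- (t * (2 * pi * norm \<xi>)\<^sup>2))) * wave \<xi> x \<partial>lborel)"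
proof -
  have [measurable]: "\<phi> \<in> borel_measurable borel" using \<phi> by (auto dest: borel_measurable_integrable)
  let ?G = "\<lambda>\<xi>::'a. complex_of_real (exp (- (t * (2 * pi * norm \<xi>)\<^sup>2)))"
  let ?h = "\<lambda>y \<xi>. \<phi> y * (?G \<xi> * wave \<xi> (x - y))"
  have G: "integrable lborel ?G"
    using Gaussian_inverse_transform[OF t, of "0::'a"] by (simp add: wave_def has_bochner_integral_iff)
  have "integrable (lborel \<Otimes>\<^sub>M lborel) (case_prod ?h)"
    by (intro integrable_pair_product[OF \<phi> G]) (auto simp: norm_mult)
  then have "(\<integral>\<xi>. (\<integral>y. ?h y \<xi> \<partial>lborel) \<partial>lborel) = (\<integral>y. (\<integral>\<xi>. ?h y \<xi> \<partial>lborel) \<partial>lborel)"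
    by (rule lborel_pair.Fubini_integral)
  moreover have "(\<integral>\<xi>. ?h y \<xi> \<partial>lborel) = of_real (heat t (x - y)) * \<phi> y" for y
  proof -
    have "(\<integral>\<xi>. ?h y \<xi> \<partial>lborel) = \<phi> y * (\<integral>\<xi>. ?G \<xi> * wave \<xi> (x - y) \<partial>lborel)"
      by (rule integral_mult_right_zero)
    also have "(\<integral>\<xi>. ?G \<xi> * wave \<xi> (x - y) \<partial>lborel) = of_real (heat t (x - y))"
      using Gaussian_inverse_transform[OF t, of "x - y"] by (simp only: has_bochner_integral_iff)
    finally show ?thesis by (simp only: mult.commute)
  qed
  moreover have "(\<integral>y. ?h y \<xi> \<partial>lborel) = (\<integral>y. \<phi> y * wave (- \<xi>) y \<partial>lborel) * ?G \<xi> * wave \<xi> x" for \<xi>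
  proof -
    have "(\<integral>y. ?h y \<xi> \<partial>lborel) = (\<integral>y. (\<phi> y * wave (- \<xi>) y) * (?G \<xi> * wave \<xi> x) \<partial>lborel)"
      by (intro Bochner_Integration.integral_cong refl) (simp add: wave_diff wave_minus ac_simps)
    also have "\<dots> = (\<integral>y. \<phi> y * wave (- \<xi>) y \<partial>lborel) * (?G \<xi> * wave \<xi> x)"
      by (rule integral_mult_left_zero)
    finally show ?thesis by (simp only: mult.assoc)
  qed
  ultimately show ?thesis by (simp only:)
qed

section \<open>Gaussian regularisation and Fourier inversion\<close>

lemma heat_rescale:
  fixes w :: "'a::euclidean_space"
  assumes t: "0 < t" shows "sqrt t ^ DIM('a) * heat t (sqrt t *\<^sub>R w) = heat 1 w"
proof -
  have "sqrt t ^ DIM('a) = t powr (real DIM('a) / 2)"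
    using t by (simp add: powr_half_sqrt[symmetric] powr_power mult.commute)
  then have "sqrt t ^ DIM('a) * t powr (- real DIM('a) / 2) = 1"
    using t by (simp add: powr_add[symmetric])
  moreover have "(4 * pi * t) powr (- real DIM('a) / 2) = (4 * pi) powr (- real DIM('a) / 2) * t powr (- real DIM('a) / 2)"
    by (rule powr_mult)
  moreover have "- (norm (sqrt t *\<^sub>R w))\<^sup>2 / (4 * t) = - (norm w)\<^sup>2 / (4 * 1)"
  proof -
    have "(norm (sqrt t *\<^sub>R w))\<^sup>2 = t * (norm w)\<^sup>2" using t by (simp add: power_mult_distrib)
    then show ?thesis using t by simp
  qed
  moreover have "a * (b * c * e) = (a * c) * (b * e)" for a b c e :: real by (simp only: ac_simps)
  ultimately show ?thesis unfolding heat_def by (simp only: mult_1_left mult_1_right)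
qed

text \<open>The substitution y = x - sqrt t w puts all the dependence on t into the argument of
  \<phi>, and boundedness of \<phi> provides a dominating function.\<close>

lemma heat_approximates_identity:
  fixes \<phi> :: "'a::euclidean_space \<Rightarrow> complex"
  assumes \<phi>: "continuous_on UNIV \<phi>" and B: "\<And>x. norm (\<phi> x) \<le> B"
  shows "(\<lambda>n. \<integral>y. of_real (heat (1 / real (Suc n)) (x - y)) * \<phi> y \<partial>lborel) \<longlonglongrightarrow> \<phi> x"
proof -
  have [measurable]: "\<phi> \<in> borel_measurable borel" by (rule borel_measurable_continuous_onI[OF \<phi>])
  let ?r = "\<lambda>n. sqrt (1 / real (Suc n))"
  have "(\<integral>y. of_real (heat (1 / real (Suc n)) (x - y)) * \<phi> y \<partial>lborel)
    = (\<integral>w. of_real (heat 1 w) * \<phi> (x - ?r n *\<^sub>R w) \<partial>lborel)" for n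
  proof -
    have pos: "0 < 1 / real (Suc n)" by simp
    have "(\<integral>y. of_real (heat (1 / real (Suc n)) (x - y)) * \<phi> y \<partial>lborel)
      = \<bar>- ?r n\<bar> ^ DIM('a) *\<^sub>R (\<integral>w. of_real (heat (1 / real (Suc n)) (x - (x + (- ?r n) *\<^sub>R w))) * \<phi> (x + (- ?r n) *\<^sub>R w) \<partial>lborel)"
      by (rule integral_affine) auto
    also have "\<dots> = (\<integral>w. ?r n ^ DIM('a) *\<^sub>R (of_real (heat (1 / real (Suc n)) (?r n *\<^sub>R w)) * \<phi> (x - ?r n *\<^sub>R w)) \<partial>lborel)"
      by (subst integral_scaleR_right[symmetric]) simp
    also have "\<dots> = (\<integral>w. of_real (heat 1 w) * \<phi> (x - ?r n *\<^sub>R w) \<partial>lborel)"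
      unfolding heat_rescale[OF pos, symmetric]
      by (simp add: scaleR_conv_of_real mult.assoc del: real_sqrt_divide)
    finally show ?thesis .
  qed
  moreover have "(\<lambda>n. \<integral>w. of_real (heat 1 w) * \<phi> (x - ?r n *\<^sub>R w) \<partial>lborel) \<longlonglongrightarrow> (\<integral>w. of_real (heat 1 (w::'a)) * \<phi> x \<partial>lborel)"
  proof (rule integral_dominated_convergence[where w = "\<lambda>w::'a. heat 1 w * B"])
    show "integrable lborel (\<lambda>w. heat 1 (w::'a) * B)"
      using heat_integral(1)[of 1, where 'a='a] by simp
    show "AE w in lborel. (\<lambda>n. of_real (heat 1 w) * \<phi> (x - ?r n *\<^sub>R w)) \<longlonglongrightarrow> of_real (heat 1 w) * \<phi> x"
    proof (intro AE_I2 tendsto_mult tendsto_const)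
      fix w :: 'a
      have "(\<lambda>n. ?r n) \<longlonglongrightarrow> sqrt 0"
        by (intro tendsto_real_sqrt lim_1_over_n[THEN LIMSEQ_Suc])
      then have "(\<lambda>n. x - ?r n *\<^sub>R w) \<longlonglongrightarrow> x - 0 *\<^sub>R w"
        by (intro tendsto_diff tendsto_const tendsto_scaleR) simp
      moreover have "isCont \<phi> x" using \<phi> by (simp add: continuous_on_eq_continuous_at)
      ultimately show "(\<lambda>n. \<phi> (x - ?r n *\<^sub>R w)) \<longlonglongrightarrow> \<phi> x"
        by (intro isCont_tendsto_compose[of _ \<phi>]) simp_all
    qed
    show "AE w in lborel. norm (of_real (heat 1 w) * \<phi> (x - ?r n *\<^sub>R w)) \<le> heat 1 w * B" for n
      by (intro AE_I2) (simp add: norm_mult heat_nonneg mult_left_mono B)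
  qed auto
  moreover have "(\<integral>w. of_real (heat 1 (w::'a)) * \<phi> x \<partial>lborel) = \<phi> x"
    using heat_integral(2)[of 1, where 'a='a] by (simp add: integral_mult_left_zero)
  ultimately show ?thesis by (simp only:)
qed

text \<open>The limit t \<rightarrow> 0 in \<open>heat_convolve_eq_transform\<close>: the left side
  tends to \<phi> x, and on the right the Gaussian tends to 1 under the integrable majorant
  |F|.\<close>

lemma Fourier_inversion:
  fixes \<phi> :: "'a::euclidean_space \<Rightarrow> complex"
  assumes \<phi>: "continuous_on UNIV \<phi>" "\<And>x. norm (\<phi> x) \<le> B" "integrable lborel \<phi>"
    and F: "integrable lborel (\<lambda>\<xi>. \<integral>y. \<phi> y * wave (- \<xi>) y \<partial>lborel)" (is "integrable _ ?F")
  shows "\<phi> x = (\<integral>\<xi>. ?F \<xi> * wave \<xi> x \<partial>lborel)"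
proof -
  have [measurable]: "?F \<in> borel_measurable borel" using F by (auto dest: borel_measurable_integrable)
  let ?t = "\<lambda>n. 1 / real (Suc n)"
  let ?G = "\<lambda>n \<xi>. ?F \<xi> * of_real (exp (- (?t n * (2 * pi * norm \<xi>)\<^sup>2))) * wave \<xi> x"
  have "(\<lambda>n. \<integral>\<xi>. ?G n \<xi> \<partial>lborel) \<longlonglongrightarrow> (\<integral>\<xi>. ?F \<xi> * wave \<xi> x \<partial>lborel)"
  proof (rule integral_dominated_convergence[where w = "\<lambda>\<xi>. norm (?F \<xi>)"])
    show "AE \<xi> in lborel. (\<lambda>n. ?G n \<xi>) \<longlonglongrightarrow> ?F \<xi> * wave \<xi> x"
    proof (intro AE_I2)
      fix \<xi> :: 'a
      have "(\<lambda>n. complex_of_real (exp (- (?t n * (2 * pi * norm \<xi>)\<^sup>2)))) \<longlonglongrightarrow> of_real (exp (- (0 * (2 * pi * norm \<xi>)\<^sup>2)))"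
        by (intro tendsto_intros lim_1_over_n[THEN LIMSEQ_Suc])
      then have "(\<lambda>n. ?G n \<xi>) \<longlonglongrightarrow> ?F \<xi> * of_real (exp (- (0 * (2 * pi * norm \<xi>)\<^sup>2))) * wave \<xi> x"
        by (intro tendsto_mult tendsto_const)
      then show "(\<lambda>n. ?G n \<xi>) \<longlonglongrightarrow> ?F \<xi> * wave \<xi> x" by simp
    qed
    show "AE \<xi> in lborel. norm (?G n \<xi>) \<le> norm (?F \<xi>)" for n
      by (intro AE_I2) (simp add: norm_mult mult_left_le)
    show "integrable lborel (\<lambda>\<xi>. norm (?F \<xi>))" using F by simp
  qed auto
  moreover have "(\<lambda>n. \<integral>\<xi>. ?G n \<xi> \<partial>lborel) \<longlonglongrightarrow> \<phi> x"
    using heat_approximates_identity[OF \<phi>(1,2), of x] by (simp only: heat_convolve_eq_transform[OF _ \<phi>(3)] zero_less_divide_1_iff of_nat_0_less_iff zero_less_Suc)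
  ultimately show ?thesis by (rule LIMSEQ_unique[OF _ , symmetric])
qed

section \<open>Test functions\<close>

definition partial :: "'a::euclidean_space \<Rightarrow> ('a \<Rightarrow> complex) \<Rightarrow> 'a \<Rightarrow> complex" where
  "partial i \<phi> x = frechet_derivative \<phi> (at x) i"

lemma Cc_infty_C_k: "\<phi> \<in> Cc_infty \<Longrightarrow> C_k k \<phi>"
  by (simp add: Cc_infty_def)

lemma Cc_infty_continuous: "\<phi> \<in> Cc_infty \<Longrightarrow> continuous_on UNIV \<phi>"
  using Cc_infty_C_k[of \<phi> 0] by simp

lemma Cc_infty_differentiable: "\<phi> \<in> Cc_infty \<Longrightarrow> \<phi> differentiable (at x)"
  using Cc_infty_C_k[of \<phi> 1] by simp

lemma Cc_infty_support:
  assumes "\<phi> \<in> Cc_infty"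
  obtains R where "\<And>x. R < norm x \<Longrightarrow> \<phi> x = 0"
proof -
  have "bounded (closure {x. \<phi> x \<noteq> 0})"
    using assms by (auto simp: Cc_infty_def intro: compact_imp_bounded)
  then obtain R where R: "\<forall>x\<in>closure {x. \<phi> x \<noteq> 0}. norm x \<le> R"
    unfolding bounded_iff by blast
  have "\<phi> x = 0" if "R < norm x" for x
  proof (rule ccontr)
    assume "\<phi> x \<noteq> 0"
    then have "x \<in> closure {x. \<phi> x \<noteq> 0}" using closure_subset[of "{x. \<phi> x \<noteq> 0}"] by auto
    then show False using R that by auto
  qed
  then show ?thesis by (rule that)
qed

lemma partial_Cc_infty:
  assumes \<phi>: "\<phi> \<in> Cc_infty" and i: "i \<in> Basis"
  shows "partial i \<phi> \<in> Cc_infty"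
proof -
  have eq: "partial i \<phi> = (\<lambda>x. frechet_derivative \<phi> (at x) i)" by (simp add: partial_def fun_eq_iff)
  have "C_k k (partial i \<phi>)" for k
    using Cc_infty_C_k[OF \<phi>, of "Suc k"] i by (simp add: eq)
  moreover have "compact (closure {x. partial i \<phi> x \<noteq> 0})"
  proof -
    let ?S = "closure {x. \<phi> x \<noteq> 0}"
    have "partial i \<phi> x = 0" if x: "x \<notin> ?S" for x
    proof -
      have "((\<lambda>_. 0) has_derivative (\<lambda>_. 0)) (at x)" by simp
      then have "(\<phi> has_derivative (\<lambda>_. 0)) (at x)"
      proof (rule has_derivative_transform_within_open)
        show "open (- ?S)" by auto
        show "0 = \<phi> y" if "y \<in> - ?S" for y
          using that closure_subset[of "{x. \<phi> x \<noteq> 0}"] by auto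
      qed (use x in auto)
      then have "(\<lambda>_. 0) = frechet_derivative \<phi> (at x)" by (rule frechet_derivative_at)
      from this[symmetric] show ?thesis by (simp add: partial_def)
    qed
    then have "{x. partial i \<phi> x \<noteq> 0} \<subseteq> ?S" by auto
    then have "closure {x. partial i \<phi> x \<noteq> 0} \<subseteq> ?S" by (rule closure_minimal) simp
    moreover have "compact ?S" using \<phi> by (simp add: Cc_infty_def)
    ultimately have "bounded (closure {x. partial i \<phi> x \<noteq> 0})"
      using bounded_subset compact_imp_bounded by blast
    then show ?thesis by (simp only: compact_eq_bounded_closed closed_closure simp_thms)
  qed
  ultimately show ?thesis by (simp add: Cc_infty_def)
qed

lemma Cc_infty_bounded:
  assumes \<phi>: "\<phi> \<in> Cc_infty"
  obtains B where "0 \<le> B" "\<And>x. norm (\<phi> x) \<le> B"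
proof -
  obtain R where R: "\<And>x. R < norm x \<Longrightarrow> \<phi> x = 0" using Cc_infty_support[OF \<phi>] by blast
  have "compact (\<phi> ` cball 0 R)"
    using Cc_infty_continuous[OF \<phi>] by (intro compact_continuous_image) (auto intro: continuous_on_subset)
  then have "bounded (\<phi> ` cball 0 R)" by (rule compact_imp_bounded)
  then obtain B where "\<forall>y\<in>\<phi> ` cball 0 R. norm y \<le> B" unfolding bounded_iff by blast
  then have B: "norm (\<phi> x) \<le> B" if "norm x \<le> R" for x using that by simp
  have "norm (\<phi> x) \<le> max B 0" for x
    using B[of x] R[of x] by (cases "norm x \<le> R") auto
  then show ?thesis using that[of "max B 0"] by auto
qed

lemma Cc_infty_integrable:
  assumes \<phi>: "\<phi> \<in> Cc_infty"
  shows "integrable lborel \<phi>"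
proof -
  obtain R where R: "\<And>x. R < norm x \<Longrightarrow> \<phi> x = 0" using Cc_infty_support[OF \<phi>] by blast
  have "integrable lborel (\<lambda>x. indicator (cball 0 R) x *\<^sub>R \<phi> x)"
    using Cc_infty_continuous[OF \<phi>] by (intro borel_integrable_compact) (auto intro: continuous_on_subset)
  also have "(\<lambda>x. indicator (cball 0 R) x *\<^sub>R \<phi> x) = \<phi>"
    using R by (auto simp: fun_eq_iff indicator_def)
  finally show ?thesis .
qed

lemma Cc_infty_measurable [measurable_dest]: "\<phi> \<in> Cc_infty \<Longrightarrow> \<phi> \<in> borel_measurable borel"
  by (rule borel_measurable_continuous_onI[OF Cc_infty_continuous])

lemma partial_has_vector_derivative:
  assumes \<phi>: "\<phi> \<in> Cc_infty"
  shows "((\<lambda>t. \<phi> (x + t *\<^sub>R i)) has_vector_derivative partial i \<phi> (x + t *\<^sub>R i)) (at t)"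
proof -
  let ?D = "frechet_derivative \<phi> (at (x + t *\<^sub>R i))"
  have D: "(\<phi> has_derivative ?D) (at (x + t *\<^sub>R i))"
    using Cc_infty_differentiable[OF \<phi>] frechet_derivative_works by blast
  have "((\<lambda>t. x + t *\<^sub>R i) has_derivative (\<lambda>h. h *\<^sub>R i)) (at t)"
    by (auto intro!: derivative_eq_intros)
  then have "((\<lambda>t. \<phi> (x + t *\<^sub>R i)) has_derivative (\<lambda>h. ?D (h *\<^sub>R i))) (at t)"
    using has_derivative_compose[of "\<lambda>t. x + t *\<^sub>R i" "\<lambda>h. h *\<^sub>R i" t UNIV \<phi> ?D] D by simp
  moreover have "?D (h *\<^sub>R i) = h *\<^sub>R ?D i" for h
    using has_derivative_bounded_linear[OF D] by (simp add: linear_cmul bounded_linear.linear)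
  ultimately show ?thesis by (simp add: has_vector_derivative_def partial_def)
qed

section \<open>Decay of the Fourier transform of a test function\<close>

definition fourier_integral :: "('a::euclidean_space \<Rightarrow> complex) \<Rightarrow> 'a \<Rightarrow> complex" where
  "fourier_integral \<phi> \<xi> = (\<integral>y. \<phi> y * wave (- \<xi>) y \<partial>lborel)"

lemma measurable_fourier_integral [measurable]:
  assumes [measurable]: "\<phi> \<in> borel_measurable borel"
  shows "fourier_integral \<phi> \<in> borel_measurable borel"
  unfolding fourier_integral_def by measurable

lemma integral_translate:
  fixes f :: "'a::euclidean_space \<Rightarrow> 'b::{banach, second_countable_topology}"
  assumes "f \<in> borel_measurable borel"
  shows "(\<integral>y. f (x + y) \<partial>lborel) = (\<integral>y. f y \<partial>lborel)"
  using integral_affine[of 1 f x] assms by simp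

lemma wave_product_integrable: "integrable lborel \<phi> \<Longrightarrow> integrable lborel (\<lambda>y. \<phi> y * wave \<xi> y)"
  by (rule Bochner_Integration.integrable_bound[of _ \<phi>]) (auto simp: norm_mult dest: borel_measurable_integrable)

text \<open>Difference quotients instead of integration by parts: a translation of \<phi> multiplies
  its transform by the value of a character, and the difference quotient of the character tends to
  the factor on the right. Dominated convergence uses a Lipschitz bound along i and the support
  enlarged from R to R + 1, as the steps h are at most 1.\<close>

lemma fourier_integral_partial:
  fixes \<phi> :: "'a::euclidean_space \<Rightarrow> complex"
  assumes \<phi>: "\<phi> \<in> Cc_infty" and i: "i \<in> Basis"
  shows "fourier_integral (partial i \<phi>) \<xi> = 2 * of_real pi * \<i> * of_real (\<xi> \<bullet> i) * fourier_integral \<phi> \<xi>"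
proof -
  note [measurable] = Cc_infty_measurable[OF \<phi>] Cc_infty_measurable[OF partial_Cc_infty[OF \<phi> i]]
  obtain R where R: "\<And>x. R < norm x \<Longrightarrow> \<phi> x = 0" using Cc_infty_support[OF \<phi>] by blast
  obtain B where B: "0 \<le> B" "\<And>x. norm (partial i \<phi> x) \<le> B"
    using Cc_infty_bounded[OF partial_Cc_infty[OF \<phi> i]] by blast
  define h where "h n = 1 / real (Suc n)" for n
  have h: "0 < h n" "h n \<le> 1" for n by (auto simp: h_def)
  have h0: "h \<longlonglongrightarrow> 0" unfolding h_def by (rule lim_1_over_n[THEN LIMSEQ_Suc])
  then have h_at: "filterlim h (at 0) sequentially"
    using h by (auto simp: filterlim_at intro!: always_eventually) (metis less_irrefl)
  let ?q = "\<lambda>n x. (\<phi> (x + h n *\<^sub>R i) - \<phi> x) /\<^sub>R h n"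
  have lip: "norm (\<phi> (x + h n *\<^sub>R i) - \<phi> x) \<le> B * h n" for x n
  proof -
    have "norm (\<phi> (x + h n *\<^sub>R i) - \<phi> (x + 0 *\<^sub>R i)) \<le> B * norm (h n - 0)"
    proof (rule differentiable_bound[of UNIV "\<lambda>t. \<phi> (x + t *\<^sub>R i)" "\<lambda>t s. s *\<^sub>R partial i \<phi> (x + t *\<^sub>R i)"])
      fix t :: real
      show "((\<lambda>t. \<phi> (x + t *\<^sub>R i)) has_derivative (\<lambda>s. s *\<^sub>R partial i \<phi> (x + t *\<^sub>R i))) (at t within UNIV)"
        using partial_has_vector_derivative[OF \<phi>] by (simp add: has_vector_derivative_def)
      show "onorm (\<lambda>s. s *\<^sub>R partial i \<phi> (x + t *\<^sub>R i)) \<le> B"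
        by (intro onorm_le) (simp add: B(2) mult_left_mono mult.commute[of B])
    qed auto
    then show ?thesis using h[of n] by simp
  qed
  have "(\<lambda>n. \<integral>x. ?q n x * wave (- \<xi>) x \<partial>lborel) \<longlonglongrightarrow> (\<integral>x. partial i \<phi> x * wave (- \<xi>) x \<partial>lborel)"
  proof (rule integral_dominated_convergence[where w = "\<lambda>x::'a. indicator (cball 0 (R + 1)) x * B"])
    show "integrable lborel (\<lambda>x::'a. indicator (cball 0 (R + 1)) x * B)"
      by (intro integrable_mult_left) (auto intro!: emeasure_bounded_finite simp: less_top[symmetric])
    show "AE x in lborel. (\<lambda>n. ?q n x * wave (- \<xi>) x) \<longlonglongrightarrow> partial i \<phi> x * wave (- \<xi>) x"
    proof (intro AE_I2 tendsto_mult tendsto_const)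
      fix x
      have "((\<lambda>t. \<phi> (x + t *\<^sub>R i)) has_vector_derivative partial i \<phi> (x + 0 *\<^sub>R i)) (at 0)"
        by (rule partial_has_vector_derivative[OF \<phi>])
      then have "((\<lambda>s. norm (\<phi> (x + (0 + s) *\<^sub>R i) - \<phi> (x + 0 *\<^sub>R i) - s *\<^sub>R partial i \<phi> (x + 0 *\<^sub>R i)) / norm s) \<longlongrightarrow> 0) (at 0)"
        unfolding has_vector_derivative_def has_derivative_at by blast
      then have "(\<lambda>n. norm (\<phi> (x + (0 + h n) *\<^sub>R i) - \<phi> (x + 0 *\<^sub>R i) - h n *\<^sub>R partial i \<phi> (x + 0 *\<^sub>R i)) / norm (h n)) \<longlonglongrightarrow> 0"
        by (rule filterlim_compose[OF _ h_at])
      moreover have "norm (\<phi> (x + (0 + h n) *\<^sub>R i) - \<phi> (x + 0 *\<^sub>R i) - h n *\<^sub>R partial i \<phi> (x + 0 *\<^sub>R i)) / norm (h n)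
        = norm (?q n x - partial i \<phi> x)" for n
      proof -
        have "?q n x - partial i \<phi> x = (\<phi> (x + h n *\<^sub>R i) - \<phi> x - h n *\<^sub>R partial i \<phi> x) /\<^sub>R h n"
          using h[of n] by (simp add: scaleR_diff_right)
        then show ?thesis by (simp add: divide_inverse mult.commute)
      qed
      ultimately have "(\<lambda>n. norm (?q n x - partial i \<phi> x)) \<longlonglongrightarrow> 0" by (simp only:)
      then show "(\<lambda>n. ?q n x) \<longlonglongrightarrow> partial i \<phi> x"
        by (rule LIM_zero_cancel[OF tendsto_norm_zero_cancel])
    qed
    show "AE x in lborel. norm (?q n x * wave (- \<xi>) x) \<le> indicator (cball 0 (R + 1)) x * B" for n
    proof (intro AE_I2)
      fix x
      show "norm (?q n x * wave (- \<xi>) x) \<le> indicator (cball 0 (R + 1)) x * B"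
      proof (cases "norm x \<le> R + 1")
        case True
        have "norm (?q n x) = norm (\<phi> (x + h n *\<^sub>R i) - \<phi> x) / h n"
          using h[of n] by (simp add: divide_inverse mult.commute)
        also have "\<dots> \<le> B" using lip[of x n] h[of n] by (simp add: divide_le_eq)
        finally show ?thesis using True by (simp add: norm_mult)
      next
        case False
        have "norm x \<le> norm (x + h n *\<^sub>R i) + norm (h n *\<^sub>R i)"
          using norm_triangle_ineq4[of "x + h n *\<^sub>R i" "h n *\<^sub>R i"] by simp
        then have "R < norm (x + h n *\<^sub>R i)" using False h[of n] i by simp
        then show ?thesis using False R[of x] R[of "x + h n *\<^sub>R i"] by simp
      qed
    qed
  qed auto
  moreover have "(\<integral>x. ?q n x * wave (- \<xi>) x \<partial>lborel) = (wave \<xi> (h n *\<^sub>R i) - 1) / of_real (h n) * fourier_integral \<phi> \<xi>" for n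
  proof -
    have int: "integrable lborel (\<lambda>x. \<phi> x * wave (- \<xi>) x)"
      by (intro wave_product_integrable Cc_infty_integrable \<phi>)
    have shift: "\<phi> (x + h n *\<^sub>R i) * wave (- \<xi>) x = wave \<xi> (h n *\<^sub>R i) * (\<phi> (h n *\<^sub>R i + x) * wave (- \<xi>) (h n *\<^sub>R i + x))" for x
    proof -
      have "wave \<xi> (h n *\<^sub>R i) * wave (- \<xi>) (h n *\<^sub>R i) = 1"
        by (simp add: wave_eq_cis cis_mult)
      then show ?thesis by (simp add: wave_add add.commute mult.left_commute mult.assoc[symmetric])
    qed
    have int2: "integrable lborel (\<lambda>x. \<phi> (x + h n *\<^sub>R i) * wave (- \<xi>) x)"
    proof (rule wave_product_integrable)
      have "integrable (distr lborel borel ((+) (h n *\<^sub>R i))) \<phi>"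
        unfolding lborel_distr_plus by (rule Cc_infty_integrable[OF \<phi>])
      then show "integrable lborel (\<lambda>x. \<phi> (x + h n *\<^sub>R i))"
        by (subst (asm) integrable_distr_eq) (auto simp: add.commute)
    qed
    have "(\<integral>x. \<phi> (x + h n *\<^sub>R i) * wave (- \<xi>) x \<partial>lborel) = wave \<xi> (h n *\<^sub>R i) * (\<integral>x. \<phi> (h n *\<^sub>R i + x) * wave (- \<xi>) (h n *\<^sub>R i + x) \<partial>lborel)"
      unfolding shift by (rule integral_mult_right_zero)
    also have "(\<integral>x. \<phi> (h n *\<^sub>R i + x) * wave (- \<xi>) (h n *\<^sub>R i + x) \<partial>lborel) = fourier_integral \<phi> \<xi>"
      unfolding fourier_integral_def by (rule integral_translate) simp
    finally have s: "(\<integral>x. \<phi> (x + h n *\<^sub>R i) * wave (- \<xi>) x \<partial>lborel) = wave \<xi> (h n *\<^sub>R i) * fourier_integral \<phi> \<xi>" .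
    have "(\<integral>x. ?q n x * wave (- \<xi>) x \<partial>lborel)
      = (\<integral>x. (1 / of_real (h n)) * (\<phi> (x + h n *\<^sub>R i) * wave (- \<xi>) x - \<phi> x * wave (- \<xi>) x) \<partial>lborel)"
      by (intro Bochner_Integration.integral_cong refl) (simp add: scaleR_conv_of_real divide_inverse algebra_simps)
    also have "\<dots> = (1 / of_real (h n)) * ((\<integral>x. \<phi> (x + h n *\<^sub>R i) * wave (- \<xi>) x \<partial>lborel) - (\<integral>x. \<phi> x * wave (- \<xi>) x \<partial>lborel))"
      unfolding Bochner_Integration.integral_diff[OF int2 int, symmetric] by (rule integral_mult_right_zero)
    also have "\<dots> = (1 / of_real (h n)) * (wave \<xi> (h n *\<^sub>R i) * fourier_integral \<phi> \<xi> - fourier_integral \<phi> \<xi>)"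
      unfolding s by (simp add: fourier_integral_def)
    finally show ?thesis by (simp add: divide_inverse algebra_simps)
  qed
  moreover have "(\<lambda>n. (wave \<xi> (h n *\<^sub>R i) - 1) / of_real (h n) * fourier_integral \<phi> \<xi>) \<longlonglongrightarrow> 2 * of_real pi * \<i> * of_real (\<xi> \<bullet> i) * fourier_integral \<phi> \<xi>"
  proof (intro tendsto_mult tendsto_const)
    let ?c = "2 * of_real pi * \<i> * of_real (\<xi> \<bullet> i)"
    have "((\<lambda>z. exp (?c * z)) has_field_derivative ?c) (at 0)"
      by (auto intro!: derivative_eq_intros)
    then have lim: "((\<lambda>z. (exp (?c * z) - 1) / z) \<longlongrightarrow> ?c) (at 0)"
      by (simp add: has_field_derivative_iff)
    have "filterlim (\<lambda>n. complex_of_real (h n)) (at 0) sequentially"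
      using h_at h by (auto simp: filterlim_at tendsto_of_real_iff[where c = 0, simplified] intro!: always_eventually)
    then have "(\<lambda>n. (exp (?c * of_real (h n)) - 1) / of_real (h n)) \<longlonglongrightarrow> ?c"
      by (rule filterlim_compose[OF lim])
    moreover have "wave \<xi> (h n *\<^sub>R i) = exp (?c * of_real (h n))" for n
      by (simp add: wave_def inner_commute mult_ac)
    ultimately show "(\<lambda>n. (wave \<xi> (h n *\<^sub>R i) - 1) / of_real (h n)) \<longlonglongrightarrow> ?c" by simp
  qed
  ultimately show ?thesis unfolding fourier_integral_def[of "partial i \<phi>"] using LIMSEQ_unique by simp
qed

text \<open>Each partial derivative contributes a factor 2 \<pi> |\<xi> \<bullet> i|, of which the
  constant 2 \<pi> \<ge> 1 is discarded; partial derivatives are again test functions, hence the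
  induction over all \<phi>.\<close>

lemma fourier_integral_coordinate_decay:
  fixes \<phi> :: "'a::euclidean_space \<Rightarrow> complex"
  assumes "\<phi> \<in> Cc_infty" "i \<in> Basis"
  shows "\<exists>C\<ge>0. \<forall>\<xi>. \<bar>\<xi> \<bullet> i\<bar> ^ k * norm (fourier_integral \<phi> \<xi>) \<le> C"
  using assms(1)
proof (induction k arbitrary: \<phi>)
  case 0
  let ?C = "\<integral>y. norm (\<phi> y) \<partial>lborel"
  have "norm (fourier_integral \<phi> \<xi>) \<le> ?C" for \<xi>
    unfolding fourier_integral_def
    using integral_norm_bound[of lborel "\<lambda>y. \<phi> y * wave (- \<xi>) y"] by (simp add: norm_mult)
  moreover have "0 \<le> ?C" by (rule integral_nonneg_AE) simp
  ultimately show ?case by (intro exI[of _ ?C]) simp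
next
  case (Suc k)
  obtain C where C: "0 \<le> C" "\<And>\<xi>. \<bar>\<xi> \<bullet> i\<bar> ^ k * norm (fourier_integral (partial i \<phi>) \<xi>) \<le> C"
    using Suc.IH[OF partial_Cc_infty[OF Suc.prems assms(2)]] by blast
  have "\<bar>\<xi> \<bullet> i\<bar> ^ Suc k * norm (fourier_integral \<phi> \<xi>) \<le> C" for \<xi>
  proof -
    have "1 * (\<bar>\<xi> \<bullet> i\<bar> ^ Suc k * norm (fourier_integral \<phi> \<xi>)) \<le> 2 * pi * (\<bar>\<xi> \<bullet> i\<bar> ^ Suc k * norm (fourier_integral \<phi> \<xi>))"
      using pi_gt3 by (intro mult_right_mono) auto
    also have "\<dots> = \<bar>\<xi> \<bullet> i\<bar> ^ k * norm (fourier_integral (partial i \<phi>) \<xi>)"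
      by (simp add: fourier_integral_partial[OF Suc.prems assms(2)] norm_mult)
    also have "\<dots> \<le> C" by (rule C)
    finally show ?thesis by simp
  qed
  then show ?case using C(1) by blast
qed

text \<open>The largest coordinate controls the norm, |\<xi>| \<le> d |\<xi> \<bullet> j|; the
  summand 1 is absorbed by the maximum with 1, which brings in the bound \<open>C0\<close> for
  exponent 0.\<close>

lemma fourier_integral_decay:
  fixes \<phi> :: "'a::euclidean_space \<Rightarrow> complex"
  assumes \<phi>: "\<phi> \<in> Cc_infty"
  shows "\<exists>C\<ge>0. \<forall>\<xi>. (1 + norm \<xi>) ^ k * norm (fourier_integral \<phi> \<xi>) \<le> C"
proof -
  have "\<forall>i\<in>Basis. \<exists>C\<ge>0. \<forall>\<xi>. \<bar>\<xi> \<bullet> i\<bar> ^ k * norm (fourier_integral \<phi> \<xi>) \<le> C"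
    using fourier_integral_coordinate_decay[OF \<phi>] by blast
  then obtain C where C: "\<And>i. i \<in> Basis \<Longrightarrow> 0 \<le> C i"
      "\<And>i \<xi>. i \<in> Basis \<Longrightarrow> \<bar>\<xi> \<bullet> i\<bar> ^ k * norm (fourier_integral \<phi> \<xi>) \<le> C i"
    by metis
  obtain b :: 'a where b: "b \<in> Basis" using nonempty_Basis by blast
  obtain C0 where C0: "0 \<le> C0" "\<And>\<xi>. norm (fourier_integral \<phi> \<xi>) \<le> C0"
    using fourier_integral_coordinate_decay[OF \<phi> b, of 0] by auto
  let ?d = "real DIM('a)"
  let ?K = "(1 + ?d) ^ k * (C0 + (\<Sum>i\<in>Basis. C i))"
  have K0: "0 \<le> (\<Sum>i\<in>Basis. C i)" using C by (intro sum_nonneg) auto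
  have "(1 + norm \<xi>) ^ k * norm (fourier_integral \<phi> \<xi>) \<le> ?K" for \<xi> :: 'a
  proof -
    obtain j where j: "j \<in> Basis" "\<And>i. i \<in> Basis \<Longrightarrow> \<bar>\<xi> \<bullet> i\<bar> \<le> \<bar>\<xi> \<bullet> j\<bar>"
    proof -
      let ?M = "Max ((\<lambda>i. \<bar>\<xi> \<bullet> i\<bar>) ` Basis)"
      have "?M \<in> (\<lambda>i. \<bar>\<xi> \<bullet> i\<bar>) ` Basis" using b by (intro Max_in) auto
      then obtain j where "j \<in> Basis" "?M = \<bar>\<xi> \<bullet> j\<bar>" by blast
      moreover have "\<bar>\<xi> \<bullet> i\<bar> \<le> ?M" if "i \<in> Basis" for i using that by simp
      ultimately show ?thesis using that by metis
    qed
    have "norm \<xi> \<le> (\<Sum>i\<in>Basis. \<bar>\<xi> \<bullet> i\<bar>)" by (rule norm_le_l1)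
    also have "\<dots> \<le> of_nat DIM('a) * \<bar>\<xi> \<bullet> j\<bar>" by (rule sum_bounded_above) (rule j)
    finally have nx: "norm \<xi> \<le> ?d * \<bar>\<xi> \<bullet> j\<bar>" .
    have "norm \<xi> \<le> ?d * max 1 \<bar>\<xi> \<bullet> j\<bar>"
      using nx by (rule order_trans) (auto intro: mult_left_mono)
    then have "1 + norm \<xi> \<le> (1 + ?d) * max 1 \<bar>\<xi> \<bullet> j\<bar>"
      using max.cobounded1[of 1 "\<bar>\<xi> \<bullet> j\<bar>"] unfolding distrib_right mult_1_left by linarith
    then have "(1 + norm \<xi>) ^ k \<le> ((1 + ?d) * max 1 \<bar>\<xi> \<bullet> j\<bar>) ^ k"
      by (intro power_mono) auto
    also have "\<dots> = (1 + ?d) ^ k * (max 1 \<bar>\<xi> \<bullet> j\<bar>) ^ k" by (rule power_mult_distrib)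
    also have "(max 1 \<bar>\<xi> \<bullet> j\<bar>) ^ k \<le> 1 + \<bar>\<xi> \<bullet> j\<bar> ^ k" by (auto simp: max_def)
    finally have "(1 + norm \<xi>) ^ k \<le> (1 + ?d) ^ k * (1 + \<bar>\<xi> \<bullet> j\<bar> ^ k)"
      by (simp add: mult_left_mono)
    then have "(1 + norm \<xi>) ^ k * norm (fourier_integral \<phi> \<xi>) \<le> (1 + ?d) ^ k * (1 + \<bar>\<xi> \<bullet> j\<bar> ^ k) * norm (fourier_integral \<phi> \<xi>)"
      by (intro mult_right_mono) auto
    also have "\<dots> = (1 + ?d) ^ k * (norm (fourier_integral \<phi> \<xi>) + \<bar>\<xi> \<bullet> j\<bar> ^ k * norm (fourier_integral \<phi> \<xi>))"
      by (simp add: algebra_simps)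
    also have "\<dots> \<le> (1 + ?d) ^ k * (C0 + C j)"
      using C0(2) C(2) j(1) by (intro mult_left_mono add_mono) auto
    also have "\<dots> \<le> ?K"
      using j(1) C(1) by (intro mult_left_mono add_left_mono member_le_sum) auto
    finally show ?thesis .
  qed
  moreover have "0 \<le> ?K" using C0 K0 by simp
  ultimately show ?thesis by blast
qed

lemma fourier_integral_weighted_integrable:
  fixes \<phi> :: "'a::euclidean_space \<Rightarrow> complex"
  assumes \<phi>: "\<phi> \<in> Cc_infty" and \<alpha>: "0 \<le> \<alpha>"
  shows "integrable lborel (\<lambda>\<xi>. of_real ((2 * pi * norm \<xi>) powr \<alpha>) * fourier_integral \<phi> \<xi>)"
proof (rule integrableI_bounded)
  note [measurable] = Cc_infty_measurable[OF \<phi>]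
  show "(\<lambda>\<xi>. of_real ((2 * pi * norm \<xi>) powr \<alpha>) * fourier_integral \<phi> \<xi>) \<in> borel_measurable lborel" by simp
  define m where "m = nat \<lceil>\<alpha>\<rceil>"
  have m: "\<alpha> \<le> real m" unfolding m_def by linarith
  \<comment> \<open>m powers outweigh the symbol of order \<alpha>, and the remaining d + 2 are what
    \<open>nn_integral_decay_le\<close> integrates with \<kappa> = d.\<close>
  define k where "k = m + DIM('a) + 2"
  obtain C where C: "0 \<le> C" "\<And>\<xi>. (1 + norm \<xi>) ^ k * norm (fourier_integral \<phi> \<xi>) \<le> C"
    using fourier_integral_decay[OF \<phi>, of k] by blast
  let ?D = "real DIM('a) + 2"
  have pt: "norm (of_real ((2 * pi * norm \<xi>) powr \<alpha>) * fourier_integral \<phi> \<xi>) \<le> (2 * pi) powr \<alpha> * C * (1 + norm \<xi>) powr (- ?D)" for \<xi>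
  proof -
    let ?s = "1 + norm \<xi>"
    have s: "1 \<le> ?s" by simp
    have "(2 * pi * norm \<xi>) powr \<alpha> = (2 * pi) powr \<alpha> * norm \<xi> powr \<alpha>" by (rule powr_mult)
    also have "norm \<xi> powr \<alpha> \<le> ?s powr \<alpha>" using \<alpha> by (intro powr_mono2) auto
    also have "?s powr \<alpha> \<le> ?s powr real m" using m s by (intro powr_mono) auto
    finally have "(2 * pi * norm \<xi>) powr \<alpha> * norm (fourier_integral \<phi> \<xi>) \<le> (2 * pi) powr \<alpha> * ?s powr real m * norm (fourier_integral \<phi> \<xi>)"
      by (simp add: mult_left_mono mult_right_mono)
    also have "?s powr real m = ?s powr (- ?D) * ?s ^ k"
    proof -
      have "0 < ?s" using s by linarith
      then have "?s ^ k = ?s powr real k" by (rule powr_realpow[symmetric])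
      then show ?thesis by (simp add: powr_add[symmetric] k_def)
    qed
    also have "(2 * pi) powr \<alpha> * (?s powr (- ?D) * ?s ^ k) * norm (fourier_integral \<phi> \<xi>)
      = (2 * pi) powr \<alpha> * ?s powr (- ?D) * (?s ^ k * norm (fourier_integral \<phi> \<xi>))" by (simp only: mult.assoc)
    also have "\<dots> \<le> (2 * pi) powr \<alpha> * ?s powr (- ?D) * C"
      by (intro mult_left_mono C) auto
    finally show ?thesis by (simp add: norm_mult ac_simps)
  qed
  have "(\<integral>\<^sup>+\<xi>. ennreal (norm (of_real ((2 * pi * norm \<xi>) powr \<alpha>) * fourier_integral \<phi> \<xi>)) \<partial>lborel)
    \<le> (\<integral>\<^sup>+\<xi>. ennreal ((2 * pi) powr \<alpha> * C) * decay ?D (0 - \<xi> :: 'a) \<partial>lborel)"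
  proof (intro nn_integral_mono)
    fix \<xi> :: 'a
    have "ennreal (norm (of_real ((2 * pi * norm \<xi>) powr \<alpha>) * fourier_integral \<phi> \<xi>)) \<le> ennreal ((2 * pi) powr \<alpha> * C * (1 + norm \<xi>) powr (- ?D))"
      by (rule ennreal_leI[OF pt])
    also have "\<dots> = ennreal ((2 * pi) powr \<alpha> * C) * decay ?D (0 - \<xi>)"
      using C(1) by (subst ennreal_mult) (auto simp: decay_def)
    finally show "ennreal (norm (of_real ((2 * pi * norm \<xi>) powr \<alpha>) * fourier_integral \<phi> \<xi>)) \<le> ennreal ((2 * pi) powr \<alpha> * C) * decay ?D (0 - \<xi>)" .
  qed
  also have "\<dots> = ennreal ((2 * pi) powr \<alpha> * C) * (\<integral>\<^sup>+\<xi>. decay ?D (0 - \<xi> :: 'a) \<partial>lborel)"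
    by (rule nn_integral_cmult) simp
  also have "(\<integral>\<^sup>+\<xi>. decay ?D (0 - \<xi> :: 'a) \<partial>lborel) \<le> 1 * ennreal (2 powr real DIM('a) * (\<Sum>n. 1 / (real n + 1)\<^sup>2))"
    by (rule nn_integral_decay_le) (auto simp: emeasure_cube powr_realpow)
  also have "ennreal ((2 * pi) powr \<alpha> * C) * (1 * ennreal (2 powr real DIM('a) * (\<Sum>n. 1 / (real n + 1)\<^sup>2))) < \<infinity>"
    by (simp add: ennreal_mult_less_top)
  finally show "(\<integral>\<^sup>+\<xi>. ennreal (norm (of_real ((2 * pi * norm \<xi>) powr \<alpha>) * fourier_integral \<phi> \<xi>)) \<partial>lborel) < \<infinity>"
    by (simp add: mult_left_mono)
qed

section \<open>Representation by heat kernels\<close>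

text \<open>No integrability is assumed, since a Bochner integral that does not exist is 0.\<close>

lemma norm_integral_le_nn_integral:
  fixes f :: "'a \<Rightarrow> 'b::{banach, second_countable_topology}"
  shows "ennreal (norm (integral\<^sup>L M f)) \<le> (\<integral>\<^sup>+x. ennreal (norm (f x)) \<partial>M)"
proof (cases "integrable M f")
  case True
  then show ?thesis by (rule integral_norm_bound_ennreal)
qed (simp add: not_integrable_integral_eq)

text \<open>The definitions integrate over \<open>lebesgue\<close>, the Fubini arguments run over
  \<open>lborel\<close>; for Borel functions the completion changes nothing.\<close>

lemma fourier_eq_integral:
  assumes "\<phi> \<in> borel_measurable borel"
  shows "fourier \<phi> \<xi> = fourier_integral \<phi> \<xi>"
proof -
  have [measurable]: "\<phi> \<in> borel_measurable borel" by fact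
  have "exp (- 2 * of_real pi * \<i> * of_real (x \<bullet> \<xi>)) = wave (- \<xi>) x" for x
    by (simp add: wave_def)
  then have "fourier \<phi> \<xi> = (\<integral>x. \<phi> x * wave (- \<xi>) x \<partial>lebesgue)"
    unfolding fourier_def by (simp only:)
  also have "\<dots> = fourier_integral \<phi> \<xi>"
    unfolding fourier_integral_def by (rule integral_completion) simp
  finally show ?thesis .
qed

lemma frac_laplacian_eq:
  assumes \<phi>: "\<phi> \<in> borel_measurable borel"
  shows "frac_laplacian \<alpha> \<phi> x = (\<integral>\<xi>. of_real ((2 * pi * norm \<xi>) powr \<alpha>) * fourier_integral \<phi> \<xi> * wave \<xi> x \<partial>lborel)"
proof -
  have [measurable]: "\<phi> \<in> borel_measurable borel" by fact
  have "frac_laplacian \<alpha> \<phi> x = (\<integral>\<xi>. of_real ((2 * pi * norm \<xi>) powr \<alpha>) * fourier_integral \<phi> \<xi> * wave \<xi> x \<partial>lebesgue)"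
    unfolding frac_laplacian_def fourier_multiplier_def inverse_fourier_def fourier_eq_integral[OF \<phi>] wave_def ..
  also have "\<dots> = (\<integral>\<xi>. of_real ((2 * pi * norm \<xi>) powr \<alpha>) * fourier_integral \<phi> \<xi> * wave \<xi> x \<partial>lborel)"
    by (rule integral_completion) simp
  finally show ?thesis .
qed

lemma measurable_frac_laplacian:
  assumes \<phi>: "\<phi> \<in> borel_measurable borel"
  shows "frac_laplacian \<alpha> \<phi> \<in> borel_measurable borel"
proof -
  have [measurable]: "\<phi> \<in> borel_measurable borel" by fact
  have "frac_laplacian \<alpha> \<phi> = (\<lambda>x. \<integral>\<xi>. of_real ((2 * pi * norm \<xi>) powr \<alpha>) * fourier_integral \<phi> \<xi> * wave \<xi> x \<partial>lborel)"
    by (rule ext) (rule frac_laplacian_eq[OF \<phi>])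
  then show ?thesis by simp
qed

lemma measurable_diff_kernel [measurable]: "diff_kernel N \<beta> T \<in> borel_measurable borel"
  unfolding diff_kernel_def by measurable

lemma one_minus_power_expand:
  fixes y :: complex
  shows "(1 - y) ^ N = 1 + (\<Sum>j=1..N. of_nat (N choose j) * (- 1) ^ j * y ^ j)"
proof -
  have "(1 - y) ^ N = (- y + 1) ^ N" by simp
  also have "\<dots> = (\<Sum>j\<le>N. of_nat (N choose j) * (- y) ^ j)"
    by (subst binomial_ring) simp
  also have "\<dots> = (\<Sum>j\<in>insert 0 {1..N}. of_nat (N choose j) * (- y) ^ j)"
    by (intro sum.cong) auto
  also have "\<dots> = 1 + (\<Sum>j=1..N. of_nat (N choose j) * (- y) ^ j)"
    by (subst sum.insert) auto
  finally show ?thesis by (simp add: power_minus[of y] mult.assoc)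
qed

text \<open>Inserting \<open>1 = (1 - e\<^bsup>-Ts\<^esup>)\<^sup>N + (1 - (1 - e\<^bsup>-Ts\<^esup>)\<^sup>N)\<close> on the Fourier side: the first
  multiplier vanishes at the origin to an order beating \<open>s\<^bsup>-\<alpha>/2\<^esup>\<close>, the second one is a
  combination of Gaussians.\<close>

lemma heat_representation:
  fixes \<phi> :: "'a::euclidean_space \<Rightarrow> complex"
  assumes \<phi>: "\<phi> \<in> Cc_infty" and \<alpha>: "0 < \<alpha>" and T: "0 < T" and N: "\<alpha> / 2 < real N"
  shows "ennreal (norm (\<phi> x)) \<le>
    ennreal (1 / Gamma (\<alpha> / 2)) * (\<integral>\<^sup>+y. diff_kernel N (\<alpha> / 2) T (x - y) * ennreal (norm (frac_laplacian \<alpha> \<phi> y)) \<partial>lborel)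
    + (\<Sum>j=1..N. of_nat (N choose j) * (\<integral>\<^sup>+y. ennreal (heat (real j * T) (x - y)) * ennreal (norm (\<phi> y)) \<partial>lborel))"
proof -
  define \<beta> where "\<beta> = \<alpha> / 2"
  have \<beta>: "0 < \<beta>" "\<beta> < real N" "\<alpha> = 2 * \<beta>" using \<alpha> N by (auto simp: \<beta>_def)
  note [measurable] = Cc_infty_measurable[OF \<phi>] measurable_frac_laplacian[OF Cc_infty_measurable[OF \<phi>]]
  define W where "W = fdiff N (\<beta> - 1)"
  have [measurable]: "W \<in> borel_measurable borel" by (simp add: W_def)
  define s where "s \<xi> = (2 * pi * norm \<xi>)\<^sup>2" for \<xi> :: 'a
  have [measurable]: "s \<in> borel_measurable borel" unfolding s_def by measurable
  have s0: "0 \<le> s \<xi>" for \<xi> by (simp add: s_def)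
  define g where "g \<xi> = of_real ((2 * pi * norm \<xi>) powr \<alpha>) * fourier_integral \<phi> \<xi>" for \<xi>
  have [measurable]: "g \<in> borel_measurable borel" unfolding g_def by measurable
  have g: "integrable lborel g"
    unfolding g_def by (rule fourier_integral_weighted_integrable[OF \<phi>]) (use \<alpha> in simp)
  define f where "f = frac_laplacian \<alpha> \<phi>"
  have [measurable]: "f \<in> borel_measurable borel" by (simp add: f_def)
  have f: "f y = (\<integral>\<xi>. g \<xi> * wave \<xi> y \<partial>lborel)" for y
    unfolding f_def g_def by (rule frac_laplacian_eq) simp
  have fourier_integral_int: "integrable lborel (fourier_integral \<phi>)"
  proof -
    \<comment> \<open>The weight with exponent 0 is 1 except at \<xi> = 0, where \<open>powr\<close>
      gives 0; so the two functions agree only almost everywhere.\<close>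
    have "integrable lborel (\<lambda>\<xi>. of_real ((2 * pi * norm \<xi>) powr 0) * fourier_integral \<phi> \<xi>)"
      by (rule fourier_integral_weighted_integrable[OF \<phi>]) simp
    then show ?thesis
    proof (rule integrable_cong_AE_imp)
      show "AE \<xi> in lborel. of_real ((2 * pi * norm \<xi>) powr 0) * fourier_integral \<phi> \<xi> = fourier_integral \<phi> \<xi>"
        using AE_lborel_singleton[of "0::'a"] by eventually_elim simp
    qed simp
  qed
  have W_int: "integrable lborel (\<lambda>t. complex_of_real (W t))"
  proof (rule integrableI_bounded)
    have "(\<integral>\<^sup>+t. ennreal (norm (complex_of_real (W t))) \<partial>lborel) = (\<integral>\<^sup>+t. ennreal (\<bar>fdiff N (\<beta> - 1) t\<bar> * t powr 0) \<partial>lborel)"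
      by (intro nn_integral_cong) (auto simp: W_def fdiff_nonpos)
    also have "\<dots> < \<infinity>"
      using fdiff_moment_finite[of \<beta> 0 N] \<beta> by simp
    finally show "(\<integral>\<^sup>+t. ennreal (norm (complex_of_real (W t))) \<partial>lborel) < \<infinity>" .
  qed simp
  \<comment> \<open>The heat flow of f at time T t, written on the Fourier side so that it can be
    integrated in t.\<close>
  define A where "A t = (\<integral>\<xi>. g \<xi> * of_real (exp (- (T * t * s \<xi>))) * wave \<xi> x \<partial>lborel)" for t
  have A: "A t = (\<integral>y. of_real (heat (T * t) (x - y)) * f y \<partial>lborel)" if "0 < t" for t
    unfolding A_def f s_def using that T by (intro heat_convolve_inverse_transform[symmetric] g) simp
  have A_le: "ennreal (norm (A t)) \<le> (\<integral>\<^sup>+y. ennreal (heat (T * t) (x - y)) * ennreal (norm (f y)) \<partial>lborel)" if "0 < t" for t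
    unfolding A[OF that]
    by (rule order.trans[OF norm_integral_le_nn_integral])
       (auto simp: norm_mult heat_nonneg ennreal_mult intro!: nn_integral_mono)
  \<comment> \<open>Absolute values go inside both integrals, which is where
    \<open>diff_kernel\<close> arises.\<close>
  have WA_le: "ennreal (T powr \<beta> * norm (\<integral>t. of_real (W t) * A t \<partial>lborel))
    \<le> (\<integral>\<^sup>+y. diff_kernel N \<beta> T (x - y) * ennreal (norm (f y)) \<partial>lborel)"
  proof -
    have "ennreal (norm (\<integral>t. of_real (W t) * A t \<partial>lborel)) \<le> (\<integral>\<^sup>+t. ennreal (norm (of_real (W t) * A t)) \<partial>lborel)"
      by (rule norm_integral_le_nn_integral)
    also have "\<dots> \<le> (\<integral>\<^sup>+t. \<integral>\<^sup>+y. ennreal (\<bar>W t\<bar> * heat (T * t) (x - y)) * ennreal (norm (f y)) \<partial>lborel \<partial>lborel)"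
    proof (intro nn_integral_mono)
      fix t
      show "ennreal (norm (of_real (W t) * A t)) \<le> (\<integral>\<^sup>+y. ennreal (\<bar>W t\<bar> * heat (T * t) (x - y)) * ennreal (norm (f y)) \<partial>lborel)"
      proof (cases "0 < t")
        case True
        have "ennreal (norm (of_real (W t) * A t)) = ennreal \<bar>W t\<bar> * ennreal (norm (A t))"
          by (simp add: norm_mult ennreal_mult)
        also have "\<dots> \<le> ennreal \<bar>W t\<bar> * (\<integral>\<^sup>+y. ennreal (heat (T * t) (x - y)) * ennreal (norm (f y)) \<partial>lborel)"
          by (intro mult_left_mono A_le True) simp
        also have "\<dots> = (\<integral>\<^sup>+y. ennreal \<bar>W t\<bar> * (ennreal (heat (T * t) (x - y)) * ennreal (norm (f y))) \<partial>lborel)"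
          by (intro nn_integral_cmult[symmetric]) simp
        also have "\<dots> = (\<integral>\<^sup>+y. ennreal (\<bar>W t\<bar> * heat (T * t) (x - y)) * ennreal (norm (f y)) \<partial>lborel)"
          by (simp add: ennreal_mult heat_nonneg mult.assoc)
        finally show ?thesis .
      qed (simp add: W_def fdiff_nonpos)
    qed
    also have "\<dots> = (\<integral>\<^sup>+y. \<integral>\<^sup>+t. ennreal (\<bar>W t\<bar> * heat (T * t) (x - y)) * ennreal (norm (f y)) \<partial>lborel \<partial>lborel)"
      by (intro lborel_pair.Fubini'[symmetric]) simp
    also have "\<dots> = (\<integral>\<^sup>+y. (\<integral>\<^sup>+t. ennreal (\<bar>W t\<bar> * heat (T * t) (x - y)) \<partial>lborel) * ennreal (norm (f y)) \<partial>lborel)"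
      by (intro nn_integral_cong nn_integral_multc) simp
    finally have "ennreal (T powr \<beta>) * ennreal (norm (\<integral>t. of_real (W t) * A t \<partial>lborel))
      \<le> ennreal (T powr \<beta>) * (\<integral>\<^sup>+y. (\<integral>\<^sup>+t. ennreal (\<bar>W t\<bar> * heat (T * t) (x - y)) \<partial>lborel) * ennreal (norm (f y)) \<partial>lborel)"
      by (intro mult_left_mono) auto
    also have "\<dots> = (\<integral>\<^sup>+y. ennreal (T powr \<beta>) * ((\<integral>\<^sup>+t. ennreal (\<bar>W t\<bar> * heat (T * t) (x - y)) \<partial>lborel) * ennreal (norm (f y))) \<partial>lborel)"
      by (intro nn_integral_cmult[symmetric]) simp
    finally show ?thesis by (simp add: diff_kernel_def W_def mult.assoc ennreal_mult)
  qed
  let ?y = "\<lambda>\<xi>. exp (- (T * s \<xi>))"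
  \<comment> \<open>\<open>fdiff_Laplace\<close> at T s; the factor T^\<beta> restores
    s^(-\<beta>).\<close>
  have Laplace: "T powr \<beta> * (\<integral>t. W t * exp (- (T * t * s \<xi>)) \<partial>lborel) = Gamma \<beta> * s \<xi> powr (- \<beta>) * (1 - ?y \<xi>) ^ N"
    if "\<xi> \<noteq> 0" for \<xi>
  proof -
    have pos: "0 < s \<xi>" "0 < T * s \<xi>" using that T by (simp_all add: s_def)
    have "(\<integral>t. W t * exp (- (T * t * s \<xi>)) \<partial>lborel) = (\<integral>t. W t * exp (- ((T * s \<xi>) * t)) \<partial>lborel)"
      by (simp add: ac_simps)
    also have "\<dots> = Gamma \<beta> * (T * s \<xi>) powr (- \<beta>) * (1 - ?y \<xi>) ^ N"
      using fdiff_Laplace[OF \<beta>(1) pos(2), of N] unfolding W_def by (rule has_bochner_integral_integral_eq)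
    also have "(T * s \<xi>) powr (- \<beta>) = T powr (- \<beta>) * s \<xi> powr (- \<beta>)" by (rule powr_mult)
    finally have "T powr \<beta> * (\<integral>t. W t * exp (- (T * t * s \<xi>)) \<partial>lborel)
      = (T powr \<beta> * T powr (- \<beta>)) * (Gamma \<beta> * s \<xi> powr (- \<beta>) * (1 - ?y \<xi>) ^ N)"
      by (simp only: ac_simps)
    also have "T powr \<beta> * T powr (- \<beta>) = 1" using T by (simp add: powr_add[symmetric])
    finally show ?thesis by simp
  qed
  \<comment> \<open>Integrating in t first leaves the multiplier, whose factor s^(-\<beta>) cancels
    the symbol (2 \<pi> |\<xi>|)^\<alpha> contained in g.\<close>
  have Fub: "T powr \<beta> * (\<integral>t. of_real (W t) * A t \<partial>lborel)
    = of_real (Gamma \<beta>) * (\<integral>\<xi>. fourier_integral \<phi> \<xi> * of_real ((1 - ?y \<xi>) ^ N) * wave \<xi> x \<partial>lborel)"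
  proof -
    let ?h = "\<lambda>t \<xi>. of_real (W t) * (g \<xi> * of_real (exp (- (T * t * s \<xi>))) * wave \<xi> x)"
    have "integrable (lborel \<Otimes>\<^sub>M lborel) (case_prod ?h)"
    proof (rule integrable_pair_product[OF W_int g])
      fix t \<xi>
      show "norm (?h t \<xi>) \<le> norm (complex_of_real (W t)) * norm (g \<xi>)"
      proof (cases "0 < t")
        case True
        then have "exp (- (T * t * s \<xi>)) \<le> 1" using T s0 by simp
        then have "norm (g \<xi>) * exp (- (T * t * s \<xi>)) \<le> norm (g \<xi>)" by (intro mult_left_le) auto
        then show ?thesis by (simp add: norm_mult mult_left_mono)
      qed (simp add: W_def fdiff_nonpos)
    qed simp
    then have "(\<integral>\<xi>. (\<integral>t. ?h t \<xi> \<partial>lborel) \<partial>lborel) = (\<integral>t. (\<integral>\<xi>. ?h t \<xi> \<partial>lborel) \<partial>lborel)"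
      by (rule lborel_pair.Fubini_integral)
    also have "\<dots> = (\<integral>t. of_real (W t) * A t \<partial>lborel)"
      unfolding A_def by (intro Bochner_Integration.integral_cong refl integral_mult_right_zero)
    finally have "T powr \<beta> * (\<integral>t. of_real (W t) * A t \<partial>lborel) = T powr \<beta> * (\<integral>\<xi>. (\<integral>t. ?h t \<xi> \<partial>lborel) \<partial>lborel)"
      by simp
    also have "\<dots> = (\<integral>\<xi>. T powr \<beta> * (\<integral>t. ?h t \<xi> \<partial>lborel) \<partial>lborel)"
      by (rule integral_mult_right_zero[symmetric])
    also have "\<dots> = (\<integral>\<xi>. of_real (Gamma \<beta>) * (fourier_integral \<phi> \<xi> * of_real ((1 - ?y \<xi>) ^ N) * wave \<xi> x) \<partial>lborel)"
    proof (intro Bochner_Integration.integral_cong refl)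
      fix \<xi> :: 'a
      have "(\<integral>t. ?h t \<xi> \<partial>lborel) = (\<integral>t. (g \<xi> * wave \<xi> x) * of_real (W t * exp (- (T * t * s \<xi>))) \<partial>lborel)"
        by (intro Bochner_Integration.integral_cong refl) (simp add: ac_simps)
      also have "\<dots> = (g \<xi> * wave \<xi> x) * of_real (\<integral>t. W t * exp (- (T * t * s \<xi>)) \<partial>lborel)"
        unfolding integral_complex_of_real[symmetric] by (rule integral_mult_right_zero)
      finally have h: "T powr \<beta> * (\<integral>t. ?h t \<xi> \<partial>lborel) = (g \<xi> * wave \<xi> x) * of_real (T powr \<beta> * (\<integral>t. W t * exp (- (T * t * s \<xi>)) \<partial>lborel))"
        by simp
      show "T powr \<beta> * (\<integral>t. ?h t \<xi> \<partial>lborel) = of_real (Gamma \<beta>) * (fourier_integral \<phi> \<xi> * of_real ((1 - ?y \<xi>) ^ N) * wave \<xi> x)"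
      proof (cases "\<xi> = 0")
        case True
        \<comment> \<open>At the origin one side vanishes through the symbol in g and the other
          because N > 0.\<close>
        then have "g \<xi> = 0" "1 - ?y \<xi> = 0" by (simp_all add: g_def s_def)
        moreover have "N \<noteq> 0" using \<beta> by auto
        ultimately show ?thesis unfolding h by simp
      next
        case False
        let ?r = "2 * pi * norm \<xi>"
        have r: "0 < ?r" using False by simp
        have "s \<xi> powr (- \<beta>) = ?r powr (- \<alpha>)"
        proof -
          have "s \<xi> = ?r powr 2" using r by (simp only: s_def powr_numeral less_imp_le)
          then show ?thesis by (simp only: powr_powr) (simp add: \<beta>(3))
        qed
        then have "?r powr \<alpha> * s \<xi> powr (- \<beta>) = 1" using r False by (simp add: powr_add[symmetric])
        then have "complex_of_real (?r powr \<alpha>) * of_real (s \<xi> powr (- \<beta>)) = 1"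
          unfolding of_real_mult[symmetric] by simp
        moreover have "(g \<xi> * wave \<xi> x) * of_real (Gamma \<beta> * s \<xi> powr (- \<beta>) * (1 - ?y \<xi>) ^ N)
          = (complex_of_real (?r powr \<alpha>) * of_real (s \<xi> powr (- \<beta>))) * (of_real (Gamma \<beta>) * (fourier_integral \<phi> \<xi> * of_real ((1 - ?y \<xi>) ^ N) * wave \<xi> x))"
          unfolding g_def of_real_mult by (simp only: ac_simps)
        ultimately show ?thesis unfolding h Laplace[OF False] by simp
      qed
    qed
    also have "\<dots> = of_real (Gamma \<beta>) * (\<integral>\<xi>. fourier_integral \<phi> \<xi> * of_real ((1 - ?y \<xi>) ^ N) * wave \<xi> x \<partial>lborel)"
      by (rule integral_mult_right_zero)
    finally show ?thesis .
  qed
  let ?H = "\<lambda>j. (\<integral>y. of_real (heat (real j * T) (x - y)) * \<phi> y \<partial>lborel)"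
  let ?c = "\<lambda>j. complex_of_nat (N choose j) * (- 1) ^ j"
  \<comment> \<open>Binomial expansion: the term j = 0 is \<phi> x by inversion, the others are
    convolutions with heat kernels at the times j T.\<close>
  have expand: "(\<integral>\<xi>. fourier_integral \<phi> \<xi> * of_real ((1 - ?y \<xi>) ^ N) * wave \<xi> x \<partial>lborel) = \<phi> x + (\<Sum>j=1..N. ?c j * ?H j)"
  proof -
    let ?E = "\<lambda>j \<xi>. fourier_integral \<phi> \<xi> * of_real (exp (- (real j * T * s \<xi>))) * wave \<xi> x"
    have bound: "integrable lborel (\<lambda>\<xi>. fourier_integral \<phi> \<xi> * of_real (exp (- (real j * T * s \<xi>))) * wave \<xi> x)" for j
    proof (rule Bochner_Integration.integrable_bound[OF fourier_integral_int])
      show "AE \<xi> in lborel. norm (?E j \<xi>) \<le> norm (fourier_integral \<phi> \<xi>)"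
        using T s0 by (intro AE_I2) (simp add: norm_mult mult_left_le)
    qed simp
    have base: "integrable lborel (\<lambda>\<xi>. fourier_integral \<phi> \<xi> * wave \<xi> x)"
      by (rule Bochner_Integration.integrable_bound[OF fourier_integral_int]) (auto simp: norm_mult)
    have "fourier_integral \<phi> \<xi> * of_real ((1 - ?y \<xi>) ^ N) * wave \<xi> x = fourier_integral \<phi> \<xi> * wave \<xi> x + (\<Sum>j=1..N. ?c j * ?E j \<xi>)" for \<xi>
    proof -
      have "complex_of_real ((1 - ?y \<xi>) ^ N) = (1 - of_real (?y \<xi>)) ^ N" by simp
      also have "\<dots> = 1 + (\<Sum>j=1..N. ?c j * of_real (?y \<xi>) ^ j)" by (rule one_minus_power_expand)
      also have "(\<lambda>j. complex_of_real (?y \<xi>) ^ j) = (\<lambda>j. of_real (exp (- (real j * T * s \<xi>))))"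
      proof
        fix j
        have "?y \<xi> ^ j = exp (real j * - (T * s \<xi>))" by (rule exp_of_nat_mult[symmetric])
        then have "complex_of_real (?y \<xi> ^ j) = of_real (exp (- (real j * T * s \<xi>)))"
          by (simp add: mult.assoc)
        then show "complex_of_real (?y \<xi>) ^ j = of_real (exp (- (real j * T * s \<xi>)))" by simp
      qed
      finally have "fourier_integral \<phi> \<xi> * of_real ((1 - ?y \<xi>) ^ N) * wave \<xi> x
        = fourier_integral \<phi> \<xi> * (1 + (\<Sum>j=1..N. ?c j * of_real (exp (- (real j * T * s \<xi>))))) * wave \<xi> x" by simp
      also have "\<dots> = fourier_integral \<phi> \<xi> * wave \<xi> x + (\<Sum>j=1..N. ?c j * ?E j \<xi>)"
      proof -
        have "fourier_integral \<phi> \<xi> * (\<Sum>j=1..N. ?c j * of_real (exp (- (real j * T * s \<xi>)))) * wave \<xi> x = (\<Sum>j=1..N. ?c j * ?E j \<xi>)"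
          unfolding sum_distrib_left sum_distrib_right by (intro sum.cong refl) (simp only: ac_simps)
        then show ?thesis by (simp only: distrib_left distrib_right mult_1_right)
      qed
      finally show ?thesis .
    qed
    then have "(\<integral>\<xi>. fourier_integral \<phi> \<xi> * of_real ((1 - ?y \<xi>) ^ N) * wave \<xi> x \<partial>lborel)
      = (\<integral>\<xi>. fourier_integral \<phi> \<xi> * wave \<xi> x + (\<Sum>j=1..N. ?c j * ?E j \<xi>) \<partial>lborel)" by (simp only:)
    also have "\<dots> = (\<integral>\<xi>. fourier_integral \<phi> \<xi> * wave \<xi> x \<partial>lborel) + (\<integral>\<xi>. (\<Sum>j=1..N. ?c j * ?E j \<xi>) \<partial>lborel)"
      by (intro Bochner_Integration.integral_add base Bochner_Integration.integrable_sum integrable_mult_right bound)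
    also have "(\<integral>\<xi>. (\<Sum>j=1..N. ?c j * ?E j \<xi>) \<partial>lborel) = (\<Sum>j=1..N. (\<integral>\<xi>. ?c j * ?E j \<xi> \<partial>lborel))"
      by (intro Bochner_Integration.integral_sum integrable_mult_right bound)
    also have "\<dots> = (\<Sum>j=1..N. ?c j * ?H j)"
    proof (intro sum.cong refl)
      fix j assume j: "j \<in> {1..N}"
      have "(\<integral>\<xi>. ?c j * ?E j \<xi> \<partial>lborel) = ?c j * (\<integral>\<xi>. ?E j \<xi> \<partial>lborel)"
        by (rule integral_mult_right_zero)
      also have "(\<integral>\<xi>. ?E j \<xi> \<partial>lborel) = ?H j"
        unfolding s_def fourier_integral_def using j T by (intro heat_convolve_eq_transform[symmetric] Cc_infty_integrable[OF \<phi>]) simp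
      finally show "(\<integral>\<xi>. ?c j * ?E j \<xi> \<partial>lborel) = ?c j * ?H j" .
    qed
    also have "(\<integral>\<xi>. fourier_integral \<phi> \<xi> * wave \<xi> x \<partial>lborel) = \<phi> x"
    proof -
      obtain B where "\<And>x. norm (\<phi> x) \<le> B" using Cc_infty_bounded[OF \<phi>] by blast
      then show ?thesis
        using Fourier_inversion[OF Cc_infty_continuous[OF \<phi>] _ Cc_infty_integrable[OF \<phi>], of B x] fourier_integral_int
        unfolding fourier_integral_def by simp
    qed
    finally show ?thesis .
  qed
  have G: "0 < Gamma \<beta>" using \<beta> by (intro Gamma_real_pos)
  have H_le: "ennreal (norm (?c j * ?H j)) \<le> of_nat (N choose j) * (\<integral>\<^sup>+y. ennreal (heat (real j * T) (x - y)) * ennreal (norm (\<phi> y)) \<partial>lborel)" for j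
  proof -
    have "ennreal (norm (?c j * ?H j)) = of_nat (N choose j) * ennreal (norm (?H j))"
      by (simp add: norm_mult norm_power ennreal_mult ennreal_of_nat_eq_real_of_nat)
    also have "ennreal (norm (?H j)) \<le> (\<integral>\<^sup>+y. ennreal (heat (real j * T) (x - y)) * ennreal (norm (\<phi> y)) \<partial>lborel)"
      by (rule order.trans[OF norm_integral_le_nn_integral])
         (auto simp: norm_mult heat_nonneg ennreal_mult intro!: nn_integral_mono)
    finally show ?thesis by (simp add: mult_left_mono)
  qed
  have "complex_of_real (Gamma \<beta>) * (\<phi> x + (\<Sum>j=1..N. ?c j * ?H j)) = T powr \<beta> * (\<integral>t. of_real (W t) * A t \<partial>lborel)"
    unfolding expand[symmetric] Fub ..
  note eq = this
  have "of_real (1 / Gamma \<beta>) * complex_of_real (Gamma \<beta>) = 1"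
    using G unfolding of_real_mult[symmetric] by simp
  then have "\<phi> x = (of_real (1 / Gamma \<beta>) * complex_of_real (Gamma \<beta>)) * (\<phi> x + (\<Sum>j=1..N. ?c j * ?H j)) - (\<Sum>j=1..N. ?c j * ?H j)"
    by (simp only: mult_1_left add_diff_cancel_right')
  also have "\<dots> = of_real (1 / Gamma \<beta>) * (T powr \<beta> * (\<integral>t. of_real (W t) * A t \<partial>lborel)) - (\<Sum>j=1..N. ?c j * ?H j)"
    by (simp only: eq mult.assoc[of "of_real (1 / Gamma \<beta>)" "complex_of_real (Gamma \<beta>)"])
  finally have "norm (\<phi> x) = norm (of_real (1 / Gamma \<beta>) * (T powr \<beta> * (\<integral>t. of_real (W t) * A t \<partial>lborel)) - (\<Sum>j=1..N. ?c j * ?H j))"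
    by (rule arg_cong)
  also have "\<dots> \<le> norm (of_real (1 / Gamma \<beta>) * (T powr \<beta> * (\<integral>t. of_real (W t) * A t \<partial>lborel))) + norm (\<Sum>j=1..N. ?c j * ?H j)"
    by (rule norm_triangle_ineq4)
  also have "norm (of_real (1 / Gamma \<beta>) * (T powr \<beta> * (\<integral>t. of_real (W t) * A t \<partial>lborel)))
    = (1 / Gamma \<beta>) * (T powr \<beta> * norm (\<integral>t. of_real (W t) * A t \<partial>lborel))"
    using G by (simp add: norm_mult norm_divide)
  also have "norm (\<Sum>j=1..N. ?c j * ?H j) \<le> (\<Sum>j=1..N. norm (?c j * ?H j))" by (rule norm_sum)
  finally have "ennreal (norm (\<phi> x)) \<le> ennreal ((1 / Gamma \<beta>) * (T powr \<beta> * norm (\<integral>t. of_real (W t) * A t \<partial>lborel)) + (\<Sum>j=1..N. norm (?c j * ?H j)))"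
    by (intro ennreal_leI) simp
  also have "\<dots> = ennreal ((1 / Gamma \<beta>) * (T powr \<beta> * norm (\<integral>t. of_real (W t) * A t \<partial>lborel))) + ennreal (\<Sum>j=1..N. norm (?c j * ?H j))"
    using G by (intro ennreal_plus sum_nonneg mult_nonneg_nonneg) auto
  also have "ennreal ((1 / Gamma \<beta>) * (T powr \<beta> * norm (\<integral>t. of_real (W t) * A t \<partial>lborel))) = ennreal (1 / Gamma \<beta>) * ennreal (T powr \<beta> * norm (\<integral>t. of_real (W t) * A t \<partial>lborel))"
    using G by (intro ennreal_mult mult_nonneg_nonneg) auto
  also have "ennreal (\<Sum>j=1..N. norm (?c j * ?H j)) = (\<Sum>j=1..N. ennreal (norm (?c j * ?H j)))"
    by (intro sum_ennreal[symmetric]) auto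
  also have "ennreal (1 / Gamma \<beta>) * ennreal (T powr \<beta> * norm (\<integral>t. of_real (W t) * A t \<partial>lborel)) + (\<Sum>j=1..N. ennreal (norm (?c j * ?H j)))
    \<le> ennreal (1 / Gamma \<beta>) * (\<integral>\<^sup>+y. diff_kernel N \<beta> T (x - y) * ennreal (norm (f y)) \<partial>lborel)
    + (\<Sum>j=1..N. of_nat (N choose j) * (\<integral>\<^sup>+y. ennreal (heat (real j * T) (x - y)) * ennreal (norm (\<phi> y)) \<partial>lborel))"
    by (intro add_mono mult_left_mono WA_le sum_mono H_le) auto
  finally show ?thesis unfolding f_def \<beta>_def .
qed

section \<open>The trace inequality\<close>

text \<open>For |u| \<le> 1 the kernel is bounded by its value at 0, and 1 + |u| \<le> 2 costs 2^D;
  for |u| > 1 \<open>heat_le\<close> with \<kappa> = D/2 applies, as |u| \<ge> (1 + |u|)/2.\<close>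

lemma heat_le_decay:
  assumes t: "0 < t" and D: "0 \<le> D"
  shows "\<exists>C\<ge>0. \<forall>u::'a::euclidean_space. ennreal (heat t u) \<le> ennreal C * decay D u"
proof -
  let ?k = "(4 * pi * t) powr (- real DIM('a) / 2)"
  obtain C where C: "0 \<le> C" "\<And>x::'a. x \<noteq> 0 \<Longrightarrow> heat t x \<le> C * (t powr (D / 2 - DIM('a) / 2) * norm x powr (- 2 * (D / 2)))"
    using heat_le[of "D / 2", where 'a='a] t D by auto
  let ?c = "C * t powr (D / 2 - DIM('a) / 2)"
  let ?K = "2 powr D * (?k + ?c)"
  have c: "0 \<le> ?c" using C(1) by simp
  have "heat t u \<le> ?K * (1 + norm u) powr (- D)" for u :: 'a
  proof (cases "norm u \<le> 1")
    case True
    have e: "exp (- (norm u)\<^sup>2 / (4 * t)) \<le> 1" using t by (simp add: divide_nonneg_pos)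
    have "heat t u \<le> ?k" unfolding heat_def using e by (intro mult_left_le) auto
    moreover have "1 \<le> 2 powr D * (1 + norm u) powr (- D)"
    proof -
      have "1 = 2 powr D * 2 powr (- D)" by (simp add: powr_add[symmetric])
      also have "\<dots> \<le> 2 powr D * (1 + norm u) powr (- D)"
        using True D by (intro mult_left_mono powr_mono2') (auto intro: add_pos_nonneg)
      finally show ?thesis .
    qed
    then have "(?k + ?c) * 1 \<le> (?k + ?c) * (2 powr D * (1 + norm u) powr (- D))"
      using c by (intro mult_left_mono) auto
    ultimately show ?thesis using c by (simp add: ac_simps)
  next
    case False
    then have "u \<noteq> 0" by auto
    from C(2)[OF this] have "heat t u \<le> ?c * norm u powr (- D)" by (simp add: mult.assoc)
    also have "norm u powr (- D) \<le> ((1 + norm u) / 2) powr (- D)"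
      using False D by (intro powr_mono2') auto
    also have "((1 + norm u) / 2) powr (- D) = 2 powr D * (1 + norm u) powr (- D)"
    proof -
      have "((1 + norm u) / 2) powr (- D) = (1 + norm u) powr (- D) / 2 powr (- D)" by (rule powr_divide)
      also have "1 / 2 powr (- D) = 2 powr D" using powr_minus_divide[of "2::real" "- D"] by simp
      then have "(1 + norm u) powr (- D) / 2 powr (- D) = 2 powr D * (1 + norm u) powr (- D)"
        by (metis divide_inverse inverse_eq_divide mult.commute)
      finally show ?thesis .
    qed
    finally have "heat t u \<le> ?c * (2 powr D * (1 + norm u) powr (- D))"
      using c by (simp add: mult_left_mono)
    also have "\<dots> \<le> (?k + ?c) * (2 powr D * (1 + norm u) powr (- D))"
      by (intro mult_right_mono) auto
    finally show ?thesis by (simp only: ac_simps)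
  qed
  then have "ennreal (heat t u) \<le> ennreal ?K * decay D u" for u :: 'a
    unfolding decay_def using c by (subst ennreal_mult[symmetric]) (auto intro!: ennreal_leI)
  moreover have "0 \<le> ?K" using c by simp
  ultimately show ?thesis by blast
qed

definition wnorm :: "real \<Rightarrow> ('a::euclidean_space \<Rightarrow> ennreal) \<Rightarrow> ('a \<Rightarrow> ennreal) \<Rightarrow> ennreal" where
  "wnorm q v F = (\<integral>\<^sup>+x. v x * F x epowr q \<partial>lborel) epowr (1 / q)"

lemma wnorm_mono:
  assumes "0 < q" "\<And>x. F x \<le> H x"
  shows "wnorm q v F \<le> wnorm q v H"
  unfolding wnorm_def using assms by (intro epowr_mono nn_integral_mono mult_left_mono) auto

lemma wnorm_cmult:
  assumes q: "0 < q" and [measurable]: "v \<in> borel_measurable borel" "F \<in> borel_measurable borel"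
  shows "wnorm q v (\<lambda>x. c * F x) = c * wnorm q v F"
proof -
  have "(\<integral>\<^sup>+x. v x * (c * F x) epowr q \<partial>lborel) = (\<integral>\<^sup>+x. c epowr q * (v x * F x epowr q) \<partial>lborel)"
    using q by (intro nn_integral_cong) (simp add: epowr_mult ac_simps)
  also have "\<dots> = c epowr q * (\<integral>\<^sup>+x. v x * F x epowr q \<partial>lborel)" by (intro nn_integral_cmult) simp
  finally show ?thesis unfolding wnorm_def using q by (simp add: epowr_mult epowr_inverse_cancel)
qed

text \<open>The constant is 4 = 2 * 2, from the exponents q and 1/q; it is absorbed later by the
  choices of \<delta> and T.\<close>

lemma wnorm_add_le:
  assumes q: "1 \<le> q" and [measurable]: "v \<in> borel_measurable borel" "F \<in> borel_measurable borel" "H \<in> borel_measurable borel"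
  shows "wnorm q v (\<lambda>x. F x + H x) \<le> 4 * (wnorm q v F + wnorm q v H)"
proof -
  let ?A = "\<integral>\<^sup>+x. v x * F x epowr q \<partial>lborel" and ?B = "\<integral>\<^sup>+x. v x * H x epowr q \<partial>lborel"
  have "(\<integral>\<^sup>+x. v x * (F x + H x) epowr q \<partial>lborel) \<le> (\<integral>\<^sup>+x. ennreal (2 powr q) * (v x * F x epowr q + v x * H x epowr q) \<partial>lborel)"
  proof (intro nn_integral_mono)
    fix x
    have "v x * (F x + H x) epowr q \<le> v x * (ennreal (2 powr q) * (F x epowr q + H x epowr q))"
      using q by (intro mult_left_mono epowr_add_le) auto
    then show "v x * (F x + H x) epowr q \<le> ennreal (2 powr q) * (v x * F x epowr q + v x * H x epowr q)"
      by (simp add: distrib_left ac_simps)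
  qed
  also have "\<dots> = ennreal (2 powr q) * (?A + ?B)"
    by (simp add: nn_integral_cmult nn_integral_add)
  finally have "wnorm q v (\<lambda>x. F x + H x) \<le> (ennreal (2 powr q) * (?A + ?B)) epowr (1 / q)"
    unfolding wnorm_def using q by (intro epowr_mono) auto
  also have "\<dots> = ennreal 2 * (?A + ?B) epowr (1 / q)"
    using q by (simp add: epowr_mult powr_powr)
  also have "\<dots> \<le> ennreal 2 * (ennreal (2 powr (1 / q)) * (?A epowr (1 / q) + ?B epowr (1 / q)))"
    using q by (intro mult_left_mono epowr_add_le) auto
  also have "\<dots> \<le> ennreal 2 * (ennreal 2 * (?A epowr (1 / q) + ?B epowr (1 / q)))"
  proof (intro mult_left_mono mult_right_mono ennreal_leI)
    have "2 powr (1 / q) \<le> 2 powr (1::real)" using q by (intro powr_mono) auto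
    then show "2 powr (1 / q) \<le> (2::real)" by simp
  qed auto
  also have "\<dots> = (ennreal 2 * ennreal 2) * (?A epowr (1 / q) + ?B epowr (1 / q))" by (rule mult.assoc[symmetric])
  also have "ennreal 2 * ennreal 2 = 4" by (subst ennreal_mult[symmetric]) auto
  finally show ?thesis unfolding wnorm_def .
qed

lemma ennreal_four_mult:
  assumes "0 \<le> a" "0 \<le> b"
  shows "ennreal (4 * (a * b)) = 4 * (ennreal a * ennreal b)"
  using assms by (simp add: ennreal_mult)

lemma ennreal_sixteen_mult:
  assumes "0 \<le> a" "0 \<le> b"
  shows "ennreal (16 * (a * b)) = 4 * (4 * (ennreal a * ennreal b))"
proof -
  have "16 * (a * b) = 4 * (4 * (a * b))" by simp
  also have "ennreal \<dots> = 4 * ennreal (4 * (a * b))" using assms by (subst ennreal_mult) auto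
  finally show ?thesis using assms by (simp only: ennreal_four_mult)
qed

text \<open>Conditions (a) and (b) enter only through \<open>growth\<close>, for large cubes, and
  \<open>local\<close>, for small ones. The near part of the kernel is at most \<open>C1\<close>
  times the kernel of the local potential for every T, so \<delta>, and with it L, can be chosen
  before T.\<close>

lemma trace_inequality_core:
  fixes v :: "'a::euclidean_space \<Rightarrow> ennreal"
  assumes \<alpha>: "0 < \<alpha>" "\<alpha> < real DIM('a)" and p: "1 < p" "p \<le> q"
    and [measurable]: "v \<in> borel_measurable borel"
    and growth: "0 \<le> G" "\<And>a l. 1 < l \<Longrightarrow> (\<integral>\<^sup>+x\<in>cube a l. v x \<partial>lborel) \<le> ennreal G * ennreal (l powr (DIM('a) * (q / p)))"
    and local: "\<And>\<delta>. 0 < \<delta> \<Longrightarrow> \<exists>L>0. \<forall>f\<in>borel_measurable borel. (\<integral>\<^sup>+x. f x epowr p \<partial>lborel) < top \<longrightarrow>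
      wnorm q v (local_potential \<alpha> L f) \<le> ennreal \<delta> * wnorm p (\<lambda>_. 1) f"
    and \<epsilon>: "0 < \<epsilon>"
  shows "\<exists>C>0. \<forall>\<phi>\<in>Cc_infty. wnorm q v (\<lambda>x. ennreal (norm (\<phi> x)))
    \<le> ennreal \<epsilon> * wnorm p (\<lambda>_. 1) (\<lambda>x. ennreal (norm (frac_laplacian \<alpha> \<phi> x)))
      + ennreal C * wnorm p (\<lambda>_. 1) (\<lambda>x. ennreal (norm (\<phi> x)))"
proof -
  have q: "1 < q" using p by simp
  define \<kappa> where "\<kappa> = real DIM('a) * (q / p)"
  have "real DIM('a) * 1 \<le> real DIM('a) * (q / p)" using p by (intro mult_left_mono) auto
  then have \<kappa>: "real DIM('a) \<le> \<kappa>" by (simp add: \<kappa>_def)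
  then have \<kappa>0: "0 \<le> \<kappa>" by (rule order.trans[rotated]) simp
  \<comment> \<open>\<open>nn_integral_decay_le\<close> handles the decay \<kappa> + 2 for a mass
    growing with exponent \<kappa> = d q/p, and likewise for Lebesgue measure because d \<le>
    \<kappa>.\<close>
  define D where "D = \<kappa> + 2"
  have D: "0 \<le> D" using \<kappa>0 by (simp add: D_def)
  \<comment> \<open>Makes the far bound of \<open>diff_kernel\<close> decay exactly like
    |x|^(-D).\<close>
  define m where "m = (D - DIM('a)) / 2"
  have m: "0 < m" "real DIM('a) + 2 * m = D" using \<kappa> by (simp add: m_def D_def) (simp add: m_def field_simps)
  define \<beta> where "\<beta> = \<alpha> / 2"
  have \<beta>: "0 < \<beta>" "\<beta> < DIM('a) / 2" "2 * \<beta> = \<alpha>" using \<alpha> by (auto simp: \<beta>_def)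
  obtain N :: nat where N: "\<beta> + m < real N" using reals_Archimedean2 by blast
  obtain C1 where C1: "0 \<le> C1" "\<And>T x::'a. 0 < T \<Longrightarrow> x \<noteq> 0 \<Longrightarrow> diff_kernel N \<beta> T x \<le> ennreal (C1 * norm x powr (\<alpha> - DIM('a)))"
    using diff_kernel_near[OF \<beta>(1,2), of N] unfolding \<beta>(3) by blast
  obtain C2 where C2: "0 \<le> C2" "\<And>T x::'a. 0 < T \<Longrightarrow> x \<noteq> 0 \<Longrightarrow> diff_kernel N \<beta> T x \<le> ennreal (C2 * T powr (\<beta> + m) * norm x powr (- D))"
    using diff_kernel_far[OF \<beta>(1) less_imp_le[OF m(1)] N, where 'a='a] unfolding m(2) by blast
  have G0: "0 < Gamma \<beta>" using \<beta> by (intro Gamma_real_pos)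
  define k1 where "k1 = 2 powr \<kappa> * (\<Sum>n. 1 / (real n + 1)\<^sup>2)"
  have k1: "0 \<le> k1" unfolding k1_def by (intro mult_nonneg_nonneg suminf_nonneg summable_decay) auto
  define K where "K = k1 powr ((p - 1) / p) * (G * k1) powr (1 / q)"
  have K: "0 \<le> K" by (simp add: K_def)
  define conv where "conv f x = (\<integral>\<^sup>+y. decay D (x - y) * f y \<partial>lborel)" for f :: "'a \<Rightarrow> ennreal" and x
  have meas_conv [measurable]: "conv f \<in> borel_measurable borel" if "f \<in> borel_measurable borel" for f
    unfolding conv_def using that by measurable
  have conv_bound: "wnorm q v (conv f) \<le> ennreal K * wnorm p (\<lambda>_. 1) f"
    if [measurable]: "f \<in> borel_measurable borel" and J: "(\<integral>\<^sup>+x. f x epowr p \<partial>lborel) < top" for f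
  proof -
    have "wnorm q v (conv f) \<le> (ennreal k1) epowr ((p - 1) / p) * (ennreal G * ennreal k1) epowr (1 / q) * (\<integral>\<^sup>+x. f x epowr p \<partial>lborel) epowr (1 / p)"
      unfolding wnorm_def conv_def
    proof (rule decay_convolution_bound[OF p])
      fix x :: 'a
      have "(\<integral>\<^sup>+y. decay D (x - y) \<partial>lborel) \<le> 1 * ennreal (2 powr \<kappa> * (\<Sum>n. 1 / (real n + 1)\<^sup>2))"
        unfolding D_def
      proof (rule nn_integral_decay_le[OF _ \<kappa>0])
        fix a :: 'a and l :: real assume l: "1 < l"
        have "l ^ DIM('a) = l powr DIM('a)" using l by (simp add: powr_realpow)
        also have "\<dots> \<le> l powr \<kappa>" using l \<kappa> by (intro powr_mono) auto
        finally show "emeasure lborel (cube a l) \<le> 1 * ennreal (l powr \<kappa>)"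
          using l by (simp add: emeasure_cube ennreal_leI)
      qed simp
      then show "(\<integral>\<^sup>+y. decay D (x - y) \<partial>lborel) \<le> ennreal k1" by (simp add: k1_def)
      have "(\<integral>\<^sup>+y. v y * decay D (x - y) \<partial>lborel) = (\<integral>\<^sup>+y. decay D (x - y) \<partial>density lborel v)"
        by (subst nn_integral_density) auto
      also have "\<dots> \<le> ennreal G * ennreal (2 powr \<kappa> * (\<Sum>n. 1 / (real n + 1)\<^sup>2))"
        unfolding D_def
      proof (rule nn_integral_decay_le[OF _ \<kappa>0])
        fix a :: 'a and l :: real assume l: "1 < l"
        have "emeasure (density lborel v) (cube a l) = (\<integral>\<^sup>+x\<in>cube a l. v x \<partial>lborel)"
          by (rule emeasure_density) simp_all
        then show "emeasure (density lborel v) (cube a l) \<le> ennreal G * ennreal (l powr \<kappa>)"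
          using growth(2)[OF l, of a] unfolding \<kappa>_def by simp
      qed simp
      finally show "(\<integral>\<^sup>+y. v y * decay D (x - y) \<partial>lborel) \<le> ennreal G * ennreal k1" by (simp add: k1_def)
    qed (use D J in auto)
    also have "\<dots> = ennreal K * wnorm p (\<lambda>_. 1) f"
      using k1 growth(1) by (simp add: wnorm_def K_def ennreal_mult[symmetric])
    finally show ?thesis .
  qed
  \<comment> \<open>The near part enters the final sum with the constant 4 C1 \<delta> / Gamma
    \<beta>, which becomes at most \<epsilon>/2; C1 + 1 avoids division by 0.\<close>
  define \<delta> where "\<delta> = \<epsilon> * Gamma \<beta> / (8 * (C1 + 1))"
  have \<delta>: "0 < \<delta>" using \<epsilon> G0 C1(1) by (simp add: \<delta>_def)
  obtain L where L: "0 < L" "\<And>f. f \<in> borel_measurable borel \<Longrightarrow> (\<integral>\<^sup>+x. f x epowr p \<partial>lborel) < top \<Longrightarrow>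
      wnorm q v (local_potential \<alpha> L f) \<le> ennreal \<delta> * wnorm p (\<lambda>_. 1) f"
    using local[OF \<delta>] by blast
  \<comment> \<open>Everything in the constant of the far part except T^(\<beta>+m): 16 = 4 * 4 from
    two uses of \<open>wnorm_add_le\<close>, and (1 + 3/L)^D from \<open>kernel\<close>.\<close>
  define M where "M = 16 / Gamma \<beta> * (C2 * (1 + 3 / L) powr D) * K"
  have M: "0 \<le> M" using G0 C2(1) K by (simp add: M_def)
  \<comment> \<open>Solves T^(\<beta>+m) = \<epsilon> / (2 (M + 1)), so that the far part gets at
    most \<epsilon>/2.\<close>
  define T where "T = (\<epsilon> / (2 * (M + 1))) powr (1 / (\<beta> + m))"
  have T: "0 < T" using \<epsilon> M by (simp add: T_def)
  have T_pow: "T powr (\<beta> + m) = \<epsilon> / (2 * (M + 1))" using \<epsilon> M \<beta> m by (simp add: T_def powr_powr)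
  define B where "B = C2 * T powr (\<beta> + m) * (1 + 3 / L) powr D"
  have B: "0 \<le> B" using C2(1) by (simp add: B_def)
  have near_const: "4 * (C1 / Gamma \<beta> * \<delta>) \<le> \<epsilon> / 2"
  proof -
    have "4 * (C1 / Gamma \<beta> * \<delta>) = (\<epsilon> / 2) * (C1 / (C1 + 1))"
      using G0 C1(1) unfolding \<delta>_def by (simp add: field_simps)
    also have "\<dots> \<le> (\<epsilon> / 2) * 1" using \<epsilon> C1(1) by (intro mult_left_mono) auto
    finally show ?thesis by simp
  qed
  have far_const: "16 * (B / Gamma \<beta> * K) \<le> \<epsilon> / 2"
  proof -
    have "16 * (B / Gamma \<beta> * K) = M * (\<epsilon> / (2 * (M + 1)))"
      unfolding B_def T_pow M_def by (simp only: divide_inverse ac_simps)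
    also have "\<dots> = (\<epsilon> / 2) * (M / (M + 1))" using M by (simp add: field_simps)
    also have "\<dots> \<le> (\<epsilon> / 2) * 1" using \<epsilon> M by (intro mult_left_mono) auto
    finally show ?thesis by simp
  qed
  have kernel: "diff_kernel N \<beta> T u \<le> ennreal C1 * (ennreal (norm u powr (\<alpha> - DIM('a))) * indicator {..<L / 3} (norm u)) + ennreal B * decay D u"
    if u: "u \<noteq> 0" for u :: 'a
  proof (cases "norm u < L / 3")
    case True
    have "diff_kernel N \<beta> T u \<le> ennreal C1 * ennreal (norm u powr (\<alpha> - DIM('a)))"
      using C1(2)[OF T u] C1(1) by (simp add: ennreal_mult)
    then show ?thesis using True by (simp add: add_increasing2)
  next
    case False
    \<comment> \<open>From |u| \<ge> L/3, that is 1 \<le> (3/L) |u|.\<close>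
    have "1 + norm u \<le> (1 + 3 / L) * norm u" using False L(1) by (simp add: field_simps)
    then have "((1 + 3 / L) * norm u) powr (- D) \<le> (1 + norm u) powr (- D)"
      using D by (intro powr_mono2') (auto intro: add_pos_nonneg)
    moreover have "((1 + 3 / L) * norm u) powr (- D) = (1 + 3 / L) powr (- D) * norm u powr (- D)"
      by (rule powr_mult)
    ultimately have "(1 + 3 / L) powr D * ((1 + 3 / L) powr (- D) * norm u powr (- D)) \<le> (1 + 3 / L) powr D * (1 + norm u) powr (- D)"
      by (intro mult_left_mono) auto
    moreover have "(1 + 3 / L) powr D * (1 + 3 / L) powr (- D) = 1"
    proof -
      have "0 < 1 + 3 / L" using L(1) by (intro add_pos_pos) auto
      then show ?thesis by (simp add: powr_add[symmetric])
    qed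
    ultimately have "norm u powr (- D) \<le> (1 + 3 / L) powr D * (1 + norm u) powr (- D)"
      by (simp add: mult.assoc[symmetric])
    then have "C2 * T powr (\<beta> + m) * norm u powr (- D) \<le> C2 * T powr (\<beta> + m) * ((1 + 3 / L) powr D * (1 + norm u) powr (- D))"
      using C2(1) by (intro mult_left_mono) auto
    also have "\<dots> = B * (1 + norm u) powr (- D)" by (simp add: B_def)
    finally have "diff_kernel N \<beta> T u \<le> ennreal (B * (1 + norm u) powr (- D))"
      using C2(2)[OF T u] by (rule order.trans[OF _ ennreal_leI, rotated])
    also have "\<dots> = ennreal B * decay D u" unfolding decay_def using B by (intro ennreal_mult) auto
    finally show ?thesis by (simp add: add_increasing)
  qed
  have "\<forall>j\<in>{1..N}. \<exists>c\<ge>0. \<forall>u::'a. ennreal (heat (real j * T) u) \<le> ennreal c * decay D u"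
    using T by (intro ballI heat_le_decay D) auto
  then obtain c where c: "\<And>j. j \<in> {1..N} \<Longrightarrow> 0 \<le> c j"
      "\<And>j u. j \<in> {1..N} \<Longrightarrow> ennreal (heat (real j * T) (u::'a)) \<le> ennreal (c j) * decay D u"
    by metis
  define B3 where "B3 = (\<Sum>j=1..N. real (N choose j) * c j)"
  have B3: "0 \<le> B3" unfolding B3_def using c(1) by (intro sum_nonneg) auto
  show ?thesis
  proof (intro exI conjI ballI)
    \<comment> \<open>The summand 1 makes C positive.\<close>
    show "0 < 16 * (B3 * K) + 1" using B3 K by (simp add: add_nonneg_pos)
    fix \<phi> :: "'a \<Rightarrow> complex" assume \<phi>: "\<phi> \<in> Cc_infty"
    note [measurable] = Cc_infty_measurable[OF \<phi>] measurable_frac_laplacian[OF Cc_infty_measurable[OF \<phi>]]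
    let ?f = "\<lambda>x. ennreal (norm (frac_laplacian \<alpha> \<phi> x))" and ?\<phi> = "\<lambda>x. ennreal (norm (\<phi> x))"
    let ?Nf = "wnorm p (\<lambda>_. 1) ?f" and ?N\<phi> = "wnorm p (\<lambda>_. 1) ?\<phi>"
    show "wnorm q v ?\<phi> \<le> ennreal \<epsilon> * ?Nf + ennreal (16 * (B3 * K) + 1) * ?N\<phi>"
    \<comment> \<open>With an infinite norm on the right the claim is trivial; the local and the
      convolution bounds ask for finite norms.\<close>
    proof (cases "?Nf = top \<or> ?N\<phi> = top")
      case True
      moreover have "0 < 16 * (B3 * K) + 1" using B3 K by (simp add: add_nonneg_pos)
      ultimately have "ennreal \<epsilon> * ?Nf + ennreal (16 * (B3 * K) + 1) * ?N\<phi> = top"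
        using \<epsilon> by (auto simp: ennreal_mult_top simp del: ennreal_plus)
      then show ?thesis by (simp only: top_greatest)
    next
      case False
      then have Jf: "(\<integral>\<^sup>+x. ?f x epowr p \<partial>lborel) < top" and J\<phi>: "(\<integral>\<^sup>+x. ?\<phi> x epowr p \<partial>lborel) < top"
        by (simp_all add: wnorm_def less_top[symmetric])
      let ?P1 = "\<lambda>x. ennreal (C1 / Gamma \<beta>) * local_potential \<alpha> L ?f x"
      let ?P2 = "\<lambda>x. ennreal (B / Gamma \<beta>) * conv ?f x"
      let ?P3 = "\<lambda>x. ennreal B3 * conv ?\<phi> x"
      have pt: "?\<phi> x \<le> ?P1 x + (?P2 x + ?P3 x)" for x
      proof -
        have "(\<integral>\<^sup>+y. diff_kernel N \<beta> T (x - y) * ?f y \<partial>lborel)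
          \<le> (\<integral>\<^sup>+y. ennreal C1 * (ennreal (norm (x - y) powr (\<alpha> - DIM('a))) * indicator {..<L / 3} (norm (x - y)) * ?f y)
              + ennreal B * (decay D (x - y) * ?f y) \<partial>lborel)"
        \<comment> \<open>Almost everywhere, as the kernel bound leaves out y = x.\<close>
        proof (rule nn_integral_mono_AE)
          show "AE y in lborel. diff_kernel N \<beta> T (x - y) * ?f y
            \<le> ennreal C1 * (ennreal (norm (x - y) powr (\<alpha> - DIM('a))) * indicator {..<L / 3} (norm (x - y)) * ?f y)
              + ennreal B * (decay D (x - y) * ?f y)"
            using AE_lborel_singleton[of x]
          proof eventually_elim
            case (elim y)
            then have "x - y \<noteq> 0" by simp
            from mult_right_mono[OF kernel[OF this], of "?f y"] show ?case
              by (simp only: distrib_right mult.assoc zero_le)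
          qed
        qed
        also have "\<dots> = ennreal C1 * local_potential \<alpha> L ?f x + ennreal B * conv ?f x"
          unfolding local_potential_def conv_def by (simp add: nn_integral_add nn_integral_cmult)
        finally have 1: "ennreal (1 / Gamma \<beta>) * (\<integral>\<^sup>+y. diff_kernel N \<beta> T (x - y) * ?f y \<partial>lborel)
          \<le> ennreal (1 / Gamma \<beta>) * (ennreal C1 * local_potential \<alpha> L ?f x + ennreal B * conv ?f x)"
          by (rule mult_left_mono) simp
        have 2: "ennreal (1 / Gamma \<beta>) * (ennreal C1 * local_potential \<alpha> L ?f x + ennreal B * conv ?f x) = ?P1 x + ?P2 x"
        proof -
          have "ennreal (1 / Gamma \<beta>) * ennreal C1 = ennreal (C1 / Gamma \<beta>)" "ennreal (1 / Gamma \<beta>) * ennreal B = ennreal (B / Gamma \<beta>)"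
            using G0 C1(1) B by (simp_all add: ennreal_mult[symmetric])
          then show ?thesis by (simp only: distrib_left mult.assoc[symmetric])
        qed
        have 3: "(\<Sum>j=1..N. of_nat (N choose j) * (\<integral>\<^sup>+y. ennreal (heat (real j * T) (x - y)) * ?\<phi> y \<partial>lborel)) \<le> ?P3 x"
        proof -
          have "of_nat (N choose j) * (\<integral>\<^sup>+y. ennreal (heat (real j * T) (x - y)) * ?\<phi> y \<partial>lborel)
            \<le> ennreal (real (N choose j) * c j) * conv ?\<phi> x" if j: "j \<in> {1..N}" for j
          proof -
            have "(\<integral>\<^sup>+y. ennreal (heat (real j * T) (x - y)) * ?\<phi> y \<partial>lborel) \<le> (\<integral>\<^sup>+y. ennreal (c j) * (decay D (x - y) * ?\<phi> y) \<partial>lborel)"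
              unfolding mult.assoc[symmetric] by (intro nn_integral_mono mult_right_mono c j) auto
            also have "\<dots> = ennreal (c j) * conv ?\<phi> x" unfolding conv_def by (intro nn_integral_cmult) simp
            finally have "of_nat (N choose j) * (\<integral>\<^sup>+y. ennreal (heat (real j * T) (x - y)) * ?\<phi> y \<partial>lborel)
              \<le> ennreal (real (N choose j)) * (ennreal (c j) * conv ?\<phi> x)"
              unfolding ennreal_of_nat_eq_real_of_nat by (rule mult_left_mono) simp
            also have "\<dots> = ennreal (real (N choose j) * c j) * conv ?\<phi> x"
              using c(1)[OF j] by (simp add: ennreal_mult mult.assoc)
            finally show ?thesis .
          qed
          then have "(\<Sum>j=1..N. of_nat (N choose j) * (\<integral>\<^sup>+y. ennreal (heat (real j * T) (x - y)) * ?\<phi> y \<partial>lborel))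
            \<le> (\<Sum>j=1..N. ennreal (real (N choose j) * c j) * conv ?\<phi> x)" by (intro sum_mono)
          also have "\<dots> = (\<Sum>j=1..N. ennreal (real (N choose j) * c j)) * conv ?\<phi> x" by (rule sum_distrib_right[symmetric])
          also have "(\<Sum>j=1..N. ennreal (real (N choose j) * c j)) = ennreal B3"
            unfolding B3_def using c(1) by (intro sum_ennreal) auto
          finally show ?thesis .
        qed
        have "\<alpha> / 2 < real N" using N m by (simp add: \<beta>_def)
        from heat_representation[OF \<phi> \<alpha>(1) T this, of x]
        have "?\<phi> x \<le> (?P1 x + ?P2 x) + ?P3 x"
          unfolding \<beta>_def[symmetric] by (rule order.trans) (intro add_mono 3 order.trans[OF 1 eq_refl[OF 2]])
        then show ?thesis by (simp only: add.assoc)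
      qed
      have "wnorm q v ?\<phi> \<le> wnorm q v (\<lambda>x. ?P1 x + (?P2 x + ?P3 x))"
        using q pt by (intro wnorm_mono) auto
      also have "\<dots> \<le> 4 * (wnorm q v ?P1 + wnorm q v (\<lambda>x. ?P2 x + ?P3 x))"
        using q by (intro wnorm_add_le) auto
      also have "\<dots> \<le> 4 * (wnorm q v ?P1 + 4 * (wnorm q v ?P2 + wnorm q v ?P3))"
        using q by (intro mult_left_mono add_left_mono wnorm_add_le) auto
      also have "wnorm q v ?P1 = ennreal (C1 / Gamma \<beta>) * wnorm q v (local_potential \<alpha> L ?f)"
        using q by (intro wnorm_cmult) auto
      also have "wnorm q v ?P2 = ennreal (B / Gamma \<beta>) * wnorm q v (conv ?f)"
        using q by (intro wnorm_cmult) auto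
      also have "wnorm q v ?P3 = ennreal B3 * wnorm q v (conv ?\<phi>)"
        using q by (intro wnorm_cmult) auto
      also have "4 * (ennreal (C1 / Gamma \<beta>) * wnorm q v (local_potential \<alpha> L ?f)
          + 4 * (ennreal (B / Gamma \<beta>) * wnorm q v (conv ?f) + ennreal B3 * wnorm q v (conv ?\<phi>)))
        \<le> 4 * (ennreal (C1 / Gamma \<beta>) * (ennreal \<delta> * ?Nf)
          + 4 * (ennreal (B / Gamma \<beta>) * (ennreal K * ?Nf) + ennreal B3 * (ennreal K * ?N\<phi>)))"
        using Jf J\<phi> by (intro mult_left_mono add_mono L(2) conv_bound) auto
      also have "\<dots> = ennreal (4 * (C1 / Gamma \<beta> * \<delta>)) * ?Nf + ennreal (16 * (B / Gamma \<beta> * K)) * ?Nf + ennreal (16 * (B3 * K)) * ?N\<phi>"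
      proof -
        have "ennreal (4 * (C1 / Gamma \<beta> * \<delta>)) = 4 * (ennreal (C1 / Gamma \<beta>) * ennreal \<delta>)"
          using G0 C1(1) \<delta> by (intro ennreal_four_mult) auto
        moreover have "ennreal (16 * (B / Gamma \<beta> * K)) = 4 * (4 * (ennreal (B / Gamma \<beta>) * ennreal K))"
          using G0 B K by (intro ennreal_sixteen_mult) auto
        moreover have "ennreal (16 * (B3 * K)) = 4 * (4 * (ennreal B3 * ennreal K))"
          using B3 K by (intro ennreal_sixteen_mult) auto
        ultimately show ?thesis by (simp only: distrib_left mult.assoc add.assoc)
      qed
      also have "\<dots> \<le> ennreal (\<epsilon> / 2) * ?Nf + ennreal (\<epsilon> / 2) * ?Nf + ennreal (16 * (B3 * K) + 1) * ?N\<phi>"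
        by (intro add_mono mult_right_mono ennreal_leI near_const far_const) auto
      also have "ennreal (\<epsilon> / 2) * ?Nf + ennreal (\<epsilon> / 2) * ?Nf = ennreal \<epsilon> * ?Nf"
      proof -
        have "ennreal (\<epsilon> / 2) * ?Nf + ennreal (\<epsilon> / 2) * ?Nf = (ennreal (\<epsilon> / 2) + ennreal (\<epsilon> / 2)) * ?Nf"
          by (rule distrib_right[symmetric])
        also have "ennreal (\<epsilon> / 2) + ennreal (\<epsilon> / 2) = ennreal \<epsilon>"
          using \<epsilon> by (subst ennreal_plus[symmetric]) auto
        finally show ?thesis .
      qed
      finally show ?thesis .
    qed
  qed
qed

section \<open>Weights: Borel versions, masses and the doubling property\<close>

lemma cube_in_cubes: "0 < l \<Longrightarrow> cube a l \<in> cubes"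
  by (auto simp: cubes_def)

lemma content_cube: "0 < l \<Longrightarrow> measure lborel (cube a l) = l ^ DIM('a)"
  for a :: "'a::euclidean_space"
  using vol_cube[of l a] by simp

text \<open>If all constants with s > 1 were infinite, the limit that defines
  \<open>A_infty_const\<close> would be \<infinity>.\<close>

lemma A_infty_imp_A_const:
  assumes "A_infty w"
  shows "\<exists>s>1. A_const s w < top"
proof (rule ccontr)
  assume "\<not> ?thesis"
  then have top: "A_const s w = top" if "1 < s" for s using that by (simp add: less_top[symmetric])
  have "((\<lambda>s::real. A_const s w) \<longlongrightarrow> top) at_top"
  proof (rule tendsto_eventually)
    show "eventually (\<lambda>s. A_const s w = top) at_top"
      using eventually_gt_at_top[of 1] by eventually_elim (rule top)
  qed
  then have "A_infty_const w = top"
    unfolding A_infty_const_def by (intro tendsto_Lim) simp_all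
  then show False using assms by (simp add: A_infty_def)
qed

text \<open>Measurability is implicit in the integrability over compact sets: the restrictions to
  balls are measurable and converge pointwise.\<close>

lemma weight_lebesgue_measurable:
  assumes "weight w"
  shows "w \<in> borel_measurable lebesgue"
proof (rule borel_measurable_LIMSEQ_real)
  show "(\<lambda>x. indicator (cball 0 (real n)) x *\<^sub>R w x) \<in> borel_measurable lebesgue" for n
  proof (rule borel_measurable_integrable)
    have "set_integrable lebesgue (cball 0 (real n)) w" using assms by (simp add: weight_def)
    then show "integrable lebesgue (\<lambda>x. indicator (cball 0 (real n)) x *\<^sub>R w x)" by (simp only: set_integrable_def)
  qed
  fix x :: 'a
  obtain n0 :: nat where n0: "norm x \<le> n0" using real_arch_simple by blast
  show "(\<lambda>n. indicator (cball 0 (real n)) x *\<^sub>R w x) \<longlonglongrightarrow> w x"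
  proof (rule tendsto_eventually)
    show "eventually (\<lambda>n. indicator (cball 0 (real n)) x *\<^sub>R w x = w x) sequentially"
      using eventually_ge_at_top[of n0] by eventually_elim (use n0 in auto)
  qed
qed

text \<open>A weight is only Lebesgue measurable, whereas the estimates are for Borel functions over
  \<open>lborel\<close>; changing it on a null set affects neither masses nor norms.\<close>

lemma weight_borel_version:
  assumes "weight w"
  obtains v where "v \<in> borel_measurable borel" "AE x in lborel. ennreal (w x) = v x"
proof -
  have "(\<lambda>x. ennreal (w x)) \<in> borel_measurable (completion lborel)"
    using weight_lebesgue_measurable[OF assms] by simp
  from completion_ex_borel_measurable[OF this] show ?thesis using that by auto
qed

lemma wmass_eq:
  assumes w: "weight w" and v: "AE x in lborel. ennreal (w x) = v x"
  shows "wmass \<theta> w Q = (\<integral>\<^sup>+x\<in>Q. v x epowr \<theta> \<partial>lborel)"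
proof -
  have "wmass \<theta> w Q = (\<integral>\<^sup>+x\<in>Q. ennreal (w x powr \<theta>) \<partial>lborel)"
    unfolding wmass_def by (rule nn_integral_completion)
  also have "\<dots> = (\<integral>\<^sup>+x\<in>Q. v x epowr \<theta> \<partial>lborel)"
  proof (rule nn_integral_cong_AE)
    show "AE x in lborel. ennreal (w x powr \<theta>) * indicator Q x = v x epowr \<theta> * indicator Q x"
      using v
    proof eventually_elim
      case (elim x)
      then show ?case using w by (simp add: weight_def flip: elim)
    qed
  qed
  finally show ?thesis .
qed

lemma Lp_norm_eq_wnorm:
  assumes w: "weight w" and v: "AE x in lborel. ennreal (w x) = v x"
  shows "Lp_norm q w \<phi> = wnorm q v (\<lambda>x. ennreal (norm (\<phi> x)))"
proof -
  have "(\<integral>\<^sup>+x. ennreal (norm (\<phi> x) powr q * w x) \<partial>lebesgue) = (\<integral>\<^sup>+x. ennreal (norm (\<phi> x) powr q * w x) \<partial>lborel)"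
    by (rule nn_integral_completion)
  also have "\<dots> = (\<integral>\<^sup>+x. v x * ennreal (norm (\<phi> x)) epowr q \<partial>lborel)"
  proof (rule nn_integral_cong_AE)
    show "AE x in lborel. ennreal (norm (\<phi> x) powr q * w x) = v x * ennreal (norm (\<phi> x)) epowr q"
      using v
    proof eventually_elim
      case (elim x)
      then show ?case using w by (simp add: weight_def ennreal_mult mult.commute flip: elim)
    qed
  qed
  finally show ?thesis by (simp add: Lp_norm_def wnorm_def)
qed

lemma Lp_norm_unweighted: "Lp_norm p (\<lambda>_. 1) \<phi> = wnorm p (\<lambda>_. 1) (\<lambda>x. ennreal (norm (\<phi> x)))"
proof -
  have "(\<integral>\<^sup>+x. ennreal (norm (\<phi> x) powr p * 1) \<partial>lebesgue) = (\<integral>\<^sup>+x. ennreal (norm (\<phi> x) powr p * 1) \<partial>lborel)"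
    by (rule nn_integral_completion)
  then show ?thesis by (simp add: Lp_norm_def wnorm_def)
qed

lemma weight_cube_finite:
  assumes w: "weight w" and v: "AE x in lborel. ennreal (w x) = v x"
  shows "(\<integral>\<^sup>+x\<in>cube a l. v x \<partial>lborel) < top"
proof -
  have "set_integrable lebesgue (cube a l) w" using w by (simp add: weight_def cube_def)
  then have "(\<integral>\<^sup>+x. ennreal (norm (indicator (cube a l) x *\<^sub>R w x)) \<partial>lebesgue) < \<infinity>"
    unfolding set_integrable_def integrable_iff_bounded by blast
  also have "(\<integral>\<^sup>+x. ennreal (norm (indicator (cube a l) x *\<^sub>R w x)) \<partial>lebesgue)
    = (\<integral>\<^sup>+x. ennreal (norm (indicator (cube a l) x *\<^sub>R w x)) \<partial>lborel)"
    by (rule nn_integral_completion)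
  also have "\<dots> = (\<integral>\<^sup>+x\<in>cube a l. v x \<partial>lborel)"
    using v w unfolding weight_def
    by (intro nn_integral_cong_AE) (auto elim!: eventually_mono simp: indicator_def)
  finally show ?thesis by simp
qed

text \<open>Hoelder's inequality for \<open>1 = w\<^bsup>1/s\<^esup> w\<^bsup>-1/s\<^esup>\<close> on \<open>A\<close>.\<close>

lemma A_const_doubling:
  fixes w :: "'a::euclidean_space \<Rightarrow> real"
  assumes w: "weight w" and v: "AE x in lborel. ennreal (w x) = v x"
    and [measurable]: "v \<in> borel_measurable borel" "A \<in> sets borel"
    and s: "1 < s" and fin: "A_const s w < top" and l: "0 < l" and A: "A \<subseteq> cube a l"
    and half: "emeasure lborel (cube a l) \<le> 2 * emeasure lborel A"
  shows "(\<integral>\<^sup>+x\<in>cube a l. v x \<partial>lborel) \<le> ennreal (2 powr s) * A_const s w * (\<integral>\<^sup>+x\<in>A. v x \<partial>lborel)"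
proof (cases "(\<integral>\<^sup>+x\<in>cube a l. v x \<partial>lborel) = 0")
  case False
  let ?Q = "cube a l"
  \<comment> \<open>The dual weight, infinite where v vanishes.\<close>
  define u where "u x = inverse (v x epowr (1 / (s - 1)))" for x
  have [measurable]: "u \<in> borel_measurable borel" unfolding u_def by measurable
  define m where "m = (\<integral>\<^sup>+x\<in>?Q. v x \<partial>lborel)"
  define mA where "mA = (\<integral>\<^sup>+x\<in>A. v x \<partial>lborel)"
  define \<sigma> where "\<sigma> = (\<integral>\<^sup>+x\<in>?Q. u x \<partial>lborel)"
  define V where "V = l ^ DIM('a)"
  have V: "0 < V" "emeasure lborel ?Q = ennreal V" using l by (simp_all add: V_def emeasure_cube)
  have m0: "m \<noteq> 0" using False by (simp add: m_def)
  have m_fin: "m < top" unfolding m_def by (rule weight_cube_finite[OF w v])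
  have s_conj: "1 < s / (s - 1)" "1 / s + 1 / (s / (s - 1)) = 1" using s by (auto simp: field_simps)
  have "(\<integral>\<^sup>+x\<in>?Q. ennreal (w x) \<partial>lebesgue) = (\<integral>\<^sup>+x\<in>?Q. ennreal (w x) \<partial>lborel)"
    by (rule nn_integral_completion)
  also have "\<dots> = m"
    unfolding m_def using v by (intro nn_integral_cong_AE) (auto elim!: eventually_mono)
  finally have int_w: "(\<integral>\<^sup>+x\<in>?Q. ennreal (w x) \<partial>lebesgue) = m" .
  have "(\<integral>\<^sup>+x\<in>?Q. inverse (ennreal (w x powr (1 / (s - 1)))) \<partial>lebesgue)
    = (\<integral>\<^sup>+x\<in>?Q. inverse (ennreal (w x powr (1 / (s - 1)))) \<partial>lborel)"
    by (rule nn_integral_completion)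
  also have "\<dots> = \<sigma>"
    unfolding \<sigma>_def u_def
  proof (rule nn_integral_cong_AE)
    show "AE x in lborel. inverse (ennreal (w x powr (1 / (s - 1)))) * indicator ?Q x
      = inverse (v x epowr (1 / (s - 1))) * indicator ?Q x"
      using v
    proof eventually_elim
      case (elim x)
      then show ?case using w by (simp add: weight_def flip: elim)
    qed
  qed
  finally have int_u: "(\<integral>\<^sup>+x\<in>?Q. inverse (ennreal (w x powr (1 / (s - 1)))) \<partial>lebesgue) = \<sigma>" .
  have vol: "vol ?Q = V" unfolding V_def by (rule vol_cube[OF l])
  have "?Q \<in> cubes" using l by (auto simp: cubes_def)
  then have "(\<integral>\<^sup>+x\<in>?Q. ennreal (w x) \<partial>lebesgue) / ennreal (vol ?Q) *
     ((\<integral>\<^sup>+x\<in>?Q. inverse (ennreal (w x powr (1 / (s - 1)))) \<partial>lebesgue) / ennreal (vol ?Q)) epowr (s - 1) \<le> A_const s w"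
    unfolding A_const_def by (rule SUP_upper)
  then have A_le: "m / ennreal V * (\<sigma> / ennreal V) epowr (s - 1) \<le> A_const s w"
    unfolding int_w int_u vol .
  \<comment> \<open>The average of v is positive, so an infinite dual mass would make the product,
    and with it \<open>A_const\<close>, infinite.\<close>
  have "\<sigma> \<noteq> top"
  proof
    assume "\<sigma> = top"
    then have "(\<sigma> / ennreal V) epowr (s - 1) = top" by (simp add: ennreal_top_divide)
    moreover have "m / ennreal V \<noteq> 0" using m0 V by (simp add: ennreal_divide_eq_0_iff)
    ultimately show False using A_le fin by (simp add: ennreal_mult_top top_unique)
  qed
  then have "AE x in lborel. u x * indicator ?Q x \<noteq> top"
    using nn_integral_PInf_AE[of "\<lambda>x. u x * indicator ?Q x" lborel] by (simp add: \<sigma>_def)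
  moreover have "AE x in lborel. v x * indicator ?Q x \<noteq> top"
    using m_fin nn_integral_PInf_AE[of "\<lambda>x. v x * indicator ?Q x" lborel] by (simp add: m_def)
  \<comment> \<open>Finiteness of \<sigma> forces v > 0 almost everywhere on the cube, where then
    v^(1/s) u^((s-1)/s) = 1.\<close>
  ultimately have one: "AE x in lborel. indicator A x \<le> (v x * indicator A x) epowr (1 / s) * (u x * indicator ?Q x) epowr ((s - 1) / s)"
  proof eventually_elim
    case (elim x)
    show ?case
    proof (cases "x \<in> A")
      case True
      then have "x \<in> ?Q" using A by auto
      then have "v x \<noteq> top" "v x \<noteq> 0" using elim by (auto simp: u_def)
      then obtain b where b: "v x = ennreal b" "0 < b" by (cases "v x") auto
      have "u x = ennreal (b powr (- (1 / (s - 1))))"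
        unfolding u_def b(1) using b(2) by (simp add: inverse_ennreal powr_minus)
      then have "v x epowr (1 / s) * u x epowr ((s - 1) / s) = ennreal (b powr (1 / s) * (b powr (- (1 / (s - 1)))) powr ((s - 1) / s))"
        using b by (simp add: ennreal_mult)
      also have "b powr (1 / s) * (b powr (- (1 / (s - 1)))) powr ((s - 1) / s) = 1"
        using b(2) s by (simp add: powr_powr powr_add[symmetric])
      finally show ?thesis using True \<open>x \<in> ?Q\<close> by simp
    qed simp
  qed
  have "emeasure lborel A = (\<integral>\<^sup>+x. indicator A x \<partial>lborel)" by simp
  also have "\<dots> \<le> (\<integral>\<^sup>+x. (v x * indicator A x) epowr (1 / s) * (u x * indicator ?Q x) epowr ((s - 1) / s) \<partial>lborel)"
    by (rule nn_integral_mono_AE[OF one])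
  also have "\<dots> \<le> (\<integral>\<^sup>+x. ((v x * indicator A x) epowr (1 / s)) epowr s \<partial>lborel) epowr (1 / s)
      * (\<integral>\<^sup>+x. ((u x * indicator ?Q x) epowr ((s - 1) / s)) epowr (s / (s - 1)) \<partial>lborel) epowr (1 / (s / (s - 1)))"
    using s s_conj by (intro nn_integral_Holder) auto
  also have "\<dots> = mA epowr (1 / s) * \<sigma> epowr ((s - 1) / s)"
    using s by (simp add: epowr_epowr mA_def \<sigma>_def)
  finally have "emeasure lborel A epowr s \<le> (mA epowr (1 / s) * \<sigma> epowr ((s - 1) / s)) epowr s"
    using s by (intro epowr_mono) auto
  also have "\<dots> = mA * \<sigma> epowr (s - 1)"
    using s by (simp add: epowr_mult epowr_epowr)
  finally have E: "emeasure lborel A epowr s \<le> mA * \<sigma> epowr (s - 1)" .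
  have "ennreal (V powr s) = emeasure lborel ?Q epowr s" using V by simp
  also have "\<dots> \<le> (ennreal 2 * emeasure lborel A) epowr s"
    using half s by (intro epowr_mono) auto
  also have "\<dots> = ennreal (2 powr s) * emeasure lborel A epowr s"
    using s by (subst epowr_mult) auto
  also have "\<dots> \<le> ennreal (2 powr s) * (mA * \<sigma> epowr (s - 1))"
    by (intro mult_left_mono E) auto
  \<comment> \<open>Multiplication by m produces m \<sigma>^(s-1), the product that
    \<open>A_const\<close> bounds; the factor V^s is cancelled at the end.\<close>
  finally have "m * ennreal (V powr s) \<le> m * (ennreal (2 powr s) * (mA * \<sigma> epowr (s - 1)))"
    by (intro mult_left_mono) auto
  also have "m * (ennreal (2 powr s) * (mA * \<sigma> epowr (s - 1))) = ennreal (2 powr s) * mA * (m * \<sigma> epowr (s - 1))"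
    by (simp only: ac_simps)
  also have "m * \<sigma> epowr (s - 1) = (m / ennreal V * (\<sigma> / ennreal V) epowr (s - 1)) * ennreal (V powr s)"
  proof -
    have \<sigma>: "\<sigma> epowr (s - 1) = ennreal (V powr (s - 1)) * (\<sigma> / ennreal V) epowr (s - 1)"
      using V s by (simp add: epowr_divide ennreal_mult_divide_cancel)
    have m: "m = ennreal V * (m / ennreal V)" using V by (simp add: ennreal_mult_divide_cancel)
    have "V powr s = V * V powr (s - 1)" using V by (simp add: powr_diff)
    then have VV: "ennreal (V powr s) = ennreal V * ennreal (V powr (s - 1))" using V by (simp add: ennreal_mult)
    have "m * \<sigma> epowr (s - 1) = (ennreal V * (m / ennreal V)) * (ennreal (V powr (s - 1)) * (\<sigma> / ennreal V) epowr (s - 1))"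
      using m \<sigma> by simp
    also have "\<dots> = (m / ennreal V * (\<sigma> / ennreal V) epowr (s - 1)) * (ennreal V * ennreal (V powr (s - 1)))"
      by (simp only: ac_simps)
    finally show ?thesis unfolding VV .
  qed
  also have "ennreal (2 powr s) * mA * ((m / ennreal V * (\<sigma> / ennreal V) epowr (s - 1)) * ennreal (V powr s))
    \<le> ennreal (2 powr s) * mA * (A_const s w * ennreal (V powr s))"
    by (intro mult_left_mono mult_right_mono A_le) auto
  also have "\<dots> = (ennreal (2 powr s) * A_const s w * mA) * ennreal (V powr s)" by (simp only: ac_simps)
  finally have "m * ennreal (V powr s) / ennreal (V powr s) \<le> (ennreal (2 powr s) * A_const s w * mA) * ennreal (V powr s) / ennreal (V powr s)"
    by (rule divide_right_mono_ennreal)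
  then show ?thesis
    using V by (simp add: mult_divide_eq_ennreal m_def mA_def)
qed simp

section \<open>Verification of the growth and smallness hypotheses in the two cases\<close>

lemma trace_inequality_A_infty:
  fixes w :: "'a::euclidean_space \<Rightarrow> real"
  assumes \<alpha>: "0 < \<alpha>" "\<alpha> < real DIM('a)" and p: "1 < p" "p \<le> q"
    and w: "weight w" and v: "AE x in lborel. ennreal (w x) = v x" and [measurable]: "v \<in> borel_measurable borel"
    and A: "A_infty w"
    and large: "(SUP Q\<in>{Q\<in>cubes. side_length Q > 1}. wmass 1 w Q epowr (1 / q) / ennreal (vol Q powr (1 / p))) < top"
    and small: "((\<lambda>t::real. SUP Q\<in>{Q\<in>cubes. side_length Q \<le> 1 / t}.
        ennreal (vol Q powr (\<alpha> / DIM('a) - 1 / p)) * wmass 1 w Q epowr (1 / q)) \<longlongrightarrow> 0) at_top"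
    and \<epsilon>: "0 < \<epsilon>"
  shows "\<exists>C>0. \<forall>\<phi>\<in>Cc_infty. wnorm q v (\<lambda>x. ennreal (norm (\<phi> x)))
    \<le> ennreal \<epsilon> * wnorm p (\<lambda>_. 1) (\<lambda>x. ennreal (norm (frac_laplacian \<alpha> \<phi> x)))
      + ennreal C * wnorm p (\<lambda>_. 1) (\<lambda>x. ennreal (norm (\<phi> x)))"
proof -
  have q: "0 < q" using p by simp
  let ?d = "real DIM('a)"
  have mass: "wmass 1 w Q = (\<integral>\<^sup>+x\<in>Q. v x \<partial>lborel)" for Q
    using wmass_eq[OF w v, of 1 Q] by simp
  obtain s where s: "1 < s" "A_const s w < top" using A_infty_imp_A_const[OF A] by blast
  \<comment> \<open>The doubling constant of \<open>A_const_doubling\<close>, finite by the choice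
    of s.\<close>
  define D where "D = enn2real (ennreal (2 powr s) * A_const s w)"
  have D: "ennreal (2 powr s) * A_const s w = ennreal D" "0 \<le> D"
    using s(2) by (simp_all add: D_def ennreal_mult_less_top)
  define S where "S = (SUP Q\<in>{Q::'a set\<in>cubes. side_length Q > 1}. wmass 1 w Q epowr (1 / q) / ennreal (vol Q powr (1 / p)))"
  have "S < top" unfolding S_def by (rule large)
  then obtain S' where S': "S = ennreal S'" "0 \<le> S'" by (cases S) auto
  show ?thesis
  proof (rule trace_inequality_core[OF \<alpha> p \<open>v \<in> borel_measurable borel\<close>, where G = "S' powr q"])
    fix a :: 'a and l :: real assume l: "1 < l"
    \<comment> \<open>The supremum over large cubes, rewritten as v(Q) \<le> S'^q |Q|^(q/p).\<close>
    have "cube a l \<in> {Q \<in> cubes. side_length Q > 1}"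
      using l by (simp add: cube_in_cubes side_length_cube)
    then have "wmass 1 w (cube a l) epowr (1 / q) / ennreal (vol (cube a l) powr (1 / p)) \<le> S"
      unfolding S_def by (rule SUP_upper)
    then have "ennreal ((l ^ DIM('a)) powr (1 / p)) * (wmass 1 w (cube a l) epowr (1 / q) / ennreal ((l ^ DIM('a)) powr (1 / p)))
      \<le> ennreal ((l ^ DIM('a)) powr (1 / p)) * S"
      using l by (intro mult_left_mono) (simp_all add: content_cube)
    then have "wmass 1 w (cube a l) epowr (1 / q) \<le> ennreal ((l ^ DIM('a)) powr (1 / p)) * ennreal S'"
      using l by (simp add: ennreal_mult_divide_cancel S')
    then have "wmass 1 w (cube a l) \<le> (ennreal ((l ^ DIM('a)) powr (1 / p)) * ennreal S') epowr q"
      using q le_epowr_iff[of "1 / q"] by simp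
    also have "\<dots> = ennreal (S' powr q) * ennreal (l powr (?d * (q / p)))"
    proof -
      have "((l ^ DIM('a)) powr (1 / p)) powr q = l powr (?d * (q / p))"
        using l by (simp add: powr_realpow[symmetric] powr_powr)
      then show ?thesis using S' q by (simp add: epowr_mult mult.commute)
    qed
    finally show "(\<integral>\<^sup>+x\<in>cube a l. v x \<partial>lborel) \<le> ennreal (S' powr q) * ennreal (l powr (?d * (q / p)))"
      by (simp add: mass)
  next
    fix \<delta> :: real assume \<delta>: "0 < \<delta>"
    let ?K = "doubling_const DIM('a) \<alpha> p q"
    have K: "0 \<le> ?K" by (rule doubling_const_nonneg[OF \<alpha>(1)])
    \<comment> \<open>Chosen so that the constant K D \<eta> of
      \<open>local_potential_doubling\<close> is at most \<delta>; the summand 1 avoids division by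
      0.\<close>
    define \<eta> where "\<eta> = \<delta> / (?K * D + 1)"
    have KD: "0 < ?K * D + 1" using K D by (simp add: add_nonneg_pos)
    then have \<eta>: "0 < \<eta>" using \<delta> by (simp add: \<eta>_def)
    \<comment> \<open>By the vanishing limit, the supremum over cubes of side at most 1/t is below
      \<eta> for some t > 0; then L = 1/t.\<close>
    have "eventually (\<lambda>t::real. (SUP Q\<in>{Q::'a set\<in>cubes. side_length Q \<le> 1 / t}.
        ennreal (vol Q powr (\<alpha> / DIM('a) - 1 / p)) * wmass 1 w Q epowr (1 / q)) < ennreal \<eta>) at_top"
      using small by (rule order_tendstoD) (use \<eta> in simp)
    then have "eventually (\<lambda>t::real. 0 < t \<and> (SUP Q\<in>{Q::'a set\<in>cubes. side_length Q \<le> 1 / t}.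
        ennreal (vol Q powr (\<alpha> / DIM('a) - 1 / p)) * wmass 1 w Q epowr (1 / q)) < ennreal \<eta>) at_top"
      using eventually_gt_at_top[of 0] by eventually_elim simp
    then obtain t :: real where t: "0 < t" "(SUP Q\<in>{Q::'a set\<in>cubes. side_length Q \<le> 1 / t}.
        ennreal (vol Q powr (\<alpha> / DIM('a) - 1 / p)) * wmass 1 w Q epowr (1 / q)) < ennreal \<eta>"
      using eventually_happens[of _ "at_top :: real filter"] by auto
    show "\<exists>L>0. \<forall>f\<in>borel_measurable borel. (\<integral>\<^sup>+x. f x epowr p \<partial>lborel) < top \<longrightarrow>
      wnorm q v (local_potential \<alpha> L f) \<le> ennreal \<delta> * wnorm p (\<lambda>_. 1) f"
    proof (intro exI[of _ "1 / t"] conjI ballI impI)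
      show "0 < 1 / t" using t by simp
      fix f :: "'a \<Rightarrow> ennreal" assume f: "f \<in> borel_measurable borel" and J: "(\<integral>\<^sup>+x. f x epowr p \<partial>lborel) < top"
      have "wnorm q v (local_potential \<alpha> (1 / t) f) \<le> ennreal ?K * ennreal D * ennreal \<eta> * (\<integral>\<^sup>+x. f x epowr p \<partial>lborel) epowr (1 / p)"
        unfolding wnorm_def
      proof (rule local_potential_doubling[OF \<alpha> p \<open>0 < 1 / t\<close> \<open>v \<in> borel_measurable borel\<close> f _ _ _ J])
        show "(\<integral>\<^sup>+x\<in>cube a l. v x \<partial>lborel) < top" for a :: 'a and l
          by (rule weight_cube_finite[OF w v])
        show "(\<integral>\<^sup>+x\<in>cube a l. v x \<partial>lborel) \<le> ennreal D * (\<integral>\<^sup>+x\<in>B. v x \<partial>lborel)"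
          if "0 < l" "B \<in> sets borel" "B \<subseteq> cube a l" "emeasure lborel (cube a l) \<le> 2 * emeasure lborel B" for a :: 'a and l B
          using A_const_doubling[OF w v _ _ s that(1,3,4)] that(2) D(1) by simp
        fix a :: 'a and l :: real assume l: "0 < l" "l \<le> 1 / t"
        have "cube a l \<in> {Q \<in> cubes. side_length Q \<le> 1 / t}"
          using l by (simp add: cube_in_cubes side_length_cube)
        then have "ennreal (vol (cube a l) powr (\<alpha> / DIM('a) - 1 / p)) * wmass 1 w (cube a l) epowr (1 / q) \<le> ennreal \<eta>"
          by (rule order.trans[OF SUP_upper less_imp_le[OF t(2)]])
        then have "(ennreal ((l ^ DIM('a)) powr (\<alpha> / DIM('a) - 1 / p)) * wmass 1 w (cube a l) epowr (1 / q)) epowr q \<le> ennreal \<eta> epowr q"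
          using l q by (intro epowr_mono) (simp_all add: content_cube)
        moreover have "((l ^ DIM('a)) powr (\<alpha> / DIM('a) - 1 / p)) powr q = l powr ((\<alpha> - ?d / p) * q)"
          using l by (simp add: powr_realpow[symmetric] powr_powr right_diff_distrib)
        ultimately have "ennreal (l powr ((\<alpha> - ?d / p) * q)) * wmass 1 w (cube a l) \<le> ennreal \<eta> epowr q"
          using q by (simp add: epowr_mult epowr_inverse_cancel)
        \<comment> \<open>Multiplying by l^(d q/p) turns the exponent (\<alpha> - d/p) q into
          \<alpha> q.\<close>
        then have "ennreal (l powr (?d * (q / p))) * (ennreal (l powr ((\<alpha> - ?d / p) * q)) * wmass 1 w (cube a l)) \<le> ennreal (l powr (?d * (q / p))) * ennreal \<eta> epowr q"
          by (intro mult_left_mono) auto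
        moreover have "l powr (?d * (q / p)) * l powr ((\<alpha> - ?d / p) * q) = l powr (\<alpha> * q)"
          using l by (simp add: powr_add[symmetric] left_diff_distrib)
        moreover have "ennreal (l powr \<alpha>) epowr q = ennreal (l powr (\<alpha> * q))"
          by (simp add: powr_powr)
        moreover have "ennreal (l ^ DIM('a)) epowr (q / p) = ennreal (l powr (?d * (q / p)))"
          using l by (simp add: powr_realpow[symmetric] powr_powr)
        ultimately show "ennreal (l powr \<alpha>) epowr q * (\<integral>\<^sup>+x\<in>cube a l. v x \<partial>lborel) \<le> ennreal \<eta> epowr q * ennreal (l ^ DIM('a)) epowr (q / p)"
          by (simp only: mass mult.assoc[symmetric] mult.commute[of "ennreal \<eta> epowr q"] ennreal_mult[symmetric] powr_ge_zero)
      qed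
      also have "\<dots> = ennreal (?K * D * \<eta>) * wnorm p (\<lambda>_. 1) f"
        using K D \<eta> by (simp add: wnorm_def ennreal_mult)
      also have "\<dots> \<le> ennreal \<delta> * wnorm p (\<lambda>_. 1) f"
      proof (intro mult_right_mono ennreal_leI)
        have "?K * D * \<eta> = \<delta> * (?K * D / (?K * D + 1))" by (simp add: \<eta>_def)
        also have "\<dots> \<le> \<delta> * 1" using \<delta> KD by (intro mult_left_mono) auto
        finally show "?K * D * \<eta> \<le> \<delta>" by simp
      qed simp
      finally show "wnorm q v (local_potential \<alpha> (1 / t) f) \<le> ennreal \<delta> * wnorm p (\<lambda>_. 1) f" .
    qed
  qed (use \<epsilon> in auto)
qed

lemma trace_inequality_bump:
  fixes w :: "'a::euclidean_space \<Rightarrow> real"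
  assumes \<alpha>: "0 < \<alpha>" "\<alpha> < real DIM('a)" and p: "1 < p" "p \<le> q" and \<theta>: "1 < \<theta>"
    and w: "weight w" and v: "AE x in lborel. ennreal (w x) = v x" and [measurable]: "v \<in> borel_measurable borel"
    and large: "(SUP Q\<in>{Q\<in>cubes. side_length Q > 1}. ennreal (vol Q powr (1 / q - 1 / p)) *
        (wmass \<theta> w Q / ennreal (vol Q)) epowr (1 / (\<theta> * q))) < top"
    and small: "((\<lambda>t::real. SUP Q\<in>{Q\<in>cubes. side_length Q \<le> 1 / t}.
        ennreal (vol Q powr (\<alpha> / DIM('a) + 1 / q - 1 / p)) *
        (wmass \<theta> w Q / ennreal (vol Q)) epowr (1 / (\<theta> * q))) \<longlongrightarrow> 0) at_top"
    and \<epsilon>: "0 < \<epsilon>"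
  shows "\<exists>C>0. \<forall>\<phi>\<in>Cc_infty. wnorm q v (\<lambda>x. ennreal (norm (\<phi> x)))
    \<le> ennreal \<epsilon> * wnorm p (\<lambda>_. 1) (\<lambda>x. ennreal (norm (frac_laplacian \<alpha> \<phi> x)))
      + ennreal C * wnorm p (\<lambda>_. 1) (\<lambda>x. ennreal (norm (\<phi> x)))"
proof -
  have q: "0 < q" using p by simp
  let ?d = "real DIM('a)"
  define S where "S = (SUP Q\<in>{Q::'a set\<in>cubes. side_length Q > 1}. ennreal (vol Q powr (1 / q - 1 / p)) *
        (wmass \<theta> w Q / ennreal (vol Q)) epowr (1 / (\<theta> * q)))"
  have "S < top" unfolding S_def by (rule large)
  then obtain S' where S': "S = ennreal S'" "0 \<le> S'" by (cases S) auto
  show ?thesis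
  proof (rule trace_inequality_core[OF \<alpha> p \<open>v \<in> borel_measurable borel\<close>, where G = "S' powr q"])
    fix a :: 'a and l :: real assume l: "1 < l"
    define V where "V = l ^ DIM('a)"
    have V: "0 < V" using l by (simp add: V_def)
    define X where "X = wmass \<theta> w (cube a l) / ennreal V"
    have X: "X = (\<integral>\<^sup>+x\<in>cube a l. v x epowr \<theta> \<partial>lborel) / ennreal V"
      unfolding X_def wmass_eq[OF w v] ..
    have "cube a l \<in> {Q \<in> cubes. side_length Q > 1}"
      using l by (simp add: cube_in_cubes side_length_cube)
    then have "ennreal (vol (cube a l) powr (1 / q - 1 / p)) * (wmass \<theta> w (cube a l) / ennreal (vol (cube a l))) epowr (1 / (\<theta> * q)) \<le> S"
      unfolding S_def by (rule SUP_upper)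
    then have "ennreal (V powr (1 / q - 1 / p)) * X epowr (1 / (\<theta> * q)) \<le> ennreal S'"
      using l by (simp add: content_cube V_def X_def S')
    then have "(ennreal (V powr (1 / q - 1 / p)) * X epowr (1 / (\<theta> * q))) epowr q \<le> ennreal S' epowr q"
      using q by (intro epowr_mono) auto
    then have XS: "ennreal (V powr (1 - q / p)) * X epowr (1 / \<theta>) \<le> ennreal (S' powr q)"
      using q S' by (simp add: epowr_mult epowr_epowr powr_powr left_diff_distrib)
    have "(\<integral>\<^sup>+x\<in>cube a l. v x \<partial>lborel) = (\<integral>\<^sup>+x. indicator (cube a l) x * v x \<partial>lborel)"
      by (simp add: mult.commute)
    \<comment> \<open>Jensen with exponent \<theta> bounds v(Q) by means of the mass of v^\<theta>;
      this is how the bump condition yields the growth on large cubes.\<close>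
    then have "(\<integral>\<^sup>+x\<in>cube a l. v x \<partial>lborel) epowr \<theta> \<le> (\<integral>\<^sup>+x. indicator (cube a l) x \<partial>lborel) epowr (\<theta> - 1)
        * (\<integral>\<^sup>+x. indicator (cube a l) x * v x epowr \<theta> \<partial>lborel)"
      using nn_integral_Jensen[OF \<theta>, of v lborel "indicator (cube a l)"] by simp
    also have "(\<integral>\<^sup>+x. indicator (cube a l) x * v x epowr \<theta> \<partial>lborel) = ennreal V * X"
      unfolding X ennreal_mult_divide_cancel[OF V] by (simp only: mult.commute)
    also have "(\<integral>\<^sup>+x. indicator (cube a l) x \<partial>lborel) = ennreal V"
      using l by (simp add: emeasure_cube V_def)
    also have "ennreal V epowr (\<theta> - 1) * (ennreal V * X) = ennreal (V powr \<theta>) * X"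
    proof -
      have "V powr \<theta> = V powr (\<theta> - 1) * V" using V by (simp add: powr_diff)
      then show ?thesis using V by (simp add: ennreal_mult mult.assoc)
    qed
    finally have "(\<integral>\<^sup>+x\<in>cube a l. v x \<partial>lborel) \<le> (ennreal (V powr \<theta>) * X) epowr (1 / \<theta>)"
      using \<theta> le_epowr_iff[of \<theta>] by simp
    also have "\<dots> = ennreal V * X epowr (1 / \<theta>)"
      using \<theta> V by (simp add: epowr_mult powr_powr)
    \<comment> \<open>The volume is split as |Q|^(q/p) |Q|^(1-q/p) to match
      \<open>XS\<close>.\<close>
    also have "\<dots> = ennreal (V powr (q / p)) * (ennreal (V powr (1 - q / p)) * X epowr (1 / \<theta>))"
    proof -
      have "V powr (q / p) * V powr (1 - q / p) = V" using V by (simp add: powr_add[symmetric])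
      moreover have "ennreal (V powr (q / p) * V powr (1 - q / p)) = ennreal (V powr (q / p)) * ennreal (V powr (1 - q / p))"
        by (intro ennreal_mult) auto
      ultimately have "ennreal V = ennreal (V powr (q / p)) * ennreal (V powr (1 - q / p))" by (simp only:)
      then show ?thesis by (simp only: mult.assoc)
    qed
    also have "\<dots> \<le> ennreal (V powr (q / p)) * ennreal (S' powr q)"
      by (intro mult_left_mono XS) simp
    also have "V powr (q / p) = l powr (?d * (q / p))"
      unfolding V_def using l by (simp add: powr_realpow[symmetric] powr_powr)
    finally show "(\<integral>\<^sup>+x\<in>cube a l. v x \<partial>lborel) \<le> ennreal (S' powr q) * ennreal (l powr (?d * (q / p)))"
      by (simp only: mult.commute)
  next
    fix \<delta> :: real assume \<delta>: "0 < \<delta>"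
    let ?K = "bump_const DIM('a) \<alpha> p q \<theta>"
    have K: "0 \<le> ?K" using \<alpha> p by (intro bump_const_nonneg) auto
    \<comment> \<open>Here K \<eta> \<le> \<delta> is required, with K the constant of
      \<open>local_potential_bump\<close>.\<close>
    define \<eta> where "\<eta> = \<delta> / (?K + 1)"
    have K1: "0 < ?K + 1" using K by (simp add: add_nonneg_pos)
    then have \<eta>: "0 < \<eta>" using \<delta> by (simp add: \<eta>_def)
    have "eventually (\<lambda>t::real. (SUP Q\<in>{Q::'a set\<in>cubes. side_length Q \<le> 1 / t}.
        ennreal (vol Q powr (\<alpha> / DIM('a) + 1 / q - 1 / p)) * (wmass \<theta> w Q / ennreal (vol Q)) epowr (1 / (\<theta> * q))) < ennreal \<eta>) at_top"
      using small by (rule order_tendstoD) (use \<eta> in simp)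
    then have "eventually (\<lambda>t::real. 0 < t \<and> (SUP Q\<in>{Q::'a set\<in>cubes. side_length Q \<le> 1 / t}.
        ennreal (vol Q powr (\<alpha> / DIM('a) + 1 / q - 1 / p)) * (wmass \<theta> w Q / ennreal (vol Q)) epowr (1 / (\<theta> * q))) < ennreal \<eta>) at_top"
      using eventually_gt_at_top[of 0] by eventually_elim simp
    then obtain t :: real where t: "0 < t" "(SUP Q\<in>{Q::'a set\<in>cubes. side_length Q \<le> 1 / t}.
        ennreal (vol Q powr (\<alpha> / DIM('a) + 1 / q - 1 / p)) * (wmass \<theta> w Q / ennreal (vol Q)) epowr (1 / (\<theta> * q))) < ennreal \<eta>"
      using eventually_happens[of _ "at_top :: real filter"] by auto
    show "\<exists>L>0. \<forall>f\<in>borel_measurable borel. (\<integral>\<^sup>+x. f x epowr p \<partial>lborel) < top \<longrightarrow>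
      wnorm q v (local_potential \<alpha> L f) \<le> ennreal \<delta> * wnorm p (\<lambda>_. 1) f"
    proof (intro exI[of _ "1 / t"] conjI ballI impI)
      show "0 < 1 / t" using t by simp
      fix f :: "'a \<Rightarrow> ennreal" assume f: "f \<in> borel_measurable borel" and J: "(\<integral>\<^sup>+x. f x epowr p \<partial>lborel) < top"
      have "wnorm q v (local_potential \<alpha> (1 / t) f) \<le> ennreal ?K * ennreal \<eta> * (\<integral>\<^sup>+x. f x epowr p \<partial>lborel) epowr (1 / p)"
        unfolding wnorm_def
      proof (rule local_potential_bump[OF \<alpha> p \<theta> \<open>0 < 1 / t\<close> \<open>v \<in> borel_measurable borel\<close> f _ _ J])
        show "(\<integral>\<^sup>+x\<in>cube a l. v x \<partial>lborel) < top" for a :: 'a and l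
          by (rule weight_cube_finite[OF w v])
        fix a :: 'a and l :: real assume l: "0 < l" "l \<le> 1 / t"
        let ?X = "((\<integral>\<^sup>+x\<in>cube a l. v x epowr \<theta> \<partial>lborel) / ennreal (l ^ DIM('a))) epowr (1 / (\<theta> * q))"
        let ?b = "1 / p - 1 / q"
        have "cube a l \<in> {Q \<in> cubes. side_length Q \<le> 1 / t}"
          using l by (simp add: cube_in_cubes side_length_cube)
        then have "ennreal (vol (cube a l) powr (\<alpha> / DIM('a) + 1 / q - 1 / p)) * (wmass \<theta> w (cube a l) / ennreal (vol (cube a l))) epowr (1 / (\<theta> * q)) \<le> ennreal \<eta>"
          by (rule order.trans[OF SUP_upper less_imp_le[OF t(2)]])
        then have "ennreal ((l ^ DIM('a)) powr (\<alpha> / DIM('a) + 1 / q - 1 / p)) * ?X \<le> ennreal \<eta>"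
          using l by (simp add: content_cube wmass_eq[OF w v])
        \<comment> \<open>Multiplying by |Q|^(1/p-1/q) leaves |Q|^(\<alpha>/d) = l^\<alpha>, the
          Riesz weight.\<close>
        then have "ennreal ((l ^ DIM('a)) powr ?b) * (ennreal ((l ^ DIM('a)) powr (\<alpha> / DIM('a) + 1 / q - 1 / p)) * ?X) \<le> ennreal ((l ^ DIM('a)) powr ?b) * ennreal \<eta>"
          by (intro mult_left_mono) auto
        moreover have "(l ^ DIM('a)) powr ?b * (l ^ DIM('a)) powr (\<alpha> / DIM('a) + 1 / q - 1 / p) = l powr \<alpha>"
        proof -
          have "(l ^ DIM('a)) powr ?b * (l ^ DIM('a)) powr (\<alpha> / DIM('a) + 1 / q - 1 / p) = (l ^ DIM('a)) powr (\<alpha> / DIM('a))"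
            using l by (simp add: powr_add[symmetric])
          also have "\<dots> = l powr \<alpha>" using l by (simp add: powr_realpow[symmetric] powr_powr)
          finally show ?thesis .
        qed
        moreover have "ennreal (l ^ DIM('a)) epowr ?b = ennreal ((l ^ DIM('a)) powr ?b)" using l by simp
        ultimately show "ennreal (l powr \<alpha>) * ?X \<le> ennreal \<eta> * ennreal (l ^ DIM('a)) epowr ?b"
          by (simp only: mult.assoc[symmetric] mult.commute[of "ennreal \<eta>"] ennreal_mult[symmetric] powr_ge_zero)
      qed
      also have "\<dots> = ennreal (?K * \<eta>) * wnorm p (\<lambda>_. 1) f"
        using K \<eta> by (simp add: wnorm_def ennreal_mult)
      also have "\<dots> \<le> ennreal \<delta> * wnorm p (\<lambda>_. 1) f"
      proof (intro mult_right_mono ennreal_leI)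
        have "?K * \<eta> = \<delta> * (?K / (?K + 1))" by (simp add: \<eta>_def)
        also have "\<dots> \<le> \<delta> * 1" using \<delta> K1 by (intro mult_left_mono) auto
        finally show "?K * \<eta> \<le> \<delta>" by simp
      qed simp
      finally show "wnorm q v (local_potential \<alpha> (1 / t) f) \<le> ennreal \<delta> * wnorm p (\<lambda>_. 1) f" .
    qed
  qed (use \<epsilon> in auto)
qed

theorem theorem1p4:
  fixes v :: "'a::euclidean_space \<Rightarrow> real" and \<alpha> p q :: real
  assumes "0 < \<alpha>" "\<alpha> < real DIM('a)" "1 < p" "p \<le> q"
    and "weight v"
    and "(A_infty v \<and>
        max (SUP Q\<in>{Q\<in>cubes. side_length Q \<le> 1}.
               ennreal (vol Q powr (\<alpha> / DIM('a) - 1 / p)) * wmass 1 v Q epowr (1 / q))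
            (SUP Q\<in>{Q\<in>cubes. side_length Q > 1}.
               wmass 1 v Q epowr (1 / q) / ennreal (vol Q powr (1 / p))) < \<infinity> \<and>
        ((\<lambda>t::real. SUP Q\<in>{Q\<in>cubes. side_length Q \<le> 1 / t}.
               ennreal (vol Q powr (\<alpha> / DIM('a) - 1 / p)) * wmass 1 v Q epowr (1 / q))
          \<longlongrightarrow> 0) at_top)
      \<or>
      (\<exists>\<theta>>1.
        max (SUP Q\<in>{Q\<in>cubes. side_length Q \<le> 1}.
               ennreal (vol Q powr (\<alpha> / DIM('a) + 1 / q - 1 / p)) *
               (wmass \<theta> v Q / ennreal (vol Q)) epowr (1 / (\<theta> * q)))
            (SUP Q\<in>{Q\<in>cubes. side_length Q > 1}.
               ennreal (vol Q powr (1 / q - 1 / p)) *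
               (wmass \<theta> v Q / ennreal (vol Q)) epowr (1 / (\<theta> * q))) < \<infinity> \<and>
        ((\<lambda>t::real. SUP Q\<in>{Q\<in>cubes. side_length Q \<le> 1 / t}.
               ennreal (vol Q powr (\<alpha> / DIM('a) + 1 / q - 1 / p)) *
               (wmass \<theta> v Q / ennreal (vol Q)) epowr (1 / (\<theta> * q)))
          \<longlongrightarrow> 0) at_top)"
  shows "\<exists>c::real. 0 \<le> c \<and> (\<forall>\<epsilon>::real. 0 < \<epsilon> \<longrightarrow> (\<exists>C::real. 0 < C \<and> (\<forall>\<phi>\<in>Cc_infty.
           Lp_norm q v \<phi> \<le> ennreal c *
             (ennreal \<epsilon> * Lp_norm p (\<lambda>_. 1) (frac_laplacian \<alpha> \<phi>)
              + ennreal C * Lp_norm p (\<lambda>_. 1) \<phi>))))"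
proof -
  obtain w where w: "w \<in> borel_measurable borel" "AE x in lborel. ennreal (v x) = w x"
    using weight_borel_version[OF assms(5)] by blast
  have "\<exists>C>0. \<forall>\<phi>\<in>Cc_infty. wnorm q w (\<lambda>x. ennreal (norm (\<phi> x)))
    \<le> ennreal \<epsilon> * wnorm p (\<lambda>_. 1) (\<lambda>x. ennreal (norm (frac_laplacian \<alpha> \<phi> x)))
      + ennreal C * wnorm p (\<lambda>_. 1) (\<lambda>x. ennreal (norm (\<phi> x)))" if \<epsilon>: "0 < \<epsilon>" for \<epsilon>
    using assms(6)
  proof (elim disjE conjE exE)
    assume "A_infty v"
      and "max (SUP Q\<in>{Q\<in>cubes. side_length Q \<le> 1}.
               ennreal (vol Q powr (\<alpha> / DIM('a) - 1 / p)) * wmass 1 v Q epowr (1 / q))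
            (SUP Q\<in>{Q\<in>cubes. side_length Q > 1}.
               wmass 1 v Q epowr (1 / q) / ennreal (vol Q powr (1 / p))) < \<infinity>"
      and "((\<lambda>t::real. SUP Q\<in>{Q\<in>cubes. side_length Q \<le> 1 / t}.
               ennreal (vol Q powr (\<alpha> / DIM('a) - 1 / p)) * wmass 1 v Q epowr (1 / q))
          \<longlongrightarrow> 0) at_top"
    then show ?thesis
      using \<epsilon> by (intro trace_inequality_A_infty[OF assms(1-5) w(2,1)]) simp_all
  next
    fix \<theta> :: real
    assume "1 < \<theta>"
      and "max (SUP Q\<in>{Q\<in>cubes. side_length Q \<le> 1}.
               ennreal (vol Q powr (\<alpha> / DIM('a) + 1 / q - 1 / p)) *
               (wmass \<theta> v Q / ennreal (vol Q)) epowr (1 / (\<theta> * q)))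
            (SUP Q\<in>{Q\<in>cubes. side_length Q > 1}.
               ennreal (vol Q powr (1 / q - 1 / p)) *
               (wmass \<theta> v Q / ennreal (vol Q)) epowr (1 / (\<theta> * q))) < \<infinity>"
      and "((\<lambda>t::real. SUP Q\<in>{Q\<in>cubes. side_length Q \<le> 1 / t}.
               ennreal (vol Q powr (\<alpha> / DIM('a) + 1 / q - 1 / p)) *
               (wmass \<theta> v Q / ennreal (vol Q)) epowr (1 / (\<theta> * q)))
          \<longlongrightarrow> 0) at_top"
    then show ?thesis
      using \<epsilon> by (intro trace_inequality_bump[OF assms(1-4) _ assms(5) w(2,1)]) simp_all
  qed
  \<comment> \<open>The constant c = 1 suffices, all constants having been absorbed into the choices
    for \<epsilon>.\<close>
  then show ?thesis
    unfolding Lp_norm_eq_wnorm[OF assms(5) w(2)] Lp_norm_unweighted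
    by (intro exI[of _ 1]) simp
qed

end
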